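(* Let $T>0$ be a fixed time horizon and let $\alpha,\lambda,\sigma>0$. Suppose that $\mathscr{E}:H\to\mathbb{R}$ is an admissible objective, that the active-subspace condition holds for $(V,Q,\mathscr{E},\xi)$, and that the initial condition $\xi$ is an $\mathcal{F}_0$-measurable $H$-valued random variable with $\mathbb{E}[\|\xi\|_H^2]<\infty$. Then the McKean--Vlasov SDE $$dX_t=-\lambda\big(X_t-\mathfrak{m}_\alpha(\mu_t)\big)\,dt+\sigma\,\|X_t-\mathfrak{m}_\alpha(\mu_t)\|_H\,\mathsf{P}_V\,dW_t^Q,\qquad X_0=\xi,\qquad \mu_t=\mathrm{Law}(X_t),\quad t\in[0,T],$$ admits a unique strong solution $X\in L^2\big(\Omega;C([0,T];H)\big)$.
   Context: $H$ is an infinite-dimensional real separable Hilbert space with inner product $\langle\cdot,\cdot\rangle_H$ and norm $\|\cdot\|_H$. $Q:H\to H$ is a symmetric, positive semi-definite, trace-class operator, and $W^Q$ is an $H$-valued $Q$-Wiener process on a filtered probability space $(\Omega,\mathcal{F},(\mathcal{F}_t)_{t\ge0},\mathbb{P})$ satisfying the usual conditions. Admissible objective: $\mathscr{E}:H\to\mathbb{R}$ is an admissible objective if there exist an exponent $p\ge1$ and constants $C_{\mathscr{E}},c,R_0,L>0$ such that (1) $\inf_{x\in H}\mathscr{E}(x)\ge0$; (2) $\mathscr{E}(x)\le C_{\mathscr{E}}(1+\|x\|_H^p)$ for all $x\in H$; (3) $\mathscr{E}(x)\ge c\|x\|_H^p$ whenever $\|x\|_H>R_0$; (4) $|\mathscr{E}(x)-\mathscr{E}(y)|\le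 L(1+\|x\|_H^{p-1}+\|y\|_H^{p-1})\|x-y\|_H$ for all $x,y\in H$. Active-subspace condition for $(V,Q,\mathscr{E},\xi)$: $V\subset H$ is a linear subspace of finite dimension $d<\infty$, $H=V\oplus V^\perp$; $\mathscr{E}$ has a global minimizer $x^*$ with $x^*\in V$; the initial law $\mu_0=\mathrm{Law}(\xi)$ is supported on $V$; and there is $\lambda_{\min}>0$ with $\langle v,Qv\rangle_H\ge\lambda_{\min}\|v\|_H^2$ for all $v\in V$. $\mathsf{P}_V$ denotes the orthogonal projection of $H$ onto $V$. Consensus point: for a probability measure $\mu$ on $H$ with finite second moment, $\mathfrak{m}_\alpha(\mu)=\dfrac{\int_H x\,e^{-\alpha\mathscr{E}(x)}\,\mu(dx)}{\int_H e^{-\alpha\mathscr{E}(x)}\,\mu(dx)}\in H$ (Bochner integral). Strong solution: an $H$-valued predictable process with almost surely continuous paths which satisfies the equation in integral form $\mathbb{P}$-a.s. for all $t\in[0,T]$. Uniqueness is pathwise: two such solutions with the same noise and initial condition are indistinguishable. *)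

theory Defs
  imports "HOL-Probability.Probability"
begin

section \<open>Operators on a real separable Hilbert space\<close>

text \<open>
  Real separable Hilbert spaces are types of sort
  \<open>{real_inner, banach, second_countable_topology}\<close>.
\<close>

definition infinite_dimensional :: "'h::real_inner itself \<Rightarrow> bool" where
  "infinite_dimensional _ \<longleftrightarrow> \<not> (\<exists>B::'h set. finite B \<and> span B = UNIV)"

definition orthonormal_basis :: "'h::real_inner set \<Rightarrow> bool" where
  "orthonormal_basis B \<longleftrightarrow>
     (\<forall>e\<in>B. norm e = 1) \<and> pairwise orthogonal B \<and> closure (span B) = UNIV"

text \<open>Trace class (nuclear) operators: \<open>A x = (\<Sum>n. \<langle>b\<^sub>n, x\<rangle> a\<^sub>n)\<close> with
  \<open>(\<Sum>n. \<parallel>a\<^sub>n\<parallel> \<parallel>b\<^sub>n\<parallel>) < \<infinity>\<close>.\<close>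

definition trace_class :: "('h \<Rightarrow>\<^sub>L 'h::{real_inner, banach}) \<Rightarrow> bool" where
  "trace_class A \<longleftrightarrow>
     (\<exists>a b :: nat \<Rightarrow> 'h. summable (\<lambda>n. norm (a n) * norm (b n)) \<and>
        (\<forall>x. (\<lambda>n. (b n \<bullet> x) *\<^sub>R a n) sums A x))"

text \<open>The trace of a trace class operator does not depend on the orthonormal basis,
  so an arbitrary one is chosen.\<close>

definition trace_op :: "('h \<Rightarrow> 'h::{real_inner, banach}) \<Rightarrow> real" where
  "trace_op A = infsum (\<lambda>e. e \<bullet> A e) (SOME B. orthonormal_basis B)"

definition covariance_operator :: "('h \<Rightarrow>\<^sub>L 'h::{real_inner, banach}) \<Rightarrow> bool" where
  "covariance_operator Q \<longleftrightarrow>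
     (\<forall>x y. Q x \<bullet> y = x \<bullet> Q y) \<and> (\<forall>x. 0 \<le> x \<bullet> Q x) \<and> trace_class Q"

definition orthogonal_projection :: "'h set \<Rightarrow> 'h \<Rightarrow>\<^sub>L 'h::{real_inner, banach}" where
  "orthogonal_projection V =
     (THE P. \<forall>x. blinfun_apply P x \<in> V \<and> (\<forall>v\<in>V. (x - P x) \<bullet> v = 0))"

section \<open>Filtrations and Wiener processes\<close>

text \<open>Time is of type \<open>real\<close>; only the \<open>\<sigma>\<close>-algebras \<open>F t\<close> with \<open>t \<ge> 0\<close> are relevant.\<close>

definition usual_filtration :: "'w measure \<Rightarrow> (real \<Rightarrow> 'w measure) \<Rightarrow> bool" where
  "usual_filtration M F \<longleftrightarrow>
     (\<forall>t\<ge>0. subalgebra M (F t)) \<and>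
     (\<forall>s t. 0 \<le> s \<longrightarrow> s \<le> t \<longrightarrow> sets (F s) \<subseteq> sets (F t)) \<and>
     (\<forall>t\<ge>0. sets (F t) = (\<Inter>u\<in>{t<..}. sets (F u))) \<and>
     (\<forall>N\<in>null_sets M. \<forall>A. A \<subseteq> N \<longrightarrow> A \<in> sets (F 0))"

definition predictable_sigma ::
    "'w measure \<Rightarrow> (real \<Rightarrow> 'w measure) \<Rightarrow> real \<Rightarrow> (real \<times> 'w) measure" where
  "predictable_sigma M F T = sigma ({0..T} \<times> space M)
     ({{s<..t} \<times> A |s t A. 0 \<le> s \<and> s < t \<and> t \<le> T \<and> A \<in> sets (F s)} \<union>
      {{0} \<times> A |A. A \<in> sets (F 0)})"

definition predictable ::
    "'w measure \<Rightarrow> (real \<Rightarrow> 'w measure) \<Rightarrow> real \<Rightarrow> (real \<Rightarrow> 'w \<Rightarrow> 'b::topological_space) \<Rightarrow> bool" where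
  "predictable M F T X \<longleftrightarrow> (\<lambda>(t, \<omega>). X t \<omega>) \<in> borel_measurable (predictable_sigma M F T)"

definition real_gaussian :: "real \<Rightarrow> real \<Rightarrow> real measure" where
  "real_gaussian m v =
     (if v = 0 then return borel m else density lborel (\<lambda>x. ennreal (normal_density m (sqrt v) x)))"

text \<open>A measure on a Hilbert space is Gaussian with mean \<open>m\<close> and covariance \<open>C\<close> iff all its
  one-dimensional projections are real Gaussians with the corresponding parameters
  (a variance \<open>0\<close> being a point mass).\<close>

definition gaussian_on ::
    "'h \<Rightarrow> ('h \<Rightarrow>\<^sub>L 'h::{real_inner, banach}) \<Rightarrow> 'h measure \<Rightarrow> bool" where
  "gaussian_on m C \<mu> \<longleftrightarrow>
     (\<forall>h. distr \<mu> borel (\<lambda>x. x \<bullet> h) = real_gaussian (m \<bullet> h) (h \<bullet> C h))"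

definition Q_Wiener_process ::
    "'w measure \<Rightarrow> (real \<Rightarrow> 'w measure) \<Rightarrow>
     ('h \<Rightarrow>\<^sub>L 'h::{real_inner, banach, second_countable_topology}) \<Rightarrow>
     (real \<Rightarrow> 'w \<Rightarrow> 'h) \<Rightarrow> bool" where
  "Q_Wiener_process M F Q W \<longleftrightarrow>
     (\<forall>t\<ge>0. W t \<in> borel_measurable (F t)) \<and>
     (AE \<omega> in M. W 0 \<omega> = 0) \<and>
     (AE \<omega> in M. continuous_on {0..} (\<lambda>t. W t \<omega>)) \<and>
     (\<forall>s t. 0 \<le> s \<longrightarrow> s < t \<longrightarrow>
        prob_space.indep_set M
          (sets (vimage_algebra (space M) (\<lambda>\<omega>. W t \<omega> - W s \<omega>) borel)) (sets (F s)) \<and>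
        gaussian_on 0 ((t - s) *\<^sub>R Q) (distr M borel (\<lambda>\<omega>. W t \<omega> - W s \<omega>)))"

section \<open>The stochastic integral\<close>

text \<open>
  An elementary process on \<open>[0,T]\<close> is given by a number \<open>n\<close> of intervals, a partition
  \<open>0 = \<tau> 0 < \<dots> < \<tau> n = T\<close>, and operator-valued simple random variables \<open>\<phi> k\<close>,
  measurable with respect to \<open>F (\<tau> k)\<close>, attached to the intervals \<open>(\<tau> k, \<tau> (k + 1)]\<close>.
\<close>

type_synonym ('w, 'h) elementary = "nat \<times> (nat \<Rightarrow> real) \<times> (nat \<Rightarrow> 'w \<Rightarrow> ('h \<Rightarrow>\<^sub>L 'h))"

fun elementary ::
    "(real \<Rightarrow> 'w measure) \<Rightarrow> real \<Rightarrow> ('w, 'h::{real_inner, banach}) elementary \<Rightarrow> bool" where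
  "elementary F T (n, \<tau>, \<phi>) \<longleftrightarrow>
     \<tau> 0 = 0 \<and> \<tau> n = T \<and> (\<forall>k<n. \<tau> k < \<tau> (Suc k)) \<and> (\<forall>k<n. simple_function (F (\<tau> k)) (\<phi> k))"

fun elementary_process ::
    "('w, 'h::{real_inner, banach}) elementary \<Rightarrow> real \<Rightarrow> 'w \<Rightarrow> ('h \<Rightarrow>\<^sub>L 'h)" where
  "elementary_process (n, \<tau>, \<phi>) s \<omega> = (\<Sum>k<n. indicator {\<tau> k<..\<tau> (Suc k)} s *\<^sub>R \<phi> k \<omega>)"

fun elementary_integral ::
    "(real \<Rightarrow> 'w \<Rightarrow> 'h) \<Rightarrow> ('w, 'h::{real_inner, banach}) elementary \<Rightarrow> real \<Rightarrow> 'w \<Rightarrow> 'h" where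
  "elementary_integral W (n, \<tau>, \<phi>) t \<omega> =
     (\<Sum>k<n. \<phi> k \<omega> (W (min t (\<tau> (Suc k))) \<omega> - W (min t (\<tau> k)) \<omega>))"

text \<open>\<open>Tr (A Q A\<^sup>*)\<close>, that is, the squared Hilbert--Schmidt norm of \<open>A Q\<^sup>1\<^sup>/\<^sup>2\<close>.\<close>

definition HS_normsq ::
    "('h \<Rightarrow>\<^sub>L 'h::{real_inner, banach}) \<Rightarrow> ('h \<Rightarrow>\<^sub>L 'h) \<Rightarrow> real" where
  "HS_normsq Q A = trace_op (\<lambda>x. A (Q (adjoint (blinfun_apply A) x)))"

definition converges_to_0_in_prob :: "'w measure \<Rightarrow> (nat \<Rightarrow> 'w \<Rightarrow> ennreal) \<Rightarrow> bool" where
  "converges_to_0_in_prob M Z \<longleftrightarrow>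
     (\<forall>\<epsilon>>0. (\<lambda>n. measure M {\<omega>\<in>space M. Z n \<omega> > ennreal \<epsilon>}) \<longlonglongrightarrow> 0)"

text \<open>
  \<open>I t = \<integral>\<^sub>0\<^sup>t \<Phi> s dW s\<close> for \<open>t \<in> [0,T]\<close>, for predictable operator-valued integrands \<open>\<Phi>\<close> with
  \<open>\<integral>\<^sub>0\<^sup>T Tr (\<Phi> Q \<Phi>\<^sup>*) ds < \<infinity>\<close> almost surely: \<open>I\<close> is an adapted, almost surely continuous process
  which is the limit in probability, at each time, of the integrals of elementary processes
  approximating \<open>\<Phi>\<close>.  This determines \<open>I\<close> up to indistinguishability and covers the
  localised integral, not only the square integrable one.
\<close>

definition has_stochastic_integral ::
    "'w measure \<Rightarrow> (real \<Rightarrow> 'w measure) \<Rightarrow>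
     ('h \<Rightarrow>\<^sub>L 'h::{real_inner, banach, second_countable_topology}) \<Rightarrow>
     (real \<Rightarrow> 'w \<Rightarrow> 'h) \<Rightarrow> real \<Rightarrow>
     (real \<Rightarrow> 'w \<Rightarrow> ('h \<Rightarrow>\<^sub>L 'h)) \<Rightarrow> (real \<Rightarrow> 'w \<Rightarrow> 'h) \<Rightarrow> bool" where
  "has_stochastic_integral M F Q W T \<Phi> I \<longleftrightarrow>
     (\<forall>h. predictable M F T (\<lambda>s \<omega>. \<Phi> s \<omega> h)) \<and>
     (AE \<omega> in M. (\<integral>\<^sup>+s\<in>{0..T}. ennreal (HS_normsq Q (\<Phi> s \<omega>)) \<partial>lborel) < \<infinity>) \<and>
     (\<forall>t\<in>{0..T}. I t \<in> borel_measurable (F t)) \<and>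
     (AE \<omega> in M. continuous_on {0..T} (\<lambda>t. I t \<omega>)) \<and>
     (\<exists>E :: nat \<Rightarrow> ('w, 'h) elementary.
        (\<forall>n. elementary F T (E n)) \<and>
        converges_to_0_in_prob M (\<lambda>n \<omega>.
          \<integral>\<^sup>+s\<in>{0..T}. ennreal (HS_normsq Q (\<Phi> s \<omega> - elementary_process (E n) s \<omega>)) \<partial>lborel) \<and>
        (\<forall>t\<in>{0..T}. converges_to_0_in_prob M (\<lambda>n \<omega>.
          ennreal (norm (I t \<omega> - elementary_integral W (E n) t \<omega>)))))"

section \<open>Consensus-based optimisation\<close>

text \<open>In Isabelle \<open>0 powr 0 = 0\<close> rather than \<open>1\<close>; for \<open>p = 1\<close> this changes the last condition only
  by a factor (at most \<open>3\<close>), which is absorbed by the existentially quantified constant \<open>L\<close>.\<close>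

definition admissible_objective :: "('h::real_normed_vector \<Rightarrow> real) \<Rightarrow> bool" where
  "admissible_objective \<E> \<longleftrightarrow>
     (\<exists>p C c R\<^sub>0 L. p \<ge> 1 \<and> C > 0 \<and> c > 0 \<and> R\<^sub>0 > 0 \<and> L > 0 \<and>
        (\<forall>x. 0 \<le> \<E> x) \<and>
        (\<forall>x. \<E> x \<le> C * (1 + norm x powr p)) \<and>
        (\<forall>x. norm x > R\<^sub>0 \<longrightarrow> c * norm x powr p \<le> \<E> x) \<and>
        (\<forall>x y. \<bar>\<E> x - \<E> y\<bar> \<le> L * (1 + norm x powr (p - 1) + norm y powr (p - 1)) * norm (x - y)))"

definition active_subspace ::
    "'h set \<Rightarrow> ('h \<Rightarrow>\<^sub>L 'h) \<Rightarrow> ('h::{real_inner, banach} \<Rightarrow> real) \<Rightarrow> 'h measure \<Rightarrow> bool" where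
  "active_subspace V Q \<E> \<mu>\<^sub>0 \<longleftrightarrow>
     (\<exists>B. finite B \<and> span B = V) \<and>
     (\<forall>x. \<exists>v\<in>V. \<exists>w. (\<forall>u\<in>V. w \<bullet> u = 0) \<and> x = v + w) \<and>
     (\<exists>x\<^sub>m\<^sub>i\<^sub>n\<in>V. \<forall>y. \<E> x\<^sub>m\<^sub>i\<^sub>n \<le> \<E> y) \<and>
     (AE x in \<mu>\<^sub>0. x \<in> V) \<and>
     (\<exists>\<kappa>>0. \<forall>v\<in>V. v \<bullet> Q v \<ge> \<kappa> * (norm v)\<^sup>2)"

definition consensus_point ::
    "real \<Rightarrow> ('h \<Rightarrow> real) \<Rightarrow> 'h measure \<Rightarrow> 'h::{banach, second_countable_topology}" where
  "consensus_point \<alpha> \<E> \<mu> =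
     (LINT x|\<mu>. exp (- \<alpha> * \<E> x) *\<^sub>R x) /\<^sub>R (LINT x|\<mu>. exp (- \<alpha> * \<E> x))"

text \<open>
  Strong solutions on \<open>[0,T]\<close> of
  \<open>dX\<^sub>t = - lam (X\<^sub>t - m\<^sub>t) dt + \<sigma> \<parallel>X\<^sub>t - m\<^sub>t\<parallel> P\<^sub>V dW\<^sub>t\<close>, \<open>X\<^sub>0 = \<xi>\<close>,
  where \<open>m\<^sub>t\<close> is the consensus point of the law of \<open>X\<^sub>t\<close>.  The consensus point is only defined for
  laws with finite second moment, whence the moment condition at each fixed time.  The integral
  equation at \<open>t = 0\<close> contains the initial condition.
\<close>

definition CBO_strong_solution ::
    "'w measure \<Rightarrow> (real \<Rightarrow> 'w measure) \<Rightarrow>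
     ('h \<Rightarrow>\<^sub>L 'h::{real_inner, banach, second_countable_topology}) \<Rightarrow>
     (real \<Rightarrow> 'w \<Rightarrow> 'h) \<Rightarrow> real \<Rightarrow> ('h \<Rightarrow> real) \<Rightarrow> 'h set \<Rightarrow>
     real \<Rightarrow> real \<Rightarrow> real \<Rightarrow> ('w \<Rightarrow> 'h) \<Rightarrow> (real \<Rightarrow> 'w \<Rightarrow> 'h) \<Rightarrow> bool" where
  "CBO_strong_solution M F Q W T \<E> V \<alpha> lam \<sigma> \<xi> X \<longleftrightarrow>
     predictable M F T X \<and>
     (AE \<omega> in M. continuous_on {0..T} (\<lambda>t. X t \<omega>)) \<and>
     (\<forall>t\<in>{0..T}. integrable M (\<lambda>\<omega>. (norm (X t \<omega>))\<^sup>2)) \<and>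
     (let m = (\<lambda>t. consensus_point \<alpha> \<E> (distr M borel (X t))) in
        (AE \<omega> in M. set_integrable lborel {0..T} (\<lambda>s. X s \<omega> - m s)) \<and>
        (\<exists>I. has_stochastic_integral M F Q W T
               (\<lambda>s \<omega>. (\<sigma> * norm (X s \<omega> - m s)) *\<^sub>R orthogonal_projection V) I \<and>
             (AE \<omega> in M. \<forall>t\<in>{0..T}.
                X t \<omega> = \<xi> \<omega> - lam *\<^sub>R (LINT s:{0..t}|lborel. X s \<omega> - m s) + I t \<omega>)))"

text \<open>Membership in \<open>L\<^sup>2(\<Omega>; C([0,T]; H))\<close> for processes with a.s. continuous paths.\<close>

definition L2_continuous ::
    "'w measure \<Rightarrow> real \<Rightarrow> (real \<Rightarrow> 'w \<Rightarrow> 'h::real_normed_vector) \<Rightarrow> bool" where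
  "L2_continuous M T X \<longleftrightarrow>
     (\<forall>t\<in>{0..T}. X t \<in> borel_measurable M) \<and>
     (AE \<omega> in M. continuous_on {0..T} (\<lambda>t. X t \<omega>)) \<and>
     (\<integral>\<^sup>+\<omega>. (SUP t\<in>{0..T}. ennreal ((norm (X t \<omega>))\<^sup>2)) \<partial>M) < \<infinity>"

definition indistinguishable_on ::
    "'w measure \<Rightarrow> real \<Rightarrow> (real \<Rightarrow> 'w \<Rightarrow> 'h) \<Rightarrow> (real \<Rightarrow> 'w \<Rightarrow> 'h) \<Rightarrow> bool" where
  "indistinguishable_on M T X Y \<longleftrightarrow> (AE \<omega> in M. \<forall>t\<in>{0..T}. X t \<omega> = Y t \<omega>)"

end

theory Submission
  imports Defs
begin

text \<open>
  For an admissible objective the weight \<open>exp (- \<alpha> \<E>)\<close> and its product with \<open>x\<close> are bounded and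
  Lipschitz, because the exponential decay absorbs every polynomial factor. Hence the consensus
  point is Lipschitz in the second-moment distance as long as its normalisation stays above some
  \<open>\<delta> > 0\<close>. Truncating the normalisation at \<open>\<delta>\<close> gives an equation that Picard iteration solves,
  given Doob's inequality and the Ito isometry. The second moment of its solution is bounded
  independently of \<open>\<delta>\<close>, since the truncated consensus point grows at most linearly with a constant
  not depending on \<open>\<delta>\<close>; such a bound forces a lower bound on the normalisation, so for small \<open>\<delta>\<close> the
  truncation is inactive.

  For uniqueness the second moments of an arbitrary solution are only known to be finite at each
  time, and its stochastic integral is only a limit in probability. Both solutions are therefore
  cut off when they become large; Gronwall's inequality first bounds their distance, and then, the
  cut-off being removed by Fatou's lemma, shows that it vanishes.
\<close>

section \<open>Orthonormal bases and Hilbert--Schmidt norms\<close>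

text \<open>The estimates behind existence are mean-square estimates, but an arbitrary competitor
  supplies only an integral that is a limit in probability of elementary ones, so no isometry
  applies to it directly. The bridge is locality: by Lenglart's inequality two such integrals agree
  almost surely on every event on which their integrands agree, and an integrand multiplied by a
  cut-off is bounded, hence has a mean-square integral. The Lipschitz bound for the consensus point
  involves the second moment of the whole difference, which the cut-off does not control; therefore
  the bounded difference of the two consensus paths is first treated as an inhomogeneity. For a
  given solution the normalisation is bounded below by compactness of \<open>{0..T}\<close>: the
  weight is bounded and positive, so its mean is continuous and positive once the paths are
  continuous. Integrals with values in the Hilbert space are reduced to scalar ones along the basis
  used in the trace, the Hilbert--Schmidt norm being the sum of the scalar variances. Completeness
  of \<open>F 0\<close> allows processes to be replaced by versions all of whose paths are
  continuous.\<close>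

locale orthonormal_sequence =
  fixes e :: "nat \<Rightarrow> 'h::{real_inner, banach}"
  assumes orth: "\<And>i j. e i \<bullet> e j = (if i = j then 1 else 0)"
begin

definition proj :: "nat \<Rightarrow> 'h \<Rightarrow> 'h" where
  "proj n x = (\<Sum>i<n. (x \<bullet> e i) *\<^sub>R e i)"

lemma inner_sum_basis: "(\<Sum>i\<in>A. c i *\<^sub>R e i) \<bullet> e j = (if finite A \<and> j \<in> A then c j else 0)"
  by (cases "finite A") (simp_all add: inner_sum_left orth if_distrib cong: if_cong)

lemma norm_sum_basis:
  assumes "finite A" shows "(norm (\<Sum>i\<in>A. c i *\<^sub>R e i))\<^sup>2 = (\<Sum>i\<in>A. (c i)\<^sup>2)"
  unfolding power2_norm_eq_inner
  by (subst inner_sum_right) (simp add: inner_sum_basis assms power2_eq_square)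

lemma bessel: "(\<Sum>i<n. (x \<bullet> e i)\<^sup>2) + (norm (x - proj n x))\<^sup>2 = (norm x)\<^sup>2"
proof -
  have "x \<bullet> proj n x = (\<Sum>i<n. (x \<bullet> e i)\<^sup>2)"
    by (simp add: proj_def inner_sum_right power2_eq_square)
  moreover have "proj n x \<bullet> proj n x = (\<Sum>i<n. (x \<bullet> e i)\<^sup>2)"
    using norm_sum_basis[of "{..<n}" "\<lambda>i. x \<bullet> e i"] by (simp add: proj_def power2_norm_eq_inner)
  ultimately show ?thesis
    by (simp add: power2_norm_eq_inner inner_diff_left inner_diff_right inner_commute)
qed

lemma bessel_le: "(\<Sum>i<n. (x \<bullet> e i)\<^sup>2) \<le> (norm x)\<^sup>2"
  using bessel[of x n] zero_le_power2[of "norm (x - proj n x)"] by linarith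

text \<open>By Pythagoras a block of the vector series has the same squared size as the block of
  squared coefficients, so the Cauchy property carries over.\<close>

lemma summable_orthogonal:
  assumes "summable (\<lambda>i. (c i)\<^sup>2)" shows "summable (\<lambda>i. c i *\<^sub>R e i)"
  unfolding summable_Cauchy
proof (intro allI impI)
  fix \<epsilon> :: real assume "\<epsilon> > 0"
  then have "\<epsilon>\<^sup>2 > 0" by simp
  then obtain N where N: "\<And>m n. m \<ge> N \<Longrightarrow> norm (\<Sum>i=m..<n. (c i)\<^sup>2) < \<epsilon>\<^sup>2"
    using assms unfolding summable_Cauchy by blast
  have "norm (\<Sum>i=m..<n. c i *\<^sub>R e i) < \<epsilon>" if "m \<ge> N" for m n
  proof -
    have "(norm (\<Sum>i=m..<n. c i *\<^sub>R e i))\<^sup>2 < \<epsilon>\<^sup>2"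
      using N[OF that, of n] by (simp add: norm_sum_basis)
    then show ?thesis using \<open>\<epsilon> > 0\<close> by (simp add: power_less_imp_less_base)
  qed
  then show "\<exists>N. \<forall>m\<ge>N. \<forall>n. norm (\<Sum>i=m..<n. c i *\<^sub>R e i) < \<epsilon>" by blast
qed

lemma summable_coeff: "summable (\<lambda>i. (x \<bullet> e i)\<^sup>2)"
  by (rule summableI_nonneg_bounded[of _ "(norm x)\<^sup>2"]) (simp_all add: bessel_le)

lemma suminf_orthogonal_coeff:
  assumes "summable (\<lambda>i. (c i)\<^sup>2)" shows "(\<Sum>i. c i *\<^sub>R e i) \<bullet> e j = c j"
proof -
  have "(\<lambda>i. (c i *\<^sub>R e i) \<bullet> e j) sums ((\<Sum>i. c i *\<^sub>R e i) \<bullet> e j)"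
    using summable_sums[OF summable_orthogonal[OF assms]]
    by (rule bounded_linear.sums[OF bounded_linear_inner_left])
  moreover have "(\<lambda>i. (c i *\<^sub>R e i) \<bullet> e j) sums c j"
    using sums_single[of j c] by (simp add: orth if_distrib[of "\<lambda>x. _ * x"] cong: if_cong)
  ultimately show ?thesis by (rule sums_unique2)
qed

end

section \<open>Expansions and adjoints in a complete orthonormal sequence\<close>

locale hilbert_basis = orthonormal_sequence e for e :: "nat \<Rightarrow> 'h::{real_inner, banach}" +
  assumes dense: "closure (span (range e)) = UNIV"
begin

lemma orthogonal_basis_eq_0:
  assumes "\<And>i. z \<bullet> e i = 0" shows "z = 0"
proof -
  have "range e \<subseteq> {x. z \<bullet> x = 0}" using assms by auto
  then have "span (range e) \<subseteq> {x. z \<bullet> x = 0}"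
    by (rule span_minimal) (rule subspace_hyperplane)
  moreover have "closed {x. z \<bullet> x = 0}" by (rule closed_hyperplane)
  ultimately have "closure (span (range e)) \<subseteq> {x. z \<bullet> x = 0}" by (rule closure_minimal)
  then have "z \<in> {x. z \<bullet> x = 0}" using dense by blast
  then show ?thesis by simp
qed

lemma expansion: "(\<lambda>i. (x \<bullet> e i) *\<^sub>R e i) sums x"
proof -
  have "x - (\<Sum>i. (x \<bullet> e i) *\<^sub>R e i) = 0"
    by (rule orthogonal_basis_eq_0)
      (simp add: inner_diff_left suminf_orthogonal_coeff[OF summable_coeff])
  then show ?thesis
    using summable_sums[OF summable_orthogonal[OF summable_coeff, of x]] by simp
qed

lemma parseval: "(\<lambda>i. (x \<bullet> e i)\<^sup>2) sums (norm x)\<^sup>2"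
  using bounded_linear.sums[OF bounded_linear_inner_right[of x] expansion[of x]]
  by (simp add: power2_norm_eq_inner) (simp add: power2_eq_square)

lemma ennreal_parseval: "(\<Sum>i. ennreal ((x \<bullet> e i)\<^sup>2)) = ennreal ((norm x)\<^sup>2)"
  by (rule suminf_ennreal_eq) (use parseval[of x] in auto)

text \<open>The adjoint is built from its would-be coefficients \<open>A (e i) \<bullet> y\<close>,
  as in the Riesz representation theorem. Existence matters because \<open>adjoint\<close> is a
  choice and carries no information otherwise.\<close>

lemma adjoint_exists:
  fixes A :: "'h \<Rightarrow>\<^sub>L 'h"
  shows "\<exists>A'. \<forall>x y. A x \<bullet> y = x \<bullet> A' y"
proof -
  have "\<exists>z. \<forall>x. A x \<bullet> y = x \<bullet> z" for y
  proof -
    define c where "c i = A (e i) \<bullet> y" for i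
    have le: "(\<Sum>i<n. (c i)\<^sup>2) \<le> (norm A * norm y)\<^sup>2" for n
    proof -
      \<comment> \<open>Testing \<open>A\<close> on the truncated candidate itself gives a bound of
        its squared norm by \<open>norm A * norm y * norm z\<close>, and one factor cancels.\<close>
      define z where "z = (\<Sum>i<n. c i *\<^sub>R e i)"
      have n: "(norm z)\<^sup>2 = (\<Sum>i<n. (c i)\<^sup>2)" unfolding z_def by (rule norm_sum_basis) simp
      also have "\<dots> = A z \<bullet> y"
        by (simp add: z_def blinfun.sum_right blinfun.scaleR_right inner_sum_left c_def power2_eq_square)
      also have "\<dots> \<le> norm (A z) * norm y" by (rule norm_cauchy_schwarz)
      also have "\<dots> \<le> (norm A * norm z) * norm y" by (intro mult_right_mono norm_blinfun) simp
      finally have "norm z * norm z \<le> (norm A * norm y) * norm z"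
        by (simp add: power2_eq_square mult_ac)
      then have "norm z \<le> norm A * norm y"
        by (cases "norm z = 0") (auto simp: mult_le_cancel_right)
      then have "(norm z)\<^sup>2 \<le> (norm A * norm y)\<^sup>2" by (rule power_mono) simp
      then show ?thesis using n by simp
    qed
    have sm: "summable (\<lambda>i. (c i)\<^sup>2)"
      by (rule summableI_nonneg_bounded[of _ "(norm A * norm y)\<^sup>2"]) (simp_all add: le)
    have "A x \<bullet> y = x \<bullet> (\<Sum>i. c i *\<^sub>R e i)" for x
    proof -
      have "(\<lambda>i. A ((x \<bullet> e i) *\<^sub>R e i) \<bullet> y) sums (A x \<bullet> y)"
        by (intro bounded_linear.sums[OF bounded_linear_inner_left]
            bounded_linear.sums[OF blinfun.bounded_linear_right] expansion)
      moreover have "(\<lambda>i. x \<bullet> (c i *\<^sub>R e i)) sums (x \<bullet> (\<Sum>i. c i *\<^sub>R e i))"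
        by (intro bounded_linear.sums[OF bounded_linear_inner_right] summable_sums summable_orthogonal sm)
      moreover have "(\<lambda>i. A ((x \<bullet> e i) *\<^sub>R e i) \<bullet> y) = (\<lambda>i. x \<bullet> (c i *\<^sub>R e i))"
        by (simp add: blinfun.scaleR_right c_def mult.commute)
      ultimately show ?thesis using sums_unique2 by metis
    qed
    then show ?thesis by blast
  qed
  then show ?thesis by metis
qed

definition adj :: "('h \<Rightarrow>\<^sub>L 'h) \<Rightarrow> 'h \<Rightarrow> 'h" where
  "adj A = adjoint (blinfun_apply A)"

lemma inner_adj: "blinfun_apply A x \<bullet> y = x \<bullet> adj A y"
proof -
  have "\<forall>x y. blinfun_apply A x \<bullet> y = x \<bullet> adj A y"
    using someI_ex[OF adjoint_exists[of A]] unfolding adj_def adjoint_def .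
  then show ?thesis by blast
qed

lemma inner_eqI: "(\<And>x. x \<bullet> y = x \<bullet> z) \<Longrightarrow> y = (z::'h)"
  using inner_eq_zero_iff[of "y - z"] by (simp add: inner_diff_right)

lemma adj_add: "adj (A + B) y = adj A y + adj B y"
  by (rule inner_eqI) (simp add: inner_adj[symmetric] inner_add blinfun.add_left)

lemma adj_diff: "adj (A - B) y = adj A y - adj B y"
  by (rule inner_eqI) (simp add: inner_adj[symmetric] inner_diff blinfun.diff_left)

lemma adj_scaleR: "adj (c *\<^sub>R A) y = c *\<^sub>R adj A y"
  by (rule inner_eqI) (simp add: inner_adj[symmetric] blinfun.scaleR_left)

lemma adj_zero: "adj 0 y = 0"
  by (rule inner_eqI) (simp add: inner_adj[symmetric])

lemma adj_sum: "adj (\<Sum>k\<in>K. A k) y = (\<Sum>k\<in>K. adj (A k) y)"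
  by (induction K rule: infinite_finite_induct) (auto simp: adj_zero adj_add)

end

section \<open>Existence and enumeration of an orthonormal basis\<close>

lemma infinite_dimensional_basis_infinite:
  fixes B :: "'h::real_inner set"
  assumes "infinite_dimensional TYPE('h)" and "\<forall>e\<in>B. norm e = 1" and "pairwise orthogonal B"
    and *: "\<And>z. (\<And>x. x \<in> B \<Longrightarrow> z \<bullet> x = 0) \<Longrightarrow> z = 0"
  shows "infinite B"
proof
  assume fin: "finite B"
  \<comment> \<open>If the family were finite, every vector would equal its finite Fourier sum,
    because the remainder is orthogonal to the family.\<close>
  have "x \<in> span B" for x
  proof -
    have "x - (\<Sum>b\<in>B. (x \<bullet> b) *\<^sub>R b) = 0"
    proof (rule *)
      fix a assume a: "a \<in> B"
      have "(\<Sum>b\<in>B. (x \<bullet> b) * (b \<bullet> a)) = (\<Sum>b\<in>B. if b = a then x \<bullet> a else 0)"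
      proof (rule sum.cong[OF refl])
        fix b assume "b \<in> B"
        show "x \<bullet> b * (b \<bullet> a) = (if b = a then x \<bullet> a else 0)"
          using a \<open>b \<in> B\<close> assms(2,3)
          by (auto simp: pairwise_def orthogonal_def norm_eq_1)
      qed
      then show "(x - (\<Sum>b\<in>B. (x \<bullet> b) *\<^sub>R b)) \<bullet> a = 0"
        using a fin by (simp add: inner_diff_left inner_sum_left)
    qed
    moreover have "(\<Sum>b\<in>B. (x \<bullet> b) *\<^sub>R b) \<in> span B"
      by (intro span_sum span_scale span_base)
    ultimately show ?thesis by simp
  qed
  then show False using assms(1) fin unfolding infinite_dimensional_def by blast
qed

text \<open>Distinct elements are at distance \<open>sqrt 2\<close>, so the balls of radius
  \<open>1/2\<close> around them are disjoint open sets, of which a second countable space holds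
  only countably many.\<close>

lemma countable_orthonormal:
  fixes B :: "'h::{real_inner, second_countable_topology} set"
  assumes n1: "\<forall>e\<in>B. norm e = 1" and o: "pairwise orthogonal B"
  shows "countable B"
proof -
  have d: "dist a b > 1" if "a \<in> B" "b \<in> B" "a \<noteq> b" for a b
  proof -
    have "(dist a b)\<^sup>2 = 2"
      using that n1 o unfolding dist_norm power2_norm_eq_inner
      by (auto simp: inner_diff_left inner_diff_right pairwise_def orthogonal_def norm_eq_1)
    then have "(1::real)\<^sup>2 < (dist a b)\<^sup>2" by simp
    then show ?thesis by (rule power_less_imp_less_base) simp
  qed
  have "disjoint ((\<lambda>a. ball a (1/2)) ` B)"
  proof (rule disjointI)
    fix U U' assume "U \<in> (\<lambda>a. ball a (1/2)) ` B" "U' \<in> (\<lambda>a. ball a (1/2)) ` B" "U \<noteq> U'"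
    then obtain a b where ab: "a \<in> B" "b \<in> B" "U = ball a (1/2)" "U' = ball b (1/2)" "a \<noteq> b" by auto
    have "False" if "dist a x < 1/2" "dist b x < 1/2" for x
      using d[OF ab(1,2,5)] that dist_triangle2[of a b x] by linarith
    then show "U \<inter> U' = {}" using ab by auto
  qed
  then have "countable ((\<lambda>a. ball a (1/2)) ` B)"
    by (intro countable_disjoint_open_subsets) auto
  moreover have "inj_on (\<lambda>a. ball a (1/2)) B"
  proof (rule inj_onI)
    fix a b assume ab: "a \<in> B" "b \<in> B" "ball a (1/2) = ball b (1/2)"
    have "b \<in> ball a (1/2)" unfolding ab(3) by simp
    then have "dist a b < 1/2" by simp
    then show "a = b" using d[OF ab(1,2)] by force
  qed
  ultimately show ?thesis by (rule countable_image_inj_on)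
qed

lemma orthonormal_enumeration:
  fixes B :: "'h::{real_inner, banach, second_countable_topology} set"
  assumes n1: "\<forall>e\<in>B. norm e = 1" and o: "pairwise orthogonal B" and inf: "infinite B"
  shows "\<exists>e. range e = B \<and> inj e \<and> orthonormal_sequence e"
proof -
  have b: "bij_betw (from_nat_into B) UNIV B"
    by (rule bij_betw_from_nat_into[OF countable_orthonormal[OF n1 o] inf])
  then have r: "range (from_nat_into B) = B" and i: "inj (from_nat_into B)"
    by (auto simp: bij_betw_def)
  have "orthonormal_sequence (from_nat_into B)"
  proof
    fix i j
    have "from_nat_into B i \<in> B" "from_nat_into B j \<in> B" using r by auto
    then show "from_nat_into B i \<bullet> from_nat_into B j = (if i = j then 1 else 0)"
      using n1 o inj_eq[OF i, of i j] by (auto simp: norm_eq_1 pairwise_def orthogonal_def)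
  qed
  then show ?thesis using r i by blast
qed

text \<open>\<open>trace_op\<close> picks its basis by \<open>SOME\<close>, which says nothing
  without existence. A maximal orthonormal set, from Zorn's lemma, has no nonzero vector orthogonal
  to it.\<close>

lemma orthonormal_basis_exists:
  assumes inf: "infinite_dimensional TYPE('h::{real_inner, banach, second_countable_topology})"
  shows "\<exists>B::'h set. orthonormal_basis B"
proof -
  define S where "S = {B::'h set. (\<forall>e\<in>B. norm e = 1) \<and> pairwise orthogonal B}"
  have "\<exists>M\<in>S. \<forall>X\<in>S. M \<subseteq> X \<longrightarrow> X = M"
  proof (rule subset_Zorn')
    fix C assume C: "subset.chain S C"
    have "pairwise orthogonal (\<Union>C)"
      unfolding pairwise_def
    proof (intro ballI impI)
      fix x y assume xy: "x \<in> \<Union>C" "y \<in> \<Union>C" "x \<noteq> y"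
      then obtain X Y where XY: "X \<in> C" "Y \<in> C" "x \<in> X" "y \<in> Y" by auto
      then have "X \<subseteq> Y \<or> Y \<subseteq> X" using C unfolding subset.chain_def by (metis psubset_imp_subset subset.chain_def C subset_chain_def)
      moreover have "pairwise orthogonal X" "pairwise orthogonal Y"
        using C XY unfolding subset.chain_def S_def by auto
      ultimately show "orthogonal x y" using XY xy(3) unfolding pairwise_def by blast
    qed
    moreover have "\<forall>e\<in>\<Union>C. norm e = 1" using C unfolding subset.chain_def S_def by auto
    ultimately show "\<Union>C \<in> S" unfolding S_def by blast
  qed
  then obtain B where B: "\<forall>e\<in>B. norm e = 1" "pairwise orthogonal B"
    and max: "\<And>X. X \<in> S \<Longrightarrow> B \<subseteq> X \<Longrightarrow> X = B" unfolding S_def by auto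
  have z: "z = 0" if h: "\<And>x. x \<in> B \<Longrightarrow> z \<bullet> x = 0" for z
  proof (rule ccontr)
    assume "z \<noteq> 0"
    define u where "u = z /\<^sub>R norm z"
    have "norm u = 1" using \<open>z \<noteq> 0\<close> by (simp add: u_def)
    moreover have uo: "u \<bullet> x = 0" if "x \<in> B" for x using h[OF that] by (simp add: u_def)
    ultimately have "insert u B \<in> S"
      using B unfolding S_def by (auto simp: pairwise_insert orthogonal_def inner_commute)
    then have "u \<in> B" using max by blast
    then show False using uo[of u] \<open>norm u = 1\<close> by simp
  qed
  have infB: "infinite B" by (rule infinite_dimensional_basis_infinite[OF inf B z])
  obtain e where e: "range e = B" "orthonormal_sequence e"
    using orthonormal_enumeration[OF B infB] by blast
  interpret orthonormal_sequence e by fact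
  have "x \<in> closure (span B)" for x
  proof -
    have "x - (\<Sum>i. (x \<bullet> e i) *\<^sub>R e i) = 0"
      by (rule z) (use e(1) in \<open>auto simp: inner_diff_left suminf_orthogonal_coeff[OF summable_coeff]\<close>)
    then have "(\<lambda>n. \<Sum>i<n. (x \<bullet> e i) *\<^sub>R e i) \<longlonglongrightarrow> x"
      using summable_sums[OF summable_orthogonal[OF summable_coeff, of x]] unfolding sums_def by simp
    moreover have "(\<Sum>i<n. (x \<bullet> e i) *\<^sub>R e i) \<in> span B" for n
      using e(1) by (intro span_sum span_scale span_base) auto
    ultimately show ?thesis
      unfolding closure_sequential by (intro exI[of _ "\<lambda>n. \<Sum>i<n. (x \<bullet> e i) *\<^sub>R e i"]) simp
  qed
  then have "orthonormal_basis B" unfolding orthonormal_basis_def using B by auto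
  then show ?thesis by blast
qed

text \<open>The sequence enumerates exactly the set picked inside \<open>trace_op\<close>, so that
  traces become series indexed by \<open>nat\<close>.\<close>

lemma trace_basis_enumeration:
  assumes inf: "infinite_dimensional TYPE('h::{real_inner, banach, second_countable_topology})"
  shows "\<exists>e::nat \<Rightarrow> 'h. hilbert_basis e \<and> inj e \<and> range e = (SOME B. orthonormal_basis B)"
proof -
  define B :: "'h set" where "B = (SOME B. orthonormal_basis B)"
  have B: "orthonormal_basis B" unfolding B_def by (rule someI_ex) (rule orthonormal_basis_exists[OF inf])
  then have B': "\<forall>e\<in>B. norm e = 1" "pairwise orthogonal B" "closure (span B) = UNIV"
    by (auto simp: orthonormal_basis_def)
  have z: "z = 0" if h: "\<And>x. x \<in> B \<Longrightarrow> z \<bullet> x = 0" for z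
  proof -
    have "B \<subseteq> {x. z \<bullet> x = 0}" using h by auto
    then have "span B \<subseteq> {x. z \<bullet> x = 0}" by (rule span_minimal) (rule subspace_hyperplane)
    then have "closure (span B) \<subseteq> {x. z \<bullet> x = 0}" by (rule closure_minimal) (rule closed_hyperplane)
    then have "z \<in> {x. z \<bullet> x = 0}" using B' by blast
    then show ?thesis by simp
  qed
  have infB: "infinite B" by (rule infinite_dimensional_basis_infinite[OF inf B'(1,2) z])
  obtain e where e: "range e = B" "inj e" "orthonormal_sequence e"
    using orthonormal_enumeration[OF B'(1,2) infB] by blast
  have "hilbert_basis e"
    using e B' by (simp add: hilbert_basis_def hilbert_basis_axioms_def)
  then show ?thesis using e B_def by blast
qed

section \<open>Traces and Hilbert--Schmidt norms relative to the covariance\<close>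

locale hilbert_trace = hilbert_basis e
  for e :: "nat \<Rightarrow> 'h::{real_inner, banach, second_countable_topology}" +
  fixes Q :: "'h \<Rightarrow>\<^sub>L 'h"
  assumes range_e: "range e = (SOME B. orthonormal_basis B)" and inj_e: "inj e"
    and covQ: "covariance_operator Q"
begin

lemma Q_nonneg: "0 \<le> x \<bullet> Q x" and Q_trace: "trace_class Q"
  using covQ unfolding covariance_operator_def by auto

text \<open>The variance per unit time of the Wiener process in direction \<open>v\<close>.\<close>

definition qf :: "'h \<Rightarrow> real" where "qf v = v \<bullet> Q v"

lemma qf_nonneg [simp]: "0 \<le> qf v" unfolding qf_def by (rule Q_nonneg)

lemma qf_scaleR: "qf (c *\<^sub>R v) = c\<^sup>2 * qf v"
  by (simp add: qf_def blinfun.scaleR_right power2_eq_square)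

text \<open>The parallelogram identity for the form \<open>qf\<close>, with the nonnegative term
  \<open>qf (u - v)\<close> dropped.\<close>

lemma qf_add_le: "qf (u + v) \<le> 2 * qf u + 2 * qf v"
proof -
  have "0 \<le> qf (u - v)" by simp
  then show ?thesis by (simp add: qf_def blinfun.add_right blinfun.diff_right inner_add inner_diff)
qed

lemma continuous_qf: "continuous_on UNIV qf"
  unfolding qf_def by (intro continuous_intros)

lemma measurable_qf [measurable]: "qf \<in> borel_measurable borel"
  by (rule borel_measurable_continuous_onI[OF continuous_qf])

definition hs :: "('h \<Rightarrow>\<^sub>L 'h) \<Rightarrow> real" where "hs A = HS_normsq Q A"

text \<open>After inserting the nuclear series of \<open>Q\<close> and exchanging it with the finite
  sum over \<open>i\<close>, Cauchy--Schwarz and Bessel bound every partial sum by the squared norm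
  of \<open>A\<close> times the nuclear sum.\<close>

lemma summable_trace: "summable (\<lambda>i. qf (adj A (e i)))"
proof -
  obtain a b :: "nat \<Rightarrow> 'h" where ab: "summable (\<lambda>n. norm (a n) * norm (b n))"
    "\<And>x. (\<lambda>n. (b n \<bullet> x) *\<^sub>R a n) sums Q x"
    using Q_trace unfolding trace_class_def by blast
  define S where "S = (\<Sum>n. norm (a n) * norm (b n))"
  have "(\<Sum>i<N. qf (adj A (e i))) \<le> (norm A)\<^sup>2 * S" for N
  proof -
    have s: "(\<lambda>n. (A (b n) \<bullet> e i) * (A (a n) \<bullet> e i)) sums qf (adj A (e i))" for i
    proof -
      have "(\<lambda>n. adj A (e i) \<bullet> ((b n \<bullet> adj A (e i)) *\<^sub>R a n)) sums (adj A (e i) \<bullet> Q (adj A (e i)))"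
        by (intro bounded_linear.sums[OF bounded_linear_inner_right] ab)
      then show ?thesis by (simp add: qf_def inner_adj inner_commute[of "adj A (e i)" "a _"])
    qed
    have "(\<lambda>n. \<Sum>i<N. (A (b n) \<bullet> e i) * (A (a n) \<bullet> e i)) sums (\<Sum>i<N. qf (adj A (e i)))"
      by (intro sums_sum s)
    moreover have "(\<lambda>n. (norm A)\<^sup>2 * (norm (a n) * norm (b n))) sums ((norm A)\<^sup>2 * S)"
      unfolding S_def by (intro sums_mult summable_sums ab)
    moreover have "(\<Sum>i<N. (A (b n) \<bullet> e i) * (A (a n) \<bullet> e i)) \<le> (norm A)\<^sup>2 * (norm (a n) * norm (b n))" for n
    proof -
      have "(\<Sum>i<N. (A (b n) \<bullet> e i) * (A (a n) \<bullet> e i)) = A (b n) \<bullet> proj N (A (a n))"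
        by (simp add: proj_def inner_sum_right mult_ac)
      also have "\<dots> \<le> norm (A (b n)) * norm (proj N (A (a n)))" by (rule norm_cauchy_schwarz)
      also have "\<dots> \<le> norm (A (b n)) * norm (A (a n))"
      proof (rule mult_left_mono)
        have "(norm (proj N (A (a n))))\<^sup>2 \<le> (norm (A (a n)))\<^sup>2"
          using bessel_le[of "A (a n)" N] norm_sum_basis[of "{..<N}" "\<lambda>i. A (a n) \<bullet> e i"]
          by (simp add: proj_def)
        then show "norm (proj N (A (a n))) \<le> norm (A (a n))" by (rule power2_le_imp_le) simp
      qed simp
      also have "\<dots> \<le> (norm A * norm (b n)) * (norm A * norm (a n))"
        by (intro mult_mono norm_blinfun) auto
      also have "\<dots> = (norm A)\<^sup>2 * (norm (a n) * norm (b n))"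
        by (simp add: power2_eq_square)
      finally show ?thesis .
    qed
    ultimately show ?thesis by (rule sums_le[rotated])
  qed
  then show ?thesis by (intro summableI_nonneg_bounded) auto
qed

text \<open>Moving \<open>A\<close> to the other side of each diagonal entry writes the trace as a
  sum of scalar variances. This is what allows scalar isometries to be added up over the
  coordinates.\<close>

lemma hs_sums: "(\<lambda>i. qf (adj A (e i))) sums hs A"
proof -
  define f where "f x = x \<bullet> A (Q (adjoint (blinfun_apply A) x))" for x
  have f: "f x = qf (adj A x)" for x
    unfolding f_def qf_def adj_def[symmetric]
    by (subst inner_commute, subst inner_adj, rule inner_commute)
  have "hs A = infsum f (range e)"
    unfolding hs_def HS_normsq_def trace_op_def f_def range_e[symmetric] ..
  also have "\<dots> = infsum (\<lambda>i. f (e i)) UNIV"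
    using infsum_reindex[OF inj_e, of f] by (simp add: o_def)
  finally have "hs A = infsum (\<lambda>i. f (e i)) UNIV" .
  moreover have "((\<lambda>i. f (e i)) has_sum (\<Sum>i. f (e i))) UNIV"
    by (rule norm_summable_imp_has_sum) (use summable_trace[of A] in \<open>auto simp: f intro: summable_sums\<close>)
  ultimately have "hs A = (\<Sum>i. qf (adj A (e i)))"
    using infsumI unfolding f by fastforce
  then show ?thesis using summable_sums[OF summable_trace[of A]] by simp
qed

lemma hs_nonneg [simp]: "0 \<le> hs A"
  using hs_sums[of A] by (rule sums_le[OF _ sums_zero, rotated]) simp

lemma hs_scaleR: "hs (c *\<^sub>R A) = c\<^sup>2 * hs A"
  using sums_mult[OF hs_sums[of A], of "c\<^sup>2"] hs_sums[of "c *\<^sub>R A"]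
  by (simp add: adj_scaleR qf_scaleR sums_iff)

lemma hs_zero [simp]: "hs 0 = 0"
  using hs_scaleR[of 0 0] by simp

lemma hs_add_le: "hs (A + B) \<le> 2 * hs A + 2 * hs B"
  by (rule sums_le[OF _ hs_sums sums_add[OF sums_mult[OF hs_sums] sums_mult[OF hs_sums]]])
    (simp add: adj_add qf_add_le)

lemma hs_diff_le: "hs (A - B) \<le> 2 * hs A + 2 * hs B"
  using hs_add_le[of A "-1 *\<^sub>R B"] hs_scaleR[of "-1" B] by simp

lemma ennreal_hs: "(\<Sum>i. ennreal (qf (adj A (e i)))) = ennreal (hs A)"
  by (rule suminf_ennreal_eq) (use hs_sums in auto)

end

section \<open>Increments of the Wiener process\<close>

lemma real_gaussian_centered_moments:
  assumes "v \<ge> 0"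
  shows "integrable (real_gaussian 0 v) (\<lambda>x. x)" "(LINT x|real_gaussian 0 v. x) = 0"
    "integrable (real_gaussian 0 v) (\<lambda>x. x\<^sup>2)" "(LINT x|real_gaussian 0 v. x\<^sup>2) = v"
proof -
  have "integrable (real_gaussian 0 v) (\<lambda>x. x) \<and> (LINT x|real_gaussian 0 v. x) = 0 \<and>
    integrable (real_gaussian 0 v) (\<lambda>x. x\<^sup>2) \<and> (LINT x|real_gaussian 0 v. x\<^sup>2) = v"
  proof (cases "v = 0")
    case True
    have i: "integrable (return borel (0::real)) f" if "f \<in> borel_measurable borel" for f :: "real \<Rightarrow> real"
    proof -
      interpret prob_space "return borel (0::real)" by (rule prob_space_return) simp
      have "AE x in return borel 0. norm (f x) \<le> norm (f 0)"
        using that by (simp add: AE_return)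
      then show ?thesis using that by (intro integrable_const_bound) auto
    qed
    have l: "(LINT x|return borel (0::real). f x) = f 0" if "f \<in> borel_measurable borel" for f :: "real \<Rightarrow> real"
      by (rule integral_return) (use that in auto)
    have eq: "real_gaussian 0 v = return borel 0" by (simp add: real_gaussian_def True)
    have sq: "(LINT x|return borel (0::real). x\<^sup>2) = v"
      using l[of "\<lambda>x. x\<^sup>2"] unfolding True by simp
    show ?thesis unfolding eq by (intro conjI i l sq) measurable
  next
    case False
    then have v: "sqrt v > 0" using assms by simp
    have 1: "has_bochner_integral lborel (\<lambda>x. normal_density 0 (sqrt v) x * x) 0"
      using normal_moment_odd[OF v, of 0 0] by simp
    have 2: "has_bochner_integral lborel (\<lambda>x. normal_density 0 (sqrt v) x * x\<^sup>2) v"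
      using normal_moment_even[OF v, of 0 1] assms by simp
    show ?thesis
      using False 1 2
      by (simp add: real_gaussian_def integrable_real_density integral_real_density has_bochner_integral_iff)
  qed
  then show "integrable (real_gaussian 0 v) (\<lambda>x. x)" "(LINT x|real_gaussian 0 v. x) = 0"
    "integrable (real_gaussian 0 v) (\<lambda>x. x\<^sup>2)" "(LINT x|real_gaussian 0 v. x\<^sup>2) = v" by auto
qed

text \<open>A deterministic form of Doob's inequality. The subtracted sum is a martingale transform
  of \<open>S\<close> with weights \<open>s k * sgn (S k)\<close> known at step \<open>k\<close>; in
  expectation it disappears and the constant 4 remains.\<close>

lemma doob_pathwise:
  fixes S :: "nat \<Rightarrow> real"
  defines "s \<equiv> \<lambda>k. Max ((\<lambda>j. \<bar>S j\<bar>) ` {..k})"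
  shows "(s m)\<^sup>2 \<le> 4 * (S m)\<^sup>2 - 4 * (\<Sum>k<m. (s k * sgn (S k)) * (S (Suc k) - S k))"
proof -
  have s0: "0 \<le> s k" for k
  proof -
    have "\<bar>S k\<bar> \<le> s k" unfolding s_def by (rule Max_ge) auto
    then show ?thesis by linarith
  qed
  have suc: "s (Suc k) = max \<bar>S (Suc k)\<bar> (s k)" for k
    unfolding s_def by (simp add: atMost_Suc)
  have *: "2 * (\<Sum>k<m. s k * (\<bar>S (Suc k)\<bar> - \<bar>S k\<bar>)) + (s m)\<^sup>2 \<le> 2 * s m * \<bar>S m\<bar>" for m
  proof (induction m)
    case 0 then show ?case by (simp add: s_def power2_eq_square mult.assoc)
  next
    case (Suc m)
    \<comment> \<open>The running maximum moves only when the new value attains it, and there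
      \<open>s (Suc m)\<close> is the absolute value of \<open>S (Suc m)\<close>.\<close>
    have "(s (Suc m))\<^sup>2 - (s m)\<^sup>2 \<le> 2 * (s (Suc m) - s m) * \<bar>S (Suc m)\<bar>"
    proof (cases "\<bar>S (Suc m)\<bar> \<le> s m")
      case False
      then have eq: "s (Suc m) = \<bar>S (Suc m)\<bar>" and le: "s m \<le> s (Suc m)" by (auto simp: suc)
      have "0 \<le> (s (Suc m) - s m)\<^sup>2" by simp
      then show ?thesis unfolding eq[symmetric] by (simp add: power2_eq_square algebra_simps)
    qed (simp add: suc)
    then show ?case using Suc by (simp add: algebra_simps)
  qed
  \<comment> \<open>Convexity of the absolute value, with subgradient
    \<open>sgn (S k)\<close>.\<close>
  have "s k * (sgn (S k) * (S (Suc k) - S k)) \<le> s k * (\<bar>S (Suc k)\<bar> - \<bar>S k\<bar>)" for k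
    by (rule mult_left_mono[OF _ s0]) (auto simp: sgn_real_def abs_real_def)
  then have "(\<Sum>k<m. (s k * sgn (S k)) * (S (Suc k) - S k)) \<le> (\<Sum>k<m. s k * (\<bar>S (Suc k)\<bar> - \<bar>S k\<bar>))"
    by (intro sum_mono) (simp add: mult.assoc)
  \<comment> \<open>Young's inequality: half of the square of \<open>s m\<close> is absorbed by the
    left-hand side, which doubles the remaining constants to 4.\<close>
  moreover have "2 * s m * \<bar>S m\<bar> \<le> (s m)\<^sup>2 / 2 + 2 * (S m)\<^sup>2"
    using zero_le_power2[of "s m - 2 * \<bar>S m\<bar>"] by (simp add: power2_diff)
  ultimately show ?thesis using *[of m] by linarith
qed

locale wiener = hilbert_trace e Q + prob_space M
  for e :: "nat \<Rightarrow> 'h::{real_inner, banach, second_countable_topology}" and Q and M :: "'w measure" +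
  fixes F :: "real \<Rightarrow> 'w measure" and W :: "real \<Rightarrow> 'w \<Rightarrow> 'h"
  assumes usual: "usual_filtration M F" and wiener: "Q_Wiener_process M F Q W"
begin

lemma subalg: "0 \<le> t \<Longrightarrow> subalgebra M (F t)"
  using usual unfolding usual_filtration_def by (elim conjE) simp

lemma space_F [simp]: "0 \<le> t \<Longrightarrow> space (F t) = space M"
  using subalg unfolding subalgebra_def by simp

lemma F_M: "f \<in> measurable (F t) N \<Longrightarrow> 0 \<le> t \<Longrightarrow> f \<in> measurable M N"
  using measurable_from_subalg[OF subalg] by blast

lemma sets_F_mono: "A \<in> sets (F s) \<Longrightarrow> 0 \<le> s \<Longrightarrow> s \<le> t \<Longrightarrow> A \<in> sets (F t)"
proof -
  assume "A \<in> sets (F s)" "0 \<le> s" "s \<le> t"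
  moreover have "\<forall>s t. 0 \<le> s \<longrightarrow> s \<le> t \<longrightarrow> sets (F s) \<subseteq> sets (F t)"
    using usual unfolding usual_filtration_def by (elim conjE)
  ultimately show ?thesis by blast
qed

lemma F_mono: "f \<in> measurable (F s) N \<Longrightarrow> 0 \<le> s \<Longrightarrow> s \<le> t \<Longrightarrow> f \<in> measurable (F t) N"
proof -
  assume f: "f \<in> measurable (F s) N" and st: "0 \<le> s" "s \<le> t"
  have "subalgebra (F t) (F s)"
    unfolding subalgebra_def using sets_F_mono[OF _ st] st by auto
  then show ?thesis using f by (rule measurable_from_subalg)
qed

lemma null_subset_F: "N \<in> null_sets M \<Longrightarrow> A \<subseteq> N \<Longrightarrow> 0 \<le> t \<Longrightarrow> A \<in> sets (F t)"
proof -
  assume A: "N \<in> null_sets M" "A \<subseteq> N" and t: "0 \<le> t"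
  have "\<forall>N\<in>null_sets M. \<forall>A. A \<subseteq> N \<longrightarrow> A \<in> sets (F 0)"
    using usual unfolding usual_filtration_def by (elim conjE)
  then have "A \<in> sets (F 0)" using A by blast
  then show ?thesis using sets_F_mono[of A 0 t] t by simp
qed

text \<open>Subsets of null sets lie in \<open>F 0\<close>, so an almost sure property defines an
  event of every \<open>F t\<close>, even when its measurability is otherwise unknown.\<close>

lemma AE_sets_F:
  assumes "AE \<omega> in M. P \<omega>" "0 \<le> t" shows "{\<omega>\<in>space M. P \<omega>} \<in> sets (F t)"
proof -
  obtain N where N: "{\<omega>\<in>space M. \<not> P \<omega>} \<subseteq> N" "N \<in> null_sets M"
    using assms(1) unfolding eventually_ae_filter by auto
  have "{\<omega>\<in>space M. \<not> P \<omega>} \<in> sets (F t)" by (rule null_subset_F[OF N(2,1) assms(2)])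
  then have "space (F t) - {\<omega>\<in>space M. \<not> P \<omega>} \<in> sets (F t)" by (rule sets.compl_sets)
  moreover have "space (F t) - {\<omega>\<in>space M. \<not> P \<omega>} = {\<omega>\<in>space M. P \<omega>}" using assms(2) by auto
  ultimately show ?thesis by simp
qed

text \<open>On the null set of disagreement the values of \<open>g\<close> are arbitrary, but by
  completeness every part of that set is an event. Adapted processes may thus be modified on null
  sets.\<close>

lemma measurable_F_AE_cong:
  fixes f g :: "'w \<Rightarrow> 'b::{second_countable_topology, metric_space, real_normed_vector}"
  assumes f: "f \<in> borel_measurable (F t)" and "AE \<omega> in M. f \<omega> = g \<omega>" "0 \<le> t"
  shows "g \<in> borel_measurable (F t)"
proof (rule measurableI)
  fix A :: "'b set" assume A: "A \<in> sets borel"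
  obtain N where N: "{\<omega>\<in>space M. \<not> f \<omega> = g \<omega>} \<subseteq> N" "N \<in> null_sets M"
    using assms(2) unfolding eventually_ae_filter by auto
  have G: "{\<omega>\<in>space M. f \<omega> = g \<omega>} \<in> sets (F t)" by (rule AE_sets_F[OF assms(2,3)])
  have B: "{\<omega>\<in>space M. f \<omega> \<noteq> g \<omega> \<and> g \<omega> \<in> A} \<in> sets (F t)"
    by (rule null_subset_F[OF N(2) _ assms(3)]) (use N in auto)
  have "(f -` A \<inter> space (F t)) \<inter> {\<omega>\<in>space M. f \<omega> = g \<omega>} \<union> {\<omega>\<in>space M. f \<omega> \<noteq> g \<omega> \<and> g \<omega> \<in> A} \<in> sets (F t)"
    using measurable_sets[OF f A] G B by auto
  moreover have "(f -` A \<inter> space (F t)) \<inter> {\<omega>\<in>space M. f \<omega> = g \<omega>} \<union> {\<omega>\<in>space M. f \<omega> \<noteq> g \<omega> \<and> g \<omega> \<in> A}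
      = g -` A \<inter> space (F t)"
    using assms(3) by auto
  ultimately show "g -` A \<inter> space (F t) \<in> sets (F t)" by simp
qed simp

text \<open>A version of \<open>W\<close> all of whose paths are continuous, still adapted by
  completeness. Suprema over time intervals can then be taken along countable sets for every
  \<omega>.\<close>

definition Wc :: "real \<Rightarrow> 'w \<Rightarrow> 'h" where
  "Wc t \<omega> = (if continuous_on {0..} (\<lambda>t. W t \<omega>) then W t \<omega> else 0)"

lemma Wc_continuous: "continuous_on {0..} (\<lambda>t. Wc t \<omega>)"
  unfolding Wc_def by (cases "continuous_on {0..} (\<lambda>t. W t \<omega>)") auto

lemma AE_Wc: "AE \<omega> in M. \<forall>t. Wc t \<omega> = W t \<omega>"
  using wiener unfolding Q_Wiener_process_def Wc_def by auto

lemma Wc_measurable: "0 \<le> t \<Longrightarrow> Wc t \<in> borel_measurable (F t)"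
proof -
  assume t: "0 \<le> t"
  have "AE \<omega> in M. W t \<omega> = Wc t \<omega>" using AE_Wc by eventually_elim simp
  moreover have "W t \<in> borel_measurable (F t)" using wiener t unfolding Q_Wiener_process_def by auto
  ultimately show ?thesis using measurable_F_AE_cong t by blast
qed

definition dW :: "real \<Rightarrow> real \<Rightarrow> 'w \<Rightarrow> 'h" where "dW s t \<omega> = Wc t \<omega> - Wc s \<omega>"

lemma dW_same [simp]: "dW s s \<omega> = 0" by (simp add: dW_def)

lemma dW_measurable: "0 \<le> s \<Longrightarrow> s \<le> t \<Longrightarrow> dW s t \<in> borel_measurable (F t)"
  unfolding dW_def by (intro borel_measurable_diff Wc_measurable F_mono[OF Wc_measurable]) auto

lemma dW_measurable_M [measurable]: "0 \<le> s \<Longrightarrow> s \<le> t \<Longrightarrow> dW s t \<in> borel_measurable M"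
  by (rule F_M[OF dW_measurable]) auto

lemma AE_dW: "AE \<omega> in M. dW s t \<omega> = W t \<omega> - W s \<omega>"
  using AE_Wc by eventually_elim (simp add: dW_def)

lemma increment_moments:
  assumes st: "0 \<le> s" "s \<le> t"
  shows "integrable M (\<lambda>\<omega>. dW s t \<omega> \<bullet> h)" "expectation (\<lambda>\<omega>. dW s t \<omega> \<bullet> h) = 0"
    "integrable M (\<lambda>\<omega>. (dW s t \<omega> \<bullet> h)\<^sup>2)" "expectation (\<lambda>\<omega>. (dW s t \<omega> \<bullet> h)\<^sup>2) = (t - s) * qf h"
proof -
  have [measurable]: "dW s t \<in> borel_measurable M" using st by measurable
  have "integrable M (\<lambda>\<omega>. dW s t \<omega> \<bullet> h) \<and> expectation (\<lambda>\<omega>. dW s t \<omega> \<bullet> h) = 0 \<and>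
    integrable M (\<lambda>\<omega>. (dW s t \<omega> \<bullet> h)\<^sup>2) \<and> expectation (\<lambda>\<omega>. (dW s t \<omega> \<bullet> h)\<^sup>2) = (t - s) * qf h"
  \<comment> \<open>The Gaussian law is given for \<open>s < t\<close> only.\<close>
  proof (cases "s = t")
    case False
    then have "s < t" using st by simp
    then have g: "gaussian_on 0 ((t - s) *\<^sub>R Q) (distr M borel (\<lambda>\<omega>. W t \<omega> - W s \<omega>))"
      using wiener st unfolding Q_Wiener_process_def by blast
    have [measurable]: "W t \<in> borel_measurable M" "W s \<in> borel_measurable M"
      using wiener st F_M unfolding Q_Wiener_process_def by (meson order.trans)+
    have "distr M borel (\<lambda>\<omega>. W t \<omega> - W s \<omega>) = distr M borel (dW s t)"
      by (rule distr_cong_AE) (use AE_dW[of s t] in auto)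
    then have "distr (distr M borel (dW s t)) borel (\<lambda>x. x \<bullet> h) = real_gaussian 0 ((t - s) * qf h)"
      using g unfolding gaussian_on_def by (simp add: blinfun.scaleR_left qf_def)
    then have d: "distr M borel (\<lambda>\<omega>. dW s t \<omega> \<bullet> h) = real_gaussian 0 ((t - s) * qf h)"
      by (simp add: distr_distr o_def)
    have v: "(t - s) * qf h \<ge> 0" using st by simp
    have m[measurable]: "(\<lambda>\<omega>. dW s t \<omega> \<bullet> h) \<in> borel_measurable M" by measurable
    show ?thesis
      using real_gaussian_centered_moments[OF v] unfolding d[symmetric]
      by (simp add: integrable_distr_eq integral_distr)
  qed simp
  then show "integrable M (\<lambda>\<omega>. dW s t \<omega> \<bullet> h)" "expectation (\<lambda>\<omega>. dW s t \<omega> \<bullet> h) = 0"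
    "integrable M (\<lambda>\<omega>. (dW s t \<omega> \<bullet> h)\<^sup>2)" "expectation (\<lambda>\<omega>. (dW s t \<omega> \<bullet> h)\<^sup>2) = (t - s) * qf h"
    by auto
qed

text \<open>Stated for increments of \<open>W\<close> itself, to which the independence assumption
  refers; the consequences are carried over to \<open>Wc\<close> almost surely afterwards.\<close>

lemma indep_var_increment:
  fixes u :: "'w \<Rightarrow> real"
  assumes st: "0 \<le> s" "s < t" and u: "u \<in> borel_measurable (F s)"
    and f: "f \<in> borel_measurable borel"
  shows "indep_var borel (\<lambda>\<omega>. f (W t \<omega> - W s \<omega>) :: real) borel u"
  unfolding indep_var_eq
proof (intro conjI)
  have [measurable]: "W t \<in> borel_measurable M" "W s \<in> borel_measurable M"
    using wiener st F_M unfolding Q_Wiener_process_def by (meson order.trans less_imp_le)+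
  note f [measurable]
  show "random_variable borel (\<lambda>\<omega>. f (W t \<omega> - W s \<omega>))" by measurable
  show "random_variable borel u" using F_M[OF u] st by simp
  have "indep_set (sets (vimage_algebra (space M) (\<lambda>\<omega>. W t \<omega> - W s \<omega>) borel)) (sets (F s))"
    using wiener st unfolding Q_Wiener_process_def by blast
  moreover have "sigma_sets (space M) {(\<lambda>\<omega>. f (W t \<omega> - W s \<omega>)) -` A \<inter> space M |A. A \<in> sets borel}
      \<subseteq> sets (vimage_algebra (space M) (\<lambda>\<omega>. W t \<omega> - W s \<omega>) borel)"
  proof -
    let ?V = "vimage_algebra (space M) (\<lambda>\<omega>. W t \<omega> - W s \<omega>) borel"
    have "(\<lambda>\<omega>. W t \<omega> - W s \<omega>) \<in> measurable ?V borel"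
      by (rule measurable_vimage_algebra1) simp
    then have "(\<lambda>\<omega>. f (W t \<omega> - W s \<omega>)) \<in> borel_measurable ?V"
      by (rule measurable_compose[OF _ f])
    then have "{(\<lambda>\<omega>. f (W t \<omega> - W s \<omega>)) -` A \<inter> space M |A. A \<in> sets borel} \<subseteq> sets ?V"
      by (auto dest: measurable_sets)
    then show ?thesis using sets.sigma_sets_subset[of _ ?V] by simp
  qed
  moreover have "sigma_sets (space M) {u -` A \<inter> space M |A. A \<in> sets borel} \<subseteq> sets (F s)"
  proof -
    have "{u -` A \<inter> space M |A. A \<in> sets borel} \<subseteq> sets (F s)"
      using measurable_sets[OF u] st by auto
    then show ?thesis using sets.sigma_sets_subset[of _ "F s"] st by simp
  qed
  ultimately show "indep_set (sigma_sets (space M) {(\<lambda>\<omega>. f (W t \<omega> - W s \<omega>)) -` A \<inter> space M |A. A \<in> sets borel})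
     (sigma_sets (space M) {u -` A \<inter> space M |A. A \<in> sets borel})"
    unfolding indep_sets2_eq by blast
qed

text \<open>Independence factorises both expectations. The first one gives the martingale property,
  the second one the diagonal terms of the isometry.\<close>

lemma increment_mult:
  fixes u :: "'w \<Rightarrow> real"
  assumes st: "0 \<le> s" "s \<le> t" and u: "u \<in> borel_measurable (F s)" and u2: "integrable M (\<lambda>\<omega>. (u \<omega>)\<^sup>2)"
  shows "integrable M (\<lambda>\<omega>. u \<omega> * (dW s t \<omega> \<bullet> h))" "expectation (\<lambda>\<omega>. u \<omega> * (dW s t \<omega> \<bullet> h)) = 0"
    "integrable M (\<lambda>\<omega>. (u \<omega>)\<^sup>2 * (dW s t \<omega> \<bullet> h)\<^sup>2)"
    "expectation (\<lambda>\<omega>. (u \<omega>)\<^sup>2 * (dW s t \<omega> \<bullet> h)\<^sup>2) = (t - s) * qf h * expectation (\<lambda>\<omega>. (u \<omega>)\<^sup>2)"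
proof -
  have [measurable]: "dW s t \<in> borel_measurable M" "u \<in> borel_measurable M"
    using st F_M[OF u] by (auto intro: dW_measurable_M)
  have u1: "integrable M u"
    by (rule square_integrable_imp_integrable) (use u2 in auto)
  have [measurable]: "W t \<in> borel_measurable M" "W s \<in> borel_measurable M"
    using wiener st F_M unfolding Q_Wiener_process_def by (meson order.trans)+
  have "integrable M (\<lambda>\<omega>. u \<omega> * (dW s t \<omega> \<bullet> h)) \<and> expectation (\<lambda>\<omega>. u \<omega> * (dW s t \<omega> \<bullet> h)) = 0 \<and>
    integrable M (\<lambda>\<omega>. (u \<omega>)\<^sup>2 * (dW s t \<omega> \<bullet> h)\<^sup>2) \<and>
    expectation (\<lambda>\<omega>. (u \<omega>)\<^sup>2 * (dW s t \<omega> \<bullet> h)\<^sup>2) = (t - s) * qf h * expectation (\<lambda>\<omega>. (u \<omega>)\<^sup>2)"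
  proof (cases "s = t")
    case False
    then have "s < t" using st by simp
    let ?D = "\<lambda>\<omega>. W t \<omega> - W s \<omega>"
    have eq: "AE \<omega> in M. ?D \<omega> \<bullet> h = dW s t \<omega> \<bullet> h" using AE_dW[of s t] by eventually_elim simp
    have i1: "integrable M (\<lambda>\<omega>. ?D \<omega> \<bullet> h)" "expectation (\<lambda>\<omega>. ?D \<omega> \<bullet> h) = 0"
      using increment_moments(1,2)[OF st, of h] integrable_cong_AE[OF _ _ eq] integral_cong_AE[OF _ _ eq] by auto
    have eq2: "AE \<omega> in M. (?D \<omega> \<bullet> h)\<^sup>2 = (dW s t \<omega> \<bullet> h)\<^sup>2" using eq by eventually_elim simp
    have i2: "integrable M (\<lambda>\<omega>. (?D \<omega> \<bullet> h)\<^sup>2)" "expectation (\<lambda>\<omega>. (?D \<omega> \<bullet> h)\<^sup>2) = (t - s) * qf h"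
      using increment_moments(3,4)[OF st, of h] integrable_cong_AE[OF _ _ eq2] integral_cong_AE[OF _ _ eq2] by auto
    have v1: "indep_var borel (\<lambda>\<omega>. ?D \<omega> \<bullet> h) borel u"
      by (rule indep_var_increment[OF st(1) \<open>s < t\<close> u, of "\<lambda>x. x \<bullet> h"]) simp
    have v2: "indep_var borel (\<lambda>\<omega>. (?D \<omega> \<bullet> h)\<^sup>2) borel (\<lambda>\<omega>. (u \<omega>)\<^sup>2)"
      by (rule indep_var_increment[OF st(1) \<open>s < t\<close> _, of "\<lambda>\<omega>. (u \<omega>)\<^sup>2" "\<lambda>x. (x \<bullet> h)\<^sup>2"]) (use u in auto)
    have e1: "AE \<omega> in M. (?D \<omega> \<bullet> h) * u \<omega> = u \<omega> * (dW s t \<omega> \<bullet> h)" using eq by eventually_elim simp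
    have e2: "AE \<omega> in M. (?D \<omega> \<bullet> h)\<^sup>2 * (u \<omega>)\<^sup>2 = (u \<omega>)\<^sup>2 * (dW s t \<omega> \<bullet> h)\<^sup>2" using eq by eventually_elim simp
    show ?thesis
      using indep_var_integrable[OF v1 i1(1) u1] indep_var_lebesgue_integral[OF v1 i1(1) u1]
        indep_var_integrable[OF v2 i2(1) u2] indep_var_lebesgue_integral[OF v2 i2(1) u2]
        integrable_cong_AE[OF _ _ e1] integral_cong_AE[OF _ _ e1]
        integrable_cong_AE[OF _ _ e2] integral_cong_AE[OF _ _ e2] i1 i2
      by auto
  qed simp
  then show "integrable M (\<lambda>\<omega>. u \<omega> * (dW s t \<omega> \<bullet> h))" "expectation (\<lambda>\<omega>. u \<omega> * (dW s t \<omega> \<bullet> h)) = 0"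
    "integrable M (\<lambda>\<omega>. (u \<omega>)\<^sup>2 * (dW s t \<omega> \<bullet> h)\<^sup>2)"
    "expectation (\<lambda>\<omega>. (u \<omega>)\<^sup>2 * (dW s t \<omega> \<bullet> h)\<^sup>2) = (t - s) * qf h * expectation (\<lambda>\<omega>. (u \<omega>)\<^sup>2)"
    by auto
qed

lemma simple_F_measurable: "simple_function (F s) v \<Longrightarrow> v \<in> borel_measurable (F s)"
  by (rule borel_measurable_simple_function)

lemma sum_over_values:
  fixes g :: "'b \<Rightarrow> real"
  assumes "finite (v ` space M)" "\<omega> \<in> space M"
  shows "(\<Sum>x\<in>v ` space M. indicator {\<omega>\<in>space M. v \<omega> = x} \<omega> * g x) = g (v \<omega>)"
proof -
  have "(\<Sum>x\<in>v ` space M. indicator {\<omega>\<in>space M. v \<omega> = x} \<omega> * g x) = (\<Sum>x\<in>v ` space M. if x = v \<omega> then g x else 0)"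
    by (rule sum.cong) (auto simp: assms(2))
  then show ?thesis using assms by simp
qed

text \<open>A random direction with finitely many values splits the space into events of
  \<open>F s\<close> on which it is constant; their indicators are taken into the factor
  \<open>u\<close> of \<open>increment_mult\<close>.\<close>

lemma increment_simple:
  fixes u :: "'w \<Rightarrow> real" and v :: "'w \<Rightarrow> 'h"
  assumes st: "0 \<le> s" "s \<le> t" and v: "simple_function (F s) v"
  shows "u \<in> borel_measurable (F s) \<Longrightarrow> integrable M (\<lambda>\<omega>. (u \<omega>)\<^sup>2) \<Longrightarrow> integrable M (\<lambda>\<omega>. u \<omega> * (dW s t \<omega> \<bullet> v \<omega>))"
    "u \<in> borel_measurable (F s) \<Longrightarrow> integrable M (\<lambda>\<omega>. (u \<omega>)\<^sup>2) \<Longrightarrow> expectation (\<lambda>\<omega>. u \<omega> * (dW s t \<omega> \<bullet> v \<omega>)) = 0"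
    "integrable M (\<lambda>\<omega>. (dW s t \<omega> \<bullet> v \<omega>)\<^sup>2)"
    "integrable M (\<lambda>\<omega>. qf (v \<omega>))"
    "expectation (\<lambda>\<omega>. (dW s t \<omega> \<bullet> v \<omega>)\<^sup>2) = (t - s) * expectation (\<lambda>\<omega>. qf (v \<omega>))"
proof -
  have fin: "finite (v ` space M)" using simple_functionD(1)[OF v] st by simp
  let ?I = "\<lambda>x \<omega>. indicator {\<omega>\<in>space M. v \<omega> = x} \<omega> :: real"
  have sets: "{\<omega>\<in>space M. v \<omega> = x} \<in> sets (F s)" for x
  proof -
    have "{\<omega>\<in>space M. v \<omega> = x} = v -` {x} \<inter> space (F s)" using st by auto
    then show ?thesis using simple_functionD(2)[OF v, of "{x}"] by simp
  qed
  have Im: "?I x \<in> borel_measurable (F s)" for x using sets by measurable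
  have setsM: "{\<omega>\<in>space M. v \<omega> = x} \<in> sets M" for x
    using sets[of x] subalg[OF st(1)] unfolding subalgebra_def by blast
  have I2: "(?I x \<omega>)\<^sup>2 = ?I x \<omega>" for x \<omega> by (simp add: indicator_def)
  have Ii: "integrable M (\<lambda>\<omega>. (?I x \<omega>)\<^sup>2)" for x
    unfolding I2 by (rule integrable_real_indicator[OF setsM]) (simp add: emeasure_eq_measure)
  show "integrable M (\<lambda>\<omega>. u \<omega> * (dW s t \<omega> \<bullet> v \<omega>))" "expectation (\<lambda>\<omega>. u \<omega> * (dW s t \<omega> \<bullet> v \<omega>)) = 0"
    if u: "u \<in> borel_measurable (F s)" "integrable M (\<lambda>\<omega>. (u \<omega>)\<^sup>2)"
  proof -
    have eq: "u \<omega> * (dW s t \<omega> \<bullet> v \<omega>) = (\<Sum>x\<in>v ` space M. (?I x \<omega> * u \<omega>) * (dW s t \<omega> \<bullet> x))" if "\<omega> \<in> space M" for \<omega>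
      using sum_over_values[OF fin that, of "\<lambda>x. u \<omega> * (dW s t \<omega> \<bullet> x)"] by (simp add: mult.assoc)
    have i: "integrable M (\<lambda>\<omega>. (?I x \<omega> * u \<omega>)\<^sup>2)" for x
      unfolding power_mult_distrib I2
      using integrable_real_mult_indicator[OF setsM u(2), of x] by (simp add: mult.commute)
    have m: "(\<lambda>\<omega>. ?I x \<omega> * u \<omega>) \<in> borel_measurable (F s)" for x using Im u by measurable
    note inc = increment_mult(1,2)[OF st m i]
    show "integrable M (\<lambda>\<omega>. u \<omega> * (dW s t \<omega> \<bullet> v \<omega>))"
      using inc by (subst Bochner_Integration.integrable_cong[OF refl eq]) auto
    show "expectation (\<lambda>\<omega>. u \<omega> * (dW s t \<omega> \<bullet> v \<omega>)) = 0"
      using inc by (subst Bochner_Integration.integral_cong[OF refl eq]) auto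
  qed
  have eq: "(dW s t \<omega> \<bullet> v \<omega>)\<^sup>2 = (\<Sum>x\<in>v ` space M. (?I x \<omega>)\<^sup>2 * (dW s t \<omega> \<bullet> x)\<^sup>2)" if "\<omega> \<in> space M" for \<omega>
    using sum_over_values[OF fin that, of "\<lambda>x. (dW s t \<omega> \<bullet> x)\<^sup>2"] by (simp add: I2)
  have eqq: "qf (v \<omega>) = (\<Sum>x\<in>v ` space M. (?I x \<omega>)\<^sup>2 * qf x)" if "\<omega> \<in> space M" for \<omega>
    using sum_over_values[OF fin that, of qf] by (simp add: I2)
  note inc = increment_mult(3,4)[OF st Im Ii]
  show "integrable M (\<lambda>\<omega>. (dW s t \<omega> \<bullet> v \<omega>)\<^sup>2)"
    using inc by (subst Bochner_Integration.integrable_cong[OF refl eq]) auto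
  show "integrable M (\<lambda>\<omega>. qf (v \<omega>))"
    using Ii by (subst Bochner_Integration.integrable_cong[OF refl eqq]) auto
  have "expectation (\<lambda>\<omega>. (dW s t \<omega> \<bullet> v \<omega>)\<^sup>2) = (\<Sum>x\<in>v ` space M. (t - s) * qf x * expectation (\<lambda>\<omega>. (?I x \<omega>)\<^sup>2))"
    using inc by (subst Bochner_Integration.integral_cong[OF refl eq]) auto
  also have "\<dots> = (t - s) * expectation (\<lambda>\<omega>. qf (v \<omega>))"
    using Ii by (subst Bochner_Integration.integral_cong[OF refl eqq]) (auto simp: sum_distrib_left mult_ac)
  finally show "expectation (\<lambda>\<omega>. (dW s t \<omega> \<bullet> v \<omega>)\<^sup>2) = (t - s) * expectation (\<lambda>\<omega>. qf (v \<omega>))" .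
qed

end

section \<open>Integrals of elementary processes\<close>

text \<open>A countable supremum of finite maxima is measurable and can be reached through discrete
  maximal inequalities. The index \<open>k\<close> runs up to \<open>2^m\<close> so that the end
  point \<open>T\<close> is included.\<close>

lemma SUP_dyadic:
  fixes f :: "real \<Rightarrow> real"
  assumes T: "0 \<le> T" and f: "continuous_on {0..T} f"
  shows "(SUP t\<in>{0..T}. ennreal (f t)) = (SUP m. SUP k\<in>{..2^m}. ennreal (f (real k * T / 2^m)))"
proof (rule antisym)
  have le: "real k * T / 2^m \<in> {0..T}" if "k \<le> 2^m" for k m :: nat
  proof -
    have "real k \<le> 2^m" using that by (metis of_nat_le_iff of_nat_numeral of_nat_power)
    then have "real k * T \<le> 2^m * T" using T by (intro mult_right_mono)
    then show ?thesis using T by (auto simp: divide_simps mult.commute)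
  qed
  show "(SUP m. SUP k\<in>{..2^m}. ennreal (f (real k * T / 2^m))) \<le> (SUP t\<in>{0..T}. ennreal (f t))"
    using le by (intro SUP_least SUP_upper) auto
  show "(SUP t\<in>{0..T}. ennreal (f t)) \<le> (SUP m. SUP k\<in>{..2^m}. ennreal (f (real k * T / 2^m)))" (is "_ \<le> ?R")
  proof (rule SUP_least)
    fix t assume t: "t \<in> {0..T}"
    \<comment> \<open>The largest dyadic point of level \<open>m\<close> that does not exceed
      \<open>t\<close>; these points converge to \<open>t\<close>, and continuity identifies the
      limit.\<close>
    define k where "k m = nat \<lfloor>t / T * 2^m\<rfloor>" for m :: nat
    have "0 \<le> t / T" "t / T \<le> 1" using t T by (auto simp: divide_simps)
    then have "t / T * 2^m \<le> 1 * 2^m" for m :: nat by (intro mult_right_mono) auto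
    then have km: "k m \<le> 2^m" for m
      unfolding k_def by (simp add: nat_le_iff floor_le_iff) (smt (verit) floor_mono floor_of_int of_int_numeral of_int_power)
    have lim: "(\<lambda>m. real (k m) * T / 2^m) \<longlonglongrightarrow> t"
    proof (cases "T = 0")
      case True then show ?thesis using t by simp
    next
      case False
      then have Tp: "T > 0" using T by simp
      have 1: "real (k m) * T / 2^m \<le> t" for m
      proof -
        have "real (k m) \<le> t / T * 2^m"
          unfolding k_def by (rule of_nat_floor) (use \<open>0 \<le> t / T\<close> in \<open>intro mult_nonneg_nonneg; simp\<close>)
        then show ?thesis using Tp by (simp add: field_simps)
      qed
      have 2: "t - T * (1/2)^m \<le> real (k m) * T / 2^m" for m
      proof -
        have "t / T * 2^m - 1 \<le> real (k m)" unfolding k_def using \<open>0 \<le> t / T\<close> by linarith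
        then have "(t / T * 2^m - 1) * T / 2^m \<le> real (k m) * T / 2^m"
          using Tp by (intro divide_right_mono mult_right_mono) auto
        moreover have "(t / T * 2^m - 1) * T / 2^m = t - T * (1/2)^m"
          using Tp by (simp add: field_simps power_divide)
        ultimately show ?thesis by simp
      qed
      have 3: "(\<lambda>m. t - T * (1/2)^m) \<longlonglongrightarrow> t - T * 0"
        by (intro tendsto_intros LIMSEQ_realpow_zero) auto
      show ?thesis
        by (rule tendsto_sandwich[OF always_eventually always_eventually _ tendsto_const])
          (use 1 2 3 in auto)
    qed
    have "(\<lambda>m. f (real (k m) * T / 2^m)) \<longlonglongrightarrow> f t"
      by (rule continuous_on_tendsto_compose[OF f lim t always_eventually]) (use le km in blast)
    then have "(\<lambda>m. ennreal (f (real (k m) * T / 2^m))) \<longlonglongrightarrow> ennreal (f t)"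
      by (rule tendsto_ennrealI)
    then show "ennreal (f t) \<le> ?R"
    proof (rule LIMSEQ_le_const2, intro exI allI impI)
      fix m :: nat
      have "ennreal (f (real (k m) * T / 2^m)) \<le> (SUP k\<in>{..2^m}. ennreal (f (real k * T / 2^m)))"
        using km by (intro SUP_upper) auto
      also have "\<dots> \<le> ?R" by (rule SUP_upper) simp
      finally show "ennreal (f (real (k m) * T / 2^m)) \<le> ?R" .
    qed
  qed
qed

lemma incseq_dyadic:
  fixes g :: "real \<Rightarrow> 'a::complete_lattice"
  shows "incseq (\<lambda>m. SUP k\<in>{..2^m}. g (real k * T / 2^m))"
proof (rule incseq_SucI)
  fix m :: nat
  show "(SUP k\<in>{..2^m}. g (real k * T / 2^m)) \<le> (SUP k\<in>{..2^Suc m}. g (real k * T / 2^Suc m))"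
  proof (rule SUP_mono)
    fix k :: nat assume "k \<in> {..2^m}"
    then show "\<exists>j\<in>{..2^Suc m}. g (real k * T / 2^m) \<le> g (real j * T / 2^Suc m)"
      by (intro bexI[of _ "2 * k"]) auto
  qed
qed

context wiener
begin

lemma simple_F_mono: "simple_function (F s) v \<Longrightarrow> 0 \<le> s \<Longrightarrow> s \<le> t \<Longrightarrow> simple_function (F t) v"
  by (rule simple_function_subalgebra[of "F s"]) (auto intro: sets_F_mono)

text \<open>The martingale property enters as orthogonality of the increments to square integrable
  variables of the past. This is what \<open>doob_pathwise\<close> asks for, as its weights
  \<open>s k * sgn (S k)\<close> are such variables.\<close>

lemma doob_L2:
  fixes S :: "nat \<Rightarrow> 'w \<Rightarrow> real" and t :: "nat \<Rightarrow> real"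
  assumes t: "\<And>k. 0 \<le> t k" "\<And>k. t k \<le> t (Suc k)"
    and Sm: "\<And>k. S k \<in> borel_measurable (F (t k))"
    and S2: "\<And>k. integrable M (\<lambda>\<omega>. (S k \<omega>)\<^sup>2)"
    and mart: "\<And>k u. u \<in> borel_measurable (F (t k)) \<Longrightarrow> integrable M (\<lambda>\<omega>. (u \<omega>)\<^sup>2) \<Longrightarrow>
       integrable M (\<lambda>\<omega>. u \<omega> * (S (Suc k) \<omega> - S k \<omega>)) \<and> expectation (\<lambda>\<omega>. u \<omega> * (S (Suc k) \<omega> - S k \<omega>)) = 0"
  shows "(\<integral>\<^sup>+\<omega>. (SUP k\<in>{..m}. ennreal ((S k \<omega>)\<^sup>2)) \<partial>M) \<le> 4 * (\<integral>\<^sup>+\<omega>. ennreal ((S m \<omega>)\<^sup>2) \<partial>M)"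
proof -
  have mono: "t j \<le> t k" if "j \<le> k" for j k using lift_Suc_mono_le[of t j k] t(2) that by blast
  define s where "s k \<omega> = Max ((\<lambda>j. \<bar>S j \<omega>\<bar>) ` {..k})" for k \<omega>
  define u where "u k \<omega> = s k \<omega> * sgn (S k \<omega>)" for k \<omega>
  have sm: "s k \<in> borel_measurable (F (t k))" for k
    unfolding s_def using F_mono[OF Sm t(1) mono] by (intro borel_measurable_Max) auto
  have um: "u k \<in> borel_measurable (F (t k))" for k
    unfolding u_def using sm Sm by (intro borel_measurable_times borel_measurable_sgn) auto
  have SM [measurable]: "S k \<in> borel_measurable M" "s k \<in> borel_measurable M" "u k \<in> borel_measurable M" for k
    using F_M Sm sm um t(1) by blast+
  have s0: "0 \<le> s k \<omega>" for k \<omega>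
  proof -
    have "\<bar>S k \<omega>\<bar> \<le> s k \<omega>" unfolding s_def by (rule Max_ge) auto
    then show ?thesis by linarith
  qed
  \<comment> \<open>Crude, and used to see that the running maximum is square integrable.\<close>
  have sle: "(s k \<omega>)\<^sup>2 \<le> (\<Sum>j\<le>k. (S j \<omega>)\<^sup>2)" for k \<omega>
  proof -
    have "s k \<omega> \<in> (\<lambda>j. \<bar>S j \<omega>\<bar>) ` {..k}" unfolding s_def by (rule Max_in) auto
    then obtain j where j: "j \<le> k" "s k \<omega> = \<bar>S j \<omega>\<bar>" by auto
    then have "(s k \<omega>)\<^sup>2 = (S j \<omega>)\<^sup>2" by simp
    also have "\<dots> \<le> (\<Sum>j\<le>k. (S j \<omega>)\<^sup>2)" using j by (intro member_le_sum) auto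
    finally show ?thesis .
  qed
  have s2: "integrable M (\<lambda>\<omega>. (s k \<omega>)\<^sup>2)" for k
  proof (rule Bochner_Integration.integrable_bound)
    show "integrable M (\<lambda>\<omega>. \<Sum>j\<le>k. (S j \<omega>)\<^sup>2)" using S2 by auto
    have "0 \<le> (\<Sum>j\<le>k. (S j \<omega>)\<^sup>2)" for \<omega> by (intro sum_nonneg) auto
    then show "AE \<omega> in M. norm ((s k \<omega>)\<^sup>2) \<le> norm (\<Sum>j\<le>k. (S j \<omega>)\<^sup>2)" using sle by simp
  qed simp
  have u2: "integrable M (\<lambda>\<omega>. (u k \<omega>)\<^sup>2)" for k
  proof (rule Bochner_Integration.integrable_bound[OF s2[of k]])
    have "(u k \<omega>)\<^sup>2 \<le> (s k \<omega>)\<^sup>2" for \<omega>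
      unfolding u_def by (auto simp: power_mult_distrib sgn_real_def)
    then show "AE \<omega> in M. norm ((u k \<omega>)\<^sup>2) \<le> norm ((s k \<omega>)\<^sup>2)" by simp
  qed simp
  note mt = mart[OF um u2]
  have path: "(s m \<omega>)\<^sup>2 \<le> 4 * (S m \<omega>)\<^sup>2 - 4 * (\<Sum>k<m. u k \<omega> * (S (Suc k) \<omega> - S k \<omega>))" for \<omega>
    using doob_pathwise[where S="\<lambda>k. S k \<omega>" and m=m] unfolding s_def u_def .
  have "expectation (\<lambda>\<omega>. (s m \<omega>)\<^sup>2) \<le> expectation (\<lambda>\<omega>. 4 * (S m \<omega>)\<^sup>2 - 4 * (\<Sum>k<m. u k \<omega> * (S (Suc k) \<omega> - S k \<omega>)))"
    by (rule integral_mono[OF s2 _ path]) (use mt S2 in auto)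
  also have "\<dots> = 4 * expectation (\<lambda>\<omega>. (S m \<omega>)\<^sup>2)"
    using mt S2 by simp
  finally have E: "expectation (\<lambda>\<omega>. (s m \<omega>)\<^sup>2) \<le> 4 * expectation (\<lambda>\<omega>. (S m \<omega>)\<^sup>2)" .
  have "(\<integral>\<^sup>+\<omega>. (SUP k\<in>{..m}. ennreal ((S k \<omega>)\<^sup>2)) \<partial>M) \<le> (\<integral>\<^sup>+\<omega>. ennreal ((s m \<omega>)\<^sup>2) \<partial>M)"
  proof (intro nn_integral_mono SUP_least ennreal_leI)
    fix \<omega> k assume "k \<in> {..m}"
    then have "\<bar>S k \<omega>\<bar> \<le> s m \<omega>" unfolding s_def by (intro Max_ge) auto
    then show "(S k \<omega>)\<^sup>2 \<le> (s m \<omega>)\<^sup>2" using s0[of m \<omega>] by (simp add: abs_le_square_iff[symmetric])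
  qed
  also have "\<dots> = ennreal (expectation (\<lambda>\<omega>. (s m \<omega>)\<^sup>2))" by (rule nn_integral_eq_integral[OF s2]) simp
  also have "\<dots> \<le> ennreal (4 * expectation (\<lambda>\<omega>. (S m \<omega>)\<^sup>2))" by (rule ennreal_leI[OF E])
  also have "\<dots> = 4 * ennreal (expectation (\<lambda>\<omega>. (S m \<omega>)\<^sup>2))"
    by (simp add: ennreal_mult)
  also have "\<dots> = 4 * (\<integral>\<^sup>+\<omega>. ennreal ((S m \<omega>)\<^sup>2) \<partial>M)" by (subst nn_integral_eq_integral[OF S2]) auto
  finally show ?thesis .
qed

section \<open>Scalar step integrals: martingale property, isometry, maximal inequality\<close>

definition step_term :: "(nat \<Rightarrow> real) \<Rightarrow> (nat \<Rightarrow> 'w \<Rightarrow> 'h) \<Rightarrow> nat \<Rightarrow> real \<Rightarrow> 'w \<Rightarrow> real" where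
  "step_term \<tau> v k t \<omega> = dW (min t (\<tau> k)) (min t (\<tau> (Suc k))) \<omega> \<bullet> v k \<omega>"

text \<open>The coordinate of an elementary integral along \<open>h\<close> has this form, with
  \<open>v k\<close> the adjoint of the operator on interval \<open>k\<close> applied to
  \<open>h\<close>; see \<open>elementary_coordinate\<close>.\<close>

definition step_integral :: "nat \<Rightarrow> (nat \<Rightarrow> real) \<Rightarrow> (nat \<Rightarrow> 'w \<Rightarrow> 'h) \<Rightarrow> real \<Rightarrow> 'w \<Rightarrow> real" where
  "step_integral n \<tau> v t \<omega> = (\<Sum>k<n. step_term \<tau> v k t \<omega>)"

context
  fixes n :: nat and \<tau> :: "nat \<Rightarrow> real" and v :: "nat \<Rightarrow> 'w \<Rightarrow> 'h"
  assumes tau0: "0 \<le> \<tau> 0" and tau: "\<And>k. k < n \<Longrightarrow> \<tau> k \<le> \<tau> (Suc k)"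
    and v: "\<And>k. k < n \<Longrightarrow> simple_function (F (\<tau> k)) (v k)"
begin

lemma tau_mono: "j \<le> k \<Longrightarrow> k \<le> n \<Longrightarrow> \<tau> j \<le> \<tau> k"
proof (induction k)
  case (Suc k)
  then show ?case using tau[of k] by (cases "j = Suc k") (auto intro: order.trans)
qed simp

lemma tau_nonneg: "k \<le> n \<Longrightarrow> 0 \<le> \<tau> k"
  using tau_mono[of 0 k] tau0 by simp

lemma step_term_0: "k < n \<Longrightarrow> t \<le> \<tau> k \<Longrightarrow> step_term \<tau> v k t \<omega> = 0"
  using tau[of k] by (simp add: step_term_def min_absorb1)

lemma step_term_measurable:
  assumes "k < n" "0 \<le> t" shows "step_term \<tau> v k t \<in> borel_measurable (F t)"
proof (cases "\<tau> k \<le> t")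
  case True
  have "dW (min t (\<tau> k)) (min t (\<tau> (Suc k))) \<in> borel_measurable (F t)"
    by (rule F_mono[OF dW_measurable]) (use assms tau[of k] tau_nonneg[of k] tau_nonneg[of "Suc k"] in auto)
  moreover have "v k \<in> borel_measurable (F t)"
    by (rule F_mono[OF simple_F_measurable[OF v]]) (use assms tau_nonneg[of k] True in auto)
  ultimately show ?thesis unfolding step_term_def by (intro borel_measurable_inner)
next
  case False
  then have "step_term \<tau> v k t = (\<lambda>_. 0)" using step_term_0[of k t] assms by (intro ext) simp
  then show ?thesis by simp
qed

lemma step_term_square:
  assumes k: "k < n" and t: "0 \<le> t"
  shows "integrable M (\<lambda>\<omega>. (step_term \<tau> v k t \<omega>)\<^sup>2)"
    "integrable M (\<lambda>\<omega>. qf (v k \<omega>))"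
    "expectation (\<lambda>\<omega>. (step_term \<tau> v k t \<omega>)\<^sup>2) = (min t (\<tau> (Suc k)) - min t (\<tau> k)) * expectation (\<lambda>\<omega>. qf (v k \<omega>))"
proof -
  note nn = tau_nonneg[of k] tau_nonneg[of "Suc k"] tau[OF k]
  show "integrable M (\<lambda>\<omega>. qf (v k \<omega>))"
    using increment_simple(4)[OF _ _ v[OF k], of "\<tau> k"] nn k by simp
  have "integrable M (\<lambda>\<omega>. (step_term \<tau> v k t \<omega>)\<^sup>2) \<and>
    expectation (\<lambda>\<omega>. (step_term \<tau> v k t \<omega>)\<^sup>2) = (min t (\<tau> (Suc k)) - min t (\<tau> k)) * expectation (\<lambda>\<omega>. qf (v k \<omega>))"
  proof (cases "\<tau> k \<le> t")
    case True
    then have m: "min t (\<tau> k) = \<tau> k" by simp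
    show ?thesis unfolding step_term_def m
      using increment_simple(3,5)[OF _ _ v[OF k], of "min t (\<tau> (Suc k))"] nn k True by simp
  next
    case False
    then show ?thesis using step_term_0[OF k, of t] nn by simp
  qed
  then show "integrable M (\<lambda>\<omega>. (step_term \<tau> v k t \<omega>)\<^sup>2)"
    "expectation (\<lambda>\<omega>. (step_term \<tau> v k t \<omega>)\<^sup>2) = (min t (\<tau> (Suc k)) - min t (\<tau> k)) * expectation (\<lambda>\<omega>. qf (v k \<omega>))"
    by auto
qed

lemma step_term_martingale:
  assumes k: "k < n" and st: "0 \<le> s" "s \<le> t"
    and u: "u \<in> borel_measurable (F s)" "integrable M (\<lambda>\<omega>. (u \<omega>)\<^sup>2)"
  shows "integrable M (\<lambda>\<omega>. u \<omega> * (step_term \<tau> v k t \<omega> - step_term \<tau> v k s \<omega>)) \<and>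
    expectation (\<lambda>\<omega>. u \<omega> * (step_term \<tau> v k t \<omega> - step_term \<tau> v k s \<omega>)) = 0"
proof -
  note nn = tau_nonneg[of k] tau_nonneg[of "Suc k"] tau[OF k]
  \<comment> \<open>Clamping to \<open>[s, t]\<close>: between the times \<open>s\<close> and
    \<open>t\<close> the term changes by the increment of \<open>Wc\<close> over the part of its
    interval inside \<open>[s, t]\<close>, which starts no earlier than \<open>s\<close>.\<close>
  define c where "c x = max s (min t x)" for x
  have eq: "step_term \<tau> v k t \<omega> - step_term \<tau> v k s \<omega> = dW (c (\<tau> k)) (c (\<tau> (Suc k))) \<omega> \<bullet> v k \<omega>" for \<omega>
  proof -
    have "Wc (min t x) \<omega> - Wc (min s x) \<omega> = Wc (c x) \<omega> - Wc s \<omega>" for x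
      using st by (auto simp: c_def min_def max_def)
    from this[of "\<tau> k"] this[of "\<tau> (Suc k)"]
    have "dW (min t (\<tau> k)) (min t (\<tau> (Suc k))) \<omega> - dW (min s (\<tau> k)) (min s (\<tau> (Suc k))) \<omega> =
        (Wc (c (\<tau> (Suc k))) \<omega> - Wc s \<omega>) - (Wc (c (\<tau> k)) \<omega> - Wc s \<omega>)"
      unfolding dW_def by (metis (no_types, lifting) diff_diff_eq2 diff_add_eq diff_diff_add add.commute)
    then show ?thesis
      unfolding step_term_def inner_diff_left[symmetric] by (simp add: dW_def)
  qed
  have c: "s \<le> c (\<tau> k)" "c (\<tau> k) \<le> c (\<tau> (Suc k))" using nn unfolding c_def by auto
  show ?thesis
  proof (cases "\<tau> k \<le> t")
    case True
    then have "\<tau> k \<le> c (\<tau> k)" unfolding c_def by auto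
    then have "simple_function (F (c (\<tau> k))) (v k)" using nn k by (intro simple_F_mono[OF v]) auto
    moreover have "u \<in> borel_measurable (F (c (\<tau> k)))" using F_mono[OF u(1) st(1) c(1)] .
    ultimately show ?thesis unfolding eq using increment_simple(1,2)[OF _ c(2), of "v k" u] u c st by auto
  next
    case False
    then have "c (\<tau> k) = t" "c (\<tau> (Suc k)) = t" using st nn by (auto simp: c_def)
    then show ?thesis unfolding eq by simp
  qed
qed

lemma step_integral_measurable:
  "m \<le> n \<Longrightarrow> 0 \<le> t \<Longrightarrow> step_integral m \<tau> v t \<in> borel_measurable (F t)"
  unfolding step_integral_def using step_term_measurable by (intro borel_measurable_sum) auto

lemma step_integral_isometry:
  "m \<le> n \<Longrightarrow> 0 \<le> t \<Longrightarrow> integrable M (\<lambda>\<omega>. (step_integral m \<tau> v t \<omega>)\<^sup>2) \<and>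
    expectation (\<lambda>\<omega>. (step_integral m \<tau> v t \<omega>)\<^sup>2) =
      (\<Sum>k<m. (min t (\<tau> (Suc k)) - min t (\<tau> k)) * expectation (\<lambda>\<omega>. qf (v k \<omega>)))"
proof (induction m arbitrary: t)
  case 0 then show ?case by (simp add: step_integral_def)
next
  case (Suc m)
  then have m: "m < n" "m \<le> n" by auto
  have IH: "integrable M (\<lambda>\<omega>. (step_integral m \<tau> v t \<omega>)\<^sup>2)" if "0 \<le> t" for t
    using Suc.IH[OF m(2) that] by blast
  let ?S = "step_integral m \<tau> v t" and ?X = "step_term \<tau> v m t"
  have M: "?S \<in> borel_measurable M" "?X \<in> borel_measurable M"
    using F_M step_integral_measurable step_term_measurable m Suc.prems by blast+
  have "integrable M (\<lambda>\<omega>. ?S \<omega> * ?X \<omega>) \<and> expectation (\<lambda>\<omega>. ?S \<omega> * ?X \<omega>) = 0"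
  proof (cases "\<tau> m \<le> t")
    case True
    \<comment> \<open>The earlier steps are complete at time \<open>\<tau> m\<close>, so their sum
      is known there, and the cross term vanishes by the martingale property of the last
      step.\<close>
    have S: "?S = step_integral m \<tau> v (\<tau> m)"
      unfolding step_integral_def
    proof (intro ext sum.cong refl)
      fix \<omega> k assume "k \<in> {..<m}"
      then have "\<tau> k \<le> \<tau> m" "\<tau> (Suc k) \<le> \<tau> m" using m by (auto intro: tau_mono)
      then show "step_term \<tau> v k t \<omega> = step_term \<tau> v k (\<tau> m) \<omega>" using True by (simp add: step_term_def min_absorb2)
    qed
    have X: "?X = (\<lambda>\<omega>. step_term \<tau> v m t \<omega> - step_term \<tau> v m (\<tau> m) \<omega>)"
      using step_term_0[OF m(1)] by simp
    show ?thesis unfolding S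
      by (subst (1 2) X) (intro step_term_martingale m True tau_nonneg step_integral_measurable IH)
  next
    case False
    then show ?thesis using step_term_0[OF m(1), of t] by simp
  qed
  then show ?case
    using Suc.IH[OF m(2) Suc.prems(2)] step_term_square[OF m(1) Suc.prems(2)]
    by (simp add: step_integral_def power2_sum mult.assoc)
qed

lemma step_integral_martingale:
  assumes st: "0 \<le> s" "s \<le> t"
    and u: "u \<in> borel_measurable (F s)" "integrable M (\<lambda>\<omega>. (u \<omega>)\<^sup>2)"
  shows "integrable M (\<lambda>\<omega>. u \<omega> * (step_integral n \<tau> v t \<omega> - step_integral n \<tau> v s \<omega>)) \<and>
    expectation (\<lambda>\<omega>. u \<omega> * (step_integral n \<tau> v t \<omega> - step_integral n \<tau> v s \<omega>)) = 0"
proof -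
  have eq: "u \<omega> * (step_integral n \<tau> v t \<omega> - step_integral n \<tau> v s \<omega>) =
      (\<Sum>k<n. u \<omega> * (step_term \<tau> v k t \<omega> - step_term \<tau> v k s \<omega>))" for \<omega>
    unfolding step_integral_def by (simp add: sum_subtractf[symmetric] sum_distrib_left)
  show ?thesis unfolding eq using step_term_martingale[OF _ st u] by auto
qed

lemma step_integral_continuous: "continuous_on {0..} (\<lambda>t. step_integral n \<tau> v t \<omega>)"
proof -
  have "continuous_on {0..} (\<lambda>t. Wc (min t (\<tau> k)) \<omega>)" if "k \<le> n" for k
    by (rule continuous_on_compose2[OF Wc_continuous]) (use tau_nonneg[OF that] in \<open>auto intro!: continuous_intros\<close>)
  then show ?thesis
    unfolding step_integral_def step_term_def dW_def by (intro continuous_intros) auto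
qed

text \<open>In \<open>ennreal\<close> the coordinates can be added up before anything is known to be
  finite.\<close>

lemma step_integral_isometry_nn:
  assumes t: "0 \<le> t"
  shows "(\<integral>\<^sup>+\<omega>. ennreal ((step_integral n \<tau> v t \<omega>)\<^sup>2) \<partial>M) =
    (\<Sum>k<n. ennreal (min t (\<tau> (Suc k)) - min t (\<tau> k)) * (\<integral>\<^sup>+\<omega>. ennreal (qf (v k \<omega>)) \<partial>M))"
proof -
  have i: "integrable M (\<lambda>\<omega>. (step_integral n \<tau> v t \<omega>)\<^sup>2)" using step_integral_isometry t by auto
  have q: "(\<integral>\<^sup>+\<omega>. ennreal (qf (v k \<omega>)) \<partial>M) = ennreal (expectation (\<lambda>\<omega>. qf (v k \<omega>)))" if "k < n" for k
    by (rule nn_integral_eq_integral[OF step_term_square(2)[OF that t]]) simp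
  have d: "0 \<le> min t (\<tau> (Suc k)) - min t (\<tau> k)" if "k < n" for k using tau[OF that] by auto
  have "(\<integral>\<^sup>+\<omega>. ennreal ((step_integral n \<tau> v t \<omega>)\<^sup>2) \<partial>M) = ennreal (expectation (\<lambda>\<omega>. (step_integral n \<tau> v t \<omega>)\<^sup>2))"
    by (rule nn_integral_eq_integral[OF i]) simp
  also have "\<dots> = ennreal (\<Sum>k<n. (min t (\<tau> (Suc k)) - min t (\<tau> k)) * expectation (\<lambda>\<omega>. qf (v k \<omega>)))"
    using step_integral_isometry[OF order_refl t] by simp
  also have "\<dots> = (\<Sum>k<n. ennreal ((min t (\<tau> (Suc k)) - min t (\<tau> k)) * expectation (\<lambda>\<omega>. qf (v k \<omega>))))"
    by (rule sum_ennreal[symmetric]) (use d in auto)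
  also have "\<dots> = (\<Sum>k<n. ennreal (min t (\<tau> (Suc k)) - min t (\<tau> k)) * (\<integral>\<^sup>+\<omega>. ennreal (qf (v k \<omega>)) \<partial>M))"
    using d q by (intro sum.cong) (auto simp: ennreal_mult)
  finally show ?thesis .
qed

text \<open>The last point of every dyadic grid is \<open>T\<close>, so the discrete inequality has
  the same right-hand side at all levels; monotone convergence does the rest.\<close>

lemma step_integral_doob:
  assumes T: "0 \<le> T"
  shows "(\<integral>\<^sup>+\<omega>. (SUP t\<in>{0..T}. ennreal ((step_integral n \<tau> v t \<omega>)\<^sup>2)) \<partial>M)
    \<le> 4 * (\<integral>\<^sup>+\<omega>. ennreal ((step_integral n \<tau> v T \<omega>)\<^sup>2) \<partial>M)"
proof -
  let ?S = "step_integral n \<tau> v"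
  have c: "continuous_on {0..T} (\<lambda>t. (?S t \<omega>)\<^sup>2)" for \<omega>
    by (intro continuous_intros continuous_on_subset[OF step_integral_continuous]) auto
  have [measurable]: "?S t \<in> borel_measurable M" if "0 \<le> t" for t
    using F_M[OF step_integral_measurable[OF order_refl that] that] .
  have "(\<integral>\<^sup>+\<omega>. (SUP t\<in>{0..T}. ennreal ((?S t \<omega>)\<^sup>2)) \<partial>M) =
      (\<integral>\<^sup>+\<omega>. (SUP m. SUP k\<in>{..2^m}. ennreal ((?S (real k * T / 2^m) \<omega>)\<^sup>2)) \<partial>M)"
    by (subst SUP_dyadic[OF T c]) simp
  also have "\<dots> = (SUP m. \<integral>\<^sup>+\<omega>. (SUP k\<in>{..2^m}. ennreal ((?S (real k * T / 2^m) \<omega>)\<^sup>2)) \<partial>M)"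
  proof (rule nn_integral_monotone_convergence_SUP)
    show "incseq (\<lambda>m \<omega>. SUP k\<in>{..2^m}. ennreal ((?S (real k * T / 2^m) \<omega>)\<^sup>2))"
      using incseq_dyadic[of "\<lambda>t. ennreal ((?S t _)\<^sup>2)" T] by (auto simp: incseq_def le_fun_def)
    show "(\<lambda>\<omega>. SUP k\<in>{..2^m}. ennreal ((?S (real k * T / 2^m) \<omega>)\<^sup>2)) \<in> borel_measurable M" for m :: nat
      using T by (intro borel_measurable_SUP) auto
  qed
  also have "\<dots> \<le> 4 * (\<integral>\<^sup>+\<omega>. ennreal ((?S T \<omega>)\<^sup>2) \<partial>M)"
  proof (rule SUP_least)
    fix m :: nat
    let ?t = "\<lambda>k. real k * T / 2^m"
    have "(\<integral>\<^sup>+\<omega>. (SUP k\<in>{..2^m}. ennreal ((?S (?t k) \<omega>)\<^sup>2)) \<partial>M)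
       \<le> 4 * (\<integral>\<^sup>+\<omega>. ennreal ((?S (?t (2^m)) \<omega>)\<^sup>2) \<partial>M)"
    proof (rule doob_L2[where t="?t"])
      show t0: "0 \<le> ?t k" for k using T by simp
      show t1: "?t k \<le> ?t (Suc k)" for k using T by (intro divide_right_mono mult_right_mono) auto
      show "?S (?t k) \<in> borel_measurable (F (?t k))" for k by (rule step_integral_measurable[OF order_refl t0])
      show "integrable M (\<lambda>\<omega>. (?S (?t k) \<omega>)\<^sup>2)" for k using step_integral_isometry[OF order_refl t0] by blast
      show "integrable M (\<lambda>\<omega>. u \<omega> * (?S (?t (Suc k)) \<omega> - ?S (?t k) \<omega>)) \<and>
        expectation (\<lambda>\<omega>. u \<omega> * (?S (?t (Suc k)) \<omega> - ?S (?t k) \<omega>)) = 0"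
        if "u \<in> borel_measurable (F (?t k))" "integrable M (\<lambda>\<omega>. (u \<omega>)\<^sup>2)" for k u
        by (rule step_integral_martingale[OF t0 t1 that])
    qed
    then show "(\<integral>\<^sup>+\<omega>. (SUP k\<in>{..2^m}. ennreal ((?S (?t k) \<omega>)\<^sup>2)) \<partial>M) \<le> 4 * (\<integral>\<^sup>+\<omega>. ennreal ((?S T \<omega>)\<^sup>2) \<partial>M)"
      by simp
  qed
  finally show ?thesis .
qed

end

section \<open>Operator-valued elementary integrals\<close>

lemma elementary_hs_integral:
  assumes E: "elementary F T (n, \<tau>, \<phi>)"
  shows "(\<integral>\<^sup>+s\<in>{0..t}. ennreal (hs (elementary_process (n, \<tau>, \<phi>) s \<omega>)) \<partial>lborel) =
    (\<Sum>k<n. ennreal (min t (\<tau> (Suc k)) - min t (\<tau> k)) * ennreal (hs (\<phi> k \<omega>)))"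
proof -
  have \<tau>: "\<tau> 0 = 0" and inc: "\<And>k. k < n \<Longrightarrow> \<tau> k < \<tau> (Suc k)" using E by auto
  have mono: "j \<le> k \<Longrightarrow> k \<le> n \<Longrightarrow> \<tau> j \<le> \<tau> k" for j k
  proof (induction k)
    case (Suc k)
    then show ?case using inc[of k] by (cases "j = Suc k") (auto intro: order.trans)
  qed simp
  have nn: "0 \<le> \<tau> k" if "k \<le> n" for k using mono[of 0 k] that \<tau> by simp
  have pw: "ennreal (hs (elementary_process (n, \<tau>, \<phi>) s \<omega>)) * indicator {0..t} s =
    (\<Sum>k<n. ennreal (hs (\<phi> k \<omega>)) * indicator {min t (\<tau> k)<..min t (\<tau> (Suc k))} s)" (is "?L = ?R") for s
  proof -
    have ind: "s \<in> {min t (\<tau> k)<..min t (\<tau> (Suc k))} \<longleftrightarrow> s \<in> {\<tau> k<..\<tau> (Suc k)} \<and> s \<le> t" if "k < n" for k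
      using inc[OF that] by (auto simp: min_def split: if_splits)
    show ?thesis
    proof (cases "\<exists>k<n. s \<in> {\<tau> k<..\<tau> (Suc k)}")
      case True
      then obtain k where k: "k < n" "s \<in> {\<tau> k<..\<tau> (Suc k)}" by blast
      have un: "j = k" if j: "j < n" "s \<in> {\<tau> j<..\<tau> (Suc j)}" for j
      proof (rule ccontr)
        assume "j \<noteq> k"
        then consider "Suc j \<le> k" | "Suc k \<le> j" by linarith
        then show False using j k mono[of "Suc j" k] mono[of "Suc k" j] by cases auto
      qed
      have "(\<Sum>j<n. indicator {\<tau> j<..\<tau> (Suc j)} s *\<^sub>R \<phi> j \<omega>) = (\<Sum>j<n. if j = k then \<phi> k \<omega> else 0)"
      proof (rule sum.cong[OF refl])
        fix j assume j: "j \<in> {..<n}"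
        show "indicator {\<tau> j<..\<tau> (Suc j)} s *\<^sub>R \<phi> j \<omega> = (if j = k then \<phi> k \<omega> else 0)"
        proof (cases "j = k")
          case True
          have "indicator {\<tau> k<..\<tau> (Suc k)} s = (1::real)" using k(2) by (rule indicator_simps(1))
          then show ?thesis unfolding True by simp
        next
          case False
          then have "s \<notin> {\<tau> j<..\<tau> (Suc j)}" using un[of j] j by blast
          then have "indicator {\<tau> j<..\<tau> (Suc j)} s = (0::real)" by (rule indicator_simps(2))
          then show ?thesis using False by simp
        qed
      qed
      then have L: "elementary_process (n, \<tau>, \<phi>) s \<omega> = \<phi> k \<omega>" using k by simp
      have "?R = (\<Sum>j<n. if j = k then ennreal (hs (\<phi> k \<omega>)) * indicator {..t} s else 0)"
      proof (rule sum.cong[OF refl])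
        fix j assume j: "j \<in> {..<n}"
        show "ennreal (hs (\<phi> j \<omega>)) * indicator {min t (\<tau> j)<..min t (\<tau> (Suc j))} s =
            (if j = k then ennreal (hs (\<phi> k \<omega>)) * indicator {..t} s else 0)"
        proof (cases "j = k")
          case True
          have "(indicator {min t (\<tau> k)<..min t (\<tau> (Suc k))} s :: ennreal) = indicator {..t} s"
            using ind[OF k(1)] k(2) by (cases "s \<le> t") (auto simp del: greaterThanAtMost_iff)
          then show ?thesis unfolding True by simp
        next
          case False
          then have "s \<notin> {min t (\<tau> j)<..min t (\<tau> (Suc j))}" using ind[of j] un[of j] j by blast
          then show ?thesis using False by simp
        qed
      qed
      then have R: "?R = ennreal (hs (\<phi> k \<omega>)) * indicator {..t} s" using k by simp
      have "0 \<le> s" using k nn[of k] by auto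
      then show ?thesis unfolding L R by (auto simp: indicator_def)
    next
      case False
      then have "indicator {\<tau> k<..\<tau> (Suc k)} s = (0::real)" if "k < n" for k
        using that by (intro indicator_simps(2)) blast
      then have "\<forall>k\<in>{..<n}. indicator {\<tau> k<..\<tau> (Suc k)} s *\<^sub>R \<phi> k \<omega> = 0" by simp
      then have "elementary_process (n, \<tau>, \<phi>) s \<omega> = 0" unfolding elementary_process.simps by (rule sum.neutral)
      moreover have "?R = 0"
      proof (rule sum.neutral, rule ballI)
        fix k assume "k \<in> {..<n}"
        then have "s \<notin> {min t (\<tau> k)<..min t (\<tau> (Suc k))}" using ind[of k] False by blast
        then show "ennreal (hs (\<phi> k \<omega>)) * indicator {min t (\<tau> k)<..min t (\<tau> (Suc k))} s = 0" by simp
      qed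
      ultimately show ?thesis by simp
    qed
  qed
  have "(\<integral>\<^sup>+s\<in>{0..t}. ennreal (hs (elementary_process (n, \<tau>, \<phi>) s \<omega>)) \<partial>lborel) =
    (\<Sum>k<n. \<integral>\<^sup>+s. ennreal (hs (\<phi> k \<omega>)) * indicator {min t (\<tau> k)<..min t (\<tau> (Suc k))} s \<partial>lborel)"
    unfolding pw by (rule nn_integral_sum) simp
  also have "\<dots> = (\<Sum>k<n. ennreal (min t (\<tau> (Suc k)) - min t (\<tau> k)) * ennreal (hs (\<phi> k \<omega>)))"
  proof (intro sum.cong refl)
    fix k assume "k \<in> {..<n}"
    then have "min t (\<tau> k) \<le> min t (\<tau> (Suc k))" using inc[of k] by auto
    then show "(\<integral>\<^sup>+s. ennreal (hs (\<phi> k \<omega>)) * indicator {min t (\<tau> k)<..min t (\<tau> (Suc k))} s \<partial>lborel) =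
      ennreal (min t (\<tau> (Suc k)) - min t (\<tau> k)) * ennreal (hs (\<phi> k \<omega>))"
      by (subst nn_integral_cmult_indicator) (auto simp: mult.commute)
  qed
  finally show ?thesis .
qed

lemma elementary_coordinate:
  "elementary_integral Wc (n, \<tau>, \<phi>) t \<omega> \<bullet> h = step_integral n \<tau> (\<lambda>k \<omega>. adj (\<phi> k \<omega>) h) t \<omega>"
  by (simp add: step_integral_def step_term_def dW_def inner_sum_left inner_adj)

lemma simple_hs_measurable:
  assumes "simple_function (F s) \<phi>" "0 \<le> s"
  shows "(\<lambda>\<omega>. ennreal (hs (\<phi> \<omega>))) \<in> borel_measurable M" "(\<lambda>\<omega>. hs (\<phi> \<omega>)) \<in> borel_measurable (F s)"
proof -
  have "simple_function (F s) (\<lambda>\<omega>. hs (\<phi> \<omega>))" by (rule simple_function_compose1[OF assms(1)])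
  then show m: "(\<lambda>\<omega>. hs (\<phi> \<omega>)) \<in> borel_measurable (F s)" by (rule borel_measurable_simple_function)
  from F_M[OF this assms(2)] show "(\<lambda>\<omega>. ennreal (hs (\<phi> \<omega>))) \<in> borel_measurable M" by simp
qed

text \<open>The supremum of a sum of squares is at most the sum of the suprema, so scalar maximal
  inequality and isometry apply coordinate by coordinate without loss in the constant;
  \<open>ennreal_hs\<close> adds the variances up again.\<close>

lemma elementary_doob:
  assumes E: "elementary F T E" and t: "0 \<le> t"
  shows "(\<integral>\<^sup>+\<omega>. (SUP s\<in>{0..t}. ennreal ((norm (elementary_integral Wc E s \<omega>))\<^sup>2)) \<partial>M) \<le>
    4 * (\<integral>\<^sup>+\<omega>. (\<integral>\<^sup>+s\<in>{0..t}. ennreal (hs (elementary_process E s \<omega>)) \<partial>lborel) \<partial>M)"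
proof -
  obtain n \<tau> \<phi> where E_eq: "E = (n, \<tau>, \<phi>)" by (cases E)
  note E' = E[unfolded E_eq]
  have \<tau>: "0 \<le> \<tau> 0" and inc: "\<And>k. k < n \<Longrightarrow> \<tau> k \<le> \<tau> (Suc k)"
    and \<phi>: "\<And>k. k < n \<Longrightarrow> simple_function (F (\<tau> k)) (\<phi> k)" using E' by (auto intro: less_imp_le)
  define v where "v i k \<omega> = adj (\<phi> k \<omega>) (e i)" for i k \<omega>
  have v: "simple_function (F (\<tau> k)) (v i k)" if "k < n" for i k
    unfolding v_def by (rule simple_function_compose1[OF \<phi>[OF that]])
  have \<tau>0: "0 \<le> \<tau> k" if "k \<le> n" for k
    using that by (induction k) (use \<tau> inc in \<open>auto simp: Suc_le_eq intro: order.trans\<close>)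
  note [measurable] = F_M[OF step_integral_measurable[OF \<tau> inc v order_refl]]
  let ?S = "\<lambda>i. step_integral n \<tau> (v i)"
  have c: "continuous_on {0..t} (\<lambda>s. (?S i s \<omega>)\<^sup>2)" for i \<omega>
    by (intro continuous_intros continuous_on_subset[OF step_integral_continuous[OF \<tau> inc v]]) auto
  have m: "(\<lambda>\<omega>. SUP s\<in>{0..t}. ennreal ((?S i s \<omega>)\<^sup>2)) \<in> borel_measurable M" for i
  proof (subst SUP_dyadic[OF t c])
    show "(\<lambda>\<omega>. SUP m. SUP k\<in>{..2^m}. ennreal ((?S i (real k * t / 2^m) \<omega>)\<^sup>2)) \<in> borel_measurable M"
      using t by (intro borel_measurable_SUP) auto
  qed
  have "(\<integral>\<^sup>+\<omega>. (SUP s\<in>{0..t}. ennreal ((norm (elementary_integral Wc E s \<omega>))\<^sup>2)) \<partial>M)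
     \<le> (\<integral>\<^sup>+\<omega>. (\<Sum>i. SUP s\<in>{0..t}. ennreal ((?S i s \<omega>)\<^sup>2)) \<partial>M)"
  proof (intro nn_integral_mono SUP_least)
    fix \<omega> s assume s: "s \<in> {0..t}"
    have "ennreal ((norm (elementary_integral Wc E s \<omega>))\<^sup>2) = (\<Sum>i. ennreal ((?S i s \<omega>)\<^sup>2))"
      unfolding ennreal_parseval[symmetric] E_eq elementary_coordinate v_def ..
    also have "\<dots> \<le> (\<Sum>i. SUP s\<in>{0..t}. ennreal ((?S i s \<omega>)\<^sup>2))"
      by (intro suminf_le SUP_upper s summableI)
    finally show "ennreal ((norm (elementary_integral Wc E s \<omega>))\<^sup>2) \<le> (\<Sum>i. SUP s\<in>{0..t}. ennreal ((?S i s \<omega>)\<^sup>2))" .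
  qed
  also have "\<dots> = (\<Sum>i. \<integral>\<^sup>+\<omega>. (SUP s\<in>{0..t}. ennreal ((?S i s \<omega>)\<^sup>2)) \<partial>M)"
    by (rule nn_integral_suminf) (rule m)
  also have "\<dots> \<le> (\<Sum>i. 4 * (\<Sum>k<n. ennreal (min t (\<tau> (Suc k)) - min t (\<tau> k)) * (\<integral>\<^sup>+\<omega>. ennreal (qf (v i k \<omega>)) \<partial>M)))"
  proof (intro suminf_le summableI)
    fix i
    show "(\<integral>\<^sup>+\<omega>. (SUP s\<in>{0..t}. ennreal ((?S i s \<omega>)\<^sup>2)) \<partial>M) \<le>
      4 * (\<Sum>k<n. ennreal (min t (\<tau> (Suc k)) - min t (\<tau> k)) * (\<integral>\<^sup>+\<omega>. ennreal (qf (v i k \<omega>)) \<partial>M))"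
      using step_integral_doob[where n=n and \<tau>=\<tau> and v="v i", OF \<tau> inc v t]
        step_integral_isometry_nn[where n=n and \<tau>=\<tau> and v="v i", OF \<tau> inc v t] by simp
  qed
  also have "\<dots> = 4 * (\<Sum>k<n. ennreal (min t (\<tau> (Suc k)) - min t (\<tau> k)) * (\<Sum>i. \<integral>\<^sup>+\<omega>. ennreal (qf (v i k \<omega>)) \<partial>M))"
    by (simp add: ennreal_suminf_cmult suminf_sum summableI)
  also have "(\<Sum>k<n. ennreal (min t (\<tau> (Suc k)) - min t (\<tau> k)) * (\<Sum>i. \<integral>\<^sup>+\<omega>. ennreal (qf (v i k \<omega>)) \<partial>M)) =
     (\<Sum>k<n. ennreal (min t (\<tau> (Suc k)) - min t (\<tau> k)) * (\<integral>\<^sup>+\<omega>. ennreal (hs (\<phi> k \<omega>)) \<partial>M))"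
  proof (intro sum.cong refl arg_cong2[where f="(*)"])
    fix k assume "k \<in> {..<n}"
    then have k: "k < n" by simp
    have "v i k \<in> borel_measurable M" for i using F_M[OF simple_F_measurable[OF v[OF k]]] \<tau>0 k by simp
    then have "(\<Sum>i. \<integral>\<^sup>+\<omega>. ennreal (qf (v i k \<omega>)) \<partial>M) = (\<integral>\<^sup>+\<omega>. (\<Sum>i. ennreal (qf (v i k \<omega>))) \<partial>M)"
      by (intro nn_integral_suminf[symmetric]) measurable
    then show "(\<Sum>i. \<integral>\<^sup>+\<omega>. ennreal (qf (v i k \<omega>)) \<partial>M) = (\<integral>\<^sup>+\<omega>. ennreal (hs (\<phi> k \<omega>)) \<partial>M)"
      by (simp add: v_def ennreal_hs)
  qed
  also have "\<dots> = (\<integral>\<^sup>+\<omega>. (\<Sum>k<n. ennreal (min t (\<tau> (Suc k)) - min t (\<tau> k)) * ennreal (hs (\<phi> k \<omega>))) \<partial>M)"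
  proof -
    have m: "(\<lambda>\<omega>. ennreal (hs (\<phi> k \<omega>))) \<in> borel_measurable M" if "k \<in> {..<n}" for k
      using that by (intro simple_hs_measurable(1)[OF \<phi> \<tau>0]) auto
    then show ?thesis by (subst nn_integral_sum) (auto simp: nn_integral_cmult)
  qed
  also have "\<dots> = (\<integral>\<^sup>+\<omega>. (\<integral>\<^sup>+s\<in>{0..t}. ennreal (hs (elementary_process E s \<omega>)) \<partial>lborel) \<partial>M)"
    unfolding E_eq by (subst elementary_hs_integral[OF E']) simp
  finally show ?thesis .
qed

lemma elementary_integral_measurable:
  assumes E: "elementary F T E" and t: "0 \<le> t"
  shows "elementary_integral Wc E t \<in> borel_measurable (F t)"
proof -
  obtain n \<tau> \<phi> where E_eq: "E = (n, \<tau>, \<phi>)" by (cases E)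
  have \<tau>: "0 \<le> \<tau> 0" and inc: "\<And>k. k < n \<Longrightarrow> \<tau> k \<le> \<tau> (Suc k)"
    and \<phi>: "\<And>k. k < n \<Longrightarrow> simple_function (F (\<tau> k)) (\<phi> k)" using E E_eq by (auto intro: less_imp_le)
  have v: "simple_function (F (\<tau> k)) (\<lambda>\<omega>. adj (\<phi> k \<omega>) (e i))" if "k < n" for i k
    by (rule simple_function_compose1[OF \<phi>[OF that]])
  have m: "(\<lambda>\<omega>. elementary_integral Wc E t \<omega> \<bullet> e i) \<in> borel_measurable (F t)" for i
    unfolding E_eq elementary_coordinate by (rule step_integral_measurable[OF \<tau> inc v order_refl t])
  show ?thesis
  proof (rule borel_measurable_LIMSEQ_metric)
    show "(\<lambda>\<omega>. \<Sum>i<n. (elementary_integral Wc E t \<omega> \<bullet> e i) *\<^sub>R e i) \<in> borel_measurable (F t)" for n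
      using m by measurable
    show "(\<lambda>n. \<Sum>i<n. (elementary_integral Wc E t \<omega> \<bullet> e i) *\<^sub>R e i) \<longlonglongrightarrow> elementary_integral Wc E t \<omega>" for \<omega>
      using expansion unfolding sums_def .
  qed
qed

lemma elementary_integral_continuous:
  assumes E: "elementary F T E"
  shows "continuous_on {0..} (\<lambda>t. elementary_integral Wc E t \<omega>)"
proof -
  obtain n \<tau> \<phi> where E_eq: "E = (n, \<tau>, \<phi>)" by (cases E)
  have \<tau>: "0 \<le> \<tau> 0" and inc: "\<And>k. k < n \<Longrightarrow> \<tau> k \<le> \<tau> (Suc k)" using E E_eq by (auto intro: less_imp_le)
  have nn: "0 \<le> \<tau> k" if "k \<le> n" for k
    using that by (induction k) (use \<tau> inc in \<open>auto simp: Suc_le_eq intro: order.trans\<close>)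
  have c: "continuous_on {0..} (\<lambda>t. Wc (min t (\<tau> k)) \<omega>)" if "k \<le> n" for k
    by (rule continuous_on_compose2[OF Wc_continuous]) (use nn[OF that] in \<open>auto intro!: continuous_intros\<close>)
  then show ?thesis
    unfolding E_eq elementary_integral.simps by (intro continuous_intros blinfun.continuous_on) auto
qed

end

section \<open>Localisation of elementary integrals\<close>

lemma strict_steps_mono:
  fixes \<tau> :: "nat \<Rightarrow> real"
  assumes "\<And>k. k < n \<Longrightarrow> \<tau> k < \<tau> (Suc k)" "j < k" "k \<le> n"
  shows "\<tau> j < \<tau> k"
  using assms(2,3)
proof (induction k)
  case (Suc k)
  have k: "\<tau> k < \<tau> (Suc k)" using assms(1) Suc.prems by simp
  show ?case
  proof (cases "j = k")
    case False
    then have "\<tau> j < \<tau> k" using Suc by simp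
    then show ?thesis using k by linarith
  qed (use k in simp)
qed simp

lemma strict_steps_mono_iff:
  fixes \<tau> :: "nat \<Rightarrow> real"
  assumes "\<And>k. k < n \<Longrightarrow> \<tau> k < \<tau> (Suc k)" "j \<le> n" "k \<le> n"
  shows "\<tau> j < \<tau> k \<longleftrightarrow> j < k" "\<tau> j \<le> \<tau> k \<longleftrightarrow> j \<le> k"
proof -
  have "\<tau> j < \<tau> k" if "j < k" by (rule strict_steps_mono[where \<tau>=\<tau> and n=n, OF assms(1) that assms(3)])
  moreover have "\<tau> k < \<tau> j" if "k < j" by (rule strict_steps_mono[where \<tau>=\<tau> and n=n, OF assms(1) that assms(2)])
  ultimately show "\<tau> j < \<tau> k \<longleftrightarrow> j < k" "\<tau> j \<le> \<tau> k \<longleftrightarrow> j \<le> k"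
    by (cases j k rule: linorder_cases; force)+
qed

lemma strict_steps_cover:
  fixes \<tau> :: "nat \<Rightarrow> real"
  assumes "\<tau> 0 < s" "s \<le> \<tau> n" shows "\<exists>k<n. s \<in> {\<tau> k<..\<tau> (Suc k)}"
  using assms
proof (induction n)
  case (Suc n)
  show ?case
  proof (cases "s \<le> \<tau> n")
    case True
    then obtain k where "k < n" "s \<in> {\<tau> k<..\<tau> (Suc k)}" using Suc by auto
    then show ?thesis using less_Suc_eq by blast
  next
    case False
    then show ?thesis using Suc.prems by (intro exI[of _ n]) auto
  qed
qed simp

lemma step_sum_at:
  fixes f :: "nat \<Rightarrow> 'b::real_vector" and \<tau> :: "nat \<Rightarrow> real"
  assumes inc: "\<And>k. k < n \<Longrightarrow> \<tau> k < \<tau> (Suc k)" and k: "k < n" "s \<in> {\<tau> k<..\<tau> (Suc k)}"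
  shows "(\<Sum>j<n. indicator {\<tau> j<..\<tau> (Suc j)} s *\<^sub>R f j) = f k"
proof -
  have "(\<Sum>j<n. indicator {\<tau> j<..\<tau> (Suc j)} s *\<^sub>R f j) = (\<Sum>j<n. if j = k then f k else 0)"
  proof (rule sum.cong[OF refl])
    fix j assume j: "j \<in> {..<n}"
    show "indicator {\<tau> j<..\<tau> (Suc j)} s *\<^sub>R f j = (if j = k then f k else 0)"
    proof (cases "j = k")
      case True
      have "indicator {\<tau> k<..\<tau> (Suc k)} s = (1::real)" using k(2) by (rule indicator_simps(1))
      then show ?thesis unfolding True by simp
    next
      case False
      have "s \<notin> {\<tau> j<..\<tau> (Suc j)}"
      proof
        assume s: "s \<in> {\<tau> j<..\<tau> (Suc j)}"
        from s k(2) have "\<tau> j < \<tau> (Suc k)" "\<tau> k < \<tau> (Suc j)" by auto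
        then have "j < Suc k" "k < Suc j"
          using strict_steps_mono_iff(1)[where \<tau>=\<tau> and n=n, OF inc] j k by auto
        then show False using False by simp
      qed
      then have "indicator {\<tau> j<..\<tau> (Suc j)} s = (0::real)" by (rule indicator_simps(2))
      then show ?thesis using False by simp
    qed
  qed
  then show ?thesis using k by simp
qed

lemma elementary_process_at:
  assumes E: "elementary F T (n, \<tau>, \<phi>)" and k: "k < n" "s \<in> {\<tau> k<..\<tau> (Suc k)}"
  shows "elementary_process (n, \<tau>, \<phi>) s \<omega> = \<phi> k \<omega>"
proof -
  have inc: "\<And>k. k < n \<Longrightarrow> \<tau> k < \<tau> (Suc k)" using E by auto
  show ?thesis unfolding elementary_process.simps by (rule step_sum_at[where \<tau>=\<tau> and n=n, OF inc k])
qed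

lemma elementary_process_outside:
  assumes E: "elementary F T (n, \<tau>, \<phi>)" and s: "s \<notin> {0<..T}"
  shows "elementary_process (n, \<tau>, \<phi>) s \<omega> = 0"
proof -
  have inc: "\<And>k. k < n \<Longrightarrow> \<tau> k < \<tau> (Suc k)" and e: "\<tau> 0 = 0" "\<tau> n = T" using E by auto
  have "indicator {\<tau> k<..\<tau> (Suc k)} s = (0::real)" if "k < n" for k
  proof -
    have "\<tau> 0 \<le> \<tau> k" "\<tau> (Suc k) \<le> \<tau> n"
      using strict_steps_mono_iff(2)[where \<tau>=\<tau> and n=n, OF inc] that by auto
    then have "s \<notin> {\<tau> k<..\<tau> (Suc k)}" using s e by auto
    then show ?thesis by (rule indicator_simps(2))
  qed
  then show ?thesis by simp
qed

section \<open>Common refinement of partitions\<close>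

lemma partition_enumeration:
  fixes S :: "real set"
  assumes "finite S" "0 \<in> S" "T \<in> S" "S \<subseteq> {0..T}"
  shows "\<exists>N \<rho>. \<rho> 0 = 0 \<and> \<rho> N = T \<and> (\<forall>k<N. \<rho> k < \<rho> (Suc k)) \<and> \<rho> ` {..N} = S"
proof -
  define xs where "xs = sorted_list_of_set S"
  have xs: "sorted_wrt (<) xs" "set xs = S" using assms(1) unfolding xs_def by auto
  then have "xs \<noteq> []" using assms(2) by auto
  define N where "N = length xs - 1"
  have len: "length xs = Suc N" using \<open>xs \<noteq> []\<close> unfolding N_def by (cases xs) auto
  have inc: "xs ! j < xs ! k" if "j < k" "k \<le> N" for j k
    using xs(1) that len by (auto simp: sorted_wrt_iff_nth_less)
  have im: "(\<lambda>k. xs ! k) ` {..N} = S"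
    unfolding xs(2)[symmetric] using len by (auto simp: in_set_conv_nth image_iff less_Suc_eq_le)
  then obtain a b where ab: "a \<le> N" "xs ! a = 0" "b \<le> N" "xs ! b = T" using assms(2,3) by (auto simp: image_iff dest: sym)
  have "xs ! 0 \<in> {0..T}" "xs ! N \<in> {0..T}" using im assms(4) by auto
  then have "xs ! 0 = 0" "xs ! N = T"
    using inc[of 0 a] inc[of b N] ab by (force, force)
  then show ?thesis using inc im by (intro exI[of _ N] exI[of _ "\<lambda>k. xs ! k"]) auto
qed

context
  fixes F :: "real \<Rightarrow> 'w measure" and T :: real and n :: nat and \<tau> :: "nat \<Rightarrow> real"
    and \<phi> :: "nat \<Rightarrow> 'w \<Rightarrow> ('h::{real_inner, banach} \<Rightarrow>\<^sub>L 'h)" and N :: nat and \<rho> :: "nat \<Rightarrow> real"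
  assumes E: "elementary F T (n, \<tau>, \<phi>)" and rho: "\<forall>k<N. \<rho> k < \<rho> (Suc k)" and sub: "\<tau> ` {..n} \<subseteq> \<rho> ` {..N}"
begin

lemma refine_index: "k \<le> n \<Longrightarrow> \<exists>j\<le>N. \<tau> k = \<rho> j"
  using sub by (force simp: subset_iff image_iff)

text \<open>A fine interval lies inside one coarse interval or outside all of them. Its right end
  point represents it because the intervals are open on the left and closed on the right.\<close>

lemma refine_process_const:
  assumes j: "j < N" and s: "s \<in> {\<rho> j<..\<rho> (Suc j)}"
  shows "elementary_process (n, \<tau>, \<phi>) s \<omega> = elementary_process (n, \<tau>, \<phi>) (\<rho> (Suc j)) \<omega>"
  unfolding elementary_process.simps
proof (rule sum.cong[OF refl])
  fix k assume k: "k \<in> {..<n}"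
  obtain a b where ab: "a \<le> N" "\<tau> k = \<rho> a" "b \<le> N" "\<tau> (Suc k) = \<rho> b"
    using refine_index[of k] refine_index[of "Suc k"] k by auto
  note iff = strict_steps_mono_iff[where \<tau>=\<rho> and n=N, OF rho[rule_format]]
  have "\<rho> a < s \<longleftrightarrow> \<rho> a < \<rho> (Suc j)"
  proof
    assume "\<rho> a < \<rho> (Suc j)"
    then have "\<rho> a \<le> \<rho> j" using iff[of a "Suc j"] iff[of a j] ab j by auto
    then show "\<rho> a < s" using s by simp
  qed (use s in auto)
  moreover have "s \<le> \<rho> b \<longleftrightarrow> \<rho> (Suc j) \<le> \<rho> b"
  proof
    assume "s \<le> \<rho> b"
    then have "\<rho> j < \<rho> b" using s by simp
    then show "\<rho> (Suc j) \<le> \<rho> b" using iff[of j b] iff[of "Suc j" b] ab j by auto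
  qed (use s in auto)
  ultimately show "indicator {\<tau> k<..\<tau> (Suc k)} s *\<^sub>R \<phi> k \<omega> = indicator {\<tau> k<..\<tau> (Suc k)} (\<rho> (Suc j)) *\<^sub>R \<phi> k \<omega>"
    unfolding ab indicator_def by simp
qed

lemma refine_integral:
  "elementary_integral W (n, \<tau>, \<phi>) t \<omega> = (\<Sum>j<N. blinfun_apply (elementary_process (n, \<tau>, \<phi>) (\<rho> (Suc j)) \<omega>)
     (W (min t (\<rho> (Suc j))) \<omega> - W (min t (\<rho> j)) \<omega>))"
proof -
  let ?g = "\<lambda>x. W (min t x) \<omega>"
  have iff: "\<rho> j < \<rho> k \<longleftrightarrow> j < k" "\<rho> j \<le> \<rho> k \<longleftrightarrow> j \<le> k" if "j \<le> N" "k \<le> N" for j k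
    using strict_steps_mono_iff[where \<tau>=\<rho> and n=N and j=j and k=k] rho that by blast+
  \<comment> \<open>The fine increments inside one coarse interval telescope.\<close>
  have tel: "(\<Sum>j<N. indicator {\<tau> k<..\<tau> (Suc k)} (\<rho> (Suc j)) *\<^sub>R (?g (\<rho> (Suc j)) - ?g (\<rho> j))) = ?g (\<tau> (Suc k)) - ?g (\<tau> k)"
    if k: "k < n" for k
  proof -
    obtain a b where ab: "a \<le> N" "\<tau> k = \<rho> a" "b \<le> N" "\<tau> (Suc k) = \<rho> b"
      using refine_index[of k] refine_index[of "Suc k"] k by auto
    have "\<tau> k < \<tau> (Suc k)" using E k by auto
    then have "a < b" using iff(1)[OF ab(1,3)] ab by simp
    have "(\<Sum>j<N. indicator {\<rho> a<..\<rho> b} (\<rho> (Suc j)) *\<^sub>R (?g (\<rho> (Suc j)) - ?g (\<rho> j))) =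
        (\<Sum>j\<in>{a..<b}. ?g (\<rho> (Suc j)) - ?g (\<rho> j))"
    proof (rule sum.mono_neutral_cong_right)
      show "\<forall>j\<in>{..<N} - {a..<b}. indicator {\<rho> a<..\<rho> b} (\<rho> (Suc j)) *\<^sub>R (?g (\<rho> (Suc j)) - ?g (\<rho> j)) = 0"
      proof
        fix j assume j: "j \<in> {..<N} - {a..<b}"
        then have "\<rho> (Suc j) \<notin> {\<rho> a<..\<rho> b}" using iff[of a "Suc j"] iff[of "Suc j" b] ab by auto
        then show "indicator {\<rho> a<..\<rho> b} (\<rho> (Suc j)) *\<^sub>R (?g (\<rho> (Suc j)) - ?g (\<rho> j)) = 0" by simp
      qed
      show "indicator {\<rho> a<..\<rho> b} (\<rho> (Suc j)) *\<^sub>R (?g (\<rho> (Suc j)) - ?g (\<rho> j)) = ?g (\<rho> (Suc j)) - ?g (\<rho> j)"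
        if "j \<in> {a..<b}" for j
      proof -
        have "\<rho> (Suc j) \<in> {\<rho> a<..\<rho> b}" using iff[of a "Suc j"] iff[of "Suc j" b] ab that by auto
        then show ?thesis by simp
      qed
    qed (use ab in auto)
    also have "\<dots> = ?g (\<rho> b) - ?g (\<rho> a)"
      using sum_Suc_diff'[of a b "\<lambda>j. ?g (\<rho> j)"] \<open>a < b\<close> by simp
    finally show ?thesis unfolding ab .
  qed
  have "(\<Sum>j<N. blinfun_apply (elementary_process (n, \<tau>, \<phi>) (\<rho> (Suc j)) \<omega>) (?g (\<rho> (Suc j)) - ?g (\<rho> j))) =
      (\<Sum>j<N. \<Sum>k<n. blinfun_apply (\<phi> k \<omega>) (indicator {\<tau> k<..\<tau> (Suc k)} (\<rho> (Suc j)) *\<^sub>R (?g (\<rho> (Suc j)) - ?g (\<rho> j))))"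
    by (simp add: blinfun.sum_left blinfun.scaleR_left blinfun.scaleR_right)
  also have "\<dots> = (\<Sum>k<n. blinfun_apply (\<phi> k \<omega>) (\<Sum>j<N. indicator {\<tau> k<..\<tau> (Suc k)} (\<rho> (Suc j)) *\<^sub>R (?g (\<rho> (Suc j)) - ?g (\<rho> j))))"
    by (subst sum.swap) (simp only: blinfun.sum_right)
  also have "\<dots> = elementary_integral W (n, \<tau>, \<phi>) t \<omega>"
    unfolding elementary_integral.simps by (rule sum.cong[OF refl]) (simp only: tel lessThan_iff)
  finally show ?thesis ..
qed

end

context wiener
begin

text \<open>The value is read off at the right end point \<open>\<rho> (Suc j)\<close>, yet it is
  known at \<open>\<rho> j\<close>: it belongs to a coarse interval that has started by
  then.\<close>

lemma refine_simple:
  assumes E: "elementary F T (n, \<tau>, \<phi>)" and \<rho>: "\<rho> 0 = 0" "\<forall>k<N. \<rho> k < \<rho> (Suc k)" and sub: "\<tau> ` {..n} \<subseteq> \<rho> ` {..N}"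
    and j: "j < N"
  shows "simple_function (F (\<rho> j)) (elementary_process (n, \<tau>, \<phi>) (\<rho> (Suc j)))"
proof (cases "\<exists>k<n. \<rho> (Suc j) \<in> {\<tau> k<..\<tau> (Suc k)}")
  case True
  then obtain k where k: "k < n" "\<rho> (Suc j) \<in> {\<tau> k<..\<tau> (Suc k)}" by blast
  note iff = strict_steps_mono_iff[where \<tau>=\<rho> and n=N, OF \<rho>(2)[rule_format]]
  obtain a where a: "a \<le> N" "\<tau> k = \<rho> a" using refine_index[OF E \<rho>(2) sub, of k] k by auto
  then have "a < Suc j" using k iff(1)[of a "Suc j"] j by auto
  then have "\<tau> k \<le> \<rho> j" using iff(2)[of a j] a j by auto
  moreover have "0 \<le> \<tau> k" using iff(2)[of 0 a] a \<rho>(1) by auto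
  moreover have "simple_function (F (\<tau> k)) (\<phi> k)" using E k by auto
  ultimately have "simple_function (F (\<rho> j)) (\<phi> k)" using simple_F_mono by blast
  moreover have "elementary_process (n, \<tau>, \<phi>) (\<rho> (Suc j)) = \<phi> k"
    by (rule ext) (rule elementary_process_at[OF E k])
  ultimately show ?thesis by simp
next
  case False
  then have "indicator {\<tau> k<..\<tau> (Suc k)} (\<rho> (Suc j)) = (0::real)" if "k < n" for k
    using that by (intro indicator_simps(2)) blast
  then have "elementary_process (n, \<tau>, \<phi>) (\<rho> (Suc j)) = (\<lambda>_. 0)" by (intro ext) simp
  then show ?thesis by simp
qed

text \<open>Approximating sequences of two integrals live on different partitions. On the union of
  the partition points their difference is elementary, so that \<open>elementary_doob\<close> and
  \<open>lenglart\<close> apply to it.\<close>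

lemma elementary_diff:
  fixes E1 E2 :: "('w, 'h) elementary"
  assumes E1: "elementary F T E1" and E2: "elementary F T E2"
  shows "\<exists>E. elementary F T E \<and> (\<forall>s \<omega>. elementary_process E s \<omega> = elementary_process E1 s \<omega> - elementary_process E2 s \<omega>)
    \<and> (\<forall>W t \<omega>. elementary_integral W E t \<omega> = elementary_integral W E1 t \<omega> - elementary_integral W E2 t \<omega>)"
proof -
  obtain n1 \<tau>1 \<phi>1 n2 \<tau>2 \<phi>2 where eq: "E1 = (n1, \<tau>1, \<phi>1)" "E2 = (n2, \<tau>2, \<phi>2)" by (metis surj_pair)
  define S where "S = \<tau>1 ` {..n1} \<union> \<tau>2 ` {..n2}"
  have r: "\<tau> ` {..n} \<subseteq> {0..T}" if "elementary F T (n, \<tau>, \<phi>)" for n \<tau> and \<phi> :: "nat \<Rightarrow> 'w \<Rightarrow> ('h \<Rightarrow>\<^sub>L 'h)"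
  proof -
    have inc: "\<And>k. k < n \<Longrightarrow> \<tau> k < \<tau> (Suc k)" and e: "\<tau> 0 = 0" "\<tau> n = T" using that by auto
    have "\<tau> k \<in> {0..T}" if "k \<le> n" for k
      using strict_steps_mono_iff(2)[where \<tau>=\<tau> and n=n, OF inc, of 0 k]
        strict_steps_mono_iff(2)[where \<tau>=\<tau> and n=n, OF inc, of k n] that e by simp
    then show ?thesis by auto
  qed
  have "0 \<in> S" "T \<in> S" using E1 unfolding S_def eq by force+
  moreover have "finite S" unfolding S_def by simp
  moreover have "S \<subseteq> {0..T}" unfolding S_def using r[OF E1[unfolded eq]] r[OF E2[unfolded eq]] by blast
  ultimately obtain N \<rho> where \<rho>: "\<rho> 0 = 0" "\<rho> N = T" "\<forall>k<N. \<rho> k < \<rho> (Suc k)" "\<rho> ` {..N} = S"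
    using partition_enumeration[of S T] by blast
  have sub: "\<tau>1 ` {..n1} \<subseteq> \<rho> ` {..N}" "\<tau>2 ` {..n2} \<subseteq> \<rho> ` {..N}" unfolding \<rho>(4) S_def by auto
  define \<psi> where "\<psi> j \<omega> = elementary_process E1 (\<rho> (Suc j)) \<omega> - elementary_process E2 (\<rho> (Suc j)) \<omega>" for j \<omega>
  have E: "elementary F T (N, \<rho>, \<psi>)"
    unfolding elementary.simps
  proof (intro conjI \<rho> allI impI)
    fix k assume k: "k < N"
    show "simple_function (F (\<rho> k)) (\<psi> k)"
      unfolding \<psi>_def eq
      by (intro simple_function_compose2[where h="(-)"] 
          refine_simple[OF E1[unfolded eq] \<rho>(1,3) sub(1) k] refine_simple[OF E2[unfolded eq] \<rho>(1,3) sub(2) k])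
  qed
  have "elementary_process (N, \<rho>, \<psi>) s \<omega> = elementary_process E1 s \<omega> - elementary_process E2 s \<omega>" for s \<omega>
  proof (cases "s \<in> {0<..T}")
    case True
    then obtain j where j: "j < N" "s \<in> {\<rho> j<..\<rho> (Suc j)}" using strict_steps_cover[of \<rho> s N] \<rho> by auto
    show ?thesis
      unfolding elementary_process_at[OF E j] \<psi>_def eq
      using refine_process_const[OF E1[unfolded eq] \<rho>(3) sub(1) j] refine_process_const[OF E2[unfolded eq] \<rho>(3) sub(2) j] by metis
  next
    case False
    show ?thesis
      unfolding eq elementary_process_outside[OF E False] elementary_process_outside[OF E1[unfolded eq] False]
        elementary_process_outside[OF E2[unfolded eq] False] by simp
  qed
  moreover have "elementary_integral W (N, \<rho>, \<psi>) t \<omega> = elementary_integral W E1 t \<omega> - elementary_integral W E2 t \<omega>" for W t \<omega>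
    unfolding eq refine_integral[OF E1[unfolded eq] \<rho>(3) sub(1)] refine_integral[OF E2[unfolded eq] \<rho>(3) sub(2)]
    by (simp add: \<psi>_def eq blinfun.diff_left sum_subtractf del: elementary_process.simps)
  ultimately show ?thesis using E by blast
qed

section \<open>Truncation by energy and Lenglart's inequality\<close>

lemma elementary_hs_integral_measurable:
  assumes E: "elementary F T E"
  shows "(\<lambda>\<omega>. \<integral>\<^sup>+s\<in>{0..t}. ennreal (hs (elementary_process E s \<omega>)) \<partial>lborel) \<in> borel_measurable M"
proof -
  obtain n \<tau> \<phi> where eq: "E = (n, \<tau>, \<phi>)" by (cases E)
  have inc: "\<And>k. k < n \<Longrightarrow> \<tau> k < \<tau> (Suc k)" "\<tau> 0 = 0" and \<phi>: "\<And>k. k < n \<Longrightarrow> simple_function (F (\<tau> k)) (\<phi> k)"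
    using E eq by auto
  have "0 \<le> \<tau> k" if "k < n" for k using strict_steps_mono_iff(2)[of n \<tau> 0 k] inc that by auto
  then have [measurable]: "(\<lambda>\<omega>. ennreal (hs (\<phi> k \<omega>))) \<in> borel_measurable M" if "k < n" for k
    using simple_hs_measurable(1)[OF \<phi>] that by blast
  show ?thesis unfolding eq elementary_hs_integral[OF E[unfolded eq]] by measurable
qed

text \<open>Switching the integrand off as soon as its accumulated energy exceeds \<open>\<eta>\<close> keeps it elementary.\<close>

lemma elementary_truncate:
  assumes E: "elementary F T E" and \<eta>: "0 \<le> \<eta>" and t: "0 \<le> t"
  shows "\<exists>E'. elementary F T E' \<and> (\<forall>\<omega>. (\<integral>\<^sup>+s\<in>{0..t}. ennreal (hs (elementary_process E' s \<omega>)) \<partial>lborel) \<le> ennreal \<eta>) \<and>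
    (\<forall>\<omega>. (\<integral>\<^sup>+s\<in>{0..t}. ennreal (hs (elementary_process E s \<omega>)) \<partial>lborel) \<le> ennreal \<eta> \<longrightarrow>
      elementary_integral Wc E' t \<omega> = elementary_integral Wc E t \<omega>)"
proof -
  obtain n \<tau> \<phi> where eq: "E = (n, \<tau>, \<phi>)" by (cases E)
  have inc: "\<And>k. k < n \<Longrightarrow> \<tau> k < \<tau> (Suc k)" "\<tau> 0 = 0" and \<phi>: "\<And>k. k < n \<Longrightarrow> simple_function (F (\<tau> k)) (\<phi> k)"
    using E eq by auto
  define d where "d k = min t (\<tau> (Suc k)) - min t (\<tau> k)" for k
  have d: "0 \<le> d k" if "k < n" for k using inc(1)[OF that] unfolding d_def by auto
  \<comment> \<open>\<open>H k\<close> includes the energy of interval \<open>k\<close>, which is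
    known at its left end: the \<open>d j\<close> are deterministic and \<open>\<phi> j\<close> for
    \<open>j \<le> k\<close> is known at \<open>\<tau> k\<close>. Hence the switch acts before the
    threshold is exceeded.\<close>
  define H where "H k \<omega> = (\<Sum>j\<le>k. d j * hs (\<phi> j \<omega>))" for k \<omega>
  define \<psi> where "\<psi> k \<omega> = (if H k \<omega> \<le> \<eta> then \<phi> k \<omega> else 0)" for k \<omega>
  have int: "(\<integral>\<^sup>+s\<in>{0..t}. ennreal (hs (elementary_process (n, \<tau>, \<theta>) s \<omega>)) \<partial>lborel) = ennreal (\<Sum>k<n. d k * hs (\<theta> k \<omega>))"
    if "elementary F T (n, \<tau>, \<theta>)" for \<theta> \<omega>
    unfolding elementary_hs_integral[OF that] d_def[symmetric] using d
    by (subst sum_ennreal[symmetric]) (auto intro!: sum.cong simp: ennreal_mult)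
  have E': "elementary F T (n, \<tau>, \<psi>)"
    unfolding elementary.simps
  proof (intro conjI allI impI)
    show "\<tau> 0 = 0" "\<tau> n = T" using E eq by auto
    show "\<tau> k < \<tau> (Suc k)" if "k < n" for k using inc that by blast
    fix k assume k: "k < n"
    have s: "simple_function (F (\<tau> k)) (\<lambda>\<omega>. d j * hs (\<phi> j \<omega>))" if "j \<in> {..k}" for j
    proof (rule simple_function_compose1[where g="\<lambda>A. d j * hs A"])
      show "simple_function (F (\<tau> k)) (\<phi> j)"
        using that k strict_steps_mono_iff(2)[of n \<tau> j k] strict_steps_mono_iff(2)[of n \<tau> 0 j] inc
        by (intro simple_F_mono[OF \<phi>]) auto
    qed
    have "simple_function (F (\<tau> k)) (H k)"
      unfolding H_def by (rule simple_function_sum[OF s])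
    then have "simple_function (F (\<tau> k)) (\<lambda>\<omega>. (\<lambda>a b. if a \<le> \<eta> then b else 0) (H k \<omega>) (\<phi> k \<omega>))"
      using \<phi>[OF k] by (rule simple_function_compose2)
    then show "simple_function (F (\<tau> k)) (\<psi> k)" unfolding \<psi>_def by simp
  qed
  have "(\<Sum>k<m. d k * hs (\<psi> k \<omega>)) \<le> \<eta>" if "m \<le> n" for m \<omega>
    using that
  proof (induction m)
    case (Suc m)
    show ?case
    proof (cases "H m \<omega> \<le> \<eta>")
      case True
      have "(\<Sum>k<Suc m. d k * hs (\<psi> k \<omega>)) \<le> (\<Sum>k<Suc m. d k * hs (\<phi> k \<omega>))"
        using d Suc.prems by (intro sum_mono mult_left_mono) (auto simp: \<psi>_def)
      also have "\<dots> = H m \<omega>" unfolding H_def by (simp add: lessThan_Suc_atMost)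
      finally show ?thesis using True by simp
    next
      case False
      then show ?thesis using Suc by (simp add: \<psi>_def)
    qed
  qed (simp add: \<eta>)
  then have le: "\<forall>\<omega>. (\<integral>\<^sup>+s\<in>{0..t}. ennreal (hs (elementary_process (n, \<tau>, \<psi>) s \<omega>)) \<partial>lborel) \<le> ennreal \<eta>"
    unfolding int[OF E'] by (intro allI ennreal_leI) auto
  have "elementary_integral Wc (n, \<tau>, \<psi>) t \<omega> = elementary_integral Wc E t \<omega>"
    if h: "(\<integral>\<^sup>+s\<in>{0..t}. ennreal (hs (elementary_process E s \<omega>)) \<partial>lborel) \<le> ennreal \<eta>" for \<omega>
  proof -
    have "ennreal (\<Sum>k<n. d k * hs (\<phi> k \<omega>)) \<le> ennreal \<eta>" using h int[OF E[unfolded eq]] unfolding eq by simp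
    then have s: "(\<Sum>k<n. d k * hs (\<phi> k \<omega>)) \<le> \<eta>" using \<eta> by (simp add: ennreal_le_iff)
    have "\<psi> k \<omega> = \<phi> k \<omega>" if k: "k < n" for k
    proof -
      have "H k \<omega> \<le> (\<Sum>k<n. d k * hs (\<phi> k \<omega>))"
        unfolding H_def using k d by (intro sum_mono2) auto
      then show ?thesis using s unfolding \<psi>_def by simp
    qed
    then show ?thesis unfolding eq by simp
  qed
  then show ?thesis using E' le by blast
qed

text \<open>Where the energy stays below \<open>\<eta>\<close>, the truncated integral coincides
  with the original one, and Markov's inequality together with \<open>elementary_doob\<close> bounds
  the truncated one; the 4 is Doob's. The event \<open>A\<close> is carried along because locality
  is tested on an event.\<close>

lemma lenglart:
  assumes E: "elementary F T E" and \<eta>: "0 \<le> \<eta>" and \<epsilon>: "0 < \<epsilon>" and t: "0 \<le> t" and A: "A \<in> events"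
  shows "prob {\<omega>\<in>A. \<epsilon> < norm (elementary_integral Wc E t \<omega>)} \<le>
    prob {\<omega>\<in>A. ennreal \<eta> < (\<integral>\<^sup>+s\<in>{0..t}. ennreal (hs (elementary_process E s \<omega>)) \<partial>lborel)} + 4 * \<eta> / \<epsilon>\<^sup>2"
proof -
  obtain E' where E': "elementary F T E'"
    and le: "\<And>\<omega>. (\<integral>\<^sup>+s\<in>{0..t}. ennreal (hs (elementary_process E' s \<omega>)) \<partial>lborel) \<le> ennreal \<eta>"
    and same: "\<And>\<omega>. (\<integral>\<^sup>+s\<in>{0..t}. ennreal (hs (elementary_process E s \<omega>)) \<partial>lborel) \<le> ennreal \<eta> \<Longrightarrow>
      elementary_integral Wc E' t \<omega> = elementary_integral Wc E t \<omega>"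
    using elementary_truncate[OF E \<eta> t] by blast
  note [measurable] = F_M[OF elementary_integral_measurable[OF E t] t] F_M[OF elementary_integral_measurable[OF E' t] t]
    elementary_hs_integral_measurable[OF E] A
  let ?h = "\<lambda>\<omega>. \<integral>\<^sup>+s\<in>{0..t}. ennreal (hs (elementary_process E s \<omega>)) \<partial>lborel"
  have AS: "A = {\<omega>\<in>space M. \<omega> \<in> A}" using sets.sets_into_space[OF A] by auto
  have m1: "{\<omega>\<in>A. ennreal \<eta> < ?h \<omega>} \<in> events" by (subst AS) (simp, measurable)
  have m2: "{\<omega>\<in>space M. \<epsilon> < norm (elementary_integral Wc E' t \<omega>)} \<in> events" by measurable
  have sub: "{\<omega>\<in>A. \<epsilon> < norm (elementary_integral Wc E t \<omega>)} \<subseteq>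
      {\<omega>\<in>A. ennreal \<eta> < ?h \<omega>} \<union> {\<omega>\<in>space M. \<epsilon> < norm (elementary_integral Wc E' t \<omega>)}"
  proof
    fix \<omega> assume w: "\<omega> \<in> {\<omega>\<in>A. \<epsilon> < norm (elementary_integral Wc E t \<omega>)}"
    show "\<omega> \<in> {\<omega>\<in>A. ennreal \<eta> < ?h \<omega>} \<union> {\<omega>\<in>space M. \<epsilon> < norm (elementary_integral Wc E' t \<omega>)}"
    proof (cases "?h \<omega> \<le> ennreal \<eta>")
      case True
      have "\<omega> \<in> space M" using w AS by blast
      then show ?thesis using w same[OF True] by simp
    next
      case False
      then show ?thesis using w by (simp add: not_le)
    qed
  qed
  have "prob {\<omega>\<in>space M. \<epsilon> < norm (elementary_integral Wc E' t \<omega>)} \<le> 4 * \<eta> / \<epsilon>\<^sup>2"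
  proof -
    have "(\<integral>\<^sup>+\<omega>. ennreal ((norm (elementary_integral Wc E' t \<omega>))\<^sup>2) \<partial>M) \<le>
        (\<integral>\<^sup>+\<omega>. (SUP s\<in>{0..t}. ennreal ((norm (elementary_integral Wc E' s \<omega>))\<^sup>2)) \<partial>M)"
      using t by (intro nn_integral_mono SUP_upper) auto
    also have "\<dots> \<le> 4 * (\<integral>\<^sup>+\<omega>. (\<integral>\<^sup>+s\<in>{0..t}. ennreal (hs (elementary_process E' s \<omega>)) \<partial>lborel) \<partial>M)"
      by (rule elementary_doob[OF E' t])
    also have "\<dots> \<le> 4 * (\<integral>\<^sup>+\<omega>. ennreal \<eta> \<partial>M)"
      using le by (intro mult_left_mono nn_integral_mono) auto
    finally have b: "(\<integral>\<^sup>+\<omega>. ennreal ((norm (elementary_integral Wc E' t \<omega>))\<^sup>2) \<partial>M) \<le> ennreal (4 * \<eta>)"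
      using \<eta> by (simp add: emeasure_space_1 ennreal_mult)
    have "emeasure M {\<omega>\<in>space M. \<epsilon> < norm (elementary_integral Wc E' t \<omega>)} \<le>
        emeasure M ({\<omega>\<in>space M. 1 \<le> ennreal (1 / \<epsilon>\<^sup>2) * ennreal ((norm (elementary_integral Wc E' t \<omega>))\<^sup>2)} \<inter> space M)"
    proof (rule emeasure_mono)
      show "{\<omega>\<in>space M. \<epsilon> < norm (elementary_integral Wc E' t \<omega>)} \<subseteq>
        {\<omega>\<in>space M. 1 \<le> ennreal (1 / \<epsilon>\<^sup>2) * ennreal ((norm (elementary_integral Wc E' t \<omega>))\<^sup>2)} \<inter> space M"
      proof safe
        fix \<omega> assume "\<epsilon> < norm (elementary_integral Wc E' t \<omega>)"
        then have "\<epsilon>\<^sup>2 \<le> (norm (elementary_integral Wc E' t \<omega>))\<^sup>2" using \<epsilon> by (intro power_mono) auto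
        then have "1 \<le> 1 / \<epsilon>\<^sup>2 * (norm (elementary_integral Wc E' t \<omega>))\<^sup>2" using \<epsilon> by (simp add: field_simps)
        then have "ennreal 1 \<le> ennreal (1 / \<epsilon>\<^sup>2 * (norm (elementary_integral Wc E' t \<omega>))\<^sup>2)" by (rule ennreal_leI)
        moreover have "ennreal (1 / \<epsilon>\<^sup>2 * (norm (elementary_integral Wc E' t \<omega>))\<^sup>2) =
            ennreal (1 / \<epsilon>\<^sup>2) * ennreal ((norm (elementary_integral Wc E' t \<omega>))\<^sup>2)" by (rule ennreal_mult) auto
        ultimately show "1 \<le> ennreal (1 / \<epsilon>\<^sup>2) * ennreal ((norm (elementary_integral Wc E' t \<omega>))\<^sup>2)"
          by (metis ennreal_1)
      qed
      show "{\<omega>\<in>space M. 1 \<le> ennreal (1 / \<epsilon>\<^sup>2) * ennreal ((norm (elementary_integral Wc E' t \<omega>))\<^sup>2)} \<inter> space M \<in> events"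
        by measurable
    qed
    also have "\<dots> = emeasure M {\<omega>\<in>space M. 1 \<le> ennreal (1 / \<epsilon>\<^sup>2) * ennreal ((norm (elementary_integral Wc E' t \<omega>))\<^sup>2)}"
      by (rule arg_cong[of _ _ "emeasure M"]) auto
    also have "\<dots> \<le> ennreal (1 / \<epsilon>\<^sup>2) * (\<integral>\<^sup>+\<omega>. ennreal ((norm (elementary_integral Wc E' t \<omega>))\<^sup>2) * indicator (space M) \<omega> \<partial>M)"
      by (rule nn_integral_Markov_inequality) measurable
    also have "\<dots> = ennreal (1 / \<epsilon>\<^sup>2) * (\<integral>\<^sup>+\<omega>. ennreal ((norm (elementary_integral Wc E' t \<omega>))\<^sup>2) \<partial>M)"
      by (intro arg_cong2[where f="(*)"] refl nn_integral_cong) simp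
    also have "\<dots> \<le> ennreal (1 / \<epsilon>\<^sup>2) * ennreal (4 * \<eta>)" by (rule mult_left_mono[OF b]) simp
    also have "\<dots> = ennreal (4 * \<eta> / \<epsilon>\<^sup>2)" using \<eta> by (simp add: ennreal_mult[symmetric])
    finally show ?thesis using \<eta> by (simp add: emeasure_eq_measure)
  qed
  moreover have "prob {\<omega>\<in>A. \<epsilon> < norm (elementary_integral Wc E t \<omega>)} \<le>
     prob {\<omega>\<in>A. ennreal \<eta> < ?h \<omega>} + prob {\<omega>\<in>space M. \<epsilon> < norm (elementary_integral Wc E' t \<omega>)}"
    by (rule order.trans[OF finite_measure_mono[OF sub] measure_Un_le[OF m1 m2]]) (use m1 m2 in auto)
  ultimately show ?thesis by linarith
qed

end

section \<open>The stochastic integral\<close>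

lemma norm_add_square_le: "(norm (a + b))\<^sup>2 \<le> 2 * (norm a)\<^sup>2 + 2 * (norm (b::'a::real_normed_vector))\<^sup>2"
proof -
  have "(norm (a + b))\<^sup>2 \<le> (norm a + norm b)\<^sup>2" by (intro power_mono norm_triangle_ineq) simp
  also have "\<dots> \<le> 2 * (norm a)\<^sup>2 + 2 * (norm b)\<^sup>2"
    using zero_le_power2[of "norm a - norm b"] by (simp add: power2_diff power2_sum)
  finally show ?thesis .
qed

lemma norm_diff_square_le: "(norm (a - b))\<^sup>2 \<le> 2 * (norm a)\<^sup>2 + 2 * (norm (b::'a::real_normed_vector))\<^sup>2"
  using norm_add_square_le[of a "- b"] by simp

text \<open>Each use of \<open>norm_add_square_le\<close> doubles a constant, which the weights
  \<open>2^(Suc k)\<close> account for; the factor \<open>(1/2)^n\<close> turns a finite weighted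
  sum into a rate of convergence.\<close>

lemma dyadic_telescope:
  fixes x :: "nat \<Rightarrow> 'a::real_normed_vector"
  assumes "n \<le> m"
  shows "(norm (x m - x n))\<^sup>2 \<le> (1/2)^n * (\<Sum>k\<in>{n..<m}. 2^(Suc k) * (norm (x (Suc k) - x k))\<^sup>2)"
  using assms
proof (induction rule: inc_induct)
  case (step n)
  let ?d = "\<lambda>k. 2^(Suc k) * (norm (x (Suc k) - x k))\<^sup>2"
  have "(norm (x m - x n))\<^sup>2 \<le> 2 * (norm (x m - x (Suc n)))\<^sup>2 + 2 * (norm (x (Suc n) - x n))\<^sup>2"
    using norm_add_square_le[of "x m - x (Suc n)" "x (Suc n) - x n"] by simp
  also have "\<dots> \<le> 2 * ((1/2)^(Suc n) * (\<Sum>k\<in>{Suc n..<m}. ?d k)) + 2 * (norm (x (Suc n) - x n))\<^sup>2"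
    using step.IH by simp
  also have "2 * (norm (x (Suc n) - x n))\<^sup>2 = (1/2)^n * ?d n"
    by (simp add: power_divide)
  also have "2 * ((1/2)^(Suc n) * (\<Sum>k\<in>{Suc n..<m}. ?d k)) = (1/2)^n * (\<Sum>k\<in>{Suc n..<m}. ?d k)" by simp
  also have "(1/2)^n * (\<Sum>k\<in>{Suc n..<m}. ?d k) + (1/2)^n * ?d n = (1/2)^n * (\<Sum>k\<in>{n..<m}. ?d k)"
    using step.hyps by (simp add: sum.atLeast_Suc_lessThan[of n m] algebra_simps)
  finally show ?case .
qed simp

text \<open>The integrands of interest are a scalar process times one fixed operator
  \<open>P\<close>, so measurability and domination concern scalar processes.\<close>

locale ito = wiener e Q M F W
  for e :: "nat \<Rightarrow> 'h::{real_inner, banach, second_countable_topology}" and Q and M :: "'w measure" and F W +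
  fixes T :: real and P :: "'h \<Rightarrow>\<^sub>L 'h"
  assumes T_pos: "0 < T"
begin

definition jointly_measurable :: "(real \<Rightarrow> 'w \<Rightarrow> real) \<Rightarrow> bool" where
  "jointly_measurable g \<longleftrightarrow> (\<lambda>(\<omega>, s). indicator {0..T} s * g s \<omega>) \<in> borel_measurable (M \<Otimes>\<^sub>M lborel)"

definition approx_error :: "real \<Rightarrow> (real \<Rightarrow> 'w \<Rightarrow> real) \<Rightarrow> ('w, 'h) elementary \<Rightarrow> 'w \<Rightarrow> ennreal" where
  "approx_error t g E \<omega> = (\<integral>\<^sup>+s\<in>{0..t}. ennreal (hs (g s \<omega> *\<^sub>R P - elementary_process E s \<omega>)) \<partial>lborel)"

definition integrand_dist :: "real \<Rightarrow> (real \<Rightarrow> 'w \<Rightarrow> real) \<Rightarrow> (real \<Rightarrow> 'w \<Rightarrow> real) \<Rightarrow> 'w \<Rightarrow> ennreal" where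
  "integrand_dist t g g' \<omega> = (\<integral>\<^sup>+s\<in>{0..t}. ennreal ((g s \<omega> - g' s \<omega>)\<^sup>2) \<partial>lborel)"

text \<open>Measurability goes through the series \<open>ennreal_hs\<close>: the operator space is
  not separable, whereas each \<open>adj (\<phi> k \<omega>) (e i)\<close> takes values in the
  separable Hilbert space.\<close>

lemma approx_error_joint:
  assumes g: "jointly_measurable g" and E: "elementary F T E" and t: "t \<le> T"
  shows "(\<lambda>(\<omega>, s). ennreal (hs (g s \<omega> *\<^sub>R P - elementary_process E s \<omega>)) * indicator {0..t} s)
     \<in> borel_measurable (M \<Otimes>\<^sub>M lborel)"
proof -
  obtain n \<tau> \<phi> where eq: "E = (n, \<tau>, \<phi>)" by (cases E)
  have inc: "\<And>k. k < n \<Longrightarrow> \<tau> k < \<tau> (Suc k)" "\<tau> 0 = 0" and \<phi>: "\<And>k. k < n \<Longrightarrow> simple_function (F (\<tau> k)) (\<phi> k)"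
    using E eq by auto
  have nn: "0 \<le> \<tau> k" if "k < n" for k using strict_steps_mono_iff(2)[of n \<tau> 0 k] inc that by auto
  have v[measurable]: "(\<lambda>\<omega>. adj (\<phi> k \<omega>) (e i)) \<in> borel_measurable M" if "k < n" for k i
    by (rule F_M[OF simple_F_measurable[OF simple_function_compose1[OF \<phi>[OF that]]] nn[OF that]])
  note g[unfolded jointly_measurable_def split_beta', measurable]
  have [measurable]: "(\<lambda>x. ennreal (qf ((indicator {0..T} (snd x) * g (snd x) (fst x)) *\<^sub>R adj P (e i) -
        (\<Sum>k<n. indicator {\<tau> k<..\<tau> (Suc k)} (snd x) *\<^sub>R adj (\<phi> k (fst x)) (e i))))) \<in> borel_measurable (M \<Otimes>\<^sub>M lborel)" for i
  proof -
    have "(\<lambda>x. \<Sum>k<n. indicator {\<tau> k<..\<tau> (Suc k)} (snd x) *\<^sub>R adj (\<phi> k (fst x)) (e i)) \<in> borel_measurable (M \<Otimes>\<^sub>M lborel)"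
    proof (rule borel_measurable_sum)
      fix k assume "k \<in> {..<n}"
      then have [measurable]: "(\<lambda>\<omega>. adj (\<phi> k \<omega>) (e i)) \<in> borel_measurable M" using v by simp
      show "(\<lambda>x. indicator {\<tau> k<..\<tau> (Suc k)} (snd x) *\<^sub>R adj (\<phi> k (fst x)) (e i)) \<in> borel_measurable (M \<Otimes>\<^sub>M lborel)"
        by measurable
    qed
    then show ?thesis by measurable
  qed
  have "(\<lambda>(\<omega>, s). (\<Sum>i. ennreal (qf ((indicator {0..T} s * g s \<omega>) *\<^sub>R adj P (e i)
      - (\<Sum>k<n. indicator {\<tau> k<..\<tau> (Suc k)} s *\<^sub>R adj (\<phi> k \<omega>) (e i))))) * indicator {0..t} s)
      \<in> borel_measurable (M \<Otimes>\<^sub>M lborel)"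
    unfolding split_beta' by measurable
  also have "(\<lambda>(\<omega>, s). (\<Sum>i. ennreal (qf ((indicator {0..T} s * g s \<omega>) *\<^sub>R adj P (e i)
      - (\<Sum>k<n. indicator {\<tau> k<..\<tau> (Suc k)} s *\<^sub>R adj (\<phi> k \<omega>) (e i))))) * indicator {0..t} s) =
      (\<lambda>(\<omega>, s). ennreal (hs (g s \<omega> *\<^sub>R P - elementary_process E s \<omega>)) * indicator {0..t} s)"
    (is "?L = ?R")
  proof
    fix x :: "'w \<times> real"
    obtain \<omega> s where x: "x = (\<omega>, s)" by (cases x)
    show "?L x = ?R x"
    proof (cases "s \<in> {0..t}")
      case True
      then have "indicator {0..T} s = (1::real)" using t by (intro indicator_simps(1)) auto
      then show ?thesis unfolding x eq by (simp add: ennreal_hs[symmetric] adj_diff adj_scaleR adj_sum)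
    qed (simp add: x)
  qed
  finally show ?thesis .
qed

lemma approx_error_section:
  assumes "jointly_measurable g" "elementary F T E" "t \<le> T" "\<omega> \<in> space M"
  shows "(\<lambda>s. ennreal (hs (g s \<omega> *\<^sub>R P - elementary_process E s \<omega>)) * indicator {0..t} s) \<in> borel_measurable lborel"
  using measurable_compose[OF measurable_Pair1'[OF assms(4), of lborel] approx_error_joint[OF assms(1-3)]] by simp

lemma approx_error_measurable:
  assumes "jointly_measurable g" "elementary F T E" "t \<le> T"
  shows "approx_error t g E \<in> borel_measurable M"
  using lborel.borel_measurable_nn_integral[OF approx_error_joint[OF assms]] unfolding approx_error_def .

lemma integrand_dist_joint:
  assumes "jointly_measurable g" "jointly_measurable g'" and t: "t \<le> T"
  shows "(\<lambda>(\<omega>, s). ennreal ((g s \<omega> - g' s \<omega>)\<^sup>2) * indicator {0..t} s) \<in> borel_measurable (M \<Otimes>\<^sub>M lborel)"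
proof -
  note assms(1,2)[unfolded jointly_measurable_def split_beta', measurable]
  have "(\<lambda>(\<omega>, s). ennreal ((indicator {0..T} s * g s \<omega> - indicator {0..T} s * g' s \<omega>)\<^sup>2) * indicator {0..t} s)
    \<in> borel_measurable (M \<Otimes>\<^sub>M lborel)"
    unfolding split_beta' by measurable
  also have "(\<lambda>(\<omega>, s). ennreal ((indicator {0..T} s * g s \<omega> - indicator {0..T} s * g' s \<omega>)\<^sup>2) * indicator {0..t} s) =
     (\<lambda>(\<omega>, s). ennreal ((g s \<omega> - g' s \<omega>)\<^sup>2) * indicator {0..t} s)"
    using t by (auto simp: fun_eq_iff indicator_def)
  finally show ?thesis .
qed

lemma integrand_dist_section:
  assumes "jointly_measurable g" "jointly_measurable g'" "t \<le> T" "\<omega> \<in> space M"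
  shows "(\<lambda>s. ennreal ((g s \<omega> - g' s \<omega>)\<^sup>2) * indicator {0..t} s) \<in> borel_measurable lborel"
  using measurable_compose[OF measurable_Pair1'[OF assms(4), of lborel] integrand_dist_joint[OF assms(1-3)]] by simp

lemma integrand_dist_measurable:
  assumes "jointly_measurable g" "jointly_measurable g'" "t \<le> T"
  shows "integrand_dist t g g' \<in> borel_measurable M"
  using lborel.borel_measurable_nn_integral[OF integrand_dist_joint[OF assms]] unfolding integrand_dist_def .

lemma elementary_dist_le:
  assumes g: "jointly_measurable g" "jointly_measurable g'" and E: "elementary F T E" "elementary F T E'"
    and t: "t \<le> T" and w: "\<omega> \<in> space M"
  shows "(\<integral>\<^sup>+s\<in>{0..t}. ennreal (hs (elementary_process E s \<omega> - elementary_process E' s \<omega>)) \<partial>lborel)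
    \<le> 4 * approx_error t g E \<omega> + 4 * approx_error t g' E' \<omega> + 4 * ennreal (hs P) * integrand_dist t g g' \<omega>"
proof -
  note m = approx_error_section[OF g(1) E(1) t w] approx_error_section[OF g(2) E(2) t w] integrand_dist_section[OF g t w]
  let ?a = "\<lambda>s. ennreal (hs (g s \<omega> *\<^sub>R P - elementary_process E s \<omega>)) * indicator {0..t} s"
  let ?b = "\<lambda>s. ennreal (hs (g' s \<omega> *\<^sub>R P - elementary_process E' s \<omega>)) * indicator {0..t} s"
  let ?c = "\<lambda>s. ennreal ((g s \<omega> - g' s \<omega>)\<^sup>2) * indicator {0..t} s"
  have "(\<integral>\<^sup>+s\<in>{0..t}. ennreal (hs (elementary_process E s \<omega> - elementary_process E' s \<omega>)) \<partial>lborel) \<le>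
    (\<integral>\<^sup>+s. 4 * ?a s + 4 * ?b s + 4 * ennreal (hs P) * ?c s \<partial>lborel)"
  proof (rule nn_integral_mono)
    fix s
    let ?A = "g s \<omega> *\<^sub>R P - elementary_process E s \<omega>" and ?B = "g' s \<omega> *\<^sub>R P - elementary_process E' s \<omega>"
    \<comment> \<open>The two approximation errors and the distance of the integrands. Two
      splittings cost a factor 2 each, and the last term is rounded up to the same factor 4.\<close>
    have "hs (elementary_process E s \<omega> - elementary_process E' s \<omega>) = hs ((?B - ?A) + (g s \<omega> - g' s \<omega>) *\<^sub>R P)"
      by (rule arg_cong[of _ _ hs]) (simp add: scaleR_diff_left)
    also have "\<dots> \<le> 2 * hs (?B - ?A) + 2 * ((g s \<omega> - g' s \<omega>)\<^sup>2 * hs P)"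
      using hs_add_le[of "?B - ?A" "(g s \<omega> - g' s \<omega>) *\<^sub>R P"] by (simp add: hs_scaleR)
    also have "\<dots> \<le> 4 * hs ?A + 4 * hs ?B + 4 * hs P * (g s \<omega> - g' s \<omega>)\<^sup>2"
    proof -
      have "0 \<le> (g s \<omega> - g' s \<omega>)\<^sup>2 * hs P" by simp
      moreover have "4 * hs P * (g s \<omega> - g' s \<omega>)\<^sup>2 = 4 * ((g s \<omega> - g' s \<omega>)\<^sup>2 * hs P)" by simp
      ultimately show ?thesis using hs_diff_le[of ?B ?A] by linarith
    qed
    finally have "ennreal (hs (elementary_process E s \<omega> - elementary_process E' s \<omega>)) \<le>
        ennreal (4 * hs ?A + 4 * hs ?B + 4 * hs P * (g s \<omega> - g' s \<omega>)\<^sup>2)" by (rule ennreal_leI)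
    also have "\<dots> = 4 * ennreal (hs ?A) + 4 * ennreal (hs ?B) + 4 * ennreal (hs P) * ennreal ((g s \<omega> - g' s \<omega>)\<^sup>2)"
      by (simp add: ennreal_plus ennreal_mult)
    finally show "ennreal (hs (elementary_process E s \<omega> - elementary_process E' s \<omega>)) * indicator {0..t} s \<le>
       4 * ?a s + 4 * ?b s + 4 * ennreal (hs P) * ?c s"
      by (cases "s \<in> {0..t}") auto
  qed
  also have "\<dots> = 4 * approx_error t g E \<omega> + 4 * approx_error t g' E' \<omega> + 4 * ennreal (hs P) * integrand_dist t g g' \<omega>"
    unfolding approx_error_def integrand_dist_def using m
    by (simp add: nn_integral_add nn_integral_cmult)
  finally show ?thesis .
qed

text \<open>The value at one time of an integral in the weak sense of
  \<open>has_stochastic_integral\<close>; in this form the integral of an arbitrary solution is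
  used.\<close>

definition ito_at :: "(real \<Rightarrow> 'w \<Rightarrow> real) \<Rightarrow> (real \<Rightarrow> 'w \<Rightarrow> 'h) \<Rightarrow> real \<Rightarrow> bool" where
  "ito_at g I t \<longleftrightarrow> (\<exists>E. (\<forall>n. elementary F T (E n)) \<and> converges_to_0_in_prob M (\<lambda>n. approx_error T g (E n)) \<and>
     converges_to_0_in_prob M (\<lambda>n \<omega>. ennreal (norm (I t \<omega> - elementary_integral Wc (E n) t \<omega>))))"

lemma approx_error_mono: "t \<le> T \<Longrightarrow> approx_error t g E \<omega> \<le> approx_error T g E \<omega>"
  unfolding approx_error_def by (intro nn_integral_mono) (auto simp: indicator_def)

text \<open>On \<open>A\<close> the integrands coincide up to \<open>t\<close>, so there the energy
  of the difference of the approximants is controlled by their approximation errors, which tend to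
  zero in probability. Lenglart's inequality restricted to \<open>A\<close> transfers this to the
  integrals.\<close>

lemma ito_local:
  assumes g: "jointly_measurable g" "jointly_measurable g'" and t: "0 \<le> t" "t \<le> T"
    and I: "I t \<in> borel_measurable M" "I' t \<in> borel_measurable M"
    and A: "A \<in> events" and same: "\<And>\<omega> s. \<omega> \<in> A \<Longrightarrow> s \<in> {0..t} \<Longrightarrow> g s \<omega> = g' s \<omega>"
    and ito: "ito_at g I t" "ito_at g' I' t"
  shows "AE \<omega> in M. \<omega> \<in> A \<longrightarrow> I t \<omega> = I' t \<omega>"
proof -
  obtain E where E: "\<And>n. elementary F T (E n)" "converges_to_0_in_prob M (\<lambda>n. approx_error T g (E n))"
     "converges_to_0_in_prob M (\<lambda>n \<omega>. ennreal (norm (I t \<omega> - elementary_integral Wc (E n) t \<omega>)))"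
    using ito(1) unfolding ito_at_def by auto
  obtain E' where E': "\<And>n. elementary F T (E' n)" "converges_to_0_in_prob M (\<lambda>n. approx_error T g' (E' n))"
     "converges_to_0_in_prob M (\<lambda>n \<omega>. ennreal (norm (I' t \<omega> - elementary_integral Wc (E' n) t \<omega>)))"
    using ito(2) unfolding ito_at_def by auto
  have AS: "A = {\<omega>\<in>space M. \<omega> \<in> A}" using sets.sets_into_space[OF A] by auto
  let ?J = "\<lambda>n. elementary_integral Wc (E n) t" and ?J' = "\<lambda>n. elementary_integral Wc (E' n) t"
  note [measurable] = F_M[OF elementary_integral_measurable[OF E(1) t(1)] t(1)]
    F_M[OF elementary_integral_measurable[OF E'(1) t(1)] t(1)] I A
    approx_error_measurable[OF g(1) E(1) order_refl] approx_error_measurable[OF g(2) E'(1) order_refl]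
  have small: "prob {\<omega>\<in>A. 3 * \<epsilon> < norm (I t \<omega> - I' t \<omega>)} \<le> 4 * \<eta> / \<epsilon>\<^sup>2" if \<epsilon>: "0 < \<epsilon>" and \<eta>: "0 < \<eta>" for \<epsilon> \<eta>
  proof -
    \<comment> \<open>\<open>3 * \<epsilon>\<close> is shared by two approximation errors and the
      integral of the difference, and \<open>\<eta>/8\<close> appears twice with factor 4. As
      \<open>n\<close> grows the four probabilities vanish and only Lenglart's term remains.\<close>
    define p where "p n = prob {\<omega>\<in>space M. ennreal \<epsilon> < ennreal (norm (I t \<omega> - ?J n \<omega>))}
      + prob {\<omega>\<in>space M. ennreal \<epsilon> < ennreal (norm (I' t \<omega> - ?J' n \<omega>))}
      + (prob {\<omega>\<in>space M. ennreal (\<eta>/8) < approx_error T g (E n) \<omega>} + prob {\<omega>\<in>space M. ennreal (\<eta>/8) < approx_error T g' (E' n) \<omega>})" for n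
    have "p \<longlonglongrightarrow> 0 + 0 + (0 + 0)"
      unfolding p_def using E(2,3) E'(2,3) \<epsilon> \<eta> unfolding converges_to_0_in_prob_def
      by (intro tendsto_add) auto
    then have "(\<lambda>n. p n + 4 * \<eta> / \<epsilon>\<^sup>2) \<longlonglongrightarrow> 0 + 4 * \<eta> / \<epsilon>\<^sup>2" by (intro tendsto_add) auto
    moreover have "prob {\<omega>\<in>A. 3 * \<epsilon> < norm (I t \<omega> - I' t \<omega>)} \<le> p n + 4 * \<eta> / \<epsilon>\<^sup>2" for n
    proof -
      obtain D where D: "elementary F T D"
        "\<And>s \<omega>. elementary_process D s \<omega> = elementary_process (E n) s \<omega> - elementary_process (E' n) s \<omega>"
        "\<And>W t \<omega>. elementary_integral W D t \<omega> = elementary_integral W (E n) t \<omega> - elementary_integral W (E' n) t \<omega>"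
        using elementary_diff[OF E(1) E'(1), of n n] by blast
      let ?h = "\<lambda>\<omega>. \<integral>\<^sup>+s\<in>{0..t}. ennreal (hs (elementary_process D s \<omega>)) \<partial>lborel"
      note [measurable] = elementary_hs_integral_measurable[OF D(1), of t] F_M[OF elementary_integral_measurable[OF D(1) t(1)] t(1)]
      have sub1: "{\<omega>\<in>A. ennreal \<eta> < ?h \<omega>} \<subseteq>
         {\<omega>\<in>space M. ennreal (\<eta>/8) < approx_error T g (E n) \<omega>} \<union> {\<omega>\<in>space M. ennreal (\<eta>/8) < approx_error T g' (E' n) \<omega>}"
      proof
        fix \<omega> assume "\<omega> \<in> {\<omega>\<in>A. ennreal \<eta> < ?h \<omega>}"
        then have w: "\<omega> \<in> A" "ennreal \<eta> < ?h \<omega>" by auto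
        have ws: "\<omega> \<in> space M" using w AS by blast
        show "\<omega> \<in> {\<omega>\<in>space M. ennreal (\<eta>/8) < approx_error T g (E n) \<omega>} \<union> {\<omega>\<in>space M. ennreal (\<eta>/8) < approx_error T g' (E' n) \<omega>}"
        proof (rule ccontr)
          assume "\<omega> \<notin> {\<omega>\<in>space M. ennreal (\<eta>/8) < approx_error T g (E n) \<omega>} \<union> {\<omega>\<in>space M. ennreal (\<eta>/8) < approx_error T g' (E' n) \<omega>}"
          then have n: "\<not> ennreal (\<eta>/8) < approx_error T g' (E' n) \<omega>" and n': "\<not> ennreal (\<eta>/8) < approx_error T g (E n) \<omega>"
            using ws by auto
          have "integrand_dist t g g' \<omega> = (\<integral>\<^sup>+(s::real). 0 \<partial>lborel)"
            unfolding integrand_dist_def using same[OF w(1)] by (intro nn_integral_cong) (auto simp: indicator_def)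
          then have "?h \<omega> \<le> 4 * approx_error t g (E n) \<omega> + 4 * approx_error t g' (E' n) \<omega>"
            using elementary_dist_le[OF g E(1) E'(1) t(2) ws, of n n] by (simp add: D(2))
          also have "\<dots> \<le> 4 * ennreal (\<eta>/8) + 4 * ennreal (\<eta>/8)"
            using n n' by (intro add_mono mult_left_mono order.trans[OF approx_error_mono[OF t(2)]]) (simp_all add: not_less)
          also have "\<dots> = ennreal \<eta>"
          proof -
            have "4 * ennreal (\<eta>/8) = ennreal (\<eta>/2)" using ennreal_mult[of 4 "\<eta>/8"] \<eta> by simp
            then show ?thesis using \<eta> by (simp add: ennreal_plus[symmetric] del: ennreal_plus)
          qed
          finally show False using w by simp
        qed
      qed
      have sub2: "{\<omega>\<in>A. 3 * \<epsilon> < norm (I t \<omega> - I' t \<omega>)} \<subseteq> {\<omega>\<in>space M. ennreal \<epsilon> < ennreal (norm (I t \<omega> - ?J n \<omega>))}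
        \<union> {\<omega>\<in>space M. ennreal \<epsilon> < ennreal (norm (I' t \<omega> - ?J' n \<omega>))} \<union> {\<omega>\<in>A. \<epsilon> < norm (elementary_integral Wc D t \<omega>)}"
      proof
        fix \<omega> assume w: "\<omega> \<in> {\<omega>\<in>A. 3 * \<epsilon> < norm (I t \<omega> - I' t \<omega>)}"
        then have ws: "\<omega> \<in> space M" using AS by blast
        have "norm (I t \<omega> - I' t \<omega>) \<le> norm (I t \<omega> - ?J n \<omega>) + norm (?J n \<omega> - ?J' n \<omega>) + norm (I' t \<omega> - ?J' n \<omega>)"
          using norm_triangle_ineq[of "I t \<omega> - ?J n \<omega>" "?J n \<omega> - I' t \<omega>"]
            norm_triangle_ineq[of "?J n \<omega> - ?J' n \<omega>" "?J' n \<omega> - I' t \<omega>"] norm_minus_commute[of "?J' n \<omega>" "I' t \<omega>"] by simp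
        then have "\<epsilon> < norm (I t \<omega> - ?J n \<omega>) \<or> \<epsilon> < norm (I' t \<omega> - ?J' n \<omega>) \<or> \<epsilon> < norm (elementary_integral Wc D t \<omega>)"
          using w unfolding D(3) by auto
        then show "\<omega> \<in> {\<omega>\<in>space M. ennreal \<epsilon> < ennreal (norm (I t \<omega> - ?J n \<omega>))}
          \<union> {\<omega>\<in>space M. ennreal \<epsilon> < ennreal (norm (I' t \<omega> - ?J' n \<omega>))} \<union> {\<omega>\<in>A. \<epsilon> < norm (elementary_integral Wc D t \<omega>)}"
          using w ws \<epsilon> by (auto simp: ennreal_less_iff)
      qed
      have mA: "{\<omega>\<in>A. \<epsilon> < norm (elementary_integral Wc D t \<omega>)} \<in> events" by (subst AS) (simp, measurable)
      have "prob {\<omega>\<in>A. 3 * \<epsilon> < norm (I t \<omega> - I' t \<omega>)} \<le> prob ({\<omega>\<in>space M. ennreal \<epsilon> < ennreal (norm (I t \<omega> - ?J n \<omega>))}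
        \<union> {\<omega>\<in>space M. ennreal \<epsilon> < ennreal (norm (I' t \<omega> - ?J' n \<omega>))} \<union> {\<omega>\<in>A. \<epsilon> < norm (elementary_integral Wc D t \<omega>)})"
        using mA by (intro finite_measure_mono[OF sub2] sets.Un) measurable
      also have "\<dots> \<le> prob ({\<omega>\<in>space M. ennreal \<epsilon> < ennreal (norm (I t \<omega> - ?J n \<omega>))}
        \<union> {\<omega>\<in>space M. ennreal \<epsilon> < ennreal (norm (I' t \<omega> - ?J' n \<omega>))}) + prob {\<omega>\<in>A. \<epsilon> < norm (elementary_integral Wc D t \<omega>)}"
        using mA by (intro measure_Un_le) measurable
      also have "\<dots> \<le> prob {\<omega>\<in>space M. ennreal \<epsilon> < ennreal (norm (I t \<omega> - ?J n \<omega>))}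
        + prob {\<omega>\<in>space M. ennreal \<epsilon> < ennreal (norm (I' t \<omega> - ?J' n \<omega>))} + prob {\<omega>\<in>A. \<epsilon> < norm (elementary_integral Wc D t \<omega>)}"
        by (intro add_right_mono measure_Un_le) measurable
      also have "prob {\<omega>\<in>A. \<epsilon> < norm (elementary_integral Wc D t \<omega>)} \<le> prob {\<omega>\<in>A. ennreal \<eta> < ?h \<omega>} + 4 * \<eta> / \<epsilon>\<^sup>2"
        using lenglart[OF D(1) _ \<epsilon> t(1) A, of \<eta>] \<eta> by simp
      also have "prob {\<omega>\<in>A. ennreal \<eta> < ?h \<omega>} \<le> prob ({\<omega>\<in>space M. ennreal (\<eta>/8) < approx_error T g (E n) \<omega>}
          \<union> {\<omega>\<in>space M. ennreal (\<eta>/8) < approx_error T g' (E' n) \<omega>})"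
        by (rule finite_measure_mono[OF sub1]) measurable
      also have "\<dots> \<le> prob {\<omega>\<in>space M. ennreal (\<eta>/8) < approx_error T g (E n) \<omega>}
          + prob {\<omega>\<in>space M. ennreal (\<eta>/8) < approx_error T g' (E' n) \<omega>}"
        by (rule measure_Un_le) measurable
      finally show ?thesis unfolding p_def by simp
    qed
    ultimately show ?thesis by (intro LIMSEQ_le_const[where X="\<lambda>n. p n + 4 * \<eta> / \<epsilon>\<^sup>2"]) auto
  qed
  have "AE \<omega> in M. \<not> (\<omega> \<in> A \<and> 3 * (1 / real (Suc m)) < norm (I t \<omega> - I' t \<omega>))" for m
  proof -
    let ?e = "1 / real (Suc m)" let ?B = "{\<omega>\<in>A. 3 * ?e < norm (I t \<omega> - I' t \<omega>)}"
    have "prob ?B \<le> 0 + \<delta>" if "\<delta> > 0" for \<delta>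
      \<comment> \<open>With this \<open>\<eta>\<close>, which is still free, Lenglart's term equals
        \<open>\<delta>\<close>.\<close>
      using small[of ?e "\<delta> * ?e\<^sup>2 / 4"] that by simp
    then have "prob ?B \<le> 0" by (rule field_le_epsilon)
    moreover have "?B \<in> events" by (subst AS) (simp, measurable)
    ultimately have "?B \<in> null_sets M" by (simp add: null_sets_def emeasure_eq_measure measure_le_0_iff)
    then show ?thesis by (rule AE_I') auto
  qed
  then have "AE \<omega> in M. \<forall>m. \<not> (\<omega> \<in> A \<and> 3 * (1 / real (Suc m)) < norm (I t \<omega> - I' t \<omega>))"
    by (subst AE_all_countable) blast
  then show ?thesis
  proof eventually_elim
    case (elim \<omega>)
    show ?case
    proof (rule impI, rule ccontr)
      assume "\<omega> \<in> A" "I t \<omega> \<noteq> I' t \<omega>"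
      then have "0 < norm (I t \<omega> - I' t \<omega>) / 3" by simp
      then obtain m where "1 / real (Suc m) < norm (I t \<omega> - I' t \<omega>) / 3" using nat_approx_posE by metis
      then show False using elim \<open>\<omega> \<in> A\<close> by (auto dest!: spec[of _ m])
    qed
  qed
qed

end

section \<open>Continuous adapted processes with square integrable supremum\<close>

definition sup_sq :: "real \<Rightarrow> (real \<Rightarrow> 'w \<Rightarrow> 'a::real_normed_vector) \<Rightarrow> 'w \<Rightarrow> ennreal" where
  "sup_sq t X \<omega> = (SUP s\<in>{0..t}. ennreal ((norm (X s \<omega>))\<^sup>2))"

lemma sup_sq_upper: "s \<in> {0..t} \<Longrightarrow> ennreal ((norm (X s \<omega>))\<^sup>2) \<le> sup_sq t X \<omega>"
  unfolding sup_sq_def by (rule SUP_upper)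

lemma sup_sq_least: "(\<And>s. s \<in> {0..t} \<Longrightarrow> ennreal ((norm (X s \<omega>))\<^sup>2) \<le> c) \<Longrightarrow> sup_sq t X \<omega> \<le> c"
  unfolding sup_sq_def by (rule SUP_least)

lemma ennreal_two_sum: "0 \<le> a \<Longrightarrow> 0 \<le> b \<Longrightarrow> ennreal (2 * a + 2 * b) = 2 * ennreal a + 2 * ennreal b"
  by (simp add: ennreal_plus ennreal_mult)

lemma sup_sq_add_le:
  assumes "\<And>s. s \<in> {0..t} \<Longrightarrow> X s \<omega> = Y s \<omega> + Z s \<omega>"
  shows "sup_sq t X \<omega> \<le> 2 * sup_sq t Y \<omega> + 2 * sup_sq t Z \<omega>"
proof (rule sup_sq_least)
  fix s assume s: "s \<in> {0..t}"
  have "ennreal ((norm (X s \<omega>))\<^sup>2) \<le> ennreal (2 * (norm (Y s \<omega>))\<^sup>2 + 2 * (norm (Z s \<omega>))\<^sup>2)"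
    unfolding assms[OF s] by (rule ennreal_leI[OF norm_add_square_le])
  also have "\<dots> = 2 * ennreal ((norm (Y s \<omega>))\<^sup>2) + 2 * ennreal ((norm (Z s \<omega>))\<^sup>2)"
    by (rule ennreal_two_sum) auto
  also have "\<dots> \<le> 2 * sup_sq t Y \<omega> + 2 * sup_sq t Z \<omega>"
    by (intro add_mono mult_left_mono sup_sq_upper s) auto
  finally show "ennreal ((norm (X s \<omega>))\<^sup>2) \<le> 2 * sup_sq t Y \<omega> + 2 * sup_sq t Z \<omega>" .
qed

lemma sup_sq_cong: "(\<And>s. s \<in> {0..t} \<Longrightarrow> norm (X s \<omega>) = norm (Y s \<omega>)) \<Longrightarrow> sup_sq t X \<omega> = sup_sq t Y \<omega>"
  unfolding sup_sq_def by (rule SUP_cong) auto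

lemma ennreal_squeeze_0:
  fixes f g :: "nat \<Rightarrow> ennreal"
  assumes "\<And>n. f n \<le> g n" "g \<longlonglongrightarrow> 0" shows "f \<longlonglongrightarrow> 0"
  by (rule tendsto_sandwich[OF always_eventually always_eventually tendsto_const assms(2)]) (use assms(1) in auto)

lemma sup_sq_minus: "sup_sq t (\<lambda>s \<omega>. X s \<omega> - Y s \<omega>) \<omega> = sup_sq t (\<lambda>s \<omega>. Y s \<omega> - X s \<omega>) \<omega>"
  by (rule sup_sq_cong) (rule norm_minus_commute)

lemma sup_sq_mono: "s \<le> t \<Longrightarrow> sup_sq s X \<omega> \<le> sup_sq t X \<omega>"
  unfolding sup_sq_def by (rule SUP_subset_mono) auto

context ito
begin

text \<open>Continuity is demanded of every path, so that suprema over intervals are measurable by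
  \<open>SUP_dyadic\<close>.\<close>

definition cont_adapted :: "(real \<Rightarrow> 'w \<Rightarrow> 'h) \<Rightarrow> bool" where
  "cont_adapted X \<longleftrightarrow> (\<forall>\<omega>. continuous_on {0..T} (\<lambda>t. X t \<omega>)) \<and> (\<forall>t\<in>{0..T}. X t \<in> borel_measurable (F t))"

lemma cont_adaptedD:
  assumes "cont_adapted X"
  shows "continuous_on {0..T} (\<lambda>t. X t \<omega>)" "t \<in> {0..T} \<Longrightarrow> X t \<in> borel_measurable (F t)"
    "t \<in> {0..T} \<Longrightarrow> X t \<in> borel_measurable M"
  using assms F_M[of "X t" t borel] unfolding cont_adapted_def by auto

lemma cont_adapted_add: "cont_adapted X \<Longrightarrow> cont_adapted Y \<Longrightarrow> cont_adapted (\<lambda>t \<omega>. X t \<omega> + Y t \<omega>)"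
  unfolding cont_adapted_def by (auto intro!: continuous_intros borel_measurable_add)

lemma cont_adapted_diff: "cont_adapted X \<Longrightarrow> cont_adapted Y \<Longrightarrow> cont_adapted (\<lambda>t \<omega>. X t \<omega> - Y t \<omega>)"
  unfolding cont_adapted_def by (auto intro!: continuous_intros borel_measurable_diff)

lemma cont_adapted_elementary: "elementary F T E \<Longrightarrow> cont_adapted (elementary_integral Wc E)"
  unfolding cont_adapted_def
  using elementary_integral_measurable continuous_on_subset[OF elementary_integral_continuous] by auto

lemma sup_sq_measurable:
  assumes X: "cont_adapted X" and t: "0 \<le> t" "t \<le> T"
  shows "sup_sq t X \<in> borel_measurable M"
proof -
  have c: "continuous_on {0..t} (\<lambda>s. (norm (X s \<omega>))\<^sup>2)" for \<omega>
    using t by (intro continuous_intros continuous_on_subset[OF cont_adaptedD(1)[OF X]]) auto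
  have eq: "sup_sq t X = (\<lambda>\<omega>. SUP m. SUP k\<in>{..2^m}. ennreal ((norm (X (real k * t / 2^m) \<omega>))\<^sup>2))"
    unfolding sup_sq_def by (rule ext) (rule SUP_dyadic[OF t(1) c])
  have "X (real k * t / 2^m) \<in> borel_measurable M" if k: "k \<in> {..2^m}" for k m :: nat
  proof (rule cont_adaptedD(3)[OF X])
    have "real k \<le> 2^m" using k by (metis atMost_iff of_nat_le_iff of_nat_numeral of_nat_power)
    then have "real k * t \<le> 2^m * t" using t by (intro mult_right_mono)
    then have "real k * t / 2^m \<le> t" by (simp add: divide_simps mult.commute)
    then show "real k * t / 2^m \<in> {0..T}" using t by auto
  qed
  then show ?thesis unfolding eq by (intro borel_measurable_SUP) auto
qed

text \<open>The squared norm of \<open>L\<^sup>2(\<Omega>; C([0,t]; H))\<close>, with values in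
  \<open>ennreal\<close> so that it can be estimated before it is known to be finite.\<close>

definition E2 :: "real \<Rightarrow> (real \<Rightarrow> 'w \<Rightarrow> 'h) \<Rightarrow> ennreal" where
  "E2 t X = (\<integral>\<^sup>+\<omega>. sup_sq t X \<omega> \<partial>M)"

lemma E2_add_le:
  assumes Y: "cont_adapted Y" "cont_adapted Z" and t: "0 \<le> t" "t \<le> T"
    and "\<And>s \<omega>. s \<in> {0..t} \<Longrightarrow> \<omega> \<in> space M \<Longrightarrow> X s \<omega> = Y s \<omega> + Z s \<omega>"
  shows "E2 t X \<le> 2 * E2 t Y + 2 * E2 t Z"
proof -
  note [measurable] = sup_sq_measurable[OF Y(1) t] sup_sq_measurable[OF Y(2) t]
  have "E2 t X \<le> (\<integral>\<^sup>+\<omega>. 2 * sup_sq t Y \<omega> + 2 * sup_sq t Z \<omega> \<partial>M)"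
    unfolding E2_def by (intro nn_integral_mono sup_sq_add_le assms(5))
  also have "\<dots> = 2 * E2 t Y + 2 * E2 t Z"
    unfolding E2_def by (subst nn_integral_add) (auto simp: nn_integral_cmult)
  finally show ?thesis .
qed

lemma E2_mono: "s \<le> t \<Longrightarrow> E2 s X \<le> E2 t X"
  unfolding E2_def by (intro nn_integral_mono sup_sq_mono)

lemma E2_minus: "E2 t (\<lambda>s \<omega>. X s \<omega> - Y s \<omega>) = E2 t (\<lambda>s \<omega>. Y s \<omega> - X s \<omega>)"
  unfolding E2_def sup_sq_minus[of t X Y] ..

text \<open>Completeness along a sequence with a summable weighted rate: the random weighted sum
  \<open>G\<close> has finite expectation, hence is finite almost surely, and where it is finite it
  bounds all increments uniformly in time.\<close>

lemma cont_adapted_limit: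
  assumes J: "\<And>n. cont_adapted (J n)"
    and C: "(\<Sum>k. ennreal (2^(Suc k)) * E2 T (\<lambda>t \<omega>. J (Suc k) t \<omega> - J k t \<omega>)) = C" and fin: "C < \<infinity>"
  shows "\<exists>I. cont_adapted I \<and> (\<forall>n. E2 T (\<lambda>t \<omega>. J n t \<omega> - I t \<omega>) \<le> ennreal ((1/2)^n) * C)"
proof -
  define D where "D k t \<omega> = J (Suc k) t \<omega> - J k t \<omega>" for k t \<omega>
  have D: "cont_adapted (D k)" for k
    using cont_adapted_diff[OF J[of "Suc k"] J[of k]] unfolding D_def .
  define G where "G \<omega> = (\<Sum>k. ennreal (2^(Suc k)) * sup_sq T (D k) \<omega>)" for \<omega>
  note sm[measurable] = sup_sq_measurable[OF D order.strict_implies_order[OF T_pos] order_refl]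
  have Gm[measurable]: "G \<in> borel_measurable M" unfolding G_def by measurable
  have intG: "(\<integral>\<^sup>+\<omega>. G \<omega> \<partial>M) = C"
    unfolding G_def C[symmetric] E2_def D_def[symmetric]
    by (subst nn_integral_suminf) (auto simp: nn_integral_cmult)
  then have AEG: "AE \<omega> in M. G \<omega> \<noteq> \<infinity>"
    using fin by (intro nn_integral_noteq_infinite) auto
  have bound: "(norm (J m t \<omega> - J n t \<omega>))\<^sup>2 \<le> (1/2)^n * enn2real (G \<omega>)"
    if G: "G \<omega> \<noteq> \<infinity>" and nm: "n \<le> m" and t: "t \<in> {0..T}" for \<omega> n m t
  proof -
    have "ennreal (\<Sum>k\<in>{n..<m}. 2^(Suc k) * (norm (J (Suc k) t \<omega> - J k t \<omega>))\<^sup>2) =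
       (\<Sum>k\<in>{n..<m}. ennreal (2^(Suc k)) * ennreal ((norm (D k t \<omega>))\<^sup>2))"
      unfolding D_def by (subst sum_ennreal[symmetric]) (auto simp: ennreal_mult)
    also have "\<dots> \<le> (\<Sum>k\<in>{n..<m}. ennreal (2^(Suc k)) * sup_sq T (D k) \<omega>)"
      by (intro sum_mono mult_left_mono sup_sq_upper t) auto
    also have "\<dots> \<le> G \<omega>" unfolding G_def by (rule sum_le_suminf[OF summableI]) auto
    also have "\<dots> = ennreal (enn2real (G \<omega>))" using G by (simp add: less_top)
    finally have "(\<Sum>k\<in>{n..<m}. 2^(Suc k) * (norm (J (Suc k) t \<omega> - J k t \<omega>))\<^sup>2) \<le> enn2real (G \<omega>)"
      by (subst (asm) ennreal_le_iff) auto
    then have "(1/2)^n * (\<Sum>k\<in>{n..<m}. 2^(Suc k) * (norm (J (Suc k) t \<omega> - J k t \<omega>))\<^sup>2) \<le> (1/2)^n * enn2real (G \<omega>)"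
      by (intro mult_left_mono) auto
    then show ?thesis using dyadic_telescope[OF nm, of "\<lambda>k. J k t \<omega>"] by linarith
  qed
  have pow0: "(\<lambda>n. (1/2)^n * c) \<longlonglongrightarrow> 0" for c :: real
    using tendsto_mult_left_zero[OF LIMSEQ_realpow_zero[of "1/2::real"], of c] by simp
  \<comment> \<open>The zero path where \<open>G\<close> is infinite keeps every path
    continuous.\<close>
  define I where "I t \<omega> = (if G \<omega> \<noteq> \<infinity> then lim (\<lambda>n. J n t \<omega>) else 0)" for t \<omega>
  have lim: "(\<lambda>n. J n t \<omega>) \<longlonglongrightarrow> I t \<omega>" if G: "G \<omega> \<noteq> \<infinity>" and t: "t \<in> {0..T}" for \<omega> t
  proof -
    have "Cauchy (\<lambda>n. J n t \<omega>)"
    proof (rule metric_CauchyI)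
      fix \<epsilon> :: real assume e: "0 < \<epsilon>"
      obtain N where N: "(1/2)^N * enn2real (G \<omega>) < (\<epsilon>/2)\<^sup>2"
        using order_tendstoD(2)[OF pow0[of "enn2real (G \<omega>)"], of "(\<epsilon>/2)\<^sup>2"] e
        by (auto simp: eventually_sequentially)
      have "norm (J m t \<omega> - J N t \<omega>) < \<epsilon>/2" if "N \<le> m" for m
        by (rule power_less_imp_less_base[where n=2]) (use bound[OF G that t] N e in auto)
      then show "\<exists>N. \<forall>m\<ge>N. \<forall>n\<ge>N. dist (J m t \<omega>) (J n t \<omega>) < \<epsilon>"
        by (metis dist_norm dist_triangle_half_l)
    qed
    then show ?thesis using G by (simp add: I_def Cauchy_convergent_iff convergent_LIMSEQ_iff)
  qed
  have boundI: "(norm (J n t \<omega> - I t \<omega>))\<^sup>2 \<le> (1/2)^n * enn2real (G \<omega>)"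
    if G: "G \<omega> \<noteq> \<infinity>" and t: "t \<in> {0..T}" for \<omega> n t
  proof (rule LIMSEQ_le_const2)
    show "(\<lambda>m. (norm (J n t \<omega> - J m t \<omega>))\<^sup>2) \<longlonglongrightarrow> (norm (J n t \<omega> - I t \<omega>))\<^sup>2"
      by (intro tendsto_intros lim G t)
    show "\<exists>N. \<forall>m\<ge>N. (norm (J n t \<omega> - J m t \<omega>))\<^sup>2 \<le> (1/2)^n * enn2real (G \<omega>)"
      using bound[OF G _ t, of n] by (auto simp: norm_minus_commute intro!: exI[of _ n])
  qed
  have cont: "continuous_on {0..T} (\<lambda>t. I t \<omega>)" for \<omega>
  proof (cases "G \<omega> = \<infinity>")
    case False
    have "uniform_limit {0..T} (\<lambda>n t. J n t \<omega>) (\<lambda>t. I t \<omega>) sequentially"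
    proof (rule uniform_limitI)
      fix \<epsilon> :: real assume e: "0 < \<epsilon>"
      have "\<forall>\<^sub>F n in sequentially. (1/2)^n * enn2real (G \<omega>) < \<epsilon>\<^sup>2"
        using order_tendstoD(2)[OF pow0[of "enn2real (G \<omega>)"], of "\<epsilon>\<^sup>2"] e by auto
      then show "\<forall>\<^sub>F n in sequentially. \<forall>t\<in>{0..T}. dist (J n t \<omega>) (I t \<omega>) < \<epsilon>"
      proof eventually_elim
        case (elim n)
        show ?case
        proof
          fix t assume t: "t \<in> {0..T}"
          show "dist (J n t \<omega>) (I t \<omega>) < \<epsilon>"
            unfolding dist_norm by (rule power_less_imp_less_base[where n=2]) (use boundI[OF False t, of n] elim e in auto)
        qed
      qed
    qed
    then show ?thesis
      by (rule uniform_limit_theorem[rotated]) (use cont_adaptedD(1)[OF J] in auto)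
  qed (simp add: I_def)
  have meas: "I t \<in> borel_measurable (F t)" if t: "t \<in> {0..T}" for t
  proof (rule borel_measurable_LIMSEQ_metric)
    \<comment> \<open>\<open>G\<close> depends on the paths up to \<open>T\<close>, but its
      finiteness is almost sure and therefore an event of \<open>F t\<close> by completeness; this
      keeps the limit adapted.\<close>
    have G: "{\<omega>\<in>space M. G \<omega> \<noteq> \<infinity>} \<in> sets (F t)" by (rule AE_sets_F[OF AEG]) (use t in auto)
    show "(\<lambda>\<omega>. if \<omega> \<in> {\<omega>\<in>space M. G \<omega> \<noteq> \<infinity>} then J n t \<omega> else 0) \<in> borel_measurable (F t)" for n
      using cont_adaptedD(2)[OF J t] G t by (intro measurable_If_set) (auto simp: Int_absorb2)
    show "(\<lambda>n. if \<omega> \<in> {\<omega>\<in>space M. G \<omega> \<noteq> \<infinity>} then J n t \<omega> else 0) \<longlonglongrightarrow> I t \<omega>" if "\<omega> \<in> space (F t)" for \<omega>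
      using lim[OF _ t, of \<omega>] that t by (cases "G \<omega> = \<infinity>") (auto simp: I_def)
  qed
  have "E2 T (\<lambda>t \<omega>. J n t \<omega> - I t \<omega>) \<le> ennreal ((1/2)^n) * C" for n
  proof -
    have "E2 T (\<lambda>t \<omega>. J n t \<omega> - I t \<omega>) \<le> (\<integral>\<^sup>+\<omega>. ennreal ((1/2)^n) * G \<omega> \<partial>M)"
      unfolding E2_def
    proof (rule nn_integral_mono_AE, use AEG in eventually_elim)
      case (elim \<omega>)
      have G: "ennreal ((1/2)^n * enn2real (G \<omega>)) = ennreal ((1/2)^n) * G \<omega>"
        using elim by (simp add: ennreal_mult less_top)
      show ?case by (rule sup_sq_least) (use boundI[OF elim, of _ n] in \<open>simp add: G[symmetric]\<close>)
    qed
    also have "\<dots> = ennreal ((1/2)^n) * C" using intG by (simp add: nn_integral_cmult)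
    finally show ?thesis .
  qed
  moreover have "cont_adapted I" unfolding cont_adapted_def using cont meas by blast
  ultimately show ?thesis by blast
qed

text \<open>The mean-square integral: elementary integrals converge uniformly in time and in mean
  square, which is stronger than the convergence in \<open>has_stochastic_integral\<close>.\<close>

definition is_ito :: "(real \<Rightarrow> 'w \<Rightarrow> real) \<Rightarrow> (real \<Rightarrow> 'w \<Rightarrow> 'h) \<Rightarrow> bool" where
  "is_ito g I \<longleftrightarrow> cont_adapted I \<and> (\<exists>E. (\<forall>n. elementary F T (E n)) \<and>
     (\<lambda>n. \<integral>\<^sup>+\<omega>. approx_error T g (E n) \<omega> \<partial>M) \<longlonglongrightarrow> 0 \<and>
     (\<lambda>n. E2 T (\<lambda>t \<omega>. elementary_integral Wc (E n) t \<omega> - I t \<omega>)) \<longlonglongrightarrow> 0)"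

lemma elementary_E2_diff_le:
  assumes g: "jointly_measurable g" "jointly_measurable g'" and E: "elementary F T E" "elementary F T E'"
    and t: "0 \<le> t" "t \<le> T"
  shows "E2 t (\<lambda>s \<omega>. elementary_integral Wc E s \<omega> - elementary_integral Wc E' s \<omega>) \<le>
    16 * (\<integral>\<^sup>+\<omega>. approx_error T g E \<omega> \<partial>M) + 16 * (\<integral>\<^sup>+\<omega>. approx_error T g' E' \<omega> \<partial>M)
      + 16 * ennreal (hs P) * (\<integral>\<^sup>+\<omega>. integrand_dist t g g' \<omega> \<partial>M)"
proof -
  obtain D where D: "elementary F T D"
    "\<And>s \<omega>. elementary_process D s \<omega> = elementary_process E s \<omega> - elementary_process E' s \<omega>"
    "\<And>W t \<omega>. elementary_integral W D t \<omega> = elementary_integral W E t \<omega> - elementary_integral W E' t \<omega>"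
    using elementary_diff[OF E] by blast
  note [measurable] = approx_error_measurable[OF g(1) E(1) order_refl] approx_error_measurable[OF g(2) E(2) order_refl]
    integrand_dist_measurable[OF g t(2)]
  have "E2 t (\<lambda>s \<omega>. elementary_integral Wc E s \<omega> - elementary_integral Wc E' s \<omega>) \<le>
     4 * (\<integral>\<^sup>+\<omega>. (\<integral>\<^sup>+s\<in>{0..t}. ennreal (hs (elementary_process D s \<omega>)) \<partial>lborel) \<partial>M)"
    unfolding E2_def sup_sq_def D(3)[symmetric] by (rule elementary_doob[OF D(1) t(1)])
  also have "\<dots> \<le> 4 * (\<integral>\<^sup>+\<omega>. 4 * approx_error T g E \<omega> + 4 * approx_error T g' E' \<omega> + 4 * ennreal (hs P) * integrand_dist t g g' \<omega> \<partial>M)"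
    unfolding D(2)
    by (intro mult_left_mono nn_integral_mono order.trans[OF elementary_dist_le[OF g E t(2)]] add_mono approx_error_mono t) auto
  also have "\<dots> = 16 * (\<integral>\<^sup>+\<omega>. approx_error T g E \<omega> \<partial>M) + 16 * (\<integral>\<^sup>+\<omega>. approx_error T g' E' \<omega> \<partial>M)
      + 16 * ennreal (hs P) * (\<integral>\<^sup>+\<omega>. integrand_dist t g g' \<omega> \<partial>M)"
    by (simp add: nn_integral_add nn_integral_cmult distrib_left mult.assoc[symmetric])
  finally show ?thesis .
qed

lemma is_ito_exists:
  assumes g: "jointly_measurable g"
    and approx: "\<And>\<epsilon>::real. \<epsilon> > 0 \<Longrightarrow> \<exists>E. elementary F T E \<and> (\<integral>\<^sup>+\<omega>. approx_error T g E \<omega> \<partial>M) \<le> ennreal \<epsilon>"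
  shows "\<exists>I. is_ito g I"
proof -
  \<comment> \<open>The rate \<open>(1/4)^n\<close> outweighs the factors \<open>2^(Suc k)\<close>
    of \<open>cont_adapted_limit\<close> and leaves a geometric series of ratio
    \<open>1/2\<close>.\<close>
  have "\<forall>n. \<exists>E. elementary F T E \<and> (\<integral>\<^sup>+\<omega>. approx_error T g E \<omega> \<partial>M) \<le> ennreal ((1/4)^n)"
    using approx by simp
  then obtain E where E: "\<And>n. elementary F T (E n)" "\<And>n. (\<integral>\<^sup>+\<omega>. approx_error T g (E n) \<omega> \<partial>M) \<le> ennreal ((1/4)^n)"
    by metis
  let ?J = "\<lambda>n. elementary_integral Wc (E n)"
  have z: "(\<integral>\<^sup>+\<omega>. integrand_dist T g g \<omega> \<partial>M) = 0" by (simp add: integrand_dist_def)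
  have le: "ennreal (2^Suc k) * E2 T (\<lambda>t \<omega>. ?J (Suc k) t \<omega> - ?J k t \<omega>) \<le> ennreal (64 * (1/2)^k)" for k
  proof -
    have "E2 T (\<lambda>t \<omega>. ?J (Suc k) t \<omega> - ?J k t \<omega>) \<le> 16 * ennreal ((1/4)^k) + 16 * ennreal ((1/4)^k)"
    proof (rule order.trans[OF elementary_E2_diff_le[OF g g E(1) E(1)]])
      have "(1/4::real)^Suc k \<le> (1/4)^k" by simp
      then have "ennreal ((1/4)^Suc k) \<le> ennreal ((1/4)^k)" by (rule ennreal_leI)
      then show "16 * (\<integral>\<^sup>+\<omega>. approx_error T g (E (Suc k)) \<omega> \<partial>M) + 16 * (\<integral>\<^sup>+\<omega>. approx_error T g (E k) \<omega> \<partial>M) +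
        16 * ennreal (hs P) * (\<integral>\<^sup>+\<omega>. integrand_dist T g g \<omega> \<partial>M) \<le> 16 * ennreal ((1/4)^k) + 16 * ennreal ((1/4)^k)"
        unfolding z using E(2)[of "Suc k"] E(2)[of k] by (auto intro!: add_mono mult_left_mono intro: order.trans)
    qed (use T_pos in auto)
    also have "\<dots> = ennreal (32 * (1/4)^k)"
    proof -
      have "16 * ennreal ((1/4)^k) = ennreal (16 * (1/4)^k)" by (subst ennreal_mult) auto
      then show ?thesis by (simp add: ennreal_plus[symmetric] del: ennreal_plus)
    qed
    finally have "ennreal (2^Suc k) * E2 T (\<lambda>t \<omega>. ?J (Suc k) t \<omega> - ?J k t \<omega>) \<le> ennreal (2^Suc k) * ennreal (32 * (1/4)^k)"
      by (rule mult_left_mono) simp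
    also have "\<dots> = ennreal (2^Suc k * (32 * (1/4)^k))" by (rule ennreal_mult[symmetric]) auto
    also have "2^Suc k * (32 * (1/4)^k) = 64 * (1/2::real)^k"
      by (simp add: power_divide power_mult_distrib[symmetric] field_simps)
    finally show ?thesis .
  qed
  define C where "C = (\<Sum>k. ennreal (2^Suc k) * E2 T (\<lambda>t \<omega>. ?J (Suc k) t \<omega> - ?J k t \<omega>))"
  have "C \<le> (\<Sum>k. ennreal (64 * (1/2)^k))" unfolding C_def by (rule suminf_le[OF le summableI summableI])
  also have "\<dots> = ennreal (\<Sum>k. 64 * (1/2)^k)"
    by (rule suminf_ennreal2) (auto intro!: summable_mult summable_geometric)
  finally have fin: "C < \<infinity>" by (auto simp: top.not_eq_extremum[symmetric] top_unique)
  obtain I where I: "cont_adapted I" "\<And>n. E2 T (\<lambda>t \<omega>. ?J n t \<omega> - I t \<omega>) \<le> ennreal ((1/2)^n) * C"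
    using cont_adapted_limit[OF cont_adapted_elementary[OF E(1)] C_def[symmetric] fin] by blast
  have p0: "(\<lambda>n. ennreal (c^n)) \<longlonglongrightarrow> 0" if "0 \<le> c" "c < 1" for c :: real
    using tendsto_ennrealI[OF LIMSEQ_realpow_zero[OF that]] by simp
  have "(\<lambda>n. C * ennreal ((1/2)^n)) \<longlonglongrightarrow> C * 0"
    using fin by (intro ennreal_tendsto_cmult p0) auto
  then have "(\<lambda>n. ennreal ((1/2)^n) * C) \<longlonglongrightarrow> 0" by (simp add: mult.commute)
  then have 1: "(\<lambda>n. E2 T (\<lambda>t \<omega>. ?J n t \<omega> - I t \<omega>)) \<longlonglongrightarrow> 0"
    by (rule ennreal_squeeze_0[OF I(2)])
  have 2: "(\<lambda>n. \<integral>\<^sup>+\<omega>. approx_error T g (E n) \<omega> \<partial>M) \<longlonglongrightarrow> 0"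
    by (rule ennreal_squeeze_0[OF E(2) p0]) auto
  show ?thesis unfolding is_ito_def using I(1) E(1) 1 2 by blast
qed

lemma is_ito_diff:
  assumes g: "jointly_measurable g" "jointly_measurable g'" and I: "is_ito g I" "is_ito g' I'"
    and t: "0 \<le> t" "t \<le> T"
  shows "E2 t (\<lambda>s \<omega>. I s \<omega> - I' s \<omega>) \<le> 64 * ennreal (hs P) * (\<integral>\<^sup>+\<omega>. integrand_dist t g g' \<omega> \<partial>M)"
proof -
  have cI: "cont_adapted I" "cont_adapted I'" using I unfolding is_ito_def by auto
  obtain E where E: "\<And>n. elementary F T (E n)" "(\<lambda>n. \<integral>\<^sup>+\<omega>. approx_error T g (E n) \<omega> \<partial>M) \<longlonglongrightarrow> 0"
     "(\<lambda>n. E2 T (\<lambda>t \<omega>. elementary_integral Wc (E n) t \<omega> - I t \<omega>)) \<longlonglongrightarrow> 0"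
    using I(1) unfolding is_ito_def by auto
  obtain E' where E': "\<And>n. elementary F T (E' n)" "(\<lambda>n. \<integral>\<^sup>+\<omega>. approx_error T g' (E' n) \<omega> \<partial>M) \<longlonglongrightarrow> 0"
     "(\<lambda>n. E2 T (\<lambda>t \<omega>. elementary_integral Wc (E' n) t \<omega> - I' t \<omega>)) \<longlonglongrightarrow> 0"
    using I(2) unfolding is_ito_def by auto
  let ?J = "\<lambda>n. elementary_integral Wc (E n)" and ?J' = "\<lambda>n. elementary_integral Wc (E' n)"
  note cJ = cont_adapted_elementary[OF E(1)] and cJ' = cont_adapted_elementary[OF E'(1)]
  \<comment> \<open>Two triangle inequalities for squares double the constant 16 of
    \<open>elementary_E2_diff_le\<close> twice; the other terms vanish in the limit, which leaves
    64.\<close>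
  define r where "r n = 2 * E2 T (\<lambda>t \<omega>. ?J n t \<omega> - I t \<omega>) + 2 * (2 * E2 T (\<lambda>t \<omega>. ?J' n t \<omega> - I' t \<omega>)
     + 2 * (16 * (\<integral>\<^sup>+\<omega>. approx_error T g (E n) \<omega> \<partial>M) + 16 * (\<integral>\<^sup>+\<omega>. approx_error T g' (E' n) \<omega> \<partial>M)
      + 16 * ennreal (hs P) * (\<integral>\<^sup>+\<omega>. integrand_dist t g g' \<omega> \<partial>M)))" for n
  have c2: "(\<lambda>n. c * f n) \<longlonglongrightarrow> c * l" if "c < \<infinity>" "f \<longlonglongrightarrow> l" for c l :: ennreal and f
    using that by (intro ennreal_tendsto_cmult) auto
  have "r \<longlonglongrightarrow> 2 * 0 + 2 * (2 * 0 + 2 * (16 * 0 + 16 * 0 + 16 * ennreal (hs P) * (\<integral>\<^sup>+\<omega>. integrand_dist t g g' \<omega> \<partial>M)))"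
    unfolding r_def by (intro tendsto_add c2 E(2,3) E'(2,3) tendsto_const) auto
  then have "r \<longlonglongrightarrow> 64 * ennreal (hs P) * (\<integral>\<^sup>+\<omega>. integrand_dist t g g' \<omega> \<partial>M)" by (simp add: mult.assoc[symmetric])
  moreover have "E2 t (\<lambda>s \<omega>. I s \<omega> - I' s \<omega>) \<le> r n" for n
  proof -
    have A: "E2 t (\<lambda>s \<omega>. I s \<omega> - I' s \<omega>) \<le> 2 * E2 t (\<lambda>s \<omega>. I s \<omega> - ?J n s \<omega>) + 2 * E2 t (\<lambda>s \<omega>. ?J n s \<omega> - I' s \<omega>)"
      by (rule E2_add_le[OF cont_adapted_diff[OF cI(1) cJ] cont_adapted_diff[OF cJ cI(2)] t]) simp
    have B: "E2 t (\<lambda>s \<omega>. ?J n s \<omega> - I' s \<omega>) \<le> 2 * E2 t (\<lambda>s \<omega>. ?J' n s \<omega> - I' s \<omega>) + 2 * E2 t (\<lambda>s \<omega>. ?J n s \<omega> - ?J' n s \<omega>)"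
      by (rule E2_add_le[OF cont_adapted_diff[OF cJ' cI(2)] cont_adapted_diff[OF cJ cJ'] t]) simp
    have C: "E2 t (\<lambda>s \<omega>. ?J n s \<omega> - ?J' n s \<omega>) \<le> 16 * (\<integral>\<^sup>+\<omega>. approx_error T g (E n) \<omega> \<partial>M) + 16 * (\<integral>\<^sup>+\<omega>. approx_error T g' (E' n) \<omega> \<partial>M)
      + 16 * ennreal (hs P) * (\<integral>\<^sup>+\<omega>. integrand_dist t g g' \<omega> \<partial>M)"
      by (rule elementary_E2_diff_le[OF g E(1) E'(1) t])
    have B': "E2 t (\<lambda>s \<omega>. ?J n s \<omega> - I' s \<omega>) \<le> 2 * E2 T (\<lambda>s \<omega>. ?J' n s \<omega> - I' s \<omega>) + 2 *
      (16 * (\<integral>\<^sup>+\<omega>. approx_error T g (E n) \<omega> \<partial>M) + 16 * (\<integral>\<^sup>+\<omega>. approx_error T g' (E' n) \<omega> \<partial>M)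
      + 16 * ennreal (hs P) * (\<integral>\<^sup>+\<omega>. integrand_dist t g g' \<omega> \<partial>M))"
      by (rule order.trans[OF B add_mono[OF mult_left_mono[OF E2_mono[OF t(2)]] mult_left_mono[OF C]]]) simp_all
    have A': "E2 t (\<lambda>s \<omega>. I s \<omega> - ?J n s \<omega>) \<le> E2 T (\<lambda>s \<omega>. ?J n s \<omega> - I s \<omega>)"
      using E2_mono[OF t(2)] unfolding E2_minus[of t I "?J n"] .
    show ?thesis
      unfolding r_def by (rule order.trans[OF A add_mono[OF mult_left_mono[OF A'] mult_left_mono[OF B']]]) simp_all
  qed
  ultimately show ?thesis by (intro LIMSEQ_le_const) auto
qed

end

section \<open>Left-continuous integrands\<close>

text \<open>Left continuity in place of continuity, because the cut-off factor \<open>below\<close>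
  jumps.\<close>

definition left_limit_on :: "real \<Rightarrow> (real \<Rightarrow> 'b::topological_space) \<Rightarrow> bool" where
  "left_limit_on T f \<longleftrightarrow> (\<forall>t\<in>{0<..T}. (f \<longlongrightarrow> f t) (at_left t))"

lemma left_limit_on_continuous:
  fixes f :: "real \<Rightarrow> 'b::t2_space"
  assumes "continuous_on {0..T} f" shows "left_limit_on T f"
  unfolding left_limit_on_def
proof
  fix t assume t: "t \<in> {0<..T}"
  have "(f \<longlongrightarrow> f t) (at t within {0..T})" using assms t unfolding continuous_on_def by auto
  then have "(f \<longlongrightarrow> f t) (at t within {0..t})" by (rule tendsto_within_subset) (use t in auto)
  moreover have "at t within {0..t} = at_left t"
    using t by (intro at_within_Icc_at_left) auto
  ultimately show "(f \<longlongrightarrow> f t) (at_left t)" by simp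
qed

text \<open>The index \<open>n\<close> stands for \<open>Suc n\<close> intervals, so that every
  \<open>n\<close> gives a partition.\<close>

definition grid :: "real \<Rightarrow> nat \<Rightarrow> nat \<Rightarrow> real" where
  "grid T n k = real k * T / real (Suc n)"

lemma grid_inc: "0 < T \<Longrightarrow> grid T n k < grid T n (Suc k)"
  unfolding grid_def by (intro divide_strict_right_mono mult_strict_right_mono) auto

lemma grid_0 [simp]: "grid T n 0 = 0" by (simp add: grid_def)

lemma grid_end [simp]: "grid T n (Suc n) = T" by (simp add: grid_def)

lemma grid_range: "0 < T \<Longrightarrow> k \<le> Suc n \<Longrightarrow> grid T n k \<in> {0..T}"
proof -
  assume T: "0 < T" and k: "k \<le> Suc n"
  have "real k * T \<le> real (Suc n) * T" using T k by (intro mult_right_mono) auto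
  then have "real k * T / real (Suc n) \<le> T" by (simp add: divide_simps mult.commute)
  then show ?thesis unfolding grid_def using T by auto
qed

lemma grid_step: "grid T n (Suc k) = grid T n k + T / real (Suc n)"
  unfolding grid_def by (simp add: algebra_simps add_divide_distrib)

text \<open>Taking the value at the left end of each interval keeps the approximation
  predictable.\<close>

definition step_approx :: "real \<Rightarrow> nat \<Rightarrow> (real \<Rightarrow> 'b) \<Rightarrow> real \<Rightarrow> 'b::real_vector" where
  "step_approx T n f s = (\<Sum>k<Suc n. indicator {grid T n k<..grid T n (Suc k)} s *\<^sub>R f (grid T n k))"

lemma step_approx_at:
  assumes T: "0 < T" and s: "s \<in> {0<..T}"
  shows "\<exists>k<Suc n. s \<in> {grid T n k<..grid T n (Suc k)} \<and> (\<forall>f. step_approx T n f s = (f (grid T n k) :: 'b::real_vector))"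
proof -
  obtain k where k: "k < Suc n" "s \<in> {grid T n k<..grid T n (Suc k)}"
    using strict_steps_cover[of "grid T n" s "Suc n"] s by auto
  have "step_approx T n f s = f (grid T n k)" for f :: "real \<Rightarrow> 'b"
    unfolding step_approx_def by (rule step_sum_at[where \<tau>="grid T n"]) (use grid_inc[OF T] k in auto)
  then show ?thesis using k by blast
qed

text \<open>The grid point used at \<open>s\<close> is strictly smaller than \<open>s\<close>, since
  the intervals are open on the left; so the grid points approach \<open>s\<close> from the side on
  which the limit is given.\<close>

lemma step_approx_tendsto:
  fixes f :: "real \<Rightarrow> 'b::real_normed_vector"
  assumes T: "0 < T" and s: "s \<in> {0<..T}" and f: "left_limit_on T f"
  shows "(\<lambda>n. step_approx T n f s) \<longlonglongrightarrow> f s"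
proof -
  have "\<forall>n. \<exists>k<Suc n. s \<in> {grid T n k<..grid T n (Suc k)} \<and> (\<forall>f. step_approx T n f s = (f (grid T n k) :: 'b))"
    using step_approx_at[OF T s] by blast
  then obtain k where k: "\<And>n. s \<in> {grid T n (k n)<..grid T n (Suc (k n))}"
    "\<And>n f. step_approx T n f s = (f (grid T n (k n)) :: 'b)" by metis
  have lim: "(\<lambda>n. grid T n (k n)) \<longlonglongrightarrow> s"
  proof (rule tendsto_sandwich[OF always_eventually always_eventually _ tendsto_const])
    have "(\<lambda>n. s - T * inverse (real (Suc n))) \<longlonglongrightarrow> s - T * 0"
      by (intro tendsto_intros LIMSEQ_inverse_real_of_nat)
    then show "(\<lambda>n. s - T / real (Suc n)) \<longlonglongrightarrow> s" by (simp add: divide_inverse)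
    show "\<forall>n. s - T / real (Suc n) \<le> grid T n (k n)"
    proof
      fix n show "s - T / real (Suc n) \<le> grid T n (k n)" using k(1)[of n] grid_step[of T n "k n"] by simp
    qed
    show "\<forall>n. grid T n (k n) \<le> s" using k(1) by (simp add: less_imp_le)
  qed
  have "filterlim (\<lambda>n. grid T n (k n)) (at_left s) sequentially"
  proof -
    have lt: "grid T n (k n) < s" for n using k(1)[of n] by simp
    then have "\<forall>n. grid T n (k n) \<in> {..<s} \<and> grid T n (k n) \<noteq> s" by (metis lessThan_iff less_irrefl)
    then show ?thesis unfolding filterlim_at using lim always_eventually by blast
  qed
  then have "(\<lambda>n. f (grid T n (k n))) \<longlonglongrightarrow> f s"
  proof (rule filterlim_compose[rotated])
    show "(f \<longlongrightarrow> f s) (at_left s)" using f s unfolding left_limit_on_def by blast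
  qed
  then show ?thesis using k(2) by simp
qed

lemma left_limit_joint_measurable:
  fixes X :: "real \<Rightarrow> 'w \<Rightarrow> 'b::{real_normed_vector, second_countable_topology}"
  assumes T: "0 < T" and X: "\<And>t. t \<in> {0..T} \<Longrightarrow> X t \<in> borel_measurable N"
    and l: "\<And>\<omega>. left_limit_on T (\<lambda>t. X t \<omega>)"
  shows "(\<lambda>(\<omega>, s). indicator {0..T} s *\<^sub>R X s \<omega>) \<in> borel_measurable (N \<Otimes>\<^sub>M lborel)"
  unfolding split_beta'
proof (rule borel_measurable_LIMSEQ_metric)
  \<comment> \<open>Time 0 lies in none of the half-open intervals and is added by hand.\<close>
  let ?f = "\<lambda>n x. indicator {0} (snd x) *\<^sub>R X 0 (fst x) + step_approx T n (\<lambda>t. X t (fst x)) (snd x)"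
  show "?f n \<in> borel_measurable (N \<Otimes>\<^sub>M lborel)" for n
  proof (rule borel_measurable_add)
    have [measurable]: "X 0 \<in> borel_measurable N" using X T by simp
    show "(\<lambda>x. indicator {0} (snd x) *\<^sub>R X 0 (fst x)) \<in> borel_measurable (N \<Otimes>\<^sub>M lborel)" by measurable
    show "(\<lambda>x. step_approx T n (\<lambda>t. X t (fst x)) (snd x)) \<in> borel_measurable (N \<Otimes>\<^sub>M lborel)"
      unfolding step_approx_def
    proof (rule borel_measurable_sum)
      fix k assume "k \<in> {..<Suc n}"
      then have [measurable]: "X (grid T n k) \<in> borel_measurable N" using X grid_range[OF T, of k n] by simp
      show "(\<lambda>x. indicator {grid T n k<..grid T n (Suc k)} (snd x) *\<^sub>R X (grid T n k) (fst x)) \<in> borel_measurable (N \<Otimes>\<^sub>M lborel)"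
        by measurable
    qed
  qed
  show "(\<lambda>n. ?f n x) \<longlonglongrightarrow> indicator {0..T} (snd x) *\<^sub>R X (snd x) (fst x)" for x
  proof (cases "snd x \<in> {0<..T}")
    case True
    then show ?thesis using step_approx_tendsto[OF T True l[of "fst x"]] by simp
  next
    case False
    have 0: "step_approx T n f (snd x) = 0" for n and f :: "real \<Rightarrow> 'b"
      unfolding step_approx_def
    proof (rule sum.neutral, rule ballI)
      fix k assume "k \<in> {..<Suc n}"
      then have "snd x \<notin> {grid T n k<..grid T n (Suc k)}"
        using False grid_range[OF T, of k n] grid_range[OF T, of "Suc k" n] by auto
      then show "indicator {grid T n k<..grid T n (Suc k)} (snd x) *\<^sub>R f (grid T n k) = 0" by simp
    qed
    show ?thesis unfolding 0 using False T by (cases "snd x = 0") auto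
  qed
qed

text \<open>The predictable sigma-algebra is not a product, so one works with rectangles
  \<open>S \<times> B\<close>. A preimage of a set without 0 is such a rectangle, and a preimage of
  a set with 0 is the complement of one; extending \<open>h\<close> by 0 makes this exact.\<close>

lemma rectangle_measurable:
  fixes h :: "'w \<Rightarrow> 'b::real_normed_vector"
  assumes rect: "\<And>B. B \<in> sets G \<Longrightarrow> S \<times> B \<in> sets N" and h: "h \<in> borel_measurable G"
  shows "(\<lambda>(s, \<omega>). indicator S s *\<^sub>R (if \<omega> \<in> space G then h \<omega> else 0)) \<in> borel_measurable N"
proof (rule measurableI)
  fix A :: "'b set" assume A: "A \<in> sets borel"
  have 1: "S \<times> (h -` (A - {0}) \<inter> space G) \<in> sets N"
    by (intro rect measurable_sets[OF h]) (use A in auto)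
  have 2: "S \<times> (h -` (- (A \<union> {0})) \<inter> space G) \<in> sets N"
    by (intro rect measurable_sets[OF h]) (use A in auto)
  show "(\<lambda>(s, \<omega>). indicator S s *\<^sub>R (if \<omega> \<in> space G then h \<omega> else 0)) -` A \<inter> space N \<in> sets N"
  proof (cases "0 \<in> A")
    case True
    then have "(\<lambda>(s, \<omega>). indicator S s *\<^sub>R (if \<omega> \<in> space G then h \<omega> else 0)) -` A \<inter> space N =
      space N - S \<times> (h -` (- (A \<union> {0})) \<inter> space G)"
      by (auto simp: indicator_def of_bool_def split: if_splits)
    then show ?thesis using 2 by auto
  next
    case False
    then have "(\<lambda>(s, \<omega>). indicator S s *\<^sub>R (if \<omega> \<in> space G then h \<omega> else 0)) -` A \<inter> space N =
      S \<times> (h -` (A - {0}) \<inter> space G)"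
      using sets.sets_into_space[OF 1] by (auto simp: indicator_def of_bool_def split: if_splits)
    then show ?thesis using 1 by auto
  qed
qed simp

section \<open>Predictability and approximation along grids\<close>

context ito
begin

lemma T_nonneg: "0 \<le> T" using T_pos by simp

definition left_cont_adapted :: "(real \<Rightarrow> 'w \<Rightarrow> 'b::topological_space) \<Rightarrow> bool" where
  "left_cont_adapted X \<longleftrightarrow> (\<forall>\<omega>. left_limit_on T (\<lambda>t. X t \<omega>)) \<and> (\<forall>t\<in>{0..T}. X t \<in> borel_measurable (F t))"

lemma cont_adapted_left: "cont_adapted X \<Longrightarrow> left_cont_adapted X"
  unfolding cont_adapted_def left_cont_adapted_def using left_limit_on_continuous by blast

lemma left_cont_adapted_const: "left_cont_adapted (\<lambda>s \<omega>. c)"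
  unfolding left_cont_adapted_def left_limit_on_def by simp

lemma left_cont_adapted_mult:
  fixes g h :: "real \<Rightarrow> 'w \<Rightarrow> real"
  assumes "left_cont_adapted g" "left_cont_adapted h" shows "left_cont_adapted (\<lambda>s \<omega>. g s \<omega> * h s \<omega>)"
  using assms unfolding left_cont_adapted_def left_limit_on_def
  by (intro conjI allI ballI tendsto_mult borel_measurable_times) blast+

lemma left_cont_adapted_joint:
  fixes X :: "real \<Rightarrow> 'w \<Rightarrow> 'b::{real_normed_vector, second_countable_topology}"
  assumes "left_cont_adapted X"
  shows "(\<lambda>(\<omega>, s). indicator {0..T} s *\<^sub>R X s \<omega>) \<in> borel_measurable (M \<Otimes>\<^sub>M lborel)"
proof (rule left_limit_joint_measurable[OF T_pos])
  show "X t \<in> borel_measurable M" if "t \<in> {0..T}" for t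
    using assms that F_M[of "X t" t borel] unfolding left_cont_adapted_def by auto
  show "left_limit_on T (\<lambda>t. X t \<omega>)" for \<omega> using assms unfolding left_cont_adapted_def by auto
qed

lemma left_cont_adapted_jointly_measurable: "left_cont_adapted g \<Longrightarrow> jointly_measurable g"
  using left_cont_adapted_joint[of g] unfolding jointly_measurable_def by simp

lemma space_predictable: "space (predictable_sigma M F T) = {0..T} \<times> space M"
  unfolding predictable_sigma_def by (rule space_measure_of_conv)

lemma predictable_generators:
  "{{s<..t} \<times> A |s t A. 0 \<le> s \<and> s < t \<and> t \<le> T \<and> A \<in> sets (F s)} \<union> {{0} \<times> A |A. A \<in> sets (F 0)}
    \<subseteq> Pow ({0..T} \<times> space M)"
proof -
  have sub: "A \<subseteq> space M" if "A \<in> sets (F s)" "0 \<le> s" for A s using sets.sets_into_space[OF that(1)] that by simp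
  show ?thesis
  proof
    fix B assume "B \<in> {{s<..t} \<times> A |s t A. 0 \<le> s \<and> s < t \<and> t \<le> T \<and> A \<in> sets (F s)} \<union> {{0} \<times> A |A. A \<in> sets (F 0)}"
    then consider s u A where "B = {s<..u} \<times> A" "0 \<le> s" "u \<le> T" "A \<in> sets (F s)" | A where "B = {0} \<times> A" "A \<in> sets (F 0)" by blast
    then show "B \<in> Pow ({0..T} \<times> space M)"
    proof cases
      case 1
      then show ?thesis using sub[of A s] by auto
    next
      case 2
      then show ?thesis using sub[of A 0] T_nonneg by auto
    qed
  qed
qed

lemma predictable_rect: "0 \<le> s \<Longrightarrow> s < t \<Longrightarrow> t \<le> T \<Longrightarrow> A \<in> sets (F s) \<Longrightarrow> {s<..t} \<times> A \<in> sets (predictable_sigma M F T)"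
  "A \<in> sets (F 0) \<Longrightarrow> {0} \<times> A \<in> sets (predictable_sigma M F T)"
  unfolding predictable_sigma_def sets_measure_of[OF predictable_generators]
  by (rule sigma_sets.Basic, blast)+

text \<open>Step processes with values from the left end points are built from the generating
  rectangles, and they converge pointwise; the generators at time 0 cover the initial value.\<close>

lemma left_cont_adapted_predictable:
  fixes X :: "real \<Rightarrow> 'w \<Rightarrow> 'b::{real_normed_vector, second_countable_topology}"
  assumes X: "left_cont_adapted X"
  shows "predictable M F T X"
  unfolding predictable_def split_beta'
proof (rule borel_measurable_LIMSEQ_metric)
  have m: "X t \<in> borel_measurable (F t)" if "t \<in> {0..T}" for t using X that unfolding left_cont_adapted_def by auto
  let ?h = "\<lambda>t \<omega>. if \<omega> \<in> space (F t) then X t \<omega> else 0"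
  let ?f = "\<lambda>n x. indicator {0} (fst x) *\<^sub>R ?h 0 (snd x) +
     (\<Sum>k<Suc n. indicator {grid T n k<..grid T n (Suc k)} (fst x) *\<^sub>R ?h (grid T n k) (snd x))"
  show "?f n \<in> borel_measurable (predictable_sigma M F T)" for n
  proof (intro borel_measurable_add borel_measurable_sum)
    show "(\<lambda>x. indicator {0} (fst x) *\<^sub>R ?h 0 (snd x)) \<in> borel_measurable (predictable_sigma M F T)"
    proof (rule rectangle_measurable[of "F 0" "{0}" "predictable_sigma M F T" "X 0", unfolded split_beta'])
      show "{0} \<times> B \<in> sets (predictable_sigma M F T)" if "B \<in> sets (F 0)" for B by (rule predictable_rect(2)[OF that])
      show "X 0 \<in> borel_measurable (F 0)" by (rule m) (use T_nonneg in auto)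
    qed
    fix k assume k: "k \<in> {..<Suc n}"
    then have g: "grid T n k \<in> {0..T}" "grid T n (Suc k) \<in> {0..T}" using grid_range[OF T_pos] by auto
    show "(\<lambda>x. indicator {grid T n k<..grid T n (Suc k)} (fst x) *\<^sub>R ?h (grid T n k) (snd x)) \<in> borel_measurable (predictable_sigma M F T)"
    proof (rule rectangle_measurable[of "F (grid T n k)" "{grid T n k<..grid T n (Suc k)}" "predictable_sigma M F T" "X (grid T n k)", unfolded split_beta'])
      show "{grid T n k<..grid T n (Suc k)} \<times> B \<in> sets (predictable_sigma M F T)" if "B \<in> sets (F (grid T n k))" for B
        by (rule predictable_rect(1)[OF _ grid_inc[OF T_pos] _ that]) (use g in auto)
      show "X (grid T n k) \<in> borel_measurable (F (grid T n k))" by (rule m[OF g(1)])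
    qed
  qed
  fix x assume "x \<in> space (predictable_sigma M F T)"
  then have x: "fst x \<in> {0..T}" "snd x \<in> space M" unfolding space_predictable by auto
  have eq: "?f n x = indicator {0} (fst x) *\<^sub>R X 0 (snd x) + step_approx T n (\<lambda>t. X t (snd x)) (fst x)" for n
  proof -
    have "?h (grid T n k) (snd x) = X (grid T n k) (snd x)" if "k \<in> {..<Suc n}" for k
      using x(2) grid_range[OF T_pos, of k n] that by simp
    then show ?thesis unfolding step_approx_def using x(2) by (intro arg_cong2[where f="(+)"] sum.cong refl) auto
  qed
  show "(\<lambda>n. ?f n x) \<longlonglongrightarrow> X (fst x) (snd x)"
  proof (cases "fst x = 0")
    case True
    have "step_approx T n f 0 = 0" for n and f :: "real \<Rightarrow> 'b"
      unfolding step_approx_def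
    proof (rule sum.neutral, rule ballI)
      fix k assume "k \<in> {..<Suc n}"
      then have "0 \<notin> {grid T n k<..grid T n (Suc k)}" using grid_range[OF T_pos, of k n] by auto
      then show "indicator {grid T n k<..grid T n (Suc k)} 0 *\<^sub>R f (grid T n k) = 0" by simp
    qed
    then show ?thesis unfolding eq using True by simp
  next
    case False
    then have "fst x \<in> {0<..T}" using x by auto
    then have "(\<lambda>n. step_approx T n (\<lambda>t. X t (snd x)) (fst x)) \<longlonglongrightarrow> X (fst x) (snd x)"
      using X unfolding left_cont_adapted_def by (intro step_approx_tendsto[OF T_pos]) auto
    then show ?thesis unfolding eq using False by simp
  qed
qed

text \<open>It suffices that the slice at time \<open>t\<close> of each generating rectangle is an
  event of \<open>F t\<close>.\<close>

lemma predictable_adapted: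
  assumes X: "predictable M F T X" and t: "t \<in> {0..T}"
  shows "X t \<in> borel_measurable (F t)"
proof -
  have "(\<lambda>\<omega>. (t, \<omega>)) \<in> measurable (F t) (predictable_sigma M F T)"
    unfolding predictable_sigma_def
  proof (rule measurable_measure_of[OF predictable_generators])
    show "(\<lambda>\<omega>. (t, \<omega>)) \<in> space (F t) \<rightarrow> {0..T} \<times> space M" using t by auto
    fix B assume "B \<in> {{s<..t} \<times> A |s t A. 0 \<le> s \<and> s < t \<and> t \<le> T \<and> A \<in> sets (F s)} \<union> {{0} \<times> A |A. A \<in> sets (F 0)}"
    then consider s u A where "B = {s<..u} \<times> A" "0 \<le> s" "A \<in> sets (F s)" | A where "B = {0} \<times> A" "A \<in> sets (F 0)" by blast
    then show "(\<lambda>\<omega>. (t, \<omega>)) -` B \<inter> space (F t) \<in> sets (F t)"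
    proof cases
      case 1
      show ?thesis
      proof (cases "t \<in> {s<..u}")
        case True
        then have "A \<in> sets (F t)" using sets_F_mono[OF 1(3,2), of t] by auto
        moreover have "(\<lambda>\<omega>. (t, \<omega>)) -` B \<inter> space (F t) = A \<inter> space (F t)" using True 1 by auto
        ultimately show ?thesis by auto
      next
        case False
        then have "(\<lambda>\<omega>. (t, \<omega>)) -` B \<inter> space (F t) = {}" using 1 by auto
        then show ?thesis by simp
      qed
    next
      case 2
      show ?thesis
      proof (cases "t = 0")
        case True
        then have "(\<lambda>\<omega>. (t, \<omega>)) -` B \<inter> space (F t) = A \<inter> space (F t)" using 2 by auto
        then show ?thesis using sets.Int[OF 2(2) sets.top[of "F 0"]] True by simp
      next
        case False
        then have "(\<lambda>\<omega>. (t, \<omega>)) -` B \<inter> space (F t) = {}" using 2 by auto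
        then show ?thesis by simp
      qed
    qed
  qed
  from measurable_compose[OF this X[unfolded predictable_def]] show ?thesis by simp
qed

text \<open>Elementary processes need finitely many values: cutting off at \<open>n\<close> and
  rounding down to multiples of \<open>1 / Suc n\<close> achieves this and still converges.\<close>

definition round_val :: "nat \<Rightarrow> real \<Rightarrow> real" where
  "round_val n x = (if \<bar>x\<bar> \<le> real n then real_of_int \<lfloor>real (Suc n) * x\<rfloor> / real (Suc n) else 0)"

lemma round_val_close: "\<bar>x\<bar> \<le> real n \<Longrightarrow> \<bar>round_val n x - x\<bar> \<le> 1 / real (Suc n)"
proof -
  assume x: "\<bar>x\<bar> \<le> real n"
  have "\<bar>real_of_int \<lfloor>real (Suc n) * x\<rfloor> - real (Suc n) * x\<bar> \<le> 1" by linarith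
  moreover have "round_val n x - x = (real_of_int \<lfloor>real (Suc n) * x\<rfloor> - real (Suc n) * x) / real (Suc n)"
    using x by (simp add: round_val_def diff_divide_distrib)
  ultimately show ?thesis by (simp add: abs_divide divide_right_mono del: of_nat_Suc)
qed

lemma round_val_bound: "\<bar>round_val n x\<bar> \<le> \<bar>x\<bar> + 1"
proof (cases "\<bar>x\<bar> \<le> real n")
  case True
  have "1 / real (Suc n) \<le> 1" by simp
  then show ?thesis using round_val_close[OF True] by linarith
qed (simp add: round_val_def)

lemma round_val_measurable [measurable]: "round_val n \<in> borel_measurable borel"
  unfolding round_val_def by measurable

lemma round_val_finite: "finite (range (round_val n))"
proof -
  define K where "K = int (Suc n) * (int n + 1)"
  have "round_val n x \<in> insert 0 ((\<lambda>k. real_of_int k / real (Suc n)) ` {-K..K})" for x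
  proof (cases "\<bar>x\<bar> \<le> real n")
    case True
    have "\<bar>real (Suc n) * x\<bar> \<le> real (Suc n) * real n" using True by (simp add: abs_mult mult_left_mono del: of_nat_Suc)
    moreover have "real_of_int (int (Suc n) * int n) = real (Suc n) * real n" by simp
    ultimately have le: "real (Suc n) * x \<le> real_of_int (int (Suc n) * int n)"
      and ge: "real_of_int (- (int (Suc n) * int n)) \<le> real (Suc n) * x" by linarith+
    have "\<lfloor>real (Suc n) * x\<rfloor> \<le> int (Suc n) * int n" using floor_mono[OF le] by (simp only: floor_of_int)
    moreover have "- (int (Suc n) * int n) \<le> \<lfloor>real (Suc n) * x\<rfloor>" using ge by (simp only: le_floor_iff)
    ultimately
    have "\<lfloor>real (Suc n) * x\<rfloor> \<in> {-K..K}" unfolding K_def by (auto simp: algebra_simps)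
    then show ?thesis using True unfolding round_val_def by auto
  qed (simp add: round_val_def)
  then have "range (round_val n) \<subseteq> insert 0 ((\<lambda>k. real_of_int k / real (Suc n)) ` {-K..K})" by blast
  then show ?thesis by (rule finite_subset) simp
qed

lemma round_val_tendsto:
  assumes "x \<longlonglongrightarrow> l" shows "(\<lambda>n. round_val n (x n)) \<longlonglongrightarrow> l"
proof -
  have "(\<lambda>n. \<bar>x n\<bar>) \<longlonglongrightarrow> \<bar>l\<bar>" using assms by (rule tendsto_rabs)
  then have 1: "\<forall>\<^sub>F n in sequentially. \<bar>x n\<bar> < \<bar>l\<bar> + 1" by (rule order_tendstoD) simp
  have 2: "\<forall>\<^sub>F n in sequentially. \<bar>l\<bar> + 1 \<le> real n"
    using filterlim_real_sequentially unfolding filterlim_at_top by blast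
  have "(\<lambda>n. round_val n (x n) - x n) \<longlonglongrightarrow> 0"
  proof (rule Lim_null_comparison)
    show "\<forall>\<^sub>F n in sequentially. norm (round_val n (x n) - x n) \<le> inverse (real (Suc n))"
      using 1 2 by eventually_elim (use round_val_close in \<open>auto simp: inverse_eq_divide\<close>)
  qed (rule LIMSEQ_inverse_real_of_nat)
  from tendsto_add[OF this assms] show ?thesis by simp
qed

definition grid_elementary :: "(real \<Rightarrow> 'w \<Rightarrow> real) \<Rightarrow> nat \<Rightarrow> ('w, 'h) elementary" where
  "grid_elementary g n = (Suc n, grid T n, \<lambda>k \<omega>. round_val n (g (grid T n k) \<omega>) *\<^sub>R P)"

lemma elementary_grid:
  assumes "left_cont_adapted g" shows "elementary F T (grid_elementary g n)"
  unfolding grid_elementary_def elementary.simps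
proof (intro conjI allI impI)
  fix k assume k: "k < Suc n"
  then have "grid T n k \<in> {0..T}" using grid_range[OF T_pos] by simp
  then have m: "g (grid T n k) \<in> borel_measurable (F (grid T n k))" using assms unfolding left_cont_adapted_def by auto
  have "simple_function (F (grid T n k)) (\<lambda>\<omega>. round_val n (g (grid T n k) \<omega>))"
  proof (rule simple_function_borel_measurable)
    show "(\<lambda>\<omega>. round_val n (g (grid T n k) \<omega>)) \<in> borel_measurable (F (grid T n k))" using m by measurable
    show "finite ((\<lambda>\<omega>. round_val n (g (grid T n k) \<omega>)) ` space (F (grid T n k)))"
      by (rule finite_subset[OF _ round_val_finite[of n]]) auto
  qed
  then show "simple_function (F (grid T n k)) (\<lambda>\<omega>. round_val n (g (grid T n k) \<omega>) *\<^sub>R P)"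
    by (rule simple_function_compose1)
qed (use grid_inc[OF T_pos] in auto)

lemma grid_elementary_process:
  assumes s: "s \<in> {0<..T}" shows "elementary_process (grid_elementary g n) s \<omega> = round_val n (step_approx T n (\<lambda>t. g t \<omega>) s) *\<^sub>R P"
proof -
  obtain k where k: "k < Suc n" "s \<in> {grid T n k<..grid T n (Suc k)}" "step_approx T n (\<lambda>t. g t \<omega>) s = g (grid T n k) \<omega>"
    using step_approx_at[OF T_pos s, of n] by blast
  have "(\<Sum>j<Suc n. indicator {grid T n j<..grid T n (Suc j)} s *\<^sub>R (round_val n (g (grid T n j) \<omega>) *\<^sub>R P)) = round_val n (g (grid T n k) \<omega>) *\<^sub>R P"
    by (rule step_sum_at[where \<tau>="grid T n" and f="\<lambda>k. round_val n (g (grid T n k) \<omega>) *\<^sub>R P"]) (use grid_inc[OF T_pos] k in auto)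
  then show ?thesis unfolding grid_elementary_def elementary_process.simps k(3) .
qed

text \<open>One bound for all times serves two dominated convergences, in time along each path and
  then in expectation.\<close>

definition square_dominated :: "(real \<Rightarrow> 'w \<Rightarrow> real) \<Rightarrow> bool" where
  "square_dominated g \<longleftrightarrow> (\<exists>G. G \<in> borel_measurable M \<and> (\<integral>\<^sup>+\<omega>. ennreal ((G \<omega>)\<^sup>2) \<partial>M) < \<infinity> \<and>
     (\<forall>\<omega>\<in>space M. \<forall>s\<in>{0..T}. \<bar>g s \<omega>\<bar> \<le> G \<omega>))"

lemma grid_approx_error:
  assumes g: "left_cont_adapted g" and G: "\<And>\<omega> s. \<omega> \<in> space M \<Longrightarrow> s \<in> {0..T} \<Longrightarrow> \<bar>g s \<omega>\<bar> \<le> G \<omega>" and w: "\<omega> \<in> space M"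
  shows "(\<lambda>n. approx_error T g (grid_elementary g n) \<omega>) \<longlonglongrightarrow> 0"
    "approx_error T g (grid_elementary g n) \<omega> \<le> ennreal (hs P * T) * (8 * ennreal ((G \<omega>)\<^sup>2) + 2)"
proof -
  \<comment> \<open>Rounding adds at most 1 to the absolute value, so the difference is at most
    \<open>2 * G \<omega> + 1\<close>, whose square is at most
    \<open>8 * (G \<omega>)\<^sup>2 + 2\<close>.\<close>
  define c where "c = ennreal (hs P) * (8 * ennreal ((G \<omega>)\<^sup>2) + 2)"
  let ?u = "\<lambda>n s. ennreal (hs (g s \<omega> *\<^sub>R P - elementary_process (grid_elementary g n) s \<omega>)) * indicator {0..T} s"
  have [measurable]: "?u n \<in> borel_measurable lborel" for n
    by (rule approx_error_section[OF left_cont_adapted_jointly_measurable[OF g] elementary_grid[OF g] order_refl w])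
  \<comment> \<open>At time 0 an elementary process vanishes and the formula for the error is a
    different one, so this null set is left aside.\<close>
  have ae: "AE s in lborel. s \<noteq> (0::real)" by (rule AE_lborel_singleton)
  have u: "?u n s = ennreal ((g s \<omega> - round_val n (step_approx T n (\<lambda>t. g t \<omega>) s))\<^sup>2 * hs P)" if "s \<in> {0<..T}" for n s
  proof -
    have "g s \<omega> *\<^sub>R P - elementary_process (grid_elementary g n) s \<omega> = (g s \<omega> - round_val n (step_approx T n (\<lambda>t. g t \<omega>) s)) *\<^sub>R P"
      unfolding grid_elementary_process[OF that] by (simp add: scaleR_diff_left)
    then show ?thesis using that by (simp add: hs_scaleR)
  qed
  have bound: "?u n s \<le> c * indicator {0..T} s" if "s \<noteq> 0" for n s
  proof (cases "s \<in> {0<..T}")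
    case True
    obtain k where k: "k < Suc n" "step_approx T n (\<lambda>t. g t \<omega>) s = g (grid T n k) \<omega>"
      using step_approx_at[OF T_pos True, of n] by blast
    have "\<bar>round_val n (g (grid T n k) \<omega>)\<bar> \<le> G \<omega> + 1"
      using round_val_bound[of n "g (grid T n k) \<omega>"] G[OF w grid_range[OF T_pos, of k n]] k by simp
    moreover have "\<bar>g s \<omega>\<bar> \<le> G \<omega>" using G[OF w, of s] True by simp
    ultimately have "\<bar>g s \<omega> - round_val n (g (grid T n k) \<omega>)\<bar> \<le> 2 * G \<omega> + 1" by linarith
    then have "(g s \<omega> - round_val n (g (grid T n k) \<omega>))\<^sup>2 \<le> (2 * G \<omega> + 1)\<^sup>2" by (metis abs_ge_zero power2_abs power_mono)
    also have "\<dots> \<le> 8 * (G \<omega>)\<^sup>2 + 2" using zero_le_power2[of "2 * G \<omega> - 1"] by (simp add: power2_sum power2_diff power_mult_distrib)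
    finally have "(g s \<omega> - round_val n (g (grid T n k) \<omega>))\<^sup>2 * hs P \<le> (8 * (G \<omega>)\<^sup>2 + 2) * hs P" by (rule mult_right_mono) simp
    then have "?u n s \<le> ennreal ((8 * (G \<omega>)\<^sup>2 + 2) * hs P)" unfolding u[OF True] k(2) by (rule ennreal_leI)
    also have "\<dots> = c" unfolding c_def by (simp add: ennreal_mult ennreal_plus mult.commute)
    finally show ?thesis using True by simp
  next
    case False
    then show ?thesis using that by simp
  qed
  have cfin: "c * ennreal T < \<infinity>" unfolding c_def by (simp add: ennreal_mult_less_top ennreal_add_eq_top less_top[symmetric] ennreal_mult_eq_top_iff)
  have cint: "(\<integral>\<^sup>+s. c * indicator {0..T} s \<partial>lborel) = c * ennreal T"
    using T_nonneg by (simp add: nn_integral_cmult_indicator)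
  have "(\<lambda>n. \<integral>\<^sup>+s. ?u n s \<partial>lborel) \<longlonglongrightarrow> (\<integral>\<^sup>+s. 0 \<partial>(lborel::real measure))"
  proof (rule nn_integral_dominated_convergence[where w="\<lambda>s. c * indicator {0..T} s"])
    show "AE s in lborel. ?u n s \<le> c * indicator {0..T} s" for n using ae by eventually_elim (rule bound)
    show "(\<integral>\<^sup>+s. c * indicator {0..T} s \<partial>lborel) < \<infinity>" unfolding cint by (rule cfin)
    show "AE s in lborel. (\<lambda>n. ?u n s) \<longlonglongrightarrow> 0" using ae
    proof eventually_elim
      case (elim s)
      show ?case
      proof (cases "s \<in> {0<..T}")
        case True
        have "(\<lambda>n. round_val n (step_approx T n (\<lambda>t. g t \<omega>) s)) \<longlonglongrightarrow> g s \<omega>"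
          using g unfolding left_cont_adapted_def by (intro round_val_tendsto step_approx_tendsto[OF T_pos True]) auto
        then have "(\<lambda>n. (g s \<omega> - round_val n (step_approx T n (\<lambda>t. g t \<omega>) s))\<^sup>2 * hs P) \<longlonglongrightarrow> (g s \<omega> - g s \<omega>)\<^sup>2 * hs P"
          by (intro tendsto_intros)
        then show ?thesis unfolding u[OF True] using tendsto_ennrealI by fastforce
      qed (use elim in simp)
    qed
  qed measurable
  then show "(\<lambda>n. approx_error T g (grid_elementary g n) \<omega>) \<longlonglongrightarrow> 0" unfolding approx_error_def by simp
  have "approx_error T g (grid_elementary g n) \<omega> \<le> (\<integral>\<^sup>+s. c * indicator {0..T} s \<partial>lborel)"
    unfolding approx_error_def by (rule nn_integral_mono_AE) (use ae in eventually_elim, rule bound)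
  also have "\<dots> = ennreal (hs P * T) * (8 * ennreal ((G \<omega>)\<^sup>2) + 2)"
    unfolding cint unfolding c_def using T_nonneg by (simp add: ennreal_mult mult_ac)
  finally show "approx_error T g (grid_elementary g n) \<omega> \<le> ennreal (hs P * T) * (8 * ennreal ((G \<omega>)\<^sup>2) + 2)" .
qed

lemma ito_integral_exists:
  assumes g: "left_cont_adapted g" and d: "square_dominated g"
  shows "\<exists>I. is_ito g I"
proof (rule is_ito_exists[OF left_cont_adapted_jointly_measurable[OF g]])
  obtain G where [measurable]: "G \<in> borel_measurable M" and Gi: "(\<integral>\<^sup>+\<omega>. ennreal ((G \<omega>)\<^sup>2) \<partial>M) < \<infinity>"
    and G: "\<And>\<omega> s. \<omega> \<in> space M \<Longrightarrow> s \<in> {0..T} \<Longrightarrow> \<bar>g s \<omega>\<bar> \<le> G \<omega>"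
    using d unfolding square_dominated_def by auto
  have [measurable]: "approx_error T g (grid_elementary g n) \<in> borel_measurable M" for n
    by (rule approx_error_measurable[OF left_cont_adapted_jointly_measurable[OF g] elementary_grid[OF g] order_refl])
  have "(\<lambda>n. \<integral>\<^sup>+\<omega>. approx_error T g (grid_elementary g n) \<omega> \<partial>M) \<longlonglongrightarrow> (\<integral>\<^sup>+\<omega>. 0 \<partial>M)"
  proof (rule nn_integral_dominated_convergence[where w="\<lambda>\<omega>. ennreal (hs P * T) * (8 * ennreal ((G \<omega>)\<^sup>2) + 2)"])
    show "AE \<omega> in M. approx_error T g (grid_elementary g n) \<omega> \<le> ennreal (hs P * T) * (8 * ennreal ((G \<omega>)\<^sup>2) + 2)" for n
      by (rule AE_I2) (rule grid_approx_error(2)[OF g G])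
    show "AE \<omega> in M. (\<lambda>n. approx_error T g (grid_elementary g n) \<omega>) \<longlonglongrightarrow> 0"
      by (rule AE_I2) (rule grid_approx_error(1)[OF g G])
    have "(\<integral>\<^sup>+\<omega>. ennreal (hs P * T) * (8 * ennreal ((G \<omega>)\<^sup>2) + 2) \<partial>M) = ennreal (hs P * T) * (8 * (\<integral>\<^sup>+\<omega>. ennreal ((G \<omega>)\<^sup>2) \<partial>M) + 2)"
      by (simp add: nn_integral_cmult nn_integral_add emeasure_space_1)
    also have "\<dots> < \<infinity>" using Gi by (simp add: ennreal_mult_less_top ennreal_mult_eq_top_iff less_top[symmetric] ennreal_add_eq_top)
    finally show "(\<integral>\<^sup>+\<omega>. ennreal (hs P * T) * (8 * ennreal ((G \<omega>)\<^sup>2) + 2) \<partial>M) < \<infinity>" .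
  qed measurable
  then have lim: "(\<lambda>n. \<integral>\<^sup>+\<omega>. approx_error T g (grid_elementary g n) \<omega> \<partial>M) \<longlonglongrightarrow> 0" by simp
  fix \<epsilon> :: real assume "0 < \<epsilon>"
  then have "\<forall>\<^sub>F n in sequentially. (\<integral>\<^sup>+\<omega>. approx_error T g (grid_elementary g n) \<omega> \<partial>M) < ennreal \<epsilon>"
    by (intro order_tendstoD(2)[OF lim]) simp
  then obtain n where "(\<integral>\<^sup>+\<omega>. approx_error T g (grid_elementary g n) \<omega> \<partial>M) < ennreal \<epsilon>"
    unfolding eventually_sequentially by blast
  then show "\<exists>E. elementary F T E \<and> (\<integral>\<^sup>+\<omega>. approx_error T g E \<omega> \<partial>M) \<le> ennreal \<epsilon>"
    using elementary_grid[OF g] less_imp_le by blast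
qed

lemma L1_converges_in_prob:
  assumes Z [measurable]: "\<And>n. Z n \<in> borel_measurable M" and lim: "(\<lambda>n. \<integral>\<^sup>+\<omega>. Z n \<omega> \<partial>M) \<longlonglongrightarrow> 0"
  shows "converges_to_0_in_prob M Z"
  unfolding converges_to_0_in_prob_def
proof (intro allI impI)
  fix \<epsilon> :: real assume e: "0 < \<epsilon>"
  have le: "ennreal (prob {\<omega>\<in>space M. ennreal \<epsilon> < Z n \<omega>}) \<le> ennreal (1/\<epsilon>) * (\<integral>\<^sup>+\<omega>. Z n \<omega> \<partial>M)" for n
  proof -
    have "emeasure M {\<omega>\<in>space M. ennreal \<epsilon> < Z n \<omega>} \<le> emeasure M {\<omega>\<in>space M. 1 \<le> ennreal (1/\<epsilon>) * Z n \<omega>}"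
    proof (rule emeasure_mono)
      show "{\<omega>\<in>space M. ennreal \<epsilon> < Z n \<omega>} \<subseteq> {\<omega>\<in>space M. 1 \<le> ennreal (1/\<epsilon>) * Z n \<omega>}"
      proof safe
        fix \<omega> assume "ennreal \<epsilon> < Z n \<omega>"
        then have "ennreal (1/\<epsilon>) * ennreal \<epsilon> \<le> ennreal (1/\<epsilon>) * Z n \<omega>" by (intro mult_left_mono) auto
        then show "1 \<le> ennreal (1/\<epsilon>) * Z n \<omega>" using e by (simp add: ennreal_mult[symmetric])
      qed
    qed measurable
    also have "\<dots> \<le> ennreal (1/\<epsilon>) * (\<integral>\<^sup>+\<omega>. Z n \<omega> * indicator (space M) \<omega> \<partial>M)"
      by (rule nn_integral_Markov_inequality) measurable
    also have "(\<integral>\<^sup>+\<omega>. Z n \<omega> * indicator (space M) \<omega> \<partial>M) = (\<integral>\<^sup>+\<omega>. Z n \<omega> \<partial>M)" by (rule nn_integral_cong) simp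
    finally show ?thesis by (simp add: emeasure_eq_measure)
  qed
  have "(\<lambda>n. ennreal (1/\<epsilon>) * (\<integral>\<^sup>+\<omega>. Z n \<omega> \<partial>M)) \<longlonglongrightarrow> ennreal (1/\<epsilon>) * 0"
    by (rule ennreal_tendsto_cmult[OF _ lim]) simp
  then have "(\<lambda>n. ennreal (prob {\<omega>\<in>space M. ennreal \<epsilon> < Z n \<omega>})) \<longlonglongrightarrow> ennreal 0"
    using ennreal_squeeze_0[OF le] by simp
  then show "(\<lambda>n. prob {\<omega>\<in>space M. ennreal \<epsilon> < Z n \<omega>}) \<longlonglongrightarrow> 0"
    by (rule tendsto_ennrealD) (auto simp: always_eventually)
qed

lemma is_ito_converges_in_prob:
  assumes g: "jointly_measurable g" and I: "is_ito g I"
  shows "\<exists>E. (\<forall>n. elementary F T (E n)) \<and> converges_to_0_in_prob M (\<lambda>n. approx_error T g (E n)) \<and>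
    (\<forall>t\<in>{0..T}. converges_to_0_in_prob M (\<lambda>n \<omega>. ennreal (norm (I t \<omega> - elementary_integral Wc (E n) t \<omega>))))"
proof -
  obtain E where E: "\<And>n. elementary F T (E n)" "(\<lambda>n. \<integral>\<^sup>+\<omega>. approx_error T g (E n) \<omega> \<partial>M) \<longlonglongrightarrow> 0"
     "(\<lambda>n. E2 T (\<lambda>t \<omega>. elementary_integral Wc (E n) t \<omega> - I t \<omega>)) \<longlonglongrightarrow> 0" and cI: "cont_adapted I"
    using I unfolding is_ito_def by auto
  have 1: "converges_to_0_in_prob M (\<lambda>n. approx_error T g (E n))"
    by (rule L1_converges_in_prob[OF approx_error_measurable[OF g E(1) order_refl] E(2)])
  have "converges_to_0_in_prob M (\<lambda>n \<omega>. ennreal (norm (I t \<omega> - elementary_integral Wc (E n) t \<omega>)))" if t: "t \<in> {0..T}" for t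
  proof -
    note [measurable] = cont_adaptedD(3)[OF cI t] cont_adaptedD(3)[OF cont_adapted_elementary[OF E(1)] t]
    have "(\<integral>\<^sup>+\<omega>. ennreal ((norm (I t \<omega> - elementary_integral Wc (E n) t \<omega>))\<^sup>2) \<partial>M) \<le>
        E2 T (\<lambda>t \<omega>. elementary_integral Wc (E n) t \<omega> - I t \<omega>)" for n
      unfolding E2_def norm_minus_commute[of "I t _"]
      by (rule nn_integral_mono) (rule sup_sq_upper[OF t, where X="\<lambda>t \<omega>. elementary_integral Wc (E n) t \<omega> - I t \<omega>"])
    then have "(\<lambda>n. \<integral>\<^sup>+\<omega>. ennreal ((norm (I t \<omega> - elementary_integral Wc (E n) t \<omega>))\<^sup>2) \<partial>M) \<longlonglongrightarrow> 0"
      using E(3) by (rule ennreal_squeeze_0)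
    then have c: "converges_to_0_in_prob M (\<lambda>n \<omega>. ennreal ((norm (I t \<omega> - elementary_integral Wc (E n) t \<omega>))\<^sup>2))"
      by (intro L1_converges_in_prob) measurable
    show ?thesis
      unfolding converges_to_0_in_prob_def
    proof (intro allI impI)
      fix \<epsilon> :: real assume e: "0 < \<epsilon>"
      \<comment> \<open>Convergence is known for the squared norms, so the thresholds are squared
        accordingly.\<close>
      have "ennreal \<epsilon> < ennreal x \<longleftrightarrow> ennreal (\<epsilon>\<^sup>2) < ennreal (x\<^sup>2)" if "0 \<le> x" for x
      proof -
        have "\<epsilon> < x \<longleftrightarrow> \<epsilon>\<^sup>2 < x\<^sup>2"
          using e that power_strict_mono[of \<epsilon> x 2] power2_less_imp_less[of \<epsilon> x] by auto
        then show ?thesis using e by (simp add: ennreal_less_iff)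
      qed
      then show "(\<lambda>n. prob {\<omega> \<in> space M. ennreal \<epsilon> < ennreal (norm (I t \<omega> - elementary_integral Wc (E n) t \<omega>))}) \<longlonglongrightarrow> 0"
        using c e unfolding converges_to_0_in_prob_def by simp
    qed
  qed
  then show ?thesis using E(1) 1 by (intro exI[of _ E] conjI allI ballI)
qed

lemma AE_elementary_integral: "AE \<omega> in M. \<forall>t. elementary_integral W E t \<omega> = elementary_integral Wc E t \<omega>"
proof -
  obtain n \<tau> \<phi> where eq: "E = (n, \<tau>, \<phi>)" by (cases E)
  show ?thesis unfolding eq using AE_Wc by eventually_elim simp
qed

text \<open>The definition of the integral speaks of \<open>W\<close>, the estimates of
  \<open>Wc\<close>. Completeness makes the elementary integrals against \<open>W\<close>
  measurable, so that almost sure equality gives equal probabilities.\<close>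

lemma converges_in_prob_W_iff:
  assumes E: "\<And>n. elementary F T (E n)" and I: "I t \<in> borel_measurable M" and t: "0 \<le> t"
  shows "converges_to_0_in_prob M (\<lambda>n \<omega>. ennreal (norm (I t \<omega> - elementary_integral W (E n) t \<omega>))) \<longleftrightarrow>
    converges_to_0_in_prob M (\<lambda>n \<omega>. ennreal (norm (I t \<omega> - elementary_integral Wc (E n) t \<omega>)))"
proof -
  note [measurable] = I F_M[OF elementary_integral_measurable[OF E t] t]
  have ae: "AE \<omega> in M. elementary_integral Wc (E n) t \<omega> = elementary_integral W (E n) t \<omega>" for n
    using AE_elementary_integral[of "E n"] by eventually_elim simp
  note [measurable] = F_M[OF measurable_F_AE_cong[OF elementary_integral_measurable[OF E t] ae t] t]
  have "prob {\<omega> \<in> space M. ennreal \<epsilon> < ennreal (norm (I t \<omega> - elementary_integral W (E n) t \<omega>))} =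
    prob {\<omega> \<in> space M. ennreal \<epsilon> < ennreal (norm (I t \<omega> - elementary_integral Wc (E n) t \<omega>))}" for n \<epsilon>
    by (rule measure_eq_AE) (use ae[of n] in \<open>eventually_elim, auto\<close>, measurable)
  then show ?thesis unfolding converges_to_0_in_prob_def by simp
qed

lemma is_ito_has_stochastic_integral:
  assumes g: "left_cont_adapted g" and d: "square_dominated g" and I: "is_ito g I"
  shows "has_stochastic_integral M F Q W T (\<lambda>s \<omega>. g s \<omega> *\<^sub>R P) I"
  unfolding has_stochastic_integral_def
proof (intro conjI allI ballI)
  have cI: "cont_adapted I" using I unfolding is_ito_def by auto
  show "predictable M F T (\<lambda>s \<omega>. (g s \<omega> *\<^sub>R P) h)" for h
  proof -
    have "(\<lambda>x. (\<lambda>(t, \<omega>). g t \<omega>) x *\<^sub>R P h) \<in> borel_measurable (predictable_sigma M F T)"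
      using left_cont_adapted_predictable[OF g] unfolding predictable_def by (intro borel_measurable_scaleR) auto
    then show ?thesis unfolding predictable_def by (simp add: blinfun.scaleR_left split_beta')
  qed
  obtain G where G: "\<And>\<omega> s. \<omega> \<in> space M \<Longrightarrow> s \<in> {0..T} \<Longrightarrow> \<bar>g s \<omega>\<bar> \<le> G \<omega>"
    using d unfolding square_dominated_def by blast
  show "AE \<omega> in M. (\<integral>\<^sup>+s\<in>{0..T}. ennreal (HS_normsq Q (g s \<omega> *\<^sub>R P)) \<partial>lborel) < \<infinity>"
  proof (rule AE_I2)
    fix \<omega> assume w: "\<omega> \<in> space M"
    have "(\<integral>\<^sup>+s\<in>{0..T}. ennreal (HS_normsq Q (g s \<omega> *\<^sub>R P)) \<partial>lborel) \<le> (\<integral>\<^sup>+s. ennreal ((G \<omega>)\<^sup>2 * hs P) * indicator {0..T} s \<partial>lborel)"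
    proof (rule nn_integral_mono)
      fix s
      show "ennreal (HS_normsq Q (g s \<omega> *\<^sub>R P)) * indicator {0..T} s \<le> ennreal ((G \<omega>)\<^sup>2 * hs P) * indicator {0..T} s"
      proof (cases "s \<in> {0..T}")
        case True
        then have "(g s \<omega>)\<^sup>2 \<le> (G \<omega>)\<^sup>2" using G[OF w True] by (metis abs_ge_zero power2_abs power_mono)
        then show ?thesis unfolding hs_def[symmetric] hs_scaleR by (intro mult_right_mono ennreal_leI) auto
      qed simp
    qed
    also have "\<dots> < \<infinity>" using T_nonneg by (simp add: nn_integral_cmult_indicator ennreal_mult_less_top)
    finally show "(\<integral>\<^sup>+s\<in>{0..T}. ennreal (HS_normsq Q (g s \<omega> *\<^sub>R P)) \<partial>lborel) < \<infinity>" .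
  qed
  show "I t \<in> borel_measurable (F t)" if "t \<in> {0..T}" for t using cont_adaptedD(2)[OF cI that] .
  show "AE \<omega> in M. continuous_on {0..T} (\<lambda>t. I t \<omega>)" using cont_adaptedD(1)[OF cI] by simp
  obtain E where "(\<forall>n. elementary F T (E n)) \<and> converges_to_0_in_prob M (\<lambda>n. approx_error T g (E n)) \<and>
    (\<forall>t\<in>{0..T}. converges_to_0_in_prob M (\<lambda>n \<omega>. ennreal (norm (I t \<omega> - elementary_integral Wc (E n) t \<omega>))))"
    using is_ito_converges_in_prob[OF left_cont_adapted_jointly_measurable[OF g] I] ..
  then have E: "\<And>n. elementary F T (E n)" "converges_to_0_in_prob M (\<lambda>n. approx_error T g (E n))"
    "\<And>t. t \<in> {0..T} \<Longrightarrow> converges_to_0_in_prob M (\<lambda>n \<omega>. ennreal (norm (I t \<omega> - elementary_integral Wc (E n) t \<omega>)))"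
    by simp_all
  have "converges_to_0_in_prob M (\<lambda>n \<omega>. ennreal (norm (I t \<omega> - elementary_integral W (E n) t \<omega>)))" if "t \<in> {0..T}" for t
  proof -
    have "0 \<le> t" using that by simp
    from converges_in_prob_W_iff[where E=E and I=I and t=t, OF E(1) cont_adaptedD(3)[OF cI that] this] E(3)[OF that]
    show ?thesis by (rule iffD2)
  qed
  then show "\<exists>E. (\<forall>n. elementary F T (E n)) \<and>
       converges_to_0_in_prob M (\<lambda>n \<omega>. \<integral>\<^sup>+s\<in>{0..T}. ennreal (HS_normsq Q (g s \<omega> *\<^sub>R P - elementary_process (E n) s \<omega>)) \<partial>lborel) \<and>
       (\<forall>t\<in>{0..T}. converges_to_0_in_prob M (\<lambda>n \<omega>. ennreal (norm (I t \<omega> - elementary_integral W (E n) t \<omega>))))"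
    using E(1) E(2)[unfolded approx_error_def hs_def] by (intro exI[of _ E] conjI allI ballI)
qed

lemma is_ito_at:
  assumes "jointly_measurable g" "is_ito g I" "t \<in> {0..T}" shows "ito_at g I t"
proof -
  obtain E where "(\<forall>n. elementary F T (E n)) \<and> converges_to_0_in_prob M (\<lambda>n. approx_error T g (E n)) \<and>
    (\<forall>t\<in>{0..T}. converges_to_0_in_prob M (\<lambda>n \<omega>. ennreal (norm (I t \<omega> - elementary_integral Wc (E n) t \<omega>))))"
    using is_ito_converges_in_prob[OF assms(1,2)] ..
  then show ?thesis unfolding ito_at_def using assms(3) by (intro exI[of _ E] conjI) simp_all
qed

lemma has_stochastic_integral_ito_at:
  assumes "has_stochastic_integral M F Q W T (\<lambda>s \<omega>. g s \<omega> *\<^sub>R P) I" and t: "t \<in> {0..T}"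
  shows "ito_at g I t"
proof -
  note D = assms(1)[unfolded has_stochastic_integral_def]
  obtain E where "(\<forall>n. elementary F T (E n)) \<and>
     converges_to_0_in_prob M (\<lambda>n \<omega>. \<integral>\<^sup>+s\<in>{0..T}. ennreal (HS_normsq Q (g s \<omega> *\<^sub>R P - elementary_process (E n) s \<omega>)) \<partial>lborel) \<and>
     (\<forall>t\<in>{0..T}. converges_to_0_in_prob M (\<lambda>n \<omega>. ennreal (norm (I t \<omega> - elementary_integral W (E n) t \<omega>))))"
    using D[THEN conjunct2, THEN conjunct2, THEN conjunct2, THEN conjunct2] ..
  then have E: "\<And>n. elementary F T (E n)"
     "converges_to_0_in_prob M (\<lambda>n \<omega>. \<integral>\<^sup>+s\<in>{0..T}. ennreal (HS_normsq Q (g s \<omega> *\<^sub>R P - elementary_process (E n) s \<omega>)) \<partial>lborel)"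
     "converges_to_0_in_prob M (\<lambda>n \<omega>. ennreal (norm (I t \<omega> - elementary_integral W (E n) t \<omega>)))"
    using t by simp_all
  have "I t \<in> borel_measurable (F t)" using D[THEN conjunct2, THEN conjunct2, THEN conjunct1] t by blast
  moreover have t0: "0 \<le> t" using t by simp
  ultimately have m: "I t \<in> borel_measurable M" by (rule F_M)
  from converges_in_prob_W_iff[where E=E and I=I and t=t, OF E(1) m t0] E(3)
  have "converges_to_0_in_prob M (\<lambda>n \<omega>. ennreal (norm (I t \<omega> - elementary_integral Wc (E n) t \<omega>)))"
    by (rule iffD1)
  then show ?thesis
    unfolding ito_at_def using E(1) E(2)[folded hs_def, folded approx_error_def] by (intro exI[of _ E] conjI allI)
qed

end

section \<open>The weight of the consensus point\<close>

text \<open>Superadditivity of the power. It lets the upper growth bound \<open>1 + r powr p\<close>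
  be compared with the single power in the lower one.\<close>

lemma powr_super:
  fixes r p :: real assumes "0 \<le> r" "1 \<le> p" shows "1 + r powr p \<le> (1 + r) powr p"
proof (cases "r = 0")
  case False
  then have r: "r > 0" using assms by simp
  have "1 \<le> (1 + r) powr (p - 1)" using r assms by (intro ge_one_powr_ge_zero) auto
  moreover have "r * r powr (p - 1) \<le> r * (1 + r) powr (p - 1)"
    using r assms by (intro mult_left_mono powr_mono2) auto
  moreover have "r * r powr (p - 1) = r powr p" using powr_mult_base[of r "p - 1"] r by simp
  moreover have "(1 + r) * (1 + r) powr (p - 1) = (1 + r) powr p" using powr_mult_base[of "1 + r" "p - 1"] r by simp
  then have "(1 + r) powr p = (1 + r) powr (p - 1) + r * (1 + r) powr (p - 1)" by (simp add: distrib_right)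
  ultimately show ?thesis by linarith
qed simp

text \<open>For large \<open>x\<close> the growth of the objective leaves
  \<open>exp (- (a * u)) * u\<close> with \<open>u = (1 + norm x) powr p\<close>, which is at most
  \<open>1 / a\<close>; elsewhere both factors are bounded.\<close>

lemma admissible_weight_decay:
  fixes \<E> :: "'h::real_normed_vector \<Rightarrow> real"
  assumes \<alpha>: "\<alpha> > 0" and p: "p \<ge> 1" and c: "c > 0" and R: "R > 0" and nn: "\<And>x. 0 \<le> \<E> x"
    and low: "\<And>x. norm x > R \<Longrightarrow> c * norm x powr p \<le> \<E> x"
  shows "\<exists>K\<ge>1. \<forall>x. exp (- \<alpha> * \<E> x) * (1 + norm x) powr p \<le> K"
proof -
  \<comment> \<open>The factor \<open>(1/2) powr p\<close> comes from
    \<open>(1 + norm x) / 2 \<le> norm x\<close>, valid once \<open>norm x\<close> is at least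
    1.\<close>
  define a where "a = \<alpha> * c * (1/2) powr p"
  have a: "a > 0" using \<alpha> c unfolding a_def by simp
  define K where "K = 1 + 1/a + (2 + R) powr p"
  have "exp (- \<alpha> * \<E> x) * (1 + norm x) powr p \<le> K" for x
  proof (cases "norm x > R + 1")
    case True
    define u where "u = (1 + norm x) powr p"
    have "(1/2) powr p * u = ((1 + norm x) / 2) powr p"
      unfolding u_def by (subst powr_mult[symmetric]) (auto simp: mult.commute)
    also have "\<dots> \<le> norm x powr p" using True R p by (intro powr_mono2) auto
    finally have "a * u \<le> \<alpha> * (c * norm x powr p)" unfolding a_def using \<alpha> c by (simp add: mult.assoc)
    also have "\<dots> \<le> \<alpha> * \<E> x" using low[of x] True \<alpha> by (intro mult_left_mono) auto
    finally have "exp (- \<alpha> * \<E> x) \<le> exp (- (a * u))" by simp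
    then have "exp (- \<alpha> * \<E> x) * u \<le> exp (- (a * u)) * u" unfolding u_def by (intro mult_right_mono) auto
    also have "\<dots> \<le> 1 / a"
    proof -
      have "a * u \<le> exp (a * u)" using exp_ge_add_one_self[of "a * u"] by linarith
      then show ?thesis using a by (simp add: exp_minus field_simps)
    qed
    also have "\<dots> \<le> K" unfolding K_def by simp
    finally show ?thesis unfolding u_def .
  next
    case False
    have "exp (- \<alpha> * \<E> x) * (1 + norm x) powr p \<le> 1 * (2 + R) powr p"
      using False nn[of x] \<alpha> p by (intro mult_mono powr_mono2) auto
    then show ?thesis unfolding K_def using a by (simp add: add_increasing)
  qed
  moreover have "K \<ge> 1" unfolding K_def using a by simp
  ultimately show ?thesis by blast
qed

text \<open>The decay of the weight absorbs the polynomial Lipschitz constant of the objective, so that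
  both integrands in the consensus point become bounded and globally Lipschitz.\<close>

lemma admissible_weight_lipschitz:
  fixes \<E> :: "'h::real_normed_vector \<Rightarrow> real"
  assumes \<alpha>: "\<alpha> > 0" and adm: "admissible_objective \<E>"
  defines "w \<equiv> \<lambda>x. exp (- \<alpha> * \<E> x)"
  shows "\<exists>B>0. (\<forall>x. norm (w x *\<^sub>R x) \<le> B) \<and> (\<forall>x y. \<bar>w x - w y\<bar> \<le> B * norm (x - y)) \<and>
    (\<forall>x y. norm (w x *\<^sub>R x - w y *\<^sub>R y) \<le> B * norm (x - y))"
proof -
  obtain p C c R L where *: "p \<ge> 1 \<and> C > 0 \<and> c > 0 \<and> R > 0 \<and> L > 0 \<and> (\<forall>x. 0 \<le> \<E> x) \<and>
      (\<forall>x. \<E> x \<le> C * (1 + norm x powr p)) \<and> (\<forall>x. norm x > R \<longrightarrow> c * norm x powr p \<le> \<E> x) \<and>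
      (\<forall>x y. \<bar>\<E> x - \<E> y\<bar> \<le> L * (1 + norm x powr (p - 1) + norm y powr (p - 1)) * norm (x - y))"
    using adm unfolding admissible_objective_def by (elim exE) (rule that)
  then have p: "p \<ge> 1" and pos: "C > 0" "c > 0" "R > 0" "L > 0" and nn: "\<And>x. 0 \<le> \<E> x"
    and low: "\<And>x. norm x > R \<Longrightarrow> c * norm x powr p \<le> \<E> x"
    and lip: "\<And>x y. \<bar>\<E> x - \<E> y\<bar> \<le> L * (1 + norm x powr (p - 1) + norm y powr (p - 1)) * norm (x - y)"
    by blast+
  obtain K where K: "K \<ge> 1" "\<And>x. w x * (1 + norm x) powr p \<le> K"
    using admissible_weight_decay[OF \<alpha> p pos(2,3) nn low] unfolding w_def by blast
  have w: "0 < w x" "w x \<le> 1" for x unfolding w_def using nn[of x] \<alpha> by auto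
  have ge1: "1 \<le> (1 + norm x) powr (p - 1)" for x :: 'h using p by (intro ge_one_powr_ge_zero) auto
  have prod: "(1 + norm x) powr (p - 1) * (1 + norm x) = (1 + norm x) powr p" for x :: 'h
    using powr_mult_base[of "1 + norm x" "p - 1"] by (simp add: mult.commute)
  have wp: "w x * (1 + norm x) powr (p - 1) * (1 + norm x) \<le> K" for x
    using K(2)[of x] prod[of x] by (simp add: mult.assoc)
  have fb: "norm (w x *\<^sub>R x) \<le> K" for x
  proof -
    have "norm (w x *\<^sub>R x) = w x * (1 * norm x)" using w(1)[of x] by simp
    also have "\<dots> \<le> w x * ((1 + norm x) powr (p - 1) * (1 + norm x))"
      using w(1)[of x] ge1[of x] by (intro mult_left_mono mult_mono) auto
    finally show ?thesis using wp[of x] by (simp add: mult.assoc)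
  qed
  define A where "A = 3 * \<alpha> * L"
  have A: "A > 0" using \<alpha> pos unfolding A_def by simp
  \<comment> \<open>\<open>A * K\<close> comes from the variation of the weight, 1 from the weight
    that multiplies \<open>x - y\<close>, and \<open>2 * K\<close> covers points at distance more
    than 1.\<close>
  define B where "B = A * K + 1 + 2 * K"
  \<comment> \<open>At distance at most 1 the polynomial Lipschitz factor of both points is at most
    \<open>3 * (1 + norm x) powr (p - 1)\<close>. Ordering the points by the objective expresses the
    loss through the larger weight \<open>w x\<close>, by
    \<open>exp (- t) \<ge> 1 - t\<close>.\<close>
  have close: "\<bar>w x - w y\<bar> \<le> A * (w x * (1 + norm x) powr (p - 1)) * norm (x - y)"
    if "norm (x - y) \<le> 1" "\<E> x \<le> \<E> y" for x y
  proof -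
    have ny: "norm y \<le> 1 + norm x" using that(1) norm_triangle_ineq2[of y x] by (simp add: norm_minus_commute)
    have "w y = w x * exp (- \<alpha> * (\<E> y - \<E> x))" unfolding w_def by (simp add: mult_exp_exp algebra_simps)
    moreover have "1 - \<alpha> * (\<E> y - \<E> x) \<le> exp (- \<alpha> * (\<E> y - \<E> x))"
      using exp_ge_add_one_self[of "- \<alpha> * (\<E> y - \<E> x)"] by simp
    ultimately have "w x * (1 - \<alpha> * (\<E> y - \<E> x)) \<le> w y" using w(1)[of x] by simp
    then have "w x - w y \<le> w x * (\<alpha> * (\<E> y - \<E> x))" by (simp add: right_diff_distrib)
    also have "\<dots> \<le> w x * (\<alpha> * (L * (3 * (1 + norm x) powr (p - 1)) * norm (x - y)))"
    proof (intro mult_left_mono)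
      have "norm x powr (p - 1) \<le> (1 + norm x) powr (p - 1)" "norm y powr (p - 1) \<le> (1 + norm x) powr (p - 1)"
        using p ny by (auto intro!: powr_mono2)
      then have "1 + norm x powr (p - 1) + norm y powr (p - 1) \<le> 3 * (1 + norm x) powr (p - 1)" using ge1[of x] by linarith
      then have "L * (1 + norm x powr (p - 1) + norm y powr (p - 1)) * norm (x - y) \<le> L * (3 * (1 + norm x) powr (p - 1)) * norm (x - y)"
        using pos by (intro mult_right_mono mult_left_mono) auto
      then show "\<E> y - \<E> x \<le> L * (3 * (1 + norm x) powr (p - 1)) * norm (x - y)" using lip[of x y] by linarith
    qed (use \<alpha> w(1)[of x] in auto)
    finally have "w x - w y \<le> A * (w x * (1 + norm x) powr (p - 1)) * norm (x - y)" unfolding A_def by (simp add: mult_ac)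
    moreover have "w y \<le> w x" unfolding w_def using that(2) \<alpha> by simp
    ultimately show ?thesis by simp
  qed
  have both: "\<bar>w x - w y\<bar> \<le> B * norm (x - y) \<and> norm (w x *\<^sub>R x - w y *\<^sub>R y) \<le> B * norm (x - y)"
    if "\<E> x \<le> \<E> y" for x y
  proof (cases "norm (x - y) \<le> 1")
    case True
    let ?n = "norm (x - y)"
    note cl = close[OF True that]
    have "w x * (1 + norm x) powr (p - 1) * 1 \<le> w x * (1 + norm x) powr (p - 1) * (1 + norm x)"
      using w(1)[of x] by (intro mult_left_mono) auto
    then have "w x * (1 + norm x) powr (p - 1) \<le> K" using wp[of x] by linarith
    then have "A * (w x * (1 + norm x) powr (p - 1)) * ?n \<le> (A * K) * ?n" using A by (intro mult_right_mono mult_left_mono) auto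
    also have "\<dots> \<le> B * ?n" unfolding B_def using K(1) by (intro mult_right_mono) auto
    finally have 1: "\<bar>w x - w y\<bar> \<le> B * ?n" using cl by linarith
    \<comment> \<open>Here \<open>x\<close> multiplies only the difference of the weights; with
      \<open>(1 + norm x) powr (p - 1)\<close> it makes up the power \<open>p\<close> that the
      weight absorbs.\<close>
    have "norm (w x *\<^sub>R x - w y *\<^sub>R y) = norm ((w x - w y) *\<^sub>R x + w y *\<^sub>R (x - y))"
      by (simp add: algebra_simps)
    also have "\<dots> \<le> \<bar>w x - w y\<bar> * norm x + w y * ?n"
      using norm_triangle_ineq[of "(w x - w y) *\<^sub>R x" "w y *\<^sub>R (x - y)"] w(1)[of y] by simp
    also have "\<bar>w x - w y\<bar> * norm x \<le> (A * (w x * (1 + norm x) powr (p - 1)) * ?n) * (1 + norm x)"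
      using cl by (intro mult_mono) auto
    also have "\<dots> = A * (w x * (1 + norm x) powr (p - 1) * (1 + norm x)) * ?n" by (simp add: mult_ac)
    also have "\<dots> \<le> A * K * ?n" using A wp[of x] by (intro mult_right_mono mult_left_mono) auto
    also have "A * K * ?n + w y * ?n \<le> A * K * ?n + 1 * ?n" using w(2)[of y] by (intro add_left_mono mult_right_mono) auto
    also have "\<dots> = (A * K + 1) * ?n" by (simp add: distrib_right)
    also have "\<dots> \<le> B * ?n" unfolding B_def using K(1) by (intro mult_right_mono) auto
    finally show ?thesis using 1 by simp
  next
    case False
    have AK: "0 \<le> A * K" using A K(1) by simp
    have "\<bar>w x - w y\<bar> \<le> 1" using w[of x] w[of y] by linarith
    also have "\<dots> \<le> 1 * norm (x - y)" using False by simp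
    also have "\<dots> \<le> B * norm (x - y)" unfolding B_def using K(1) AK by (intro mult_right_mono) auto
    finally have 1: "\<bar>w x - w y\<bar> \<le> B * norm (x - y)" .
    have "norm (w x *\<^sub>R x - w y *\<^sub>R y) \<le> norm (w x *\<^sub>R x) + norm (w y *\<^sub>R y)" by (rule norm_triangle_ineq4)
    also have "\<dots> \<le> K + K" by (intro add_mono fb)
    also have "\<dots> = 2 * K * 1" by simp
    also have "\<dots> \<le> B * norm (x - y)" unfolding B_def using K(1) AK False by (intro mult_mono) auto
    finally show ?thesis using 1 by simp
  qed
  have "\<bar>w x - w y\<bar> \<le> B * norm (x - y) \<and> norm (w x *\<^sub>R x - w y *\<^sub>R y) \<le> B * norm (x - y)" for x y
    using both[of x y] both[of y x] by (cases "\<E> x \<le> \<E> y") (auto simp: abs_minus_commute norm_minus_commute)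
  moreover have "norm (w x *\<^sub>R x) \<le> B" for x
  proof -
    have "K \<le> B" unfolding B_def using K(1) A by (simp add: add_increasing)
    then show ?thesis using fb[of x] by linarith
  qed
  moreover have "B > 0" unfolding B_def using A K(1) by (simp add: add_pos_pos)
  ultimately show ?thesis by blast
qed

text \<open>\<open>S\<close> is a bound for the second moment of a law. By the first inequality the normalisation of the
  consensus point is then at least \<open>\<kappa>\<close>; by the second the consensus point grows at most linearly in
  the root mean square, with a constant that does not depend on \<open>S\<close>.\<close>

lemma admissible_weight_growth:
  fixes \<E> :: "'h::real_normed_vector \<Rightarrow> real"
  assumes \<alpha>: "\<alpha> > 0" and adm: "admissible_objective \<E>"
  defines "w \<equiv> \<lambda>x. exp (- \<alpha> * \<E> x)"
  shows "\<exists>b>0. \<forall>S\<ge>0. \<exists>\<kappa>>0. (\<forall>x. 2 * \<kappa> * (1 - (norm x)\<^sup>2 / (2 * (S + 1))) \<le> w x) \<and>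
    (\<forall>x. norm (w x *\<^sub>R x) \<le> b * (1 + sqrt S) * w x + 2 * \<kappa> * norm x)"
proof -
  obtain p C c R L where *: "p \<ge> 1 \<and> C > 0 \<and> c > 0 \<and> R > 0 \<and> L > 0 \<and> (\<forall>x. 0 \<le> \<E> x) \<and>
      (\<forall>x. \<E> x \<le> C * (1 + norm x powr p)) \<and> (\<forall>x. norm x > R \<longrightarrow> c * norm x powr p \<le> \<E> x) \<and>
      (\<forall>x y. \<bar>\<E> x - \<E> y\<bar> \<le> L * (1 + norm x powr (p - 1) + norm y powr (p - 1)) * norm (x - y))"
    using adm unfolding admissible_objective_def by (elim exE) (rule that)
  then have p: "p \<ge> 1" and pos: "C > 0" "c > 0" "R > 0"
    and up: "\<And>x. \<E> x \<le> C * (1 + norm x powr p)"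
    and low: "\<And>x. norm x > R \<Longrightarrow> c * norm x powr p \<le> \<E> x"
    by blast+
  \<comment> \<open>Chosen so that \<open>b * (1 + sqrt S)\<close> dominates the radius
    \<open>R'\<close> below; the 3 comes from \<open>1 + r \<le> 3 * (1 + sqrt S)\<close>.\<close>
  define b where "b = R + 1 + 3 * (1 + C / c)"
  have "\<exists>\<kappa>>0. (\<forall>x. 2 * \<kappa> * (1 - (norm x)\<^sup>2 / (2 * (S + 1))) \<le> w x) \<and>
    (\<forall>x. norm (w x *\<^sub>R x) \<le> b * (1 + sqrt S) * w x + 2 * \<kappa> * norm x)" if S: "S \<ge> 0" for S
  proof -
    \<comment> \<open>By Chebyshev a law with second moment at most \<open>S\<close> has at least
      half of its mass in the ball of radius \<open>r\<close>.\<close>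
    define r where "r = sqrt (2 * (S + 1))"
    have r: "r > 0" "r\<^sup>2 = 2 * (S + 1)" using S unfolding r_def by auto
    have rle: "r \<le> 2 * (1 + sqrt S)"
    proof -
      have eq: "(2 * (1 + sqrt S))\<^sup>2 = 4 + 8 * sqrt S + 4 * S" using S by (simp add: power2_sum power_mult_distrib)
      have s: "0 \<le> sqrt S" using S by simp
      have "2 * (S + 1) \<le> 4 + 4 * S" using S by (simp add: distrib_left)
      also have "\<dots> \<le> (2 * (1 + sqrt S))\<^sup>2" unfolding eq using S by simp
      finally have "2 * (S + 1) \<le> (2 * (1 + sqrt S))\<^sup>2" .
      then show ?thesis unfolding r_def by (rule real_le_lsqrt[rotated]) (use s in simp)
    qed
    \<comment> \<open>Half of the smallest weight that the upper growth bound allows on the ball of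
      radius \<open>r\<close>.\<close>
    define \<kappa> where "\<kappa> = exp (- \<alpha> * (C * (1 + r powr p))) / 2"
    have \<kappa>: "\<kappa> > 0" unfolding \<kappa>_def by simp
    have "2 * \<kappa> * (1 - (norm x)\<^sup>2 / (2 * (S + 1))) \<le> w x" for x
    proof (cases "norm x \<le> r")
      case True
      then have "norm x powr p \<le> r powr p" using p by (intro powr_mono2) auto
      then have "C * (1 + norm x powr p) \<le> C * (1 + r powr p)" using pos by simp
      then have "\<E> x \<le> C * (1 + r powr p)" using up[of x] by linarith
      then have "2 * \<kappa> \<le> w x" unfolding \<kappa>_def w_def using \<alpha> by simp
      moreover have "2 * \<kappa> * (1 - (norm x)\<^sup>2 / (2 * (S + 1))) \<le> 2 * \<kappa> * 1"
        using \<kappa> S by (intro mult_left_mono) auto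
      ultimately show ?thesis by linarith
    next
      case False
      then have "r\<^sup>2 \<le> (norm x)\<^sup>2" using r by (intro power_mono) auto
      then have "1 - (norm x)\<^sup>2 / (2 * (S + 1)) \<le> 0" using r S by (simp add: field_simps)
      then have "2 * \<kappa> * (1 - (norm x)\<^sup>2 / (2 * (S + 1))) \<le> 0" using \<kappa> by (simp add: mult_nonneg_nonpos)
      then show ?thesis unfolding w_def by (meson exp_ge_zero order_trans)
    qed
    moreover have "norm (w x *\<^sub>R x) \<le> b * (1 + sqrt S) * w x + 2 * \<kappa> * norm x" for x
    proof -
      \<comment> \<open>Beyond \<open>R'\<close> the lower growth bound exceeds
        \<open>C * (1 + r powr p)\<close>, so the weight is at most \<open>2 * \<kappa>\<close>;
        within \<open>R'\<close> the factor \<open>norm x\<close> is bounded. The factor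
        \<open>1 + C / c\<close> compares the two growth bounds.\<close>
      define R' where "R' = R + 1 + (1 + C / c) * (1 + r)"
      have Cc: "1 \<le> 1 + C / c" using pos by simp
      have "1 + r \<le> 1 + 2 * (1 + sqrt S)" using rle by simp
      also have "\<dots> \<le> 3 * (1 + sqrt S)" using S by (simp add: distrib_left)
      finally have "(1 + C / c) * (1 + r) \<le> (1 + C / c) * (3 * (1 + sqrt S))"
        using Cc by (intro mult_left_mono) auto
      moreover have "(R + 1) * 1 \<le> (R + 1) * (1 + sqrt S)" using pos S by (intro mult_left_mono) auto
      moreover have "b * (1 + sqrt S) = (R + 1) * (1 + sqrt S) + (1 + C / c) * (3 * (1 + sqrt S))"
        unfolding b_def by (simp add: algebra_simps add_divide_distrib)
      ultimately have R'b: "R' \<le> b * (1 + sqrt S)"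
        unfolding R'_def using add_mono[of "(R + 1) * 1"] by (metis mult_1_right)
      have wx: "0 < w x" unfolding w_def by simp
      have bS: "0 \<le> b * (1 + sqrt S)" using R'b pos r Cc unfolding R'_def by (smt (verit) mult_nonneg_nonneg)
      show ?thesis
      proof (cases "norm x \<le> R'")
        case True
        have "norm (w x *\<^sub>R x) = norm x * w x" using wx by simp
        also have "\<dots> \<le> b * (1 + sqrt S) * w x" using True R'b wx by (intro mult_right_mono) auto
        finally show ?thesis using \<kappa> by (simp add: add_increasing2)
      next
        case False
        have xR: "norm x > R" using False pos Cc r unfolding R'_def by (smt (verit) mult_nonneg_nonneg)
        have "C * (1 + r powr p) \<le> C * (1 + r) powr p" using powr_super[of r p] r p pos by simp
        also have "\<dots> = c * ((C / c) * (1 + r) powr p)" using pos by simp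
        also have "\<dots> \<le> c * ((1 + C / c) powr p * (1 + r) powr p)"
        proof (intro mult_left_mono mult_right_mono)
          have "(1 + C / c) powr 1 \<le> (1 + C / c) powr p" using p Cc by (intro powr_mono) auto
          then show "C / c \<le> (1 + C / c) powr p" using Cc by simp
        qed (use pos in auto)
        also have "\<dots> = c * ((1 + C / c) * (1 + r)) powr p" using Cc r by (simp add: powr_mult)
        also have "\<dots> \<le> c * norm x powr p"
          using False pos Cc r p unfolding R'_def by (intro mult_left_mono powr_mono2) auto
        also have "\<dots> \<le> \<E> x" by (rule low[OF xR])
        finally have "w x \<le> 2 * \<kappa>" unfolding w_def \<kappa>_def using \<alpha> by simp
        then have "norm (w x *\<^sub>R x) \<le> 2 * \<kappa> * norm x" using wx by (simp add: mult_right_mono)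
        moreover have "0 \<le> b * (1 + sqrt S) * w x" using bS wx by simp
        ultimately show ?thesis by linarith
      qed
    qed
    ultimately show ?thesis using \<kappa> by blast
  qed
  moreover have "b > 0" unfolding b_def using pos by (simp add: add_pos_pos)
  ultimately show ?thesis by blast
qed

section \<open>Gronwall and the truncated consensus point\<close>

lemma exp_nn_integral_le:
  assumes "0 \<le> c" "0 < \<beta>" "0 \<le> t"
  shows "(\<integral>\<^sup>+s\<in>{0..t}. ennreal (c * exp (\<beta> * s)) \<partial>lborel) \<le> ennreal (c / \<beta> * exp (\<beta> * t))"
proof -
  have "(\<integral>\<^sup>+s\<in>{0..t}. ennreal (c * exp (\<beta> * s)) \<partial>lborel) = ennreal (c / \<beta> * exp (\<beta> * t) - c / \<beta> * exp (\<beta> * 0))"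
  proof (rule nn_integral_FTC_Icc)
    show "((\<lambda>s. c / \<beta> * exp (\<beta> * s)) has_real_derivative c * exp (\<beta> * x)) (at x)" for x
      using assms by (auto intro!: derivative_eq_intros)
  qed (use assms in auto)
  also have "\<dots> \<le> ennreal (c / \<beta> * exp (\<beta> * t))" using assms by (intro ennreal_leI) simp
  finally show ?thesis .
qed

text \<open>Gronwall's inequality without measurability, by looking at the supremum of
  \<open>exp (- 2 K t) y t\<close>; the supremum is finite because \<open>y\<close> is bounded.\<close>

lemma gronwall_nn:
  fixes y :: "real \<Rightarrow> ennreal"
  assumes K: "0 < K" and a: "0 \<le> a" and B: "B < \<infinity>" "\<And>t. t \<in> {0..T} \<Longrightarrow> y t \<le> B"
    and y: "\<And>t. t \<in> {0..T} \<Longrightarrow> y t \<le> ennreal a + ennreal K * (\<integral>\<^sup>+s\<in>{0..t}. y s \<partial>lborel)"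
    and t: "t \<in> {0..T}"
  shows "y t \<le> ennreal (2 * a * exp (2 * K * t))"
proof -
  \<comment> \<open>The rate \<open>2 * K\<close>, twice the constant of the inequality, makes the
    integral contribute only half of the supremum, which is then absorbed; the factor 2 in the
    conclusion is the price.\<close>
  define z where "z s = enn2real (y s) * exp (- 2 * K * s)" for s
  have yz: "y s = ennreal (z s * exp (2 * K * s))" if "s \<in> {0..T}" for s
  proof -
    have "y s < \<infinity>" using B(2)[OF that] B(1) by (rule order.strict_trans1)
    moreover have "z s * exp (2 * K * s) = enn2real (y s)" unfolding z_def by (simp add: mult.assoc mult_exp_exp)
    ultimately show ?thesis by (simp add: less_top)
  qed
  have z0: "0 \<le> z s" for s unfolding z_def by simp
  have zb: "z s \<le> enn2real B" if "s \<in> {0..T}" for s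
  proof -
    have "enn2real (y s) \<le> enn2real B" using B that by (intro enn2real_mono) auto
    moreover have "exp (- 2 * K * s) \<le> 1" using K that by simp
    ultimately have "z s \<le> enn2real B * 1" unfolding z_def by (intro mult_mono) auto
    then show ?thesis by simp
  qed
  define A where "A = (SUP s\<in>{0..T}. z s)"
  have bdd: "bdd_above (z ` {0..T})" by (rule bdd_aboveI[of _ "enn2real B"]) (use zb in auto)
  have zA: "z s \<le> A" if "s \<in> {0..T}" for s unfolding A_def by (rule cSUP_upper[OF that bdd])
  have A0: "0 \<le> A" using zA[OF t] z0[of t] by linarith
  have step: "z s \<le> a + A / 2" if s: "s \<in> {0..T}" for s
  proof -
    have "(\<integral>\<^sup>+r\<in>{0..s}. y r \<partial>lborel) \<le> (\<integral>\<^sup>+r\<in>{0..s}. ennreal (A * exp (2 * K * r)) \<partial>lborel)"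
    proof (rule nn_integral_mono)
      fix r :: real
      show "y r * indicator {0..s} r \<le> ennreal (A * exp (2 * K * r)) * indicator {0..s} r"
      proof (cases "r \<in> {0..s}")
        case True
        then have "r \<in> {0..T}" using s by auto
        then show ?thesis unfolding yz[OF \<open>r \<in> {0..T}\<close>] using zA by (intro mult_right_mono ennreal_leI) auto
      qed simp
    qed
    also have "\<dots> \<le> ennreal (A / (2 * K) * exp (2 * K * s))"
      by (rule exp_nn_integral_le) (use A0 K s in auto)
    finally have "y s \<le> ennreal a + ennreal K * ennreal (A / (2 * K) * exp (2 * K * s))"
      using y[OF s] by (meson add_left_mono mult_left_mono order_trans zero_le)
    also have "\<dots> = ennreal (a + A / 2 * exp (2 * K * s))"
      using a A0 K by (simp add: ennreal_plus[symmetric] ennreal_mult[symmetric] del: ennreal_plus)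
    finally have "ennreal (z s * exp (2 * K * s)) \<le> ennreal (a + A / 2 * exp (2 * K * s))" unfolding yz[OF s] .
    then have "z s * exp (2 * K * s) \<le> a + A / 2 * exp (2 * K * s)"
      by (subst (asm) ennreal_le_iff) (use a A0 in auto)
    also have "\<dots> \<le> a * exp (2 * K * s) + A / 2 * exp (2 * K * s)"
      using a K s by (intro add_right_mono) (simp add: mult_left_le[of _ a, simplified] mult_le_cancel_left1)
    also have "\<dots> = (a + A / 2) * exp (2 * K * s)" by (simp add: distrib_right)
    finally show ?thesis by simp
  qed
  have "A \<le> a + A / 2" unfolding A_def by (rule cSUP_least) (use t step A_def in auto)
  then have "A \<le> 2 * a" by linarith
  then have "z t * exp (2 * K * t) \<le> 2 * a * exp (2 * K * t)" using zA[OF t] by (intro mult_right_mono) auto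
  then show ?thesis unfolding yz[OF t] by (rule ennreal_leI)
qed

lemma lipschitz_measurable:
  fixes \<phi> :: "'h::real_normed_vector \<Rightarrow> 'b::real_normed_vector"
  assumes "\<And>x y. norm (\<phi> x - \<phi> y) \<le> C * norm (x - y)" "0 \<le> C"
  shows "continuous_on UNIV \<phi>" "\<phi> \<in> borel_measurable borel"
proof -
  have "C-lipschitz_on UNIV \<phi>" by (rule lipschitz_onI) (use assms in \<open>auto simp: dist_norm\<close>)
  then show "continuous_on UNIV \<phi>" by (rule lipschitz_on_continuous_on)
  then show "\<phi> \<in> borel_measurable borel" by (rule borel_measurable_continuous_onI)
qed

context prob_space
begin

text \<open>Jensen's inequality for the square, as Cauchy--Schwarz against the constant 1.\<close>

lemma expectation_square_le:
  assumes Z: "integrable M Z" and nn: "\<And>\<omega>. 0 \<le> Z \<omega>"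
  shows "ennreal ((expectation Z)\<^sup>2) \<le> (\<integral>\<^sup>+\<omega>. ennreal ((Z \<omega>)\<^sup>2) \<partial>M)"
proof -
  have [measurable]: "Z \<in> borel_measurable M" using Z by simp
  have e: "ennreal (expectation Z) = (\<integral>\<^sup>+\<omega>. ennreal (Z \<omega>) \<partial>M)"
    by (rule nn_integral_eq_integral[symmetric]) (use Z nn in auto)
  have "ennreal ((expectation Z)\<^sup>2) = (\<integral>\<^sup>+\<omega>. ennreal (Z \<omega>) * 1 \<partial>M)\<^sup>2"
    using e nn by (simp add: ennreal_power[symmetric] integral_nonneg)
  also have "\<dots> \<le> (\<integral>\<^sup>+\<omega>. (ennreal (Z \<omega>))\<^sup>2 \<partial>M) * (\<integral>\<^sup>+\<omega>. 1\<^sup>2 \<partial>M)"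
    by (rule Cauchy_Schwarz_nn_integral) measurable
  also have "\<dots> = (\<integral>\<^sup>+\<omega>. ennreal ((Z \<omega>)\<^sup>2) \<partial>M)"
    using nn by (simp add: emeasure_space_1 ennreal_power)
  finally show ?thesis .
qed

lemma integrable_bounded:
  fixes f :: "'a \<Rightarrow> 'b::{banach, second_countable_topology}"
  assumes "f \<in> borel_measurable M" "\<And>\<omega>. norm (f \<omega>) \<le> C" shows "integrable M f"
  by (rule integrable_const_bound[where B=C]) (use assms in auto)

lemma mean_lipschitz:
  fixes \<phi> :: "'h::{real_normed_vector, second_countable_topology} \<Rightarrow> 'b::{banach, second_countable_topology}"
  assumes lip: "\<And>x y. norm (\<phi> x - \<phi> y) \<le> C * norm (x - y)" and C: "0 \<le> C" and bnd: "\<And>x. norm (\<phi> x) \<le> C'"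
    and [measurable]: "X \<in> borel_measurable M" "Y \<in> borel_measurable M"
  shows "ennreal ((norm (expectation (\<lambda>\<omega>. \<phi> (X \<omega>)) - expectation (\<lambda>\<omega>. \<phi> (Y \<omega>))))\<^sup>2) \<le>
    ennreal (C\<^sup>2) * (\<integral>\<^sup>+\<omega>. ennreal ((norm (X \<omega> - Y \<omega>))\<^sup>2) \<partial>M)"
proof -
  have [measurable]: "\<phi> \<in> borel_measurable borel" by (rule lipschitz_measurable(2)[OF lip C])
  have i: "integrable M (\<lambda>\<omega>. \<phi> (X \<omega>))" "integrable M (\<lambda>\<omega>. \<phi> (Y \<omega>))"
    by (rule integrable_bounded[OF _ bnd]; measurable)+
  have iZ: "integrable M (\<lambda>\<omega>. norm (\<phi> (X \<omega>) - \<phi> (Y \<omega>)))" using i by simp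
  have "norm (expectation (\<lambda>\<omega>. \<phi> (X \<omega>)) - expectation (\<lambda>\<omega>. \<phi> (Y \<omega>))) \<le> expectation (\<lambda>\<omega>. norm (\<phi> (X \<omega>) - \<phi> (Y \<omega>)))"
    using integral_norm_bound[of M "\<lambda>\<omega>. \<phi> (X \<omega>) - \<phi> (Y \<omega>)"] i by simp
  then have "ennreal ((norm (expectation (\<lambda>\<omega>. \<phi> (X \<omega>)) - expectation (\<lambda>\<omega>. \<phi> (Y \<omega>))))\<^sup>2) \<le>
      ennreal ((expectation (\<lambda>\<omega>. norm (\<phi> (X \<omega>) - \<phi> (Y \<omega>))))\<^sup>2)"
    by (intro ennreal_leI power_mono) auto
  also have "\<dots> \<le> (\<integral>\<^sup>+\<omega>. ennreal ((norm (\<phi> (X \<omega>) - \<phi> (Y \<omega>)))\<^sup>2) \<partial>M)"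
    by (rule expectation_square_le[OF iZ]) simp
  also have "\<dots> \<le> (\<integral>\<^sup>+\<omega>. ennreal (C\<^sup>2) * ennreal ((norm (X \<omega> - Y \<omega>))\<^sup>2) \<partial>M)"
  proof (rule nn_integral_mono)
    fix \<omega>
    have "(norm (\<phi> (X \<omega>) - \<phi> (Y \<omega>)))\<^sup>2 \<le> C\<^sup>2 * (norm (X \<omega> - Y \<omega>))\<^sup>2"
      unfolding power_mult_distrib[symmetric] using lip by (intro power_mono) auto
    then show "ennreal ((norm (\<phi> (X \<omega>) - \<phi> (Y \<omega>)))\<^sup>2) \<le> ennreal (C\<^sup>2) * ennreal ((norm (X \<omega> - Y \<omega>))\<^sup>2)"
      unfolding ennreal_mult[symmetric, OF zero_le_power2 zero_le_power2] by (rule ennreal_leI)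
  qed
  also have "\<dots> = ennreal (C\<^sup>2) * (\<integral>\<^sup>+\<omega>. ennreal ((norm (X \<omega> - Y \<omega>))\<^sup>2) \<partial>M)"
    by (rule nn_integral_cmult) measurable
  finally show ?thesis .
qed

text \<open>Boundedness of \<open>\<phi>\<close> provides the dominating function. This covers
  arbitrary solutions as well, whose second moments are not known to be bounded in time.\<close>

lemma mean_continuous:
  fixes \<phi> :: "'h::{real_normed_vector, second_countable_topology} \<Rightarrow> 'b::{banach, second_countable_topology}"
  and S :: "real set"
  assumes \<phi>: "continuous_on UNIV \<phi>" and bnd: "\<And>x. norm (\<phi> x) \<le> C"
    and X: "\<And>t. t \<in> S \<Longrightarrow> X t \<in> borel_measurable M" and cont: "\<And>\<omega>. continuous_on S (\<lambda>t. X t \<omega>)"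
  shows "continuous_on S (\<lambda>t. expectation (\<lambda>\<omega>. \<phi> (X t \<omega>)))"
proof (rule continuous_on_sequentiallyI)
  fix u a assume u: "\<forall>n. u n \<in> S" and a: "a \<in> S" and lim: "u \<longlonglongrightarrow> a"
  have [measurable]: "\<phi> \<in> borel_measurable borel" by (rule borel_measurable_continuous_onI[OF \<phi>])
  have [measurable]: "X (u n) \<in> borel_measurable M" "X a \<in> borel_measurable M" for n using X u a by auto
  show "(\<lambda>n. expectation (\<lambda>\<omega>. \<phi> (X (u n) \<omega>))) \<longlonglongrightarrow> expectation (\<lambda>\<omega>. \<phi> (X a \<omega>))"
  proof (rule integral_dominated_convergence[where w="\<lambda>_. C"])
    show "AE \<omega> in M. (\<lambda>n. \<phi> (X (u n) \<omega>)) \<longlonglongrightarrow> \<phi> (X a \<omega>)"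
    proof (rule AE_I2)
      fix \<omega>
      have "(\<lambda>n. X (u n) \<omega>) \<longlonglongrightarrow> X a \<omega>"
        by (rule continuous_on_tendsto_compose[OF cont lim a always_eventually]) (use u in blast)
      then show "(\<lambda>n. \<phi> (X (u n) \<omega>)) \<longlonglongrightarrow> \<phi> (X a \<omega>)"
        by (rule continuous_on_tendsto_compose[OF \<phi>]) auto
    qed
  qed (use bnd in auto)
qed

end

section \<open>The consensus point along a process\<close>

locale cbo = ito e Q M F W T P
  for e :: "nat \<Rightarrow> 'h::{real_inner, banach, second_countable_topology}" and Q and M :: "'w measure" and F W T P +
  fixes \<E> :: "'h \<Rightarrow> real" and \<alpha> lam \<sigma> :: real and \<xi> :: "'w \<Rightarrow> 'h"
  assumes \<alpha>_pos: "\<alpha> > 0" and admissible: "admissible_objective \<E>"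
    and \<xi>_measurable: "\<xi> \<in> borel_measurable (F 0)" and \<xi>_square: "integrable M (\<lambda>\<omega>. (norm (\<xi> \<omega>))\<^sup>2)"
begin

definition wt :: "'h \<Rightarrow> real" where "wt x = exp (- \<alpha> * \<E> x)"

definition wB :: real where
  "wB = (SOME B. B > 0 \<and> (\<forall>x. norm (wt x *\<^sub>R x) \<le> B) \<and> (\<forall>x y. \<bar>wt x - wt y\<bar> \<le> B * norm (x - y)) \<and>
    (\<forall>x y. norm (wt x *\<^sub>R x - wt y *\<^sub>R y) \<le> B * norm (x - y)))"

lemma wB: "wB > 0" "norm (wt x *\<^sub>R x) \<le> wB" "norm (wt x - wt y) \<le> wB * norm (x - y)"
  "norm (wt x *\<^sub>R x - wt y *\<^sub>R y) \<le> wB * norm (x - y)"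
  using someI_ex[OF admissible_weight_lipschitz[OF \<alpha>_pos admissible, folded wt_def], folded wB_def] by auto

lemma wt_pos: "0 < wt x" by (simp add: wt_def)

lemma wt_le_1: "norm (wt x) \<le> 1"
proof -
  have "0 \<le> \<E> x" using admissible unfolding admissible_objective_def by (elim exE conjE) (erule spec)
  then show ?thesis using \<alpha>_pos by (simp add: wt_def)
qed

lemma wt_measurable [measurable]: "wt \<in> borel_measurable borel"
  using wB(1) by (intro lipschitz_measurable(2)[OF wB(3)]) simp

definition wbar :: "(real \<Rightarrow> 'w \<Rightarrow> 'h) \<Rightarrow> real \<Rightarrow> real" where
  "wbar X t = expectation (\<lambda>\<omega>. wt (X t \<omega>))"

definition fbar :: "(real \<Rightarrow> 'w \<Rightarrow> 'h) \<Rightarrow> real \<Rightarrow> 'h" where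
  "fbar X t = expectation (\<lambda>\<omega>. wt (X t \<omega>) *\<^sub>R X t \<omega>)"

text \<open>The consensus point with its normalisation bounded below by \<open>\<delta>\<close>.\<close>

definition cons :: "real \<Rightarrow> (real \<Rightarrow> 'w \<Rightarrow> 'h) \<Rightarrow> real \<Rightarrow> 'h" where
  "cons \<delta> X t = fbar X t /\<^sub>R max (wbar X t) \<delta>"

definition msq :: "(real \<Rightarrow> 'w \<Rightarrow> 'h) \<Rightarrow> real \<Rightarrow> ennreal" where
  "msq X t = (\<integral>\<^sup>+\<omega>. ennreal ((norm (X t \<omega>))\<^sup>2) \<partial>M)"

lemma integrable_wt:
  assumes [measurable]: "X \<in> borel_measurable M"
  shows "integrable M (\<lambda>\<omega>. wt (X \<omega>))" "integrable M (\<lambda>\<omega>. wt (X \<omega>) *\<^sub>R X \<omega>)"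
  by (rule integrable_bounded[OF _ wt_le_1], measurable) (rule integrable_bounded[OF _ wB(2)], measurable)

lemma consensus_point_eq:
  assumes [measurable]: "X t \<in> borel_measurable M"
  shows "consensus_point \<alpha> \<E> (distr M borel (X t)) = fbar X t /\<^sub>R wbar X t"
  unfolding consensus_point_def fbar_def wbar_def wt_def[symmetric]
  by (subst (1 2) integral_distr) auto

lemma fbar_bound: "X t \<in> borel_measurable M \<Longrightarrow> norm (fbar X t) \<le> wB"
proof -
  assume m: "X t \<in> borel_measurable M"
  have "norm (fbar X t) \<le> expectation (\<lambda>\<omega>. norm (wt (X t \<omega>) *\<^sub>R X t \<omega>))"
    unfolding fbar_def by (rule integral_norm_bound)
  also have "\<dots> \<le> expectation (\<lambda>\<omega>. wB)"
    by (rule integral_mono[OF integrable_norm[OF integrable_wt(2)[OF m]] _ wB(2)]) simp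
  finally show ?thesis by (simp add: prob_space)
qed

lemma wbar_pos: "X t \<in> borel_measurable M \<Longrightarrow> 0 < wbar X t"
proof -
  assume m: "X t \<in> borel_measurable M"
  have i: "integrable M (\<lambda>\<omega>. wt (X t \<omega>))" by (rule integrable_wt(1)[OF m])
  have "wbar X t \<noteq> 0"
  proof
    assume "wbar X t = 0"
    then have "AE \<omega> in M. wt (X t \<omega>) = 0"
      using integral_nonneg_eq_0_iff_AE[OF i] wt_pos unfolding wbar_def by (auto simp: less_imp_le)
    then have "AE \<omega> in M. False" by eventually_elim (use wt_pos in \<open>auto simp: less_le\<close>)
    then show False by simp
  qed
  moreover have "0 \<le> wbar X t" unfolding wbar_def using wt_pos by (intro Bochner_Integration.integral_nonneg) (auto simp: less_imp_le)
  ultimately show ?thesis by simp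
qed

text \<open>A difference of quotients splits into a change of numerator, divided by at least
  \<open>\<delta>\<close>, and a change of normalisation, divided by the square of
  \<open>\<delta>\<close> and multiplied by a numerator of size at most \<open>wB\<close>. Both
  changes are at most \<open>wB\<close> times the root of the second-moment distance.\<close>

lemma cons_lipschitz:
  assumes \<delta>: "\<delta> > 0" and X: "X t \<in> borel_measurable M" and Y: "Y t \<in> borel_measurable M"
  shows "ennreal ((norm (cons \<delta> X t - cons \<delta> Y t))\<^sup>2) \<le>
    ennreal (2 * wB\<^sup>2 / \<delta>\<^sup>2 + 2 * wB^4 / \<delta>^4) * msq (\<lambda>t \<omega>. X t \<omega> - Y t \<omega>) t"
proof (cases "msq (\<lambda>t \<omega>. X t \<omega> - Y t \<omega>) t = \<infinity>")
  \<comment> \<open>For an infinite distance the claim rests on the constant being positive, since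
    \<open>0 * \<infinity> = 0\<close> in \<open>ennreal\<close>.\<close>
  case True
  define c where "c = 2 * wB\<^sup>2 / \<delta>\<^sup>2 + 2 * wB^4 / \<delta>^4"
  have "0 < c" unfolding c_def using wB(1) \<delta> by (intro add_pos_pos) auto
  then have "ennreal c * \<infinity> = \<infinity>" by (simp add: ennreal_mult_eq_top_iff)
  then show ?thesis unfolding True c_def[symmetric] by simp
next
  case False
  define d where "d = enn2real (msq (\<lambda>t \<omega>. X t \<omega> - Y t \<omega>) t)"
  have d: "msq (\<lambda>t \<omega>. X t \<omega> - Y t \<omega>) t = ennreal d" "0 \<le> d" using False unfolding d_def by (auto simp: less_top)
  define a b where "a = max (wbar X t) \<delta>" and "b = max (wbar Y t) \<delta>"
  have ab: "\<delta> \<le> a" "\<delta> \<le> b" unfolding a_def b_def by auto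
  have "ennreal ((norm (fbar X t - fbar Y t))\<^sup>2) \<le> ennreal (wB\<^sup>2 * d)"
    using mean_lipschitz[OF wB(4) less_imp_le[OF wB(1)] wB(2) X Y] d
    unfolding fbar_def msq_def by (simp add: ennreal_mult)
  then have f: "(norm (fbar X t - fbar Y t))\<^sup>2 \<le> wB\<^sup>2 * d" using d by (subst (asm) ennreal_le_iff) auto
  have "ennreal ((norm (wbar X t - wbar Y t))\<^sup>2) \<le> ennreal (wB\<^sup>2 * d)"
    using mean_lipschitz[OF wB(3) less_imp_le[OF wB(1)] wt_le_1 X Y] d
    unfolding wbar_def msq_def by (simp add: ennreal_mult)
  then have "(norm (wbar X t - wbar Y t))\<^sup>2 \<le> wB\<^sup>2 * d" using d by (subst (asm) ennreal_le_iff) auto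
  \<comment> \<open>The maximum with \<open>\<delta>\<close> does not increase distances.\<close>
  moreover have "(b - a)\<^sup>2 \<le> (norm (wbar X t - wbar Y t))\<^sup>2"
    unfolding a_def b_def by (subst abs_le_square_iff[symmetric]) auto
  ultimately have g: "(b - a)\<^sup>2 \<le> wB\<^sup>2 * d" by linarith
  have pos: "0 < a" "0 < b" using ab \<delta> by auto
  have eq: "cons \<delta> X t - cons \<delta> Y t = (1 / a) *\<^sub>R (fbar X t - fbar Y t) + ((b - a) / (a * b)) *\<^sub>R fbar Y t"
  proof -
    have "(b - a) / (a * b) = 1 / a - 1 / b" using pos by (simp add: field_simps)
    then show ?thesis unfolding cons_def a_def[symmetric] b_def[symmetric]
      by (simp add: scaleR_diff_right scaleR_diff_left inverse_eq_divide)
  qed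
  have "(norm (cons \<delta> X t - cons \<delta> Y t))\<^sup>2 \<le>
      2 * (norm ((1 / a) *\<^sub>R (fbar X t - fbar Y t)))\<^sup>2 + 2 * (norm (((b - a) / (a * b)) *\<^sub>R fbar Y t))\<^sup>2"
    unfolding eq by (rule norm_add_square_le)
  also have "(norm ((1 / a) *\<^sub>R (fbar X t - fbar Y t)))\<^sup>2 \<le> wB\<^sup>2 * d / \<delta>\<^sup>2"
  proof -
    have "(norm ((1 / a) *\<^sub>R (fbar X t - fbar Y t)))\<^sup>2 = (norm (fbar X t - fbar Y t))\<^sup>2 / a\<^sup>2"
      by (simp add: power_divide)
    also have "\<dots> \<le> wB\<^sup>2 * d / \<delta>\<^sup>2" using f ab \<delta> d(2) by (intro frac_le power_mono) auto
    finally show ?thesis .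
  qed
  also have "(norm (((b - a) / (a * b)) *\<^sub>R fbar Y t))\<^sup>2 \<le> wB^4 * d / \<delta>^4"
  proof -
    have "(norm (((b - a) / (a * b)) *\<^sub>R fbar Y t))\<^sup>2 = ((b - a)\<^sup>2 * (norm (fbar Y t))\<^sup>2) / (a * b)\<^sup>2"
      by (simp add: power_mult_distrib power_divide abs_mult)
    also have "\<dots> \<le> (wB\<^sup>2 * d * wB\<^sup>2) / (\<delta> * \<delta>)\<^sup>2"
      using g ab \<delta> d fbar_bound[of Y t, OF Y] wB(1) by (intro frac_le mult_mono power_mono) auto
    also have "\<dots> = wB^4 * d / \<delta>^4" by (simp add: power2_eq_square power4_eq_xxxx mult_ac)
    finally show ?thesis .
  qed
  finally have "(norm (cons \<delta> X t - cons \<delta> Y t))\<^sup>2 \<le> (2 * wB\<^sup>2 / \<delta>\<^sup>2 + 2 * wB^4 / \<delta>^4) * d"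
    by (simp add: distrib_right)
  then have "ennreal ((norm (cons \<delta> X t - cons \<delta> Y t))\<^sup>2) \<le> ennreal ((2 * wB\<^sup>2 / \<delta>\<^sup>2 + 2 * wB^4 / \<delta>^4) * d)" by (rule ennreal_leI)
  then show ?thesis unfolding d(1) using d(2) by (simp add: ennreal_mult)
qed

lemma means_continuous:
  assumes X: "cont_adapted X"
  shows "continuous_on {0..T} (wbar X)" "continuous_on {0..T} (fbar X)"
proof -
  have c: "continuous_on UNIV wt" "continuous_on UNIV (\<lambda>x. wt x *\<^sub>R x)"
    by (rule lipschitz_measurable(1)[OF wB(3) less_imp_le[OF wB(1)]], rule lipschitz_measurable(1)[OF wB(4) less_imp_le[OF wB(1)]])
  show "continuous_on {0..T} (wbar X)"
    unfolding wbar_def using mean_continuous[OF c(1) wt_le_1 cont_adaptedD(3)[OF X] cont_adaptedD(1)[OF X]] .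
  show "continuous_on {0..T} (fbar X)"
    unfolding fbar_def using mean_continuous[OF c(2) wB(2) cont_adaptedD(3)[OF X] cont_adaptedD(1)[OF X]] .
qed

lemma cons_continuous:
  assumes X: "cont_adapted X" and \<delta>: "\<delta> > 0"
  shows "continuous_on {0..T} (cons \<delta> X)"
proof -
  have "max (wbar X t) \<delta> \<noteq> 0" for t using \<delta> by (simp add: max_def)
  then show ?thesis
    unfolding cons_def using means_continuous[OF X] by (intro continuous_intros) auto
qed

lemma det_cont_adapted:
  assumes "continuous_on {0..T} u" shows "cont_adapted (\<lambda>t \<omega>. u t)"
  using assms unfolding cont_adapted_def by simp

lemma sup_sq_finite:
  assumes "cont_adapted X" shows "sup_sq T X \<omega> < \<infinity>"
proof -
  have "compact ((\<lambda>t. X t \<omega>) ` {0..T})"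
    by (rule compact_continuous_image[OF cont_adaptedD(1)[OF assms] compact_Icc])
  then have "bounded ((\<lambda>t. X t \<omega>) ` {0..T})" by (rule compact_imp_bounded)
  then obtain B where "\<forall>x\<in>(\<lambda>t. X t \<omega>) ` {0..T}. norm x \<le> B" unfolding bounded_iff ..
  then have B: "\<And>t. t \<in> {0..T} \<Longrightarrow> norm (X t \<omega>) \<le> B" by simp
  have "sup_sq T X \<omega> \<le> ennreal (B\<^sup>2)"
    by (rule sup_sq_least, rule ennreal_leI, rule power_mono[OF B]) auto
  then show ?thesis by (rule order.strict_trans1) simp
qed

lemma det_E2_finite:
  assumes "continuous_on {0..T} u" shows "E2 T (\<lambda>t \<omega>. u t) < \<infinity>"
proof -
  have "bounded (u ` {0..T})" by (intro compact_imp_bounded compact_continuous_image assms compact_Icc)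
  then obtain B where "\<forall>x\<in>u ` {0..T}. norm x \<le> B" unfolding bounded_iff ..
  then have B: "\<And>t. t \<in> {0..T} \<Longrightarrow> norm (u t) \<le> B" by simp
  have "E2 T (\<lambda>t \<omega>. u t) \<le> (\<integral>\<^sup>+\<omega>. ennreal (B\<^sup>2) \<partial>M)"
    unfolding E2_def by (rule nn_integral_mono, rule sup_sq_least, rule ennreal_leI, rule power_mono[OF B]) auto
  also have "\<dots> < \<infinity>" by (simp add: emeasure_space_1)
  finally show ?thesis .
qed

text \<open>The space of adapted elements of \<open>L\<^sup>2(\<Omega>; C([0,T]; H))\<close>, in
  which the Picard iteration runs.\<close>

definition good :: "(real \<Rightarrow> 'w \<Rightarrow> 'h) \<Rightarrow> bool" where
  "good X \<longleftrightarrow> cont_adapted X \<and> E2 T X < \<infinity>"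

lemma good_add: "good X \<Longrightarrow> good Y \<Longrightarrow> good (\<lambda>t \<omega>. X t \<omega> + Y t \<omega>)"
proof -
  assume XY: "good X" "good Y"
  have "E2 T (\<lambda>t \<omega>. X t \<omega> + Y t \<omega>) \<le> 2 * E2 T X + 2 * E2 T Y"
    using XY unfolding good_def by (intro E2_add_le T_nonneg) auto
  also have "\<dots> < \<infinity>" using XY unfolding good_def by (simp add: ennreal_mult_less_top)
  finally show ?thesis using XY cont_adapted_add unfolding good_def by blast
qed

lemma cont_adapted_scale: "cont_adapted X \<Longrightarrow> cont_adapted (\<lambda>t \<omega>. c *\<^sub>R X t \<omega>)"
  unfolding cont_adapted_def by (auto intro!: continuous_intros borel_measurable_scaleR)

lemma E2_scale: "cont_adapted X \<Longrightarrow> 0 \<le> t \<Longrightarrow> t \<le> T \<Longrightarrow> E2 t (\<lambda>t \<omega>. c *\<^sub>R X t \<omega>) = ennreal (c\<^sup>2) * E2 t X"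
proof -
  assume X: "cont_adapted X" and t: "0 \<le> t" "t \<le> T"
  have "sup_sq t (\<lambda>t \<omega>. c *\<^sub>R X t \<omega>) \<omega> = ennreal (c\<^sup>2) * sup_sq t X \<omega>" for \<omega>
    unfolding sup_sq_def SUP_mult_left_ennreal by (simp add: power_mult_distrib ennreal_mult)
  then have "E2 t (\<lambda>t \<omega>. c *\<^sub>R X t \<omega>) = (\<integral>\<^sup>+\<omega>. ennreal (c\<^sup>2) * sup_sq t X \<omega> \<partial>M)"
    unfolding E2_def by (intro nn_integral_cong)
  also have "\<dots> = ennreal (c\<^sup>2) * E2 t X"
    unfolding E2_def by (rule nn_integral_cmult[OF sup_sq_measurable[OF X t]])
  finally show ?thesis .
qed

lemma good_scale: "good X \<Longrightarrow> good (\<lambda>t \<omega>. c *\<^sub>R X t \<omega>)"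
  unfolding good_def using cont_adapted_scale[of X c] E2_scale[of X T c] T_nonneg by (simp add: ennreal_mult_less_top)

lemma good_det: "continuous_on {0..T} u \<Longrightarrow> good (\<lambda>t \<omega>. u t)"
  unfolding good_def using det_cont_adapted det_E2_finite by blast

lemma good_diff: "good X \<Longrightarrow> good Y \<Longrightarrow> good (\<lambda>t \<omega>. X t \<omega> - Y t \<omega>)"
  using good_add[of X "\<lambda>t \<omega>. (-1) *\<^sub>R Y t \<omega>"] good_scale[of Y "-1"] by simp

lemma good_initial: "good (\<lambda>t. \<xi>)"
proof -
  have c: "cont_adapted (\<lambda>t. \<xi>)" unfolding cont_adapted_def using F_mono[OF \<xi>_measurable] by auto
  have "sup_sq T (\<lambda>t. \<xi>) \<omega> \<le> ennreal ((norm (\<xi> \<omega>))\<^sup>2)" for \<omega> by (rule sup_sq_least) simp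
  then have "E2 T (\<lambda>t. \<xi>) \<le> (\<integral>\<^sup>+\<omega>. ennreal ((norm (\<xi> \<omega>))\<^sup>2) \<partial>M)" unfolding E2_def by (rule nn_integral_mono)
  also have "\<dots> < \<infinity>" using \<xi>_square by (simp add: nn_integral_eq_integral)
  finally show ?thesis using c unfolding good_def by blast
qed

lemma scaled_norm_left_cont:
  assumes Z: "cont_adapted Z" shows "left_cont_adapted (\<lambda>s \<omega>. c * norm (Z s \<omega>))"
  unfolding left_cont_adapted_def
proof (intro conjI allI ballI)
  show "left_limit_on T (\<lambda>t. c * norm (Z t \<omega>))" for \<omega>
    by (intro left_limit_on_continuous continuous_intros cont_adaptedD(1)[OF Z])
  show "(\<lambda>\<omega>. c * norm (Z t \<omega>)) \<in> borel_measurable (F t)" if "t \<in> {0..T}" for t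
    using cont_adaptedD(2)[OF Z that] by measurable
qed

lemma scaled_norm_dominated:
  assumes Z: "good Z" shows "square_dominated (\<lambda>s \<omega>. c * norm (Z s \<omega>))"
proof -
  have Zc: "cont_adapted Z" and fin: "E2 T Z < \<infinity>" using Z unfolding good_def by auto
  note [measurable] = sup_sq_measurable[OF Zc T_nonneg order_refl]
  define G where "G \<omega> = \<bar>c\<bar> * sqrt (enn2real (sup_sq T Z \<omega>))" for \<omega>
  have G2: "ennreal ((G \<omega>)\<^sup>2) = ennreal (c\<^sup>2) * sup_sq T Z \<omega>" for \<omega>
    unfolding G_def using sup_sq_finite[OF Zc, of \<omega>] by (simp add: power_mult_distrib ennreal_mult less_top)
  have "\<bar>c * norm (Z s \<omega>)\<bar> \<le> G \<omega>" if "s \<in> {0..T}" for s \<omega>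
  proof -
    have "ennreal ((norm (Z s \<omega>))\<^sup>2) \<le> ennreal (enn2real (sup_sq T Z \<omega>))"
      using sup_sq_upper[OF that, of Z \<omega>] sup_sq_finite[OF Zc, of \<omega>] by (simp add: less_top)
    then have "(norm (Z s \<omega>))\<^sup>2 \<le> enn2real (sup_sq T Z \<omega>)" by (subst (asm) ennreal_le_iff) auto
    then have "norm (Z s \<omega>) \<le> sqrt (enn2real (sup_sq T Z \<omega>))" by (rule real_le_rsqrt)
    then show ?thesis unfolding G_def abs_mult by (intro mult_left_mono) auto
  qed
  moreover have "(\<integral>\<^sup>+\<omega>. ennreal ((G \<omega>)\<^sup>2) \<partial>M) < \<infinity>"
    unfolding G2 using fin by (simp add: nn_integral_cmult E2_def ennreal_mult_less_top)
  moreover have "G \<in> borel_measurable M" unfolding G_def by measurable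
  ultimately show ?thesis unfolding square_dominated_def by blast
qed

end

section \<open>Existence by Picard iteration\<close>

context cbo
begin

section \<open>The drift integral\<close>

definition drift :: "(real \<Rightarrow> 'w \<Rightarrow> 'h) \<Rightarrow> real \<Rightarrow> 'w \<Rightarrow> 'h" where
  "drift Z t \<omega> = (LINT s:{0..t}|lborel. Z s \<omega>)"

lemma drift_integrable:
  assumes Z: "cont_adapted Z" and t: "t \<le> T"
  shows "set_integrable lborel {0..t} (\<lambda>s. Z s \<omega>)"
  unfolding set_integrable_def
  by (rule borel_integrable_compact[OF compact_Icc continuous_on_subset[OF cont_adaptedD(1)[OF Z]]]) (use t in auto)

lemma drift_diff:
  assumes "cont_adapted X" "cont_adapted Y" and t: "t \<le> T"
  shows "drift (\<lambda>s \<omega>. X s \<omega> - Y s \<omega>) t \<omega> = drift X t \<omega> - drift Y t \<omega>"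
  unfolding drift_def by (rule set_integral_diff(2)[OF drift_integrable[OF assms(1) t] drift_integrable[OF assms(2) t]])

text \<open>Cauchy--Schwarz in time, the length of the interval being at most
  \<open>T\<close>.\<close>

lemma drift_bound:
  assumes Z: "cont_adapted Z" and s: "s \<in> {0..t}" and t: "t \<le> T"
  shows "ennreal ((norm (drift Z s \<omega>))\<^sup>2) \<le> ennreal T * (\<integral>\<^sup>+r\<in>{0..t}. ennreal ((norm (Z r \<omega>))\<^sup>2) \<partial>lborel)"
proof -
  let ?f = "\<lambda>r. indicator {0..s} r *\<^sub>R Z r \<omega>"
  have i: "integrable lborel ?f" using drift_integrable[OF Z, of s \<omega>] s t unfolding set_integrable_def by simp
  then have [measurable]: "?f \<in> borel_measurable lborel" by simp
  have "ennreal (norm (drift Z s \<omega>)) \<le> (\<integral>\<^sup>+r. ennreal (norm (?f r)) \<partial>lborel)"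
    unfolding drift_def set_lebesgue_integral_def by (rule integral_norm_bound_ennreal[OF i])
  also have "\<dots> = (\<integral>\<^sup>+r. indicator {0..s} r * ennreal (norm (?f r)) \<partial>lborel)"
    by (intro nn_integral_cong) (auto simp: indicator_def)
  finally have "(ennreal (norm (drift Z s \<omega>)))\<^sup>2 \<le> (\<integral>\<^sup>+r. indicator {0..s} r * ennreal (norm (?f r)) \<partial>lborel)\<^sup>2"
    by (intro power_mono) auto
  also have "\<dots> \<le> (\<integral>\<^sup>+r. (indicator {0..s} r)\<^sup>2 \<partial>lborel) * (\<integral>\<^sup>+r. (ennreal (norm (?f r)))\<^sup>2 \<partial>lborel)"
    by (rule Cauchy_Schwarz_nn_integral) measurable
  also have "\<dots> \<le> ennreal T * (\<integral>\<^sup>+r\<in>{0..t}. ennreal ((norm (Z r \<omega>))\<^sup>2) \<partial>lborel)"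
  proof (rule mult_mono)
    have "(\<integral>\<^sup>+r. (indicator {0..s} r)\<^sup>2 \<partial>lborel) = (\<integral>\<^sup>+r. indicator {0..s} r \<partial>lborel)"
      by (intro nn_integral_cong) (auto simp: indicator_def)
    also have "\<dots> = ennreal s" using s by simp
    finally show "(\<integral>\<^sup>+r. (indicator {0..s} r)\<^sup>2 \<partial>lborel) \<le> ennreal T" using s t by (auto intro: ennreal_leI)
    show "(\<integral>\<^sup>+r. (ennreal (norm (?f r)))\<^sup>2 \<partial>lborel) \<le> (\<integral>\<^sup>+r\<in>{0..t}. ennreal ((norm (Z r \<omega>))\<^sup>2) \<partial>lborel)"
    proof (rule nn_integral_mono)
      fix r
      show "(ennreal (norm (?f r)))\<^sup>2 \<le> ennreal ((norm (Z r \<omega>))\<^sup>2) * indicator {0..t} r"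
        using s by (cases "r \<in> {0..s}") (auto simp: ennreal_power)
    qed
  qed auto
  finally show ?thesis by (simp add: ennreal_power)
qed

lemma drift_continuous:
  assumes Z: "cont_adapted Z" shows "continuous_on {0..T} (\<lambda>t. drift Z t \<omega>)"
proof -
  have "bounded ((\<lambda>t. Z t \<omega>) ` {0..T})"
    by (intro compact_imp_bounded compact_continuous_image cont_adaptedD(1)[OF Z] compact_Icc)
  then obtain B where "\<forall>x\<in>(\<lambda>t. Z t \<omega>) ` {0..T}. norm x \<le> B" unfolding bounded_iff ..
  then have B: "\<And>t. t \<in> {0..T} \<Longrightarrow> norm (Z t \<omega>) \<le> B" by simp
  have B0: "0 \<le> B" by (rule order.trans[OF norm_ge_zero B[of 0]]) (use T_nonneg in simp)
  have le: "norm (drift Z b \<omega> - drift Z a \<omega>) \<le> B * (b - a)" if ab: "0 \<le> a" "a \<le> b" "b \<le> T" for a b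
  proof -
    have ib: "set_integrable lborel {0..b} (\<lambda>s. Z s \<omega>)" by (rule drift_integrable[OF Z ab(3)])
    have i: "set_integrable lborel {0..a} (\<lambda>s. Z s \<omega>)" "set_integrable lborel {a<..b} (\<lambda>s. Z s \<omega>)"
      by (rule set_integrable_subset[OF ib]; use ab in auto)+
    have u: "{0..b} = {0..a} \<union> {a<..b}" using ab by auto
    have "drift Z b \<omega> = drift Z a \<omega> + (LINT s:{a<..b}|lborel. Z s \<omega>)"
      unfolding drift_def u by (rule set_integral_Un) (use i in auto)
    then have "norm (drift Z b \<omega> - drift Z a \<omega>) = norm (LINT s|lborel. indicator {a<..b} s *\<^sub>R Z s \<omega>)"
      by (simp add: set_lebesgue_integral_def)
    also have "\<dots> \<le> (LINT s|lborel. norm (indicator {a<..b} s *\<^sub>R Z s \<omega>))" by (rule integral_norm_bound)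
    also have "\<dots> \<le> (LINT s|lborel. indicator {a<..b} s * B)"
    proof (rule integral_mono)
      show "integrable lborel (\<lambda>s. norm (indicator {a<..b} s *\<^sub>R Z s \<omega>))" using i(2) unfolding set_integrable_def by (rule integrable_norm)
      show "integrable lborel (\<lambda>s. indicator {a<..b} s * B)" by (intro integrable_mult_left integrable_real_indicator) (use ab in auto)
      show "norm (indicator {a<..b} s *\<^sub>R Z s \<omega>) \<le> indicator {a<..b} s * B" for s
        using B[of s] ab by (cases "s \<in> {a<..b}") auto
    qed
    also have "\<dots> = B * (b - a)" using ab by simp
    finally show ?thesis .
  qed
  have "B-lipschitz_on {0..T} (\<lambda>t. drift Z t \<omega>)"
  proof (rule lipschitz_onI[OF _ B0])
    fix x y assume xy: "x \<in> {0..T}" "y \<in> {0..T}"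
    show "dist (drift Z x \<omega>) (drift Z y \<omega>) \<le> B * dist x y"
      using le[of x y] le[of y x] xy by (cases "x \<le> y") (auto simp: dist_norm norm_minus_commute)
  qed
  then show ?thesis by (rule lipschitz_on_continuous_on)
qed

lemma drift_cont_adapted:
  assumes Z: "cont_adapted Z" shows "cont_adapted (drift Z)"
  unfolding cont_adapted_def
proof (intro conjI allI ballI drift_continuous[OF Z])
  fix t assume t: "t \<in> {0..T}"
  show "drift Z t \<in> borel_measurable (F t)"
  \<comment> \<open>Joint measurability over \<open>{0..t}\<close> with respect to
    \<open>F t\<close> is available for intervals of positive length; at time 0 the integral is
    zero.\<close>
  proof (cases "t = 0")
    case True
    have "drift Z 0 = (\<lambda>\<omega>. 0)"
    proof
      fix \<omega>
      have "AE s in lborel. indicator {0..0} s *\<^sub>R Z s \<omega> = 0"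
        using AE_lborel_singleton[of "0::real"] by eventually_elim auto
      then show "drift Z 0 \<omega> = 0" unfolding drift_def set_lebesgue_integral_def by (rule integral_eq_zero_AE)
    qed
    then show ?thesis using True by simp
  next
    case False
    then have tp: "0 < t" using t by simp
    have "(\<lambda>(\<omega>, s). indicator {0..t} s *\<^sub>R Z s \<omega>) \<in> borel_measurable (F t \<Otimes>\<^sub>M lborel)"
    proof (rule left_limit_joint_measurable[OF tp])
      show "Z s \<in> borel_measurable (F t)" if "s \<in> {0..t}" for s
        using F_mono[OF cont_adaptedD(2)[OF Z, of s], of t] that t by auto
      show "left_limit_on t (\<lambda>s. Z s \<omega>)" for \<omega>
        by (rule left_limit_on_continuous[OF continuous_on_subset[OF cont_adaptedD(1)[OF Z]]]) (use t in auto)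
    qed
    then have "(\<lambda>\<omega>. LINT s|lborel. indicator {0..t} s *\<^sub>R Z s \<omega>) \<in> borel_measurable (F t)"
      by (rule lborel.borel_measurable_lebesgue_integral)
    then show ?thesis unfolding drift_def set_lebesgue_integral_def .
  qed
qed

section \<open>Mean-square estimates for drift and noise\<close>

lemma scalar_tonelli:
  assumes g: "jointly_measurable g" and t: "t \<le> T"
  shows "(\<integral>\<^sup>+\<omega>. (\<integral>\<^sup>+r\<in>{0..t}. ennreal ((g r \<omega>)\<^sup>2) \<partial>lborel) \<partial>M) = (\<integral>\<^sup>+r\<in>{0..t}. (\<integral>\<^sup>+\<omega>. ennreal ((g r \<omega>)\<^sup>2) \<partial>M) \<partial>lborel)"
proof -
  interpret L: pair_sigma_finite M lborel ..
  have z: "jointly_measurable (\<lambda>s \<omega>. 0)" unfolding jointly_measurable_def by simp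
  have m: "(\<lambda>(\<omega>, s). ennreal ((g s \<omega>)\<^sup>2) * indicator {0..t} s) \<in> borel_measurable (M \<Otimes>\<^sub>M lborel)"
    using integrand_dist_joint[OF g z t] by simp
  have sec: "(\<lambda>\<omega>. ennreal ((g s \<omega>)\<^sup>2)) \<in> borel_measurable M" if "s \<in> {0..t}" for s
  proof -
    have "(\<lambda>\<omega>. ennreal ((g s \<omega>)\<^sup>2) * indicator {0..t} s) \<in> borel_measurable M"
      using measurable_compose[OF measurable_Pair2'[of s lborel M] m] by simp
    then show ?thesis using that by simp
  qed
  have "(\<integral>\<^sup>+\<omega>. (\<integral>\<^sup>+r\<in>{0..t}. ennreal ((g r \<omega>)\<^sup>2) \<partial>lborel) \<partial>M) = (\<integral>\<^sup>+r. (\<integral>\<^sup>+\<omega>. ennreal ((g r \<omega>)\<^sup>2) * indicator {0..t} r \<partial>M) \<partial>lborel)"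
    using L.Fubini[OF m] lborel.nn_integral_fst[OF m] L.nn_integral_snd[OF m] by simp
  also have "\<dots> = (\<integral>\<^sup>+r\<in>{0..t}. (\<integral>\<^sup>+\<omega>. ennreal ((g r \<omega>)\<^sup>2) \<partial>M) \<partial>lborel)"
  proof (rule nn_integral_cong)
    fix r
    show "(\<integral>\<^sup>+\<omega>. ennreal ((g r \<omega>)\<^sup>2) * indicator {0..t} r \<partial>M) = (\<integral>\<^sup>+\<omega>. ennreal ((g r \<omega>)\<^sup>2) \<partial>M) * indicator {0..t} r"
      using sec[of r] by (cases "r \<in> {0..t}") auto
  qed
  finally show ?thesis .
qed

lemma msq_tonelli:
  assumes Z: "cont_adapted Z" and t: "t \<le> T"
  shows "(\<integral>\<^sup>+\<omega>. (\<integral>\<^sup>+r\<in>{0..t}. ennreal ((norm (Z r \<omega>))\<^sup>2) \<partial>lborel) \<partial>M) = (\<integral>\<^sup>+r\<in>{0..t}. msq Z r \<partial>lborel)"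
proof -
  have "jointly_measurable (\<lambda>s \<omega>. norm (Z s \<omega>))"
    using left_cont_adapted_jointly_measurable[OF scaled_norm_left_cont[OF Z, of 1]] by simp
  from scalar_tonelli[OF this t] show ?thesis unfolding msq_def .
qed

lemma section_measurable:
  assumes Z: "cont_adapted Z" and t: "t \<le> T"
  shows "(\<lambda>\<omega>. \<integral>\<^sup>+r\<in>{0..t}. ennreal ((norm (Z r \<omega>))\<^sup>2) \<partial>lborel) \<in> borel_measurable M"
proof -
  have j: "jointly_measurable (\<lambda>s \<omega>. norm (Z s \<omega>))"
    using left_cont_adapted_jointly_measurable[OF scaled_norm_left_cont[OF Z, of 1]] by simp
  have z: "jointly_measurable (\<lambda>s \<omega>. 0)" unfolding jointly_measurable_def by simp
  show ?thesis using integrand_dist_measurable[OF j z t] unfolding integrand_dist_def by simp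
qed

lemma E2_drift:
  assumes Z: "cont_adapted Z" and t: "0 \<le> t" "t \<le> T"
  shows "E2 t (drift Z) \<le> ennreal T * (\<integral>\<^sup>+r\<in>{0..t}. msq Z r \<partial>lborel)"
proof -
  have "E2 t (drift Z) \<le> (\<integral>\<^sup>+\<omega>. ennreal T * (\<integral>\<^sup>+r\<in>{0..t}. ennreal ((norm (Z r \<omega>))\<^sup>2) \<partial>lborel) \<partial>M)"
    unfolding E2_def by (intro nn_integral_mono sup_sq_least drift_bound[OF Z _ t(2)])
  also have "\<dots> = ennreal T * (\<integral>\<^sup>+r\<in>{0..t}. msq Z r \<partial>lborel)"
    using nn_integral_cmult[OF section_measurable[OF Z t(2)]] msq_tonelli[OF Z t(2)] by simp
  finally show ?thesis .
qed

text \<open>The noise coefficient is Lipschitz by the reverse triangle inequality. The factor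
  \<open>\<eta>\<close> is the constant 1 for existence and the cut-off \<open>below\<close> for
  uniqueness.\<close>

lemma E2_ito_norm:
  assumes X: "cont_adapted X" "cont_adapted Y" and \<eta>: "left_cont_adapted \<eta>"
    and I: "is_ito (\<lambda>s \<omega>. \<sigma> * norm (X s \<omega>) * \<eta> s \<omega>) I" "is_ito (\<lambda>s \<omega>. \<sigma> * norm (Y s \<omega>) * \<eta> s \<omega>) I'"
    and t: "0 \<le> t" "t \<le> T"
  shows "E2 t (\<lambda>s \<omega>. I s \<omega> - I' s \<omega>) \<le> ennreal (64 * hs P * \<sigma>\<^sup>2) *
    (\<integral>\<^sup>+r\<in>{0..t}. (\<integral>\<^sup>+\<omega>. ennreal ((norm (X r \<omega> - Y r \<omega>) * \<eta> r \<omega>)\<^sup>2) \<partial>M) \<partial>lborel)"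
proof -
  let ?cX = "\<lambda>s \<omega>. \<sigma> * norm (X s \<omega>) * \<eta> s \<omega>" and ?cY = "\<lambda>s \<omega>. \<sigma> * norm (Y s \<omega>) * \<eta> s \<omega>"
  let ?h = "\<lambda>s \<omega>. norm (X s \<omega> - Y s \<omega>) * \<eta> s \<omega>"
  note jm = left_cont_adapted_jointly_measurable[OF left_cont_adapted_mult[OF scaled_norm_left_cont \<eta>]]
  have jh: "jointly_measurable ?h" using jm[OF cont_adapted_diff[OF X], of 1] by simp
  have jz: "jointly_measurable (\<lambda>s \<omega>. 0)" unfolding jointly_measurable_def by simp
  have m: "integrand_dist t ?h (\<lambda>s \<omega>. 0) \<in> borel_measurable M" by (rule integrand_dist_measurable[OF jh jz t(2)])
  have "E2 t (\<lambda>s \<omega>. I s \<omega> - I' s \<omega>) \<le> 64 * ennreal (hs P) * (\<integral>\<^sup>+\<omega>. integrand_dist t ?cX ?cY \<omega> \<partial>M)"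
    by (rule is_ito_diff[OF jm[OF X(1)] jm[OF X(2)] I t])
  also have "\<dots> \<le> 64 * ennreal (hs P) * (\<integral>\<^sup>+\<omega>. ennreal (\<sigma>\<^sup>2) * integrand_dist t ?h (\<lambda>s \<omega>. 0) \<omega> \<partial>M)"
  proof (intro mult_left_mono nn_integral_mono)
    fix \<omega> assume w: "\<omega> \<in> space M"
    have "integrand_dist t ?cX ?cY \<omega> \<le> (\<integral>\<^sup>+r. ennreal (\<sigma>\<^sup>2) * (ennreal ((?h r \<omega> - 0)\<^sup>2) * indicator {0..t} r) \<partial>lborel)"
      unfolding integrand_dist_def
    proof (rule nn_integral_mono)
      fix r
      have "\<bar>norm (X r \<omega>) - norm (Y r \<omega>)\<bar> \<le> \<bar>norm (X r \<omega> - Y r \<omega>)\<bar>" using norm_triangle_ineq3[of "X r \<omega>" "Y r \<omega>"] by simp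
      then have "(norm (X r \<omega>) - norm (Y r \<omega>))\<^sup>2 \<le> (norm (X r \<omega> - Y r \<omega>))\<^sup>2" by (simp only: abs_le_square_iff)
      then have "(\<sigma> * \<eta> r \<omega>)\<^sup>2 * (norm (X r \<omega>) - norm (Y r \<omega>))\<^sup>2 \<le> (\<sigma> * \<eta> r \<omega>)\<^sup>2 * (norm (X r \<omega> - Y r \<omega>))\<^sup>2"
        by (rule mult_left_mono) simp
      moreover have "?cX r \<omega> - ?cY r \<omega> = \<sigma> * \<eta> r \<omega> * (norm (X r \<omega>) - norm (Y r \<omega>))" by (simp add: algebra_simps)
      ultimately have "(?cX r \<omega> - ?cY r \<omega>)\<^sup>2 \<le> \<sigma>\<^sup>2 * (?h r \<omega> - 0)\<^sup>2" by (simp add: power_mult_distrib mult_ac)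
      then have "ennreal ((?cX r \<omega> - ?cY r \<omega>)\<^sup>2) \<le> ennreal (\<sigma>\<^sup>2) * ennreal ((?h r \<omega> - 0)\<^sup>2)"
        unfolding ennreal_mult[symmetric, OF zero_le_power2 zero_le_power2] by (rule ennreal_leI)
      then show "ennreal ((?cX r \<omega> - ?cY r \<omega>)\<^sup>2) * indicator {0..t} r \<le>
          ennreal (\<sigma>\<^sup>2) * (ennreal ((?h r \<omega> - 0)\<^sup>2) * indicator {0..t} r)"
        by (cases "r \<in> {0..t}") auto
    qed
    also have "\<dots> = ennreal (\<sigma>\<^sup>2) * integrand_dist t ?h (\<lambda>s \<omega>. 0) \<omega>"
      unfolding integrand_dist_def by (rule nn_integral_cmult) (rule integrand_dist_section[OF jh jz t(2) w])
    finally show "integrand_dist t ?cX ?cY \<omega> \<le> ennreal (\<sigma>\<^sup>2) * integrand_dist t ?h (\<lambda>s \<omega>. 0) \<omega>" .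
  qed auto
  also have "\<dots> = 64 * ennreal (hs P) * (ennreal (\<sigma>\<^sup>2) * (\<integral>\<^sup>+\<omega>. integrand_dist t ?h (\<lambda>s \<omega>. 0) \<omega> \<partial>M))"
    by (simp only: nn_integral_cmult[OF m])
  also have "\<dots> = ennreal (64 * hs P * \<sigma>\<^sup>2) * (\<integral>\<^sup>+\<omega>. integrand_dist t ?h (\<lambda>s \<omega>. 0) \<omega> \<partial>M)"
    by (simp add: ennreal_mult mult.assoc)
  finally show ?thesis unfolding integrand_dist_def diff_0_right scalar_tonelli[OF jh t(2)] .
qed

text \<open>Twice the drift constant \<open>lam\<^sup>2 * T\<close> plus twice the noise constant
  \<open>64 * hs P * \<sigma>\<^sup>2\<close>; the summand 1 makes it positive.\<close>

definition K_flow :: real where "K_flow = 2 * lam\<^sup>2 * T + 128 * hs P * \<sigma>\<^sup>2 + 1"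

lemma K_flow_pos: "0 < K_flow"
  unfolding K_flow_def using T_nonneg by (intro add_nonneg_pos add_nonneg_nonneg mult_nonneg_nonneg) auto

lemma K_flow_combine:
  "2 * (ennreal (lam\<^sup>2) * (ennreal T * J)) + 2 * (ennreal (64 * hs P * \<sigma>\<^sup>2) * J) \<le> ennreal K_flow * J"
proof -
  have "2 * (ennreal (lam\<^sup>2) * (ennreal T * J)) + 2 * (ennreal (64 * hs P * \<sigma>\<^sup>2) * J) = ennreal (2 * lam\<^sup>2 * T + 128 * hs P * \<sigma>\<^sup>2) * J"
  proof -
    have 1: "2 * (ennreal (lam\<^sup>2) * (ennreal T * J)) = ennreal (2 * lam\<^sup>2 * T) * J"
      using T_nonneg by (simp add: ennreal_mult mult.assoc)
    have 2: "2 * (ennreal (64 * hs P * \<sigma>\<^sup>2) * J) = ennreal (128 * hs P * \<sigma>\<^sup>2) * J"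
    proof -
      have "2 * ennreal (64 * hs P * \<sigma>\<^sup>2) = ennreal (2 * (64 * hs P * \<sigma>\<^sup>2))" by (subst ennreal_mult) auto
      then show ?thesis by (simp add: mult.assoc[symmetric])
    qed
    show ?thesis unfolding 1 2 distrib_right[symmetric] using T_nonneg by (subst ennreal_plus) auto
  qed
  also have "\<dots> \<le> ennreal K_flow * J" unfolding K_flow_def by (intro mult_right_mono ennreal_leI) auto
  finally show ?thesis .
qed

lemma dynamics_diff:
  assumes X: "cont_adapted X" "cont_adapted Y" and I: "is_ito (\<lambda>s \<omega>. \<sigma> * norm (X s \<omega>)) I" "is_ito (\<lambda>s \<omega>. \<sigma> * norm (Y s \<omega>)) I'"
    and t: "0 \<le> t" "t \<le> T"
    and D: "\<And>s \<omega>. s \<in> {0..t} \<Longrightarrow> D s \<omega> = (I s \<omega> - lam *\<^sub>R drift X s \<omega>) - (I' s \<omega> - lam *\<^sub>R drift Y s \<omega>)"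
  shows "E2 t D \<le> ennreal K_flow * (\<integral>\<^sup>+r\<in>{0..t}. msq (\<lambda>s \<omega>. X s \<omega> - Y s \<omega>) r \<partial>lborel)"
proof -
  let ?Z = "\<lambda>s \<omega>. X s \<omega> - Y s \<omega>" and ?J = "\<integral>\<^sup>+r\<in>{0..t}. msq (\<lambda>s \<omega>. X s \<omega> - Y s \<omega>) r \<partial>lborel"
  have Z: "cont_adapted ?Z" by (rule cont_adapted_diff[OF X])
  have cI: "cont_adapted I" "cont_adapted I'" using I unfolding is_ito_def by auto
  have ito: "E2 t (\<lambda>s \<omega>. I s \<omega> - I' s \<omega>) \<le> ennreal (64 * hs P * \<sigma>\<^sup>2) * ?J"
    using E2_ito_norm[where \<eta>="\<lambda>s \<omega>. 1", OF X left_cont_adapted_const _ _ t, of I I'] I unfolding msq_def[abs_def] by simp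
  have "E2 t D \<le> 2 * E2 t (\<lambda>s \<omega>. (- lam) *\<^sub>R drift ?Z s \<omega>) + 2 * E2 t (\<lambda>s \<omega>. I s \<omega> - I' s \<omega>)"
  proof (rule E2_add_le[OF cont_adapted_scale[OF drift_cont_adapted[OF Z]] cont_adapted_diff[OF cI] t])
    fix s \<omega> assume s: "s \<in> {0..t}"
    have e: "drift ?Z s \<omega> = drift X s \<omega> - drift Y s \<omega>" by (rule drift_diff[OF X]) (use s t in auto)
    show "D s \<omega> = (- lam) *\<^sub>R drift ?Z s \<omega> + (I s \<omega> - I' s \<omega>)"
      unfolding e D[OF s] by (simp add: algebra_simps)
  qed
  also have "\<dots> \<le> 2 * (ennreal (lam\<^sup>2) * (ennreal T * ?J)) + 2 * (ennreal (64 * hs P * \<sigma>\<^sup>2) * ?J)"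
    using E2_drift[OF Z t] ito E2_scale[OF drift_cont_adapted[OF Z] t, of "- lam"]
    by (intro add_mono mult_left_mono) (auto intro: mult_left_mono)
  also have "\<dots> \<le> ennreal K_flow * ?J" by (rule K_flow_combine)
  finally show ?thesis .
qed

text \<open>Makes the zero process a partner in \<open>dynamics_diff\<close>, so that the bound for
  a single process is a case of the difference estimate.\<close>

lemma is_ito_zero: "is_ito (\<lambda>s \<omega>. \<sigma> * norm (0::'h)) (\<lambda>t \<omega>. 0)"
proof -
  define E :: "('w, 'h) elementary" where "E = (1, \<lambda>k. real k * T, \<lambda>k \<omega>. 0)"
  have E: "elementary F T E" unfolding E_def using T_pos by simp
  have p: "elementary_process E s \<omega> = 0" for s \<omega> unfolding E_def by simp
  have i: "elementary_integral Wc E t \<omega> = 0" for t \<omega> unfolding E_def by simp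
  have "cont_adapted (\<lambda>t \<omega>. 0)" unfolding cont_adapted_def by simp
  moreover have "(\<integral>\<^sup>+\<omega>. approx_error T (\<lambda>s \<omega>. \<sigma> * norm (0::'h)) E \<omega> \<partial>M) = 0"
    unfolding approx_error_def p by simp
  moreover have "E2 T (\<lambda>t \<omega>. elementary_integral Wc E t \<omega> - 0) = 0"
  proof -
    have "sup_sq T (\<lambda>t \<omega>. elementary_integral Wc E t \<omega> - 0) \<omega> \<le> 0" for \<omega>
      by (rule sup_sq_least) (simp add: i)
    then have "E2 T (\<lambda>t \<omega>. elementary_integral Wc E t \<omega> - 0) \<le> (\<integral>\<^sup>+\<omega>. 0 \<partial>M)"
      unfolding E2_def by (intro nn_integral_mono)
    then show ?thesis by simp
  qed
  ultimately show ?thesis unfolding is_ito_def using E by (intro conjI exI[of _ "\<lambda>n. E"]) auto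
qed

text \<open>One Picard step along a prescribed consensus path \<open>u\<close>. It is a relation
  because the stochastic integral is determined only up to a null set.\<close>

definition flow :: "(real \<Rightarrow> 'h) \<Rightarrow> (real \<Rightarrow> 'w \<Rightarrow> 'h) \<Rightarrow> (real \<Rightarrow> 'w \<Rightarrow> 'h) \<Rightarrow> bool" where
  "flow u X X' \<longleftrightarrow> (\<exists>I. is_ito (\<lambda>s \<omega>. \<sigma> * norm (X s \<omega> - u s)) I \<and>
     (\<forall>t \<omega>. X' t \<omega> = \<xi> \<omega> - lam *\<^sub>R drift (\<lambda>s \<omega>. X s \<omega> - u s) t \<omega> + I t \<omega>))"

lemma flow_diff:
  assumes X: "good X" "good Y" and u: "continuous_on {0..T} u" "continuous_on {0..T} v"
    and f: "flow u X X'" "flow v Y Y'" and t: "0 \<le> t" "t \<le> T"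
  shows "E2 t (\<lambda>s \<omega>. X' s \<omega> - Y' s \<omega>) \<le> ennreal K_flow * (\<integral>\<^sup>+r\<in>{0..t}. msq (\<lambda>s \<omega>. (X s \<omega> - u s) - (Y s \<omega> - v s)) r \<partial>lborel)"
proof -
  obtain I where I: "is_ito (\<lambda>s \<omega>. \<sigma> * norm (X s \<omega> - u s)) I" "\<And>t \<omega>. X' t \<omega> = \<xi> \<omega> - lam *\<^sub>R drift (\<lambda>s \<omega>. X s \<omega> - u s) t \<omega> + I t \<omega>"
    using f(1) unfolding flow_def by blast
  obtain J where J: "is_ito (\<lambda>s \<omega>. \<sigma> * norm (Y s \<omega> - v s)) J" "\<And>t \<omega>. Y' t \<omega> = \<xi> \<omega> - lam *\<^sub>R drift (\<lambda>s \<omega>. Y s \<omega> - v s) t \<omega> + J t \<omega>"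
    using f(2) unfolding flow_def by blast
  have c: "cont_adapted (\<lambda>s \<omega>. X s \<omega> - u s)" "cont_adapted (\<lambda>s \<omega>. Y s \<omega> - v s)"
    using X u cont_adapted_diff det_cont_adapted unfolding good_def by blast+
  show ?thesis by (rule dynamics_diff[OF c I(1) J(1) t]) (simp add: I(2) J(2))
qed

lemma flow_bound:
  assumes X: "good X" and u: "continuous_on {0..T} u" and f: "flow u X X'" and t: "0 \<le> t" "t \<le> T"
  shows "E2 t (\<lambda>s \<omega>. X' s \<omega> - \<xi> \<omega>) \<le> ennreal K_flow * (\<integral>\<^sup>+r\<in>{0..t}. msq (\<lambda>s \<omega>. X s \<omega> - u s) r \<partial>lborel)"
proof -
  obtain I where I: "is_ito (\<lambda>s \<omega>. \<sigma> * norm (X s \<omega> - u s)) I" "\<And>t \<omega>. X' t \<omega> = \<xi> \<omega> - lam *\<^sub>R drift (\<lambda>s \<omega>. X s \<omega> - u s) t \<omega> + I t \<omega>"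
    using f unfolding flow_def by blast
  have c: "cont_adapted (\<lambda>s \<omega>. X s \<omega> - u s)" "cont_adapted (\<lambda>s \<omega>. 0)"
    using X u cont_adapted_diff det_cont_adapted unfolding good_def by blast (simp add: cont_adapted_def)
  have d0: "drift (\<lambda>s \<omega>. 0) t \<omega> = 0" for t \<omega> unfolding drift_def set_lebesgue_integral_def by simp
  have "E2 t (\<lambda>s \<omega>. X' s \<omega> - \<xi> \<omega>) \<le> ennreal K_flow * (\<integral>\<^sup>+r\<in>{0..t}. msq (\<lambda>s \<omega>. (X s \<omega> - u s) - 0) r \<partial>lborel)"
    by (rule dynamics_diff[OF c I(1) is_ito_zero t]) (simp add: I(2) d0)
  then show ?thesis by simp
qed

lemma msq_le_E2: "s \<in> {0..t} \<Longrightarrow> msq X s \<le> E2 t X"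
  unfolding msq_def E2_def by (intro nn_integral_mono sup_sq_upper)

lemma integral_msq_le_E2:
  assumes "0 \<le> t" shows "(\<integral>\<^sup>+r\<in>{0..t}. msq X r \<partial>lborel) \<le> E2 t X * ennreal t"
proof -
  have "(\<integral>\<^sup>+r\<in>{0..t}. msq X r \<partial>lborel) \<le> (\<integral>\<^sup>+r. E2 t X * indicator {0..t} r \<partial>lborel)"
    by (rule nn_integral_mono) (auto simp: indicator_def intro: msq_le_E2)
  then show ?thesis using assms by (simp add: nn_integral_cmult_indicator)
qed

lemma flow_exists:
  assumes X: "good X" and u: "continuous_on {0..T} u"
  shows "\<exists>X'. flow u X X' \<and> good X'"
proof -
  have Z: "good (\<lambda>s \<omega>. X s \<omega> - u s)" by (rule good_diff[OF X good_det[OF u]])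
  then have Zc: "cont_adapted (\<lambda>s \<omega>. X s \<omega> - u s)" unfolding good_def by simp
  obtain I where I: "is_ito (\<lambda>s \<omega>. \<sigma> * norm (X s \<omega> - u s)) I"
    using ito_integral_exists[OF scaled_norm_left_cont[OF Zc] scaled_norm_dominated[OF Z]] by blast
  define X' where "X' t \<omega> = \<xi> \<omega> - lam *\<^sub>R drift (\<lambda>s \<omega>. X s \<omega> - u s) t \<omega> + I t \<omega>" for t \<omega>
  have f: "flow u X X'" unfolding flow_def using I X'_def by blast
  have cI: "cont_adapted I" using I unfolding is_ito_def by blast
  have c\<xi>: "cont_adapted (\<lambda>t. \<xi>)" using good_initial unfolding good_def by simp
  have c: "cont_adapted X'"
    unfolding X'_def using cont_adapted_add[OF cont_adapted_diff[OF c\<xi> cont_adapted_scale[OF drift_cont_adapted[OF Zc], of lam]] cI] .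
  have "E2 T (\<lambda>s \<omega>. X' s \<omega> - \<xi> \<omega>) \<le> ennreal K_flow * (E2 T (\<lambda>s \<omega>. X s \<omega> - u s) * ennreal T)"
    by (rule order.trans[OF flow_bound[OF X u f T_nonneg order_refl]]) (intro mult_left_mono integral_msq_le_E2 T_nonneg zero_le)
  also have "\<dots> < \<infinity>" using Z unfolding good_def by (simp add: ennreal_mult_less_top)
  finally have "good (\<lambda>s \<omega>. X' s \<omega> - \<xi> \<omega>)" unfolding good_def using cont_adapted_diff[OF c c\<xi>] by simp
  from good_add[OF this good_initial] have "good X'" by simp
  then show ?thesis using f by blast
qed

section \<open>The Picard sequence and its limit\<close>

definition R_cons :: "real \<Rightarrow> real" where
  "R_cons \<delta> = 2 + 2 * (2 * wB\<^sup>2 / \<delta>\<^sup>2 + 2 * wB^4 / \<delta>^4)"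

lemma R_cons_pos: "0 < R_cons \<delta>"
  unfolding R_cons_def by (intro add_pos_nonneg) auto

text \<open>The dependence on the law enters here: the consensus points differ by a deterministic
  vector whose square is bounded by the same second moment as the difference of the
  processes.\<close>

lemma msq_residual_le:
  assumes \<delta>: "\<delta> > 0" and X: "X r \<in> borel_measurable M" "Y r \<in> borel_measurable M"
  shows "msq (\<lambda>s \<omega>. (X s \<omega> - cons \<delta> X s) - (Y s \<omega> - cons \<delta> Y s)) r
    \<le> ennreal (R_cons \<delta>) * msq (\<lambda>s \<omega>. X s \<omega> - Y s \<omega>) r"
proof -
  let ?m = "msq (\<lambda>s \<omega>. X s \<omega> - Y s \<omega>) r" and ?\<Lambda> = "2 * wB\<^sup>2 / \<delta>\<^sup>2 + 2 * wB^4 / \<delta>^4"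
  note [measurable] = X
  have "msq (\<lambda>s \<omega>. (X s \<omega> - cons \<delta> X s) - (Y s \<omega> - cons \<delta> Y s)) r \<le>
     (\<integral>\<^sup>+\<omega>. 2 * ennreal ((norm (X r \<omega> - Y r \<omega>))\<^sup>2) + 2 * ennreal ((norm (cons \<delta> X r - cons \<delta> Y r))\<^sup>2) \<partial>M)"
    unfolding msq_def
  proof (rule nn_integral_mono)
    fix \<omega>
    have "(norm ((X r \<omega> - cons \<delta> X r) - (Y r \<omega> - cons \<delta> Y r)))\<^sup>2 = (norm ((X r \<omega> - Y r \<omega>) - (cons \<delta> X r - cons \<delta> Y r)))\<^sup>2"
      by (simp add: algebra_simps)
    also have "\<dots> \<le> 2 * (norm (X r \<omega> - Y r \<omega>))\<^sup>2 + 2 * (norm (cons \<delta> X r - cons \<delta> Y r))\<^sup>2" by (rule norm_diff_square_le)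
    finally have "ennreal ((norm ((X r \<omega> - cons \<delta> X r) - (Y r \<omega> - cons \<delta> Y r)))\<^sup>2) \<le>
       ennreal (2 * (norm (X r \<omega> - Y r \<omega>))\<^sup>2 + 2 * (norm (cons \<delta> X r - cons \<delta> Y r))\<^sup>2)" by (rule ennreal_leI)
    also have "\<dots> = 2 * ennreal ((norm (X r \<omega> - Y r \<omega>))\<^sup>2) + 2 * ennreal ((norm (cons \<delta> X r - cons \<delta> Y r))\<^sup>2)"
      by (rule ennreal_two_sum) auto
    finally show "ennreal ((norm ((X r \<omega> - cons \<delta> X r) - (Y r \<omega> - cons \<delta> Y r)))\<^sup>2) \<le>
       2 * ennreal ((norm (X r \<omega> - Y r \<omega>))\<^sup>2) + 2 * ennreal ((norm (cons \<delta> X r - cons \<delta> Y r))\<^sup>2)" .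
  qed
  also have "\<dots> = 2 * ?m + 2 * ennreal ((norm (cons \<delta> X r - cons \<delta> Y r))\<^sup>2)"
    unfolding msq_def by (simp add: nn_integral_add nn_integral_cmult emeasure_space_1)
  also have "\<dots> \<le> 2 * ?m + 2 * (ennreal ?\<Lambda> * ?m)"
    by (intro add_left_mono mult_left_mono cons_lipschitz \<delta> X) simp
  also have "\<dots> = ennreal (R_cons \<delta>) * ?m"
    unfolding R_cons_def
  proof -
    have "ennreal (2 + 2 * l) = 2 + 2 * ennreal l" if "0 \<le> l" for l
      using that by (simp add: ennreal_mult)
    from this[of ?\<Lambda>] have "ennreal (2 + 2 * ?\<Lambda>) = 2 + 2 * ennreal ?\<Lambda>" by fastforce
    then have "ennreal (2 + 2 * ?\<Lambda>) * ?m = 2 * ?m + 2 * ennreal ?\<Lambda> * ?m" by (simp only: distrib_right)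
    then show "2 * ?m + 2 * (ennreal ?\<Lambda> * ?m) = ennreal (2 + 2 * ?\<Lambda>) * ?m" by (simp only: mult.assoc)
  qed
  finally show ?thesis .
qed

text \<open>The limit \<open>X\<close> and its Picard image \<open>X'\<close> agree only almost
  surely, as stochastic integrals do, so the equation is recorded for the pair.\<close>

lemma picard_limit:
  assumes \<delta>: "\<delta> > 0"
  shows "\<exists>X X'. good X \<and> flow (cons \<delta> X) X X' \<and> good X' \<and> (AE \<omega> in M. \<forall>t\<in>{0..T}. X t \<omega> = X' t \<omega>)"
proof -
  have cu: "continuous_on {0..T} (cons \<delta> X)" if "good X" for X
    using cons_continuous[OF _ \<delta>] that unfolding good_def by blast
  have "\<exists>X. \<forall>n. good (X n) \<and> flow (cons \<delta> (X n)) (X n) (X (Suc n))"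
  proof (rule dependent_nat_choice)
    show "\<exists>X. good X" using good_initial by blast
    show "\<exists>Y. good Y \<and> flow (cons \<delta> X) X Y" if "good X" for X n
      using flow_exists[OF that cu[OF that]] by blast
  qed
  then obtain X where g: "\<And>n. good (X n)" and f: "\<And>n. flow (cons \<delta> (X n)) (X n) (X (Suc n))" by blast
  have cX: "cont_adapted (X n)" for n using g unfolding good_def by blast
  let ?D = "\<lambda>n t \<omega>. X (Suc n) t \<omega> - X n t \<omega>"
  define L where "L = K_flow * R_cons \<delta>"
  have L: "0 < L" unfolding L_def using K_flow_pos R_cons_pos by simp
  define A where "A = enn2real (E2 T (?D 0))"
  have A0: "0 \<le> A" unfolding A_def by simp
  have gD: "good (?D n)" for n by (rule good_diff[OF g g])
  \<comment> \<open>Integrating the weight \<open>exp (4 * L * t)\<close> divides it by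
    \<open>4 * L\<close>, and \<open>L\<close> is the product of the two constants of a step; so
    every iteration gains the factor \<open>1/4\<close>, whatever \<open>T\<close> is.\<close>
  have dec: "E2 t (?D n) \<le> ennreal (A * (1/4)^n * exp (4 * L * t))" if t: "t \<in> {0..T}" for n t
    using t
  proof (induction n arbitrary: t)
    case 0
    have "E2 t (?D 0) \<le> E2 T (?D 0)" using 0 by (intro E2_mono) auto
    also have "\<dots> = ennreal A" using gD[of 0] unfolding A_def good_def by (simp add: less_top)
    also have "\<dots> \<le> ennreal (A * (1/4)^0 * exp (4 * L * t))"
    proof (rule ennreal_leI)
      have "A * 1 \<le> A * exp (4 * L * t)" using A0 L 0 by (intro mult_left_mono) auto
      then show "A \<le> A * (1/4)^0 * exp (4 * L * t)" by simp
    qed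
    finally show ?case .
  next
    case (Suc n)
    have "E2 t (?D (Suc n)) \<le> ennreal K_flow *
      (\<integral>\<^sup>+r\<in>{0..t}. msq (\<lambda>s \<omega>. (X (Suc n) s \<omega> - cons \<delta> (X (Suc n)) s) - (X n s \<omega> - cons \<delta> (X n) s)) r \<partial>lborel)"
      by (rule flow_diff[OF g g cu[OF g] cu[OF g] f f]) (use Suc.prems in auto)
    also have "\<dots> \<le> ennreal K_flow * (\<integral>\<^sup>+r\<in>{0..t}. ennreal (R_cons \<delta> * (A * (1/4)^n) * exp (4 * L * r)) \<partial>lborel)"
    proof (intro mult_left_mono nn_integral_mono)
      fix r
      show "msq (\<lambda>s \<omega>. (X (Suc n) s \<omega> - cons \<delta> (X (Suc n)) s) - (X n s \<omega> - cons \<delta> (X n) s)) r * indicator {0..t} r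
        \<le> ennreal (R_cons \<delta> * (A * (1/4)^n) * exp (4 * L * r)) * indicator {0..t} r"
      proof (cases "r \<in> {0..t}")
        case True
        then have r: "r \<in> {0..T}" using Suc.prems by auto
        have "msq (\<lambda>s \<omega>. (X (Suc n) s \<omega> - cons \<delta> (X (Suc n)) s) - (X n s \<omega> - cons \<delta> (X n) s)) r \<le>
            ennreal (R_cons \<delta>) * msq (?D n) r"
          by (rule msq_residual_le[where X="X (Suc n)" and Y="X n" and r=r, OF \<delta> cont_adaptedD(3)[OF cX r] cont_adaptedD(3)[OF cX r]])
        also have "\<dots> \<le> ennreal (R_cons \<delta>) * ennreal (A * (1/4)^n * exp (4 * L * r))"
          by (intro mult_left_mono order.trans[OF msq_le_E2 Suc.IH[OF r]]) (use r in auto)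
        also have "\<dots> = ennreal (R_cons \<delta> * (A * (1/4)^n) * exp (4 * L * r))"
          using R_cons_pos[of \<delta>] A0 by (subst ennreal_mult[symmetric]) (auto simp: mult.assoc)
        finally show ?thesis using True by simp
      qed simp
    qed simp
    also have "\<dots> \<le> ennreal K_flow * ennreal (R_cons \<delta> * (A * (1/4)^n) / (4 * L) * exp (4 * L * t))"
      using L A0 R_cons_pos[of \<delta>] Suc.prems by (intro mult_left_mono exp_nn_integral_le) auto
    also have "\<dots> = ennreal (K_flow * (R_cons \<delta> * (A * (1/4)^n) / (4 * L) * exp (4 * L * t)))"
      using L A0 R_cons_pos[of \<delta>] K_flow_pos by (subst ennreal_mult) auto
    also have "K_flow * (R_cons \<delta> * (A * (1/4)^n) / (4 * L) * exp (4 * L * t)) = A * (1/4)^Suc n * exp (4 * L * t)"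
      unfolding L_def using K_flow_pos R_cons_pos[of \<delta>] by simp
    finally show ?case .
  qed
  define C where "C = (\<Sum>k. ennreal (2^Suc k) * E2 T (?D k))"
  define c where "c = 2 * (A * exp (4 * L * T))"
  \<comment> \<open>The gain \<open>1/4\<close> per step outweighs the weights
    \<open>2^(Suc k)\<close> of \<open>cont_adapted_limit\<close>.\<close>
  have "C \<le> (\<Sum>k. ennreal (c * (1/2)^k))"
    unfolding C_def
  proof (rule suminf_le[OF _ summableI summableI])
    fix k
    have "ennreal (2^Suc k) * E2 T (?D k) \<le> ennreal (2^Suc k) * ennreal (A * (1/4)^k * exp (4 * L * T))"
      using dec[of T k] T_nonneg by (intro mult_left_mono) auto
    also have "\<dots> = ennreal (2^Suc k * (A * (1/4)^k * exp (4 * L * T)))"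
      using A0 by (intro ennreal_mult[symmetric]) auto
    also have "2^Suc k * (A * (1/4)^k * exp (4 * L * T)) = c * (2^k * (1/4)^k)" unfolding c_def by simp
    also have "(2^k * (1/4)^k :: real) = (1/2)^k" by (simp add: power_mult_distrib[symmetric])
    finally show "ennreal (2^Suc k) * E2 T (?D k) \<le> ennreal (c * (1/2)^k)" .
  qed
  also have "\<dots> = ennreal (\<Sum>k. c * (1/2)^k)"
    by (rule suminf_ennreal2) (use A0 in \<open>auto simp: c_def intro!: summable_mult summable_geometric\<close>)
  finally have Cfin: "C < \<infinity>" by (rule order.strict_trans1) simp
  obtain Y where Y: "cont_adapted Y" "\<And>n. E2 T (\<lambda>t \<omega>. X n t \<omega> - Y t \<omega>) \<le> ennreal ((1/2)^n) * C"
    using cont_adapted_limit[OF cX C_def[symmetric] Cfin] by blast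
  have p0: "(\<lambda>n. ennreal ((1/2::real)^n) * C) \<longlonglongrightarrow> 0"
  proof -
    have "(\<lambda>n. C * ennreal ((1/2)^n)) \<longlonglongrightarrow> C * ennreal 0"
      by (intro ennreal_tendsto_cmult tendsto_ennrealI LIMSEQ_realpow_zero) (use Cfin in auto)
    then show ?thesis by (simp add: mult.commute)
  qed
  have lim: "(\<lambda>n. E2 T (\<lambda>t \<omega>. X n t \<omega> - Y t \<omega>)) \<longlonglongrightarrow> 0" by (rule ennreal_squeeze_0[OF Y(2) p0])
  have "E2 T (\<lambda>t \<omega>. X 0 t \<omega> - Y t \<omega>) < \<infinity>"
    by (rule order.strict_trans1[OF Y(2)]) (use Cfin in simp)
  then have "good (\<lambda>t \<omega>. X 0 t \<omega> - Y t \<omega>)" unfolding good_def using cont_adapted_diff[OF cX Y(1)] by blast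
  from good_diff[OF g[of 0] this] have gY: "good Y" by simp
  obtain Y' where Y': "flow (cons \<delta> Y) Y Y'" "good Y'" using flow_exists[OF gY cu[OF gY]] by blast
  have cY': "cont_adapted Y'" using Y' unfolding good_def by blast
  define c where "c = ennreal K_flow * (ennreal (R_cons \<delta>) * ennreal T)"
  have cfin: "c < \<infinity>" unfolding c_def by (simp add: ennreal_mult_less_top)
  \<comment> \<open>Continuity of the Picard step: the images of the iterates converge to the image
    of the limit. These images are the shifted iterates, so the limit is a fixed point.\<close>
  have b: "E2 T (\<lambda>t \<omega>. X (Suc n) t \<omega> - Y' t \<omega>) \<le> c * E2 T (\<lambda>t \<omega>. X n t \<omega> - Y t \<omega>)" for n
  proof -
    have "E2 T (\<lambda>t \<omega>. X (Suc n) t \<omega> - Y' t \<omega>) \<le> ennreal K_flow *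
      (\<integral>\<^sup>+r\<in>{0..T}. msq (\<lambda>s \<omega>. (X n s \<omega> - cons \<delta> (X n) s) - (Y s \<omega> - cons \<delta> Y s)) r \<partial>lborel)"
      by (rule flow_diff[OF g gY cu[OF g] cu[OF gY] f Y'(1) T_nonneg order_refl])
    also have "\<dots> \<le> ennreal K_flow * (\<integral>\<^sup>+r. (ennreal (R_cons \<delta>) * E2 T (\<lambda>t \<omega>. X n t \<omega> - Y t \<omega>)) * indicator {0..T} r \<partial>lborel)"
    proof (intro mult_left_mono nn_integral_mono)
      fix r
      show "msq (\<lambda>s \<omega>. (X n s \<omega> - cons \<delta> (X n) s) - (Y s \<omega> - cons \<delta> Y s)) r * indicator {0..T} r
         \<le> (ennreal (R_cons \<delta>) * E2 T (\<lambda>t \<omega>. X n t \<omega> - Y t \<omega>)) * indicator {0..T} r"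
      proof (cases "r \<in> {0..T}")
        case True
        have "msq (\<lambda>s \<omega>. (X n s \<omega> - cons \<delta> (X n) s) - (Y s \<omega> - cons \<delta> Y s)) r \<le>
            ennreal (R_cons \<delta>) * msq (\<lambda>t \<omega>. X n t \<omega> - Y t \<omega>) r"
          by (rule msq_residual_le[where X="X n" and Y=Y and r=r, OF \<delta> cont_adaptedD(3)[OF cX True] cont_adaptedD(3)[OF Y(1) True]])
        also have "\<dots> \<le> ennreal (R_cons \<delta>) * E2 T (\<lambda>t \<omega>. X n t \<omega> - Y t \<omega>)"
          by (intro mult_left_mono msq_le_E2 True) simp
        finally show ?thesis using True by simp
      qed simp
    qed simp
    also have "\<dots> = c * E2 T (\<lambda>t \<omega>. X n t \<omega> - Y t \<omega>)"
      unfolding c_def using T_nonneg by (subst nn_integral_cmult_indicator) (simp_all add: mult_ac)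
    finally show ?thesis .
  qed
  have "E2 T (\<lambda>t \<omega>. Y t \<omega> - Y' t \<omega>) \<le> 2 * E2 T (\<lambda>t \<omega>. X (Suc n) t \<omega> - Y t \<omega>) + 2 * (c * E2 T (\<lambda>t \<omega>. X n t \<omega> - Y t \<omega>))" for n
  proof -
    have "E2 T (\<lambda>t \<omega>. Y t \<omega> - Y' t \<omega>) \<le> 2 * E2 T (\<lambda>t \<omega>. Y t \<omega> - X (Suc n) t \<omega>) + 2 * E2 T (\<lambda>t \<omega>. X (Suc n) t \<omega> - Y' t \<omega>)"
      by (rule E2_add_le[OF cont_adapted_diff[OF Y(1) cX] cont_adapted_diff[OF cX cY'] T_nonneg order_refl]) simp
    also have "\<dots> \<le> 2 * E2 T (\<lambda>t \<omega>. X (Suc n) t \<omega> - Y t \<omega>) + 2 * (c * E2 T (\<lambda>t \<omega>. X n t \<omega> - Y t \<omega>))"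
      unfolding E2_minus[of T Y "X (Suc n)"] by (intro add_left_mono mult_left_mono b) simp
    finally show ?thesis .
  qed
  moreover have "(\<lambda>n. 2 * E2 T (\<lambda>t \<omega>. X (Suc n) t \<omega> - Y t \<omega>) + 2 * (c * E2 T (\<lambda>t \<omega>. X n t \<omega> - Y t \<omega>))) \<longlonglongrightarrow> 2 * 0 + 2 * (c * 0)"
    using cfin by (intro tendsto_add ennreal_tendsto_cmult lim LIMSEQ_Suc[OF lim]) auto
  ultimately have "E2 T (\<lambda>t \<omega>. Y t \<omega> - Y' t \<omega>) \<le> 2 * 0 + 2 * (c * 0)" by (intro LIMSEQ_le_const) auto
  then have "(\<integral>\<^sup>+\<omega>. sup_sq T (\<lambda>t \<omega>. Y t \<omega> - Y' t \<omega>) \<omega> \<partial>M) = 0" unfolding E2_def by simp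
  then have "AE \<omega> in M. sup_sq T (\<lambda>t \<omega>. Y t \<omega> - Y' t \<omega>) \<omega> = 0"
    by (subst (asm) nn_integral_0_iff_AE[OF sup_sq_measurable[OF cont_adapted_diff[OF Y(1) cY'] T_nonneg order_refl]])
  then have "AE \<omega> in M. \<forall>t\<in>{0..T}. Y t \<omega> = Y' t \<omega>"
  proof eventually_elim
    case (elim \<omega>)
    show ?case
    proof
      fix t assume "t \<in> {0..T}"
      from sup_sq_upper[OF this, of "\<lambda>t \<omega>. Y t \<omega> - Y' t \<omega>" \<omega>] show "Y t \<omega> = Y' t \<omega>" unfolding elim by simp
    qed
  qed
  then show ?thesis using gY Y' by blast
qed

text \<open>The linear growth of the consensus point does not see the truncation level \<open>\<delta>\<close>.\<close>

definition growth :: real where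
  "growth = (SOME b. b > 0 \<and> (\<forall>S\<ge>0. \<exists>\<kappa>>0. (\<forall>x. 2 * \<kappa> * (1 - (norm x)\<^sup>2 / (2 * (S + 1))) \<le> wt x) \<and>
    (\<forall>x. norm (wt x *\<^sub>R x) \<le> b * (1 + sqrt S) * wt x + 2 * \<kappa> * norm x)))"

lemma growth: "growth > 0" "S \<ge> 0 \<Longrightarrow> \<exists>\<kappa>>0. (\<forall>x. 2 * \<kappa> * (1 - (norm x)\<^sup>2 / (2 * (S + 1))) \<le> wt x) \<and>
    (\<forall>x. norm (wt x *\<^sub>R x) \<le> growth * (1 + sqrt S) * wt x + 2 * \<kappa> * norm x)"
  using someI_ex[OF admissible_weight_growth[OF \<alpha>_pos admissible, folded wt_def], folded growth_def] by auto

text \<open>Both pointwise inequalities of \<open>growth\<close> are integrated. Since the same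
  \<open>\<kappa>\<close> occurs in both, the error term \<open>2 * \<kappa> * norm x\<close> is
  absorbed by the normalisation.\<close>

lemma moment_bounds:
  assumes S: "S \<ge> 0"
  shows "\<exists>\<kappa>>0. \<forall>X t. X t \<in> borel_measurable M \<longrightarrow> msq X t \<le> ennreal S \<longrightarrow>
    \<kappa> \<le> wbar X t \<and> norm (fbar X t) \<le> (growth * (1 + sqrt S) + 2 * sqrt S) * wbar X t"
proof -
  obtain \<kappa> where k: "\<kappa> > 0" "\<And>x. 2 * \<kappa> * (1 - (norm x)\<^sup>2 / (2 * (S + 1))) \<le> wt x"
    "\<And>x. norm (wt x *\<^sub>R x) \<le> growth * (1 + sqrt S) * wt x + 2 * \<kappa> * norm x"
    using growth(2)[OF S] by blast
  have "\<kappa> \<le> wbar X t \<and> norm (fbar X t) \<le> (growth * (1 + sqrt S) + 2 * sqrt S) * wbar X t"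
    if X[measurable]: "X t \<in> borel_measurable M" and m: "msq X t \<le> ennreal S" for X t
  proof -
    have fin: "msq X t < \<infinity>" using m by (rule order.strict_trans1) simp
    have i2: "integrable M (\<lambda>\<omega>. (norm (X t \<omega>))\<^sup>2)"
      using fin unfolding msq_def by (intro integrableI_bounded) auto
    have i1: "integrable M (\<lambda>\<omega>. norm (X t \<omega>))" by (rule square_integrable_imp_integrable) (use i2 in auto)
    have ES: "expectation (\<lambda>\<omega>. (norm (X t \<omega>))\<^sup>2) \<le> S"
    proof -
      have "ennreal (expectation (\<lambda>\<omega>. (norm (X t \<omega>))\<^sup>2)) \<le> ennreal S"
        using m nn_integral_eq_integral[OF i2] unfolding msq_def by simp
      then show ?thesis using S by (subst (asm) ennreal_le_iff) auto
    qed
    have E1: "expectation (\<lambda>\<omega>. norm (X t \<omega>)) \<le> sqrt S"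
    proof (rule real_le_rsqrt)
      have "ennreal ((expectation (\<lambda>\<omega>. norm (X t \<omega>)))\<^sup>2) \<le> ennreal S"
        by (rule order.trans[OF expectation_square_le[OF i1] m[unfolded msq_def]]) simp
      then show "(expectation (\<lambda>\<omega>. norm (X t \<omega>)))\<^sup>2 \<le> S" using S by (subst (asm) ennreal_le_iff) auto
    qed
    note iw = integrable_wt[OF X]
    have "expectation (\<lambda>\<omega>. 2 * \<kappa> * (1 - (norm (X t \<omega>))\<^sup>2 / (2 * (S + 1)))) \<le> wbar X t"
      unfolding wbar_def by (rule integral_mono[OF _ iw(1) k(2)]) (use i2 in auto)
    also have "expectation (\<lambda>\<omega>. 2 * \<kappa> * (1 - (norm (X t \<omega>))\<^sup>2 / (2 * (S + 1)))) = 2 * \<kappa> * (1 - expectation (\<lambda>\<omega>. (norm (X t \<omega>))\<^sup>2) / (2 * (S + 1)))"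
      using i2 by (simp add: prob_space)
    finally have "2 * \<kappa> * (1 - expectation (\<lambda>\<omega>. (norm (X t \<omega>))\<^sup>2) / (2 * (S + 1))) \<le> wbar X t" .
    \<comment> \<open>\<open>S / (2 * (S + 1))\<close> is at most one half; this uses up the factor
      2 in \<open>2 * \<kappa>\<close>.\<close>
    moreover have "2 * \<kappa> * (1/2) \<le> 2 * \<kappa> * (1 - expectation (\<lambda>\<omega>. (norm (X t \<omega>))\<^sup>2) / (2 * (S + 1)))"
      using k(1) S ES by (intro mult_left_mono) (auto simp: field_simps)
    ultimately have kw: "\<kappa> \<le> wbar X t" by simp
    have "norm (fbar X t) \<le> expectation (\<lambda>\<omega>. norm (wt (X t \<omega>) *\<^sub>R X t \<omega>))"
      unfolding fbar_def by (rule integral_norm_bound)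
    also have "\<dots> \<le> expectation (\<lambda>\<omega>. growth * (1 + sqrt S) * wt (X t \<omega>) + 2 * \<kappa> * norm (X t \<omega>))"
      by (rule integral_mono[OF integrable_norm[OF iw(2)] _ k(3)]) (use iw i1 in auto)
    also have "\<dots> = growth * (1 + sqrt S) * wbar X t + 2 * \<kappa> * expectation (\<lambda>\<omega>. norm (X t \<omega>))"
      unfolding wbar_def using iw i1 by simp
    also have "2 * \<kappa> * expectation (\<lambda>\<omega>. norm (X t \<omega>)) \<le> 2 * wbar X t * sqrt S"
      using kw k(1) E1 by (intro mult_mono) (auto intro: Bochner_Integration.integral_nonneg)
    also have "growth * (1 + sqrt S) * wbar X t + 2 * wbar X t * sqrt S = (growth * (1 + sqrt S) + 2 * sqrt S) * wbar X t"
      by (simp add: algebra_simps)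
    finally show ?thesis using kw by simp
  qed
  then show ?thesis using k(1) by blast
qed

text \<open>Raising the normalisation to at least \<open>\<delta>\<close> can only shorten the
  vector, so the bound for the consensus point itself applies at every level
  \<open>\<delta>\<close>.\<close>

lemma cons_growth:
  assumes S: "S \<ge> 0" and \<delta>: "\<delta> > 0" and X: "X t \<in> borel_measurable M" and m: "msq X t \<le> ennreal S"
  shows "(norm (cons \<delta> X t))\<^sup>2 \<le> 2 * (growth + 2)\<^sup>2 * (1 + S)"
proof -
  have w: "0 < wbar X t" by (rule wbar_pos[of X t, OF X])
  have f: "norm (fbar X t) \<le> (growth * (1 + sqrt S) + 2 * sqrt S) * wbar X t"
    using moment_bounds[OF S] X m by blast
  have "norm (cons \<delta> X t) = norm (fbar X t) / max (wbar X t) \<delta>"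
    unfolding cons_def using w by (simp add: divide_inverse mult.commute)
  also have "\<dots> \<le> norm (fbar X t) / wbar X t" using w by (intro divide_left_mono) (auto simp: max_def)
  also have "\<dots> \<le> growth * (1 + sqrt S) + 2 * sqrt S" using f w by (simp add: field_simps)
  also have "\<dots> \<le> (growth + 2) * (1 + sqrt S)" by (simp add: algebra_simps)
  finally have "(norm (cons \<delta> X t))\<^sup>2 \<le> ((growth + 2) * (1 + sqrt S))\<^sup>2" by (rule power_mono) simp
  also have "\<dots> \<le> (growth + 2)\<^sup>2 * (2 * (1 + S))"
  proof -
    have "(1 + sqrt S)\<^sup>2 \<le> 2 * (1 + S)"
      using norm_add_square_le[of 1 "sqrt S"] S by simp
    then show ?thesis unfolding power_mult_distrib by (intro mult_left_mono) auto
  qed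
  also have "\<dots> = 2 * (growth + 2)\<^sup>2 * (1 + S)" by (rule mult.left_commute[THEN trans]) (rule mult.assoc[symmetric])
  finally show ?thesis .
qed

text \<open>The bound can be fixed before \<open>\<delta>\<close>: it is made of the initial second
  moment, \<open>T\<close>, \<open>K_flow\<close> and \<open>growth\<close>.\<close>

lemma a_priori_bound:
  "\<exists>S\<ge>0. \<forall>\<delta>>0. \<forall>X X'. good X \<longrightarrow> flow (cons \<delta> X) X X' \<longrightarrow> (AE \<omega> in M. \<forall>t\<in>{0..T}. X t \<omega> = X' t \<omega>) \<longrightarrow>
    (\<forall>t\<in>{0..T}. msq X t \<le> ennreal S)"
proof -
  define m0 where "m0 = expectation (\<lambda>\<omega>. (norm (\<xi> \<omega>))\<^sup>2)"
  have m0: "0 \<le> m0" unfolding m0_def by simp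
  \<comment> \<open>Covers \<open>2 * s\<close> from the process and
    \<open>2 * (norm (cons \<delta> X r))\<^sup>2\<close> from the consensus point, the latter by
    twice the constant of \<open>cons_growth\<close>.\<close>
  define c where "c = 2 + 4 * (growth + 2)\<^sup>2"
  have c: "c \<ge> 1" unfolding c_def by (simp add: add_increasing2)
  define a where "a = c * (1 + 2 * m0)"
  define K where "K = 2 * c * K_flow"
  have K: "0 < K" unfolding K_def using c K_flow_pos by simp
  define S where "S = 2 * a * exp (2 * K * T)"
  have a0: "0 \<le> a" unfolding a_def using c m0 by simp
  have S0: "S \<ge> 0" unfolding S_def using a0 by simp
  have "msq X t \<le> ennreal S"
    if \<delta>: "\<delta> > 0" and g: "good X" and f: "flow (cons \<delta> X) X X'" and ae: "AE \<omega> in M. \<forall>t\<in>{0..T}. X t \<omega> = X' t \<omega>" and t: "t \<in> {0..T}"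
    for \<delta> X X' t
  proof -
    have cX: "cont_adapted X" using g unfolding good_def by blast
    have cu: "continuous_on {0..T} (cons \<delta> X)" by (rule cons_continuous[OF cX \<delta>])
    \<comment> \<open>This multiple of \<open>1 + msq X t\<close> bounds the second moment of
      \<open>X - cons \<delta> X\<close>, so the integral inequality closes on itself.\<close>
    define y where "y t = ennreal c * (1 + msq X t)" for t
    have mfin: "msq X t \<le> E2 T X" if "t \<in> {0..T}" for t by (rule msq_le_E2[OF that])
    have res: "msq (\<lambda>s \<omega>. X s \<omega> - cons \<delta> X s) r \<le> y r" if r: "r \<in> {0..T}" for r
    proof -
      have fin: "msq X r < \<infinity>" using mfin[OF r] g unfolding good_def by (auto intro: order.strict_trans1)
      define s where "s = enn2real (msq X r)"
      have s: "msq X r = ennreal s" "0 \<le> s" using fin unfolding s_def by (auto simp: less_top)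
      note m[measurable] = cont_adaptedD(3)[OF cX r]
      have "msq (\<lambda>s \<omega>. X s \<omega> - cons \<delta> X s) r \<le> (\<integral>\<^sup>+\<omega>. 2 * ennreal ((norm (X r \<omega>))\<^sup>2) + 2 * ennreal ((norm (cons \<delta> X r))\<^sup>2) \<partial>M)"
        unfolding msq_def
        by (rule nn_integral_mono) (subst ennreal_two_sum[symmetric], auto intro!: ennreal_leI norm_diff_square_le simp del: ennreal_plus)
      also have "\<dots> = 2 * msq X r + 2 * ennreal ((norm (cons \<delta> X r))\<^sup>2)"
        unfolding msq_def by (simp add: nn_integral_add nn_integral_cmult emeasure_space_1)
      also have "\<dots> = ennreal (2 * s + 2 * (norm (cons \<delta> X r))\<^sup>2)"
        unfolding s(1) using s(2) by (intro ennreal_two_sum[symmetric]) auto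
      also have "\<dots> \<le> ennreal (c * (1 + s))"
      proof (rule ennreal_leI)
        have "(norm (cons \<delta> X r))\<^sup>2 \<le> 2 * (growth + 2)\<^sup>2 * (1 + s)"
          by (rule cons_growth[where X=X and t=r, OF s(2) \<delta> m]) (simp add: s(1))
        then show "2 * s + 2 * (norm (cons \<delta> X r))\<^sup>2 \<le> c * (1 + s)" unfolding c_def by (simp add: algebra_simps)
      qed
      also have "\<dots> = y r" unfolding y_def s(1) using s(2) c by (simp add: ennreal_mult)
      finally show ?thesis .
    qed
    have step: "y r \<le> ennreal a + ennreal K * (\<integral>\<^sup>+s\<in>{0..r}. y s \<partial>lborel)" if r: "r \<in> {0..T}" for r
    proof -
      note m[measurable] = cont_adaptedD(3)[OF cX r]
      have [measurable]: "\<xi> \<in> borel_measurable M" by (rule F_M[OF \<xi>_measurable]) simp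
      have "msq X r \<le> (\<integral>\<^sup>+\<omega>. 2 * ennreal ((norm (\<xi> \<omega>))\<^sup>2) + 2 * ennreal ((norm (X r \<omega> - \<xi> \<omega>))\<^sup>2) \<partial>M)"
        unfolding msq_def
      proof (rule nn_integral_mono)
        fix \<omega>
        have "ennreal ((norm (X r \<omega>))\<^sup>2) \<le> ennreal (2 * (norm (\<xi> \<omega>))\<^sup>2 + 2 * (norm (X r \<omega> - \<xi> \<omega>))\<^sup>2)"
          using norm_add_square_le[of "\<xi> \<omega>" "X r \<omega> - \<xi> \<omega>"] by (intro ennreal_leI) simp
        then show "ennreal ((norm (X r \<omega>))\<^sup>2) \<le> 2 * ennreal ((norm (\<xi> \<omega>))\<^sup>2) + 2 * ennreal ((norm (X r \<omega> - \<xi> \<omega>))\<^sup>2)"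
          by (subst ennreal_two_sum[symmetric]) auto
      qed
      also have "\<dots> = 2 * ennreal m0 + 2 * msq (\<lambda>s \<omega>. X s \<omega> - \<xi> \<omega>) r"
        unfolding msq_def m0_def using nn_integral_eq_integral[OF \<xi>_square] by (simp add: nn_integral_add nn_integral_cmult)
      finally have split: "msq X r \<le> 2 * ennreal m0 + 2 * msq (\<lambda>s \<omega>. X s \<omega> - \<xi> \<omega>) r" .
      have "msq (\<lambda>s \<omega>. X s \<omega> - \<xi> \<omega>) r = msq (\<lambda>s \<omega>. X' s \<omega> - \<xi> \<omega>) r"
        unfolding msq_def by (rule nn_integral_cong_AE, rule eventually_mono[OF ae]) (use r in auto)
      also have "\<dots> \<le> E2 r (\<lambda>s \<omega>. X' s \<omega> - \<xi> \<omega>)" by (rule msq_le_E2) (use r in auto)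
      also have "\<dots> \<le> ennreal K_flow * (\<integral>\<^sup>+s\<in>{0..r}. msq (\<lambda>s \<omega>. X s \<omega> - cons \<delta> X s) s \<partial>lborel)"
        by (rule flow_bound[OF g cu f]) (use r in auto)
      also have "\<dots> \<le> ennreal K_flow * (\<integral>\<^sup>+s\<in>{0..r}. y s \<partial>lborel)"
      proof (intro mult_left_mono nn_integral_mono)
        fix s show "msq (\<lambda>s \<omega>. X s \<omega> - cons \<delta> X s) s * indicator {0..r} s \<le> y s * indicator {0..r} s"
          using res[of s] r by (cases "s \<in> {0..r}") auto
      qed simp
      finally have "2 * ennreal m0 + 2 * msq (\<lambda>s \<omega>. X s \<omega> - \<xi> \<omega>) r \<le> 2 * ennreal m0 + 2 * (ennreal K_flow * (\<integral>\<^sup>+s\<in>{0..r}. y s \<partial>lborel))"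
        by (intro add_left_mono mult_left_mono) simp_all
      with split have "1 + msq X r \<le> 1 + (2 * ennreal m0 + 2 * (ennreal K_flow * (\<integral>\<^sup>+s\<in>{0..r}. y s \<partial>lborel)))"
        by (intro add_left_mono) (rule order.trans)
      then have "y r \<le> ennreal c * (1 + (2 * ennreal m0 + 2 * (ennreal K_flow * (\<integral>\<^sup>+s\<in>{0..r}. y s \<partial>lborel))))"
        unfolding y_def[of r] by (rule mult_left_mono) simp
      also have "\<dots> = ennreal a + ennreal K * (\<integral>\<^sup>+s\<in>{0..r}. y s \<partial>lborel)"
      proof -
        have 1: "ennreal a = ennreal c * (1 + 2 * ennreal m0)" unfolding a_def using c m0 by (simp add: ennreal_mult)
        have 2: "ennreal K = ennreal c * (2 * ennreal K_flow)" unfolding K_def using c K_flow_pos by (simp add: ennreal_mult mult_ac)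
        show ?thesis unfolding 1 2 by (simp add: distrib_left mult.assoc add.assoc)
      qed
      finally show ?thesis .
    qed
    \<comment> \<open>Gronwall's inequality asks for some finite bound; this one depends on
      \<open>X\<close> but does not enter the conclusion.\<close>
    have fin: "ennreal c * (1 + E2 T X) < \<infinity>" using g unfolding good_def by (simp add: ennreal_mult_less_top)
    have "y t \<le> ennreal (2 * a * exp (2 * K * t))"
      by (rule gronwall_nn[OF K a0 fin _ step t]) (use mfin in \<open>auto simp: y_def intro!: mult_left_mono add_left_mono\<close>)
    also have "\<dots> \<le> ennreal S" unfolding S_def using t K a0 by (intro ennreal_leI mult_left_mono) auto
    finally have "y t \<le> ennreal S" .
    moreover have "msq X t \<le> y t"
    proof -
      have "1 * msq X t \<le> ennreal c * (1 + msq X t)" using c by (intro mult_mono) (auto simp: add_increasing)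
      then show ?thesis unfolding y_def by simp
    qed
    ultimately show ?thesis by (rule order.trans[rotated])
  qed
  then show ?thesis using S0 by blast
qed

lemma is_ito_cong:
  assumes "\<And>s \<omega>. s \<in> {0..T} \<Longrightarrow> g s \<omega> = g' s \<omega>" and "is_ito g I" shows "is_ito g' I"
proof -
  have "approx_error T g E = approx_error T g' E" for E
    unfolding approx_error_def using assms(1) by (intro ext nn_integral_cong) (auto simp: indicator_def)
  then show ?thesis using assms(2) unfolding is_ito_def by simp
qed

lemma cbo_solution_exists:
  assumes P: "P = orthogonal_projection V"
  shows "\<exists>X. CBO_strong_solution M F Q W T \<E> V \<alpha> lam \<sigma> \<xi> X \<and> L2_continuous M T X"
proof -
  obtain S where S: "S \<ge> 0" and bound: "\<And>\<delta> X X'. \<delta> > 0 \<Longrightarrow> good X \<Longrightarrow> flow (cons \<delta> X) X X' \<Longrightarrow>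
      (AE \<omega> in M. \<forall>t\<in>{0..T}. X t \<omega> = X' t \<omega>) \<Longrightarrow> \<forall>t\<in>{0..T}. msq X t \<le> ennreal S"
    using a_priori_bound by blast
  \<comment> \<open>The order of choices matters: \<open>S\<close> is independent of the truncation
    level, \<open>\<delta>\<close> is the lower bound that \<open>S\<close> forces on the
    normalisation, and the truncated equation is solved for this \<open>\<delta>\<close>.\<close>
  obtain \<delta> where \<delta>: "\<delta> > 0" and low: "\<And>X t. X t \<in> borel_measurable M \<Longrightarrow> msq X t \<le> ennreal S \<Longrightarrow> \<delta> \<le> wbar X t"
    using moment_bounds[OF S] by blast
  obtain X X' where g: "good X" and f: "flow (cons \<delta> X) X X'" and ae: "AE \<omega> in M. \<forall>t\<in>{0..T}. X t \<omega> = X' t \<omega>"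
    using picard_limit[OF \<delta>] by blast
  have cX: "cont_adapted X" and EX: "E2 T X < \<infinity>" using g unfolding good_def by auto
  note meas = cont_adaptedD(3)[OF cX]
  define m where "m t = consensus_point \<alpha> \<E> (distr M borel (X t))" for t
  \<comment> \<open>The truncation is inactive at every time, so the truncated equation is the
    original one.\<close>
  have m: "m t = cons \<delta> X t" if t: "t \<in> {0..T}" for t
  proof -
    have "\<delta> \<le> wbar X t" using low[of X t] meas[OF t] bound[OF \<delta> g f ae] t by blast
    then show ?thesis unfolding m_def consensus_point_eq[where X=X and t=t, OF meas[OF t]] cons_def by (simp add: max_absorb1)
  qed
  have cm: "continuous_on {0..T} m"
    by (subst continuous_on_cong[OF refl m]) (simp_all add: cons_continuous[OF cX \<delta>])
  have gZ: "good (\<lambda>s \<omega>. X s \<omega> - m s)" by (rule good_diff[OF g good_det[OF cm]])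
  then have Z: "cont_adapted (\<lambda>s \<omega>. X s \<omega> - m s)" unfolding good_def by blast
  obtain I where I: "is_ito (\<lambda>s \<omega>. \<sigma> * norm (X s \<omega> - cons \<delta> X s)) I"
    "\<And>t \<omega>. X' t \<omega> = \<xi> \<omega> - lam *\<^sub>R drift (\<lambda>s \<omega>. X s \<omega> - cons \<delta> X s) t \<omega> + I t \<omega>"
    using f unfolding flow_def by blast
  have I': "is_ito (\<lambda>s \<omega>. \<sigma> * norm (X s \<omega> - m s)) I" by (rule is_ito_cong[OF _ I(1)]) (simp add: m)
  have SI: "has_stochastic_integral M F Q W T (\<lambda>s \<omega>. (\<sigma> * norm (X s \<omega> - m s)) *\<^sub>R orthogonal_projection V) I"
    using is_ito_has_stochastic_integral[OF scaled_norm_left_cont[OF Z] scaled_norm_dominated[OF gZ] I'] unfolding P .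
  have d: "drift (\<lambda>s \<omega>. X s \<omega> - cons \<delta> X s) t \<omega> = (LINT s:{0..t}|lborel. X s \<omega> - m s)" if "t \<in> {0..T}" for t \<omega>
    unfolding drift_def by (rule set_lebesgue_integral_cong) (use that m in auto)
  have eq: "AE \<omega> in M. \<forall>t\<in>{0..T}. X t \<omega> = \<xi> \<omega> - lam *\<^sub>R (LINT s:{0..t}|lborel. X s \<omega> - m s) + I t \<omega>"
    using ae by eventually_elim (simp add: I(2) d)
  have sq: "integrable M (\<lambda>\<omega>. (norm (X t \<omega>))\<^sup>2)" if t: "t \<in> {0..T}" for t
  proof (rule integrableI_bounded)
    show "(\<lambda>\<omega>. (norm (X t \<omega>))\<^sup>2) \<in> borel_measurable M" using meas[OF t] by measurable
    have "msq X t < \<infinity>" by (rule order.strict_trans1[OF msq_le_E2[OF t] EX])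
    then show "(\<integral>\<^sup>+\<omega>. ennreal (norm ((norm (X t \<omega>))\<^sup>2)) \<partial>M) < \<infinity>" unfolding msq_def by simp
  qed
  have "CBO_strong_solution M F Q W T \<E> V \<alpha> lam \<sigma> \<xi> X"
    unfolding CBO_strong_solution_def Let_def m_def[symmetric]
  proof (intro conjI exI[of _ I])
    show "predictable M F T X" by (rule left_cont_adapted_predictable[OF cont_adapted_left[OF cX]])
    show "AE \<omega> in M. continuous_on {0..T} (\<lambda>t. X t \<omega>)" using cont_adaptedD(1)[OF cX] by simp
    show "\<forall>t\<in>{0..T}. integrable M (\<lambda>\<omega>. (norm (X t \<omega>))\<^sup>2)" using sq by blast
    show "AE \<omega> in M. set_integrable lborel {0..T} (\<lambda>s. X s \<omega> - m s)" using drift_integrable[OF Z order_refl] by simp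
  qed (use SI eq in auto)
  moreover have "L2_continuous M T X"
    unfolding L2_continuous_def using meas cont_adaptedD(1)[OF cX] EX unfolding E2_def sup_sq_def by auto
  ultimately show ?thesis by blast
qed

end

section \<open>Uniqueness by localisation\<close>

context ito
begin

text \<open>\<open>Z'\<close> is not assumed measurable, and \<open>measure\<close> is 0 on sets
  that are not events. Its level sets are events because they differ from those of \<open>Z\<close>
  only within a null set and the filtration is complete.\<close>

lemma converges_in_prob_AE_cong:
  assumes Z: "\<And>n. Z n \<in> borel_measurable M" and ae: "\<And>n. AE \<omega> in M. Z' n \<omega> = Z n \<omega>"
    and lim: "converges_to_0_in_prob M Z'"
  shows "converges_to_0_in_prob M Z"
proof -
  have "prob {\<omega>\<in>space M. ennreal \<epsilon> < Z' n \<omega>} = prob {\<omega>\<in>space M. ennreal \<epsilon> < Z n \<omega>}" for n \<epsilon>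
  proof (rule measure_eq_AE)
    let ?A = "{\<omega>\<in>space M. ennreal \<epsilon> < Z n \<omega>}" and ?B = "{\<omega>\<in>space M. ennreal \<epsilon> < Z' n \<omega>}"
    let ?S = "{\<omega>\<in>space M. Z' n \<omega> = Z n \<omega>}" and ?S' = "{\<omega>\<in>space M. Z' n \<omega> = Z n \<omega> \<or> ennreal \<epsilon> < Z' n \<omega>}"
    have sub: "sets (F 0) \<subseteq> events" using subalg[of 0] unfolding subalgebra_def by simp
    have "?S \<in> sets (F 0)" by (rule AE_sets_F[OF ae]) simp
    moreover have "?S' \<in> sets (F 0)"
    proof (rule AE_sets_F)
      show "AE \<omega> in M. Z' n \<omega> = Z n \<omega> \<or> ennreal \<epsilon> < Z' n \<omega>" using ae[of n] by eventually_elim simp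
    qed simp
    ultimately have S: "?S \<in> events" "?S' \<in> events" using sub by blast+
    show A: "?A \<in> events" using Z[of n] by measurable
    \<comment> \<open>Both \<open>?S\<close> and \<open>?S'\<close> have full measure and hence are
      events; their difference is the part of \<open>?B\<close> on which \<open>Z'\<close> and
      \<open>Z\<close> disagree.\<close>
    have "?B = (?A \<inter> ?S) \<union> (?S' - ?S)" by auto
    then show "?B \<in> events" using sets.Un[OF sets.Int[OF A S(1)] sets.Diff[OF S(2) S(1)]] by simp
    show "AE \<omega> in M. (\<omega> \<in> ?B) = (\<omega> \<in> ?A)" using ae[of n] by eventually_elim simp
  qed
  then show ?thesis using lim unfolding converges_to_0_in_prob_def by simp
qed

lemma ito_at_AE_cong:
  assumes g: "jointly_measurable g" and ae: "AE \<omega> in M. \<forall>s\<in>{0..T}. g s \<omega> = g' s \<omega>" and I: "ito_at g' I t"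
  shows "ito_at g I t"
proof -
  obtain E where E: "\<And>n. elementary F T (E n)" "converges_to_0_in_prob M (\<lambda>n. approx_error T g' (E n))"
     "converges_to_0_in_prob M (\<lambda>n \<omega>. ennreal (norm (I t \<omega> - elementary_integral Wc (E n) t \<omega>)))"
    using I unfolding ito_at_def by (elim exE conjE) blast
  have "AE \<omega> in M. approx_error T g (E n) \<omega> = approx_error T g' (E n) \<omega>" for n
    using ae
  proof eventually_elim
    case (elim \<omega>)
    then show ?case unfolding approx_error_def by (intro nn_integral_cong) (auto simp: indicator_def)
  qed
  then have ae': "AE \<omega> in M. approx_error T g' (E n) \<omega> = approx_error T g (E n) \<omega>" for n
    by (rule eventually_mono) (erule sym)
  have "converges_to_0_in_prob M (\<lambda>n. approx_error T g (E n))"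
    by (rule converges_in_prob_AE_cong[OF approx_error_measurable[OF g E(1) order_refl] ae' E(2)])
  then show ?thesis unfolding ito_at_def using E(1,3) by (intro exI[of _ E] conjI allI)
qed

text \<open>Plays the role of a stopping time, but is left-continuous in time and hence admissible as a
  factor of the integrand.\<close>

definition below :: "(real \<Rightarrow> 'w \<Rightarrow> real) \<Rightarrow> real \<Rightarrow> real \<Rightarrow> 'w \<Rightarrow> real" where
  "below Z N t \<omega> = (if \<forall>r\<in>{0..t}. Z r \<omega> \<le> N then 1 else 0)"

text \<open>If the level is exceeded on \<open>{0..t}\<close> then, by continuity of
  \<open>Z\<close>, already before \<open>t\<close>; so the factor at \<open>t\<close> equals its
  values just before. The comparison \<open>\<le> N\<close> matters, as a strict one could switch
  off at the hitting time itself.\<close>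

lemma below_left_cont_adapted:
  assumes c: "\<And>\<omega>. continuous_on {0..T} (\<lambda>t. Z t \<omega>)" and m: "\<And>t. t \<in> {0..T} \<Longrightarrow> Z t \<in> borel_measurable (F t)"
    and nn: "\<And>t \<omega>. 0 \<le> Z t \<omega>" "0 \<le> N"
  shows "left_cont_adapted (below Z N)"
  unfolding left_cont_adapted_def left_limit_on_def
proof (intro conjI allI ballI)
  fix \<omega> t assume t: "t \<in> {0<..T}"
  show "((\<lambda>s. below Z N s \<omega>) \<longlongrightarrow> below Z N t \<omega>) (at_left t)"
  proof (rule tendsto_eventually)
    have ev0: "\<forall>\<^sub>F s in at_left t. r < s" if "r < t" for r
      using that by (rule eventually_at_leftI[rotated]) auto
    have evl: "\<forall>\<^sub>F s in at_left t. s < t" by (rule eventually_at_leftI[of "t - 1"]) auto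
    show "\<forall>\<^sub>F s in at_left t. below Z N s \<omega> = below Z N t \<omega>"
    proof (cases "\<forall>r\<in>{0..t}. Z r \<omega> \<le> N")
      case True
      show ?thesis using evl by eventually_elim (use True in \<open>auto simp: below_def\<close>)
    next
      case False
      have "\<exists>r\<in>{0..<t}. N < Z r \<omega>"
      proof (rule ccontr)
        assume "\<not> ?thesis"
        then have le: "Z r \<omega> \<le> N" if "r \<in> {0..<t}" for r using that by (simp add: not_less)
        have "left_limit_on T (\<lambda>t. Z t \<omega>)" by (rule left_limit_on_continuous[OF c])
        then have "((\<lambda>s. Z s \<omega>) \<longlongrightarrow> Z t \<omega>) (at_left t)" using t unfolding left_limit_on_def by blast
        then have "Z t \<omega> \<le> N"
        proof (rule tendsto_upperbound)
          show "\<forall>\<^sub>F s in at_left t. Z s \<omega> \<le> N" using evl ev0[of 0, OF greaterThanAtMost_iff[THEN iffD1, OF t, THEN conjunct1]]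
              by eventually_elim (rule le, simp)
        qed simp
        then show False using False le by (metis atLeastAtMost_iff atLeastLessThan_iff linorder_neqE_linordered_idom not_le)
      qed
      then obtain r where r: "r \<in> {0..<t}" "N < Z r \<omega>" by blast
      have "\<forall>\<^sub>F s in at_left t. r < s" by (rule ev0) (use r in simp)
      then show ?thesis
      proof (rule eventually_mono)
        fix s assume s: "r < s"
        have "\<not> (\<forall>r\<in>{0..s}. Z r \<omega> \<le> N)" using r s by (intro notI) (auto dest!: bspec[of _ _ r])
        then show "below Z N s \<omega> = below Z N t \<omega>" using False by (simp add: below_def)
      qed
    qed
  qed
next
  fix t assume t: "t \<in> {0..T}"
  \<comment> \<open>Dyadic points of \<open>{0..t}\<close> decide the condition, which makes it
    measurable at time \<open>t\<close>; nonnegativity allows it to be read in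
    \<open>ennreal\<close>.\<close>
  have "(\<forall>r\<in>{0..t}. Z r \<omega> \<le> N) \<longleftrightarrow> (SUP m. SUP k\<in>{..2^m}. ennreal (Z (real k * t / 2^m) \<omega>)) \<le> ennreal N" for \<omega>
  proof -
    have "(SUP m. SUP k\<in>{..2^m}. ennreal (Z (real k * t / 2^m) \<omega>)) = (SUP r\<in>{0..t}. ennreal (Z r \<omega>))"
      by (rule SUP_dyadic[symmetric]) (use t in \<open>auto intro: continuous_on_subset[OF c]\<close>)
    then show ?thesis using nn by (simp add: SUP_le_iff)
  qed
  then have eq: "below Z N t = (\<lambda>\<omega>. if (SUP m. SUP k\<in>{..2^m}. ennreal (Z (real k * t / 2^m) \<omega>)) \<le> ennreal N then 1 else 0)"
    unfolding below_def by (intro ext) simp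
  have "Z (real k * t / 2^m) \<in> borel_measurable (F t)" if k: "k \<in> {..2^m}" for k m :: nat
  proof -
    have "real k * t \<le> 2^m * t" using k t by (intro mult_right_mono) (auto simp: of_nat_le_iff[symmetric] simp del: of_nat_le_iff)
    then have "real k * t / 2^m \<le> t" by (simp add: divide_simps mult.commute)
    then show ?thesis using F_mono[OF m[of "real k * t / 2^m"]] t by auto
  qed
  then have "(\<lambda>\<omega>. SUP m. SUP k\<in>{..2^m}. ennreal (Z (real k * t / 2^m) \<omega>)) \<in> borel_measurable (F t)"
    by (intro borel_measurable_SUP measurable_compose[OF _ measurable_ennreal]) auto
  then show "below Z N t \<in> borel_measurable (F t)" unfolding eq by measurable
qed

end

section \<open>Comparison of two solutions with prescribed consensus paths\<close>

context cbo
begin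

text \<open>Solutions with everywhere continuous paths of the equation with a prescribed consensus path \<open>u\<close>.\<close>

definition prescribed_solution :: "(real \<Rightarrow> 'h) \<Rightarrow> (real \<Rightarrow> 'w \<Rightarrow> 'h) \<Rightarrow> bool" where
  "prescribed_solution u X \<longleftrightarrow> cont_adapted X \<and> (\<exists>I. \<forall>t\<in>{0..T}. I t \<in> borel_measurable M \<and>
     ito_at (\<lambda>s \<omega>. \<sigma> * norm (X s \<omega> - u s)) I t \<and>
     (AE \<omega> in M. X t \<omega> = \<xi> \<omega> - lam *\<^sub>R drift (\<lambda>s \<omega>. X s \<omega> - u s) t \<omega> + I t \<omega>))"

text \<open>A continuous \<open>u\<close> is bounded on \<open>{0..T}\<close> and the cut keeps
  \<open>X\<close> below \<open>N\<close>, so the integrand is bounded and has a mean-square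
  integral.\<close>

lemma cut_integral:
  assumes X: "cont_adapted X" and u: "continuous_on {0..T} u" and \<eta>: "left_cont_adapted \<eta>"
    and b: "\<And>s \<omega>. s \<in> {0..T} \<Longrightarrow> \<eta> s \<omega> = 0 \<or> (\<eta> s \<omega> = 1 \<and> norm (X s \<omega>) \<le> N)"
  shows "left_cont_adapted (\<lambda>s \<omega>. \<sigma> * norm (X s \<omega> - u s) * \<eta> s \<omega>)" "\<exists>J. is_ito (\<lambda>s \<omega>. \<sigma> * norm (X s \<omega> - u s) * \<eta> s \<omega>) J"
proof -
  have "cont_adapted (\<lambda>s \<omega>. X s \<omega> - u s)" by (rule cont_adapted_diff[OF X det_cont_adapted[OF u]])
  from left_cont_adapted_mult[OF scaled_norm_left_cont[OF this] \<eta>]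
  show l: "left_cont_adapted (\<lambda>s \<omega>. \<sigma> * norm (X s \<omega> - u s) * \<eta> s \<omega>)" .
  have "bounded (u ` {0..T})" by (intro compact_imp_bounded compact_continuous_image u compact_Icc)
  then obtain B where "\<forall>x\<in>u ` {0..T}. norm x \<le> B" unfolding bounded_iff ..
  then have B: "\<And>t. t \<in> {0..T} \<Longrightarrow> norm (u t) \<le> B" by simp
  have "\<bar>\<sigma> * norm (X s \<omega> - u s) * \<eta> s \<omega>\<bar> \<le> \<bar>\<sigma>\<bar> * (\<bar>N\<bar> + \<bar>B\<bar>)" if s: "s \<in> {0..T}" for s \<omega>
    using b[OF s, of \<omega>]
  proof
    assume 1: "\<eta> s \<omega> = 1 \<and> norm (X s \<omega>) \<le> N"
    have "norm (X s \<omega> - u s) \<le> \<bar>N\<bar> + \<bar>B\<bar>" using 1 B[OF s] norm_triangle_ineq4[of "X s \<omega>" "u s"] by linarith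
    then show ?thesis using 1 by (auto simp: abs_mult intro!: mult_left_mono)
  qed simp
  then have "square_dominated (\<lambda>s \<omega>. \<sigma> * norm (X s \<omega> - u s) * \<eta> s \<omega>)"
    unfolding square_dominated_def by (intro exI[of _ "\<lambda>\<omega>. \<bar>\<sigma>\<bar> * (\<bar>N\<bar> + \<bar>B\<bar>)"]) (simp add: emeasure_space_1)
  then show "\<exists>J. is_ito (\<lambda>s \<omega>. \<sigma> * norm (X s \<omega> - u s) * \<eta> s \<omega>) J" by (rule ito_integral_exists[OF l])
qed

text \<open>If the cut-off is 1 at time \<open>t\<close>, it was 1 all along, and locality replaces
  the integrals of the two solutions by those of the cut integrands, to which
  \<open>E2_ito_norm\<close> applies. The difference of the consensus paths stays as a separate
  term.\<close>

lemma stopped_difference: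
  fixes X Y :: "real \<Rightarrow> 'w \<Rightarrow> 'h" and N :: real
  defines "\<eta> \<equiv> below (\<lambda>s \<omega>. norm (X s \<omega>) + norm (Y s \<omega>)) N"
  assumes u: "continuous_on {0..T} u" "continuous_on {0..T} v" and X: "prescribed_solution u X" and Y: "prescribed_solution v Y" and N: "0 \<le> N"
    and t: "t \<in> {0..T}"
  shows "(\<integral>\<^sup>+\<omega>. ennreal (\<eta> t \<omega> * (norm (X t \<omega> - Y t \<omega>))\<^sup>2) \<partial>M) \<le> ennreal K_flow *
    (\<integral>\<^sup>+s\<in>{0..t}. (2 * (\<integral>\<^sup>+\<omega>. ennreal (\<eta> s \<omega> * (norm (X s \<omega> - Y s \<omega>))\<^sup>2) \<partial>M) + 2 * ennreal ((norm (u s - v s))\<^sup>2)) \<partial>lborel)"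
proof -
  have cX: "cont_adapted X" and cY: "cont_adapted Y" using X Y unfolding prescribed_solution_def by auto
  obtain I where I: "\<And>t. t \<in> {0..T} \<Longrightarrow> I t \<in> borel_measurable M"
     "\<And>t. t \<in> {0..T} \<Longrightarrow> ito_at (\<lambda>s \<omega>. \<sigma> * norm (X s \<omega> - u s)) I t"
     "\<And>t. t \<in> {0..T} \<Longrightarrow> AE \<omega> in M. X t \<omega> = \<xi> \<omega> - lam *\<^sub>R drift (\<lambda>s \<omega>. X s \<omega> - u s) t \<omega> + I t \<omega>"
    using X[unfolded prescribed_solution_def] by blast
  obtain J where J: "\<And>t. t \<in> {0..T} \<Longrightarrow> J t \<in> borel_measurable M"
     "\<And>t. t \<in> {0..T} \<Longrightarrow> ito_at (\<lambda>s \<omega>. \<sigma> * norm (Y s \<omega> - v s)) J t"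
     "\<And>t. t \<in> {0..T} \<Longrightarrow> AE \<omega> in M. Y t \<omega> = \<xi> \<omega> - lam *\<^sub>R drift (\<lambda>s \<omega>. Y s \<omega> - v s) t \<omega> + J t \<omega>"
    using Y[unfolded prescribed_solution_def] by blast
  have t0: "0 \<le> t" "t \<le> T" using t by auto
  have \<eta>: "left_cont_adapted \<eta>" unfolding \<eta>_def
    by (rule below_left_cont_adapted)
      (use cont_adaptedD[OF cX] cont_adaptedD[OF cY] N in \<open>auto intro!: continuous_intros borel_measurable_add borel_measurable_norm\<close>)
  have \<eta>1: "\<eta> s \<omega> = 1" if "\<eta> t \<omega> = 1" "s \<in> {0..t}" for s \<omega>
    using that unfolding \<eta>_def below_def by (auto split: if_splits)
  have \<eta>01: "\<eta> s \<omega> = 0 \<or> \<eta> s \<omega> = 1" for s \<omega> unfolding \<eta>_def below_def by auto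
  have \<eta>b: "\<eta> s \<omega> = 0 \<or> (\<eta> s \<omega> = 1 \<and> norm (X s \<omega>) + norm (Y s \<omega>) \<le> N)" if "s \<in> {0..T}" for s \<omega>
    using that unfolding \<eta>_def below_def by auto
  have b: "\<eta> s \<omega> = 0 \<or> (\<eta> s \<omega> = 1 \<and> norm (X s \<omega>) \<le> N)" "\<eta> s \<omega> = 0 \<or> (\<eta> s \<omega> = 1 \<and> norm (Y s \<omega>) \<le> N)"
    if "s \<in> {0..T}" for s \<omega> using \<eta>b[OF that, of \<omega>] norm_ge_zero[of "X s \<omega>"] norm_ge_zero[of "Y s \<omega>"] by linarith+
  let ?gX = "\<lambda>s \<omega>. \<sigma> * norm (X s \<omega> - u s)" and ?gY = "\<lambda>s \<omega>. \<sigma> * norm (Y s \<omega> - v s)"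
  let ?cX = "\<lambda>s \<omega>. \<sigma> * norm (X s \<omega> - u s) * \<eta> s \<omega>" and ?cY = "\<lambda>s \<omega>. \<sigma> * norm (Y s \<omega> - v s) * \<eta> s \<omega>"
  let ?Z = "\<lambda>s \<omega>. (X s \<omega> - u s) - (Y s \<omega> - v s)"
  let ?h = "\<lambda>s \<omega>. norm (?Z s \<omega>) * \<eta> s \<omega>"
  have zX: "cont_adapted (\<lambda>s \<omega>. X s \<omega> - u s)" by (rule cont_adapted_diff[OF cX det_cont_adapted[OF u(1)]])
  have zY: "cont_adapted (\<lambda>s \<omega>. Y s \<omega> - v s)" by (rule cont_adapted_diff[OF cY det_cont_adapted[OF u(2)]])
  have z: "cont_adapted ?Z" by (rule cont_adapted_diff[OF zX zY])
  note jm = left_cont_adapted_jointly_measurable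
  have jX: "jointly_measurable ?gX" and jY: "jointly_measurable ?gY"
    by (rule jm[OF scaled_norm_left_cont[OF zX]], rule jm[OF scaled_norm_left_cont[OF zY]])
  obtain I' where I': "is_ito ?cX I'" using cut_integral(2)[OF cX u(1) \<eta> b(1)] by blast
  obtain J' where J': "is_ito ?cY J'" using cut_integral(2)[OF cY u(2) \<eta> b(2)] by blast
  have jcX: "jointly_measurable ?cX" by (rule jm[OF cut_integral(1)[OF cX u(1) \<eta> b(1)]])
  have jcY: "jointly_measurable ?cY" by (rule jm[OF cut_integral(1)[OF cY u(2) \<eta> b(2)]])
  have jh: "jointly_measurable ?h" using jm[OF left_cont_adapted_mult[OF scaled_norm_left_cont[OF z, of 1] \<eta>]] by simp
  have cI': "cont_adapted I'" "cont_adapted J'" using I' J' unfolding is_ito_def by auto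
  \<comment> \<open>Decided at the final time \<open>t\<close> of the integrals;
    \<open>ito_local\<close> accepts any event.\<close>
  define A where "A = {\<omega>\<in>space M. \<eta> t \<omega> = 1}"
  have \<eta>m[measurable]: "\<eta> s \<in> borel_measurable M" if "s \<in> {0..T}" for s
    using \<eta> F_M[of "\<eta> s" s borel] that unfolding left_cont_adapted_def by auto
  have A: "A \<in> events" unfolding A_def using \<eta>m[OF t] by measurable
  have eI: "AE \<omega> in M. \<omega> \<in> A \<longrightarrow> I t \<omega> = I' t \<omega>"
    by (rule ito_local[OF jX jcX t0 I(1)[OF t] cont_adaptedD(3)[OF cI'(1) t] A _ I(2)[OF t] is_ito_at[OF jcX I' t]])
      (use \<eta>1 in \<open>auto simp: A_def\<close>)
  have eJ: "AE \<omega> in M. \<omega> \<in> A \<longrightarrow> J t \<omega> = J' t \<omega>"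
    by (rule ito_local[OF jY jcY t0 J(1)[OF t] cont_adaptedD(3)[OF cI'(2) t] A _ J(2)[OF t] is_ito_at[OF jcY J' t]])
      (use \<eta>1 in \<open>auto simp: A_def\<close>)
  define G where "G \<omega> = (\<integral>\<^sup>+r\<in>{0..t}. ennreal ((?h r \<omega>)\<^sup>2) \<partial>lborel)" for \<omega>
  have jz: "jointly_measurable (\<lambda>s \<omega>. 0)" unfolding jointly_measurable_def by simp
  have Gm[measurable]: "G \<in> borel_measurable M"
    using integrand_dist_measurable[OF jh jz t0(2)] unfolding integrand_dist_def G_def[abs_def] by simp
  define R where "R = (\<integral>\<^sup>+\<omega>. G \<omega> \<partial>M)"
  note [measurable] = sup_sq_measurable[OF cont_adapted_diff[OF cI'] t0]
  have "AE \<omega> in M. ennreal (\<eta> t \<omega> * (norm (X t \<omega> - Y t \<omega>))\<^sup>2) \<le>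
     2 * (ennreal (lam\<^sup>2) * (ennreal T * G \<omega>)) + 2 * sup_sq t (\<lambda>s \<omega>. I' s \<omega> - J' s \<omega>) \<omega>"
    using I(3)[OF t] J(3)[OF t] eI eJ AE_space
  proof eventually_elim
    case (elim \<omega>)
    show ?case
    proof (cases "\<eta> t \<omega> = 1")
      case True
      then have "\<omega> \<in> A" using elim(5) unfolding A_def by simp
      then have ij: "I t \<omega> = I' t \<omega>" "J t \<omega> = J' t \<omega>" using elim(3,4) by auto
      have d: "drift ?Z t \<omega> = drift (\<lambda>s \<omega>. X s \<omega> - u s) t \<omega> - drift (\<lambda>s \<omega>. Y s \<omega> - v s) t \<omega>"
        by (rule drift_diff[OF zX zY t0(2)])
      have "X t \<omega> - Y t \<omega> = (- lam) *\<^sub>R drift ?Z t \<omega> + (I' t \<omega> - J' t \<omega>)"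
        unfolding elim(1,2) ij d by (simp add: algebra_simps)
      then have "(norm (X t \<omega> - Y t \<omega>))\<^sup>2 \<le> 2 * (norm ((- lam) *\<^sub>R drift ?Z t \<omega>))\<^sup>2 + 2 * (norm (I' t \<omega> - J' t \<omega>))\<^sup>2"
        using norm_add_square_le[of "(- lam) *\<^sub>R drift ?Z t \<omega>" "I' t \<omega> - J' t \<omega>"] by simp
      then have "ennreal ((norm (X t \<omega> - Y t \<omega>))\<^sup>2) \<le> ennreal (2 * (norm ((- lam) *\<^sub>R drift ?Z t \<omega>))\<^sup>2 + 2 * (norm (I' t \<omega> - J' t \<omega>))\<^sup>2)"
        by (rule ennreal_leI)
      also have "\<dots> = 2 * ennreal ((norm ((- lam) *\<^sub>R drift ?Z t \<omega>))\<^sup>2) + 2 * ennreal ((norm (I' t \<omega> - J' t \<omega>))\<^sup>2)"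
        by (rule ennreal_two_sum) auto
      also have "\<dots> \<le> 2 * (ennreal (lam\<^sup>2) * (ennreal T * G \<omega>)) + 2 * sup_sq t (\<lambda>s \<omega>. I' s \<omega> - J' s \<omega>) \<omega>"
      proof (intro add_mono mult_left_mono)
        have "ennreal ((norm ((- lam) *\<^sub>R drift ?Z t \<omega>))\<^sup>2) = ennreal (lam\<^sup>2) * ennreal ((norm (drift ?Z t \<omega>))\<^sup>2)"
          by (simp add: power_mult_distrib ennreal_mult)
        also have "ennreal ((norm (drift ?Z t \<omega>))\<^sup>2) \<le> ennreal T * (\<integral>\<^sup>+r\<in>{0..t}. ennreal ((norm (?Z r \<omega>))\<^sup>2) \<partial>lborel)"
          by (rule drift_bound[OF z _ t0(2)]) (use t0 in auto)
        \<comment> \<open>On this event the factor \<open>\<eta>\<close> is 1 throughout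
          \<open>{0..t}\<close> and may be inserted.\<close>
        also have "(\<integral>\<^sup>+r\<in>{0..t}. ennreal ((norm (?Z r \<omega>))\<^sup>2) \<partial>lborel) = G \<omega>"
          unfolding G_def by (intro nn_integral_cong) (use \<eta>1[OF True] in \<open>auto simp: indicator_def\<close>)
        finally show "ennreal ((norm ((- lam) *\<^sub>R drift ?Z t \<omega>))\<^sup>2) \<le> ennreal (lam\<^sup>2) * (ennreal T * G \<omega>)"
          by (simp add: mult_left_mono)
        show "ennreal ((norm (I' t \<omega> - J' t \<omega>))\<^sup>2) \<le> sup_sq t (\<lambda>s \<omega>. I' s \<omega> - J' s \<omega>) \<omega>"
          by (rule sup_sq_upper[of t t "\<lambda>s \<omega>. I' s \<omega> - J' s \<omega>"]) (use t0 in auto)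
      qed simp_all
      finally show ?thesis using True by simp
    qed (use \<eta>01[of t \<omega>] in simp)
  qed
  then have "(\<integral>\<^sup>+\<omega>. ennreal (\<eta> t \<omega> * (norm (X t \<omega> - Y t \<omega>))\<^sup>2) \<partial>M) \<le>
     (\<integral>\<^sup>+\<omega>. 2 * (ennreal (lam\<^sup>2) * (ennreal T * G \<omega>)) + 2 * sup_sq t (\<lambda>s \<omega>. I' s \<omega> - J' s \<omega>) \<omega> \<partial>M)"
    by (rule nn_integral_mono_AE)
  also have "\<dots> = 2 * (ennreal (lam\<^sup>2) * (ennreal T * R)) + 2 * E2 t (\<lambda>s \<omega>. I' s \<omega> - J' s \<omega>)"
    unfolding R_def E2_def by (simp add: nn_integral_add nn_integral_cmult)
  also have "\<dots> \<le> 2 * (ennreal (lam\<^sup>2) * (ennreal T * R)) + 2 * (ennreal (64 * hs P * \<sigma>\<^sup>2) * R)"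
    using E2_ito_norm[OF zX zY \<eta> I' J' t0] unfolding R_def G_def scalar_tonelli[OF jh t0(2)] by (intro add_left_mono mult_left_mono) simp_all
  also have "\<dots> \<le> ennreal K_flow * R" by (rule K_flow_combine)
  also have "\<dots> \<le> ennreal K_flow * (\<integral>\<^sup>+s\<in>{0..t}. (2 * (\<integral>\<^sup>+\<omega>. ennreal (\<eta> s \<omega> * (norm (X s \<omega> - Y s \<omega>))\<^sup>2) \<partial>M) + 2 * ennreal ((norm (u s - v s))\<^sup>2)) \<partial>lborel)"
  proof (rule mult_left_mono)
    have "R = (\<integral>\<^sup>+r\<in>{0..t}. (\<integral>\<^sup>+\<omega>. ennreal ((?h r \<omega>)\<^sup>2) \<partial>M) \<partial>lborel)"
      unfolding R_def G_def by (rule scalar_tonelli[OF jh t0(2)])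
    also have "\<dots> \<le> (\<integral>\<^sup>+s\<in>{0..t}. (2 * (\<integral>\<^sup>+\<omega>. ennreal (\<eta> s \<omega> * (norm (X s \<omega> - Y s \<omega>))\<^sup>2) \<partial>M) + 2 * ennreal ((norm (u s - v s))\<^sup>2)) \<partial>lborel)"
    proof (rule nn_integral_mono)
      fix s
      show "(\<integral>\<^sup>+\<omega>. ennreal ((?h s \<omega>)\<^sup>2) \<partial>M) * indicator {0..t} s \<le>
        (2 * (\<integral>\<^sup>+\<omega>. ennreal (\<eta> s \<omega> * (norm (X s \<omega> - Y s \<omega>))\<^sup>2) \<partial>M) + 2 * ennreal ((norm (u s - v s))\<^sup>2)) * indicator {0..t} s"
      proof (cases "s \<in> {0..t}")
        case True
        then have s: "s \<in> {0..T}" using t0 by auto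
        note [measurable] = \<eta>m[OF s] cont_adaptedD(3)[OF cX s] cont_adaptedD(3)[OF cY s]
        have "(\<integral>\<^sup>+\<omega>. ennreal ((?h s \<omega>)\<^sup>2) \<partial>M) \<le> (\<integral>\<^sup>+\<omega>. 2 * ennreal (\<eta> s \<omega> * (norm (X s \<omega> - Y s \<omega>))\<^sup>2) + 2 * ennreal ((norm (u s - v s))\<^sup>2) \<partial>M)"
        proof (rule nn_integral_mono)
          fix \<omega>
          have "ennreal ((norm (?Z s \<omega>))\<^sup>2) \<le> ennreal (2 * (norm (X s \<omega> - Y s \<omega>))\<^sup>2 + 2 * (norm (u s - v s))\<^sup>2)"
            using norm_diff_square_le[of "X s \<omega> - Y s \<omega>" "u s - v s"] by (intro ennreal_leI) (simp add: algebra_simps)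
          also have "\<dots> = 2 * ennreal ((norm (X s \<omega> - Y s \<omega>))\<^sup>2) + 2 * ennreal ((norm (u s - v s))\<^sup>2)"
            by (rule ennreal_two_sum) auto
          finally show "ennreal ((?h s \<omega>)\<^sup>2) \<le> 2 * ennreal (\<eta> s \<omega> * (norm (X s \<omega> - Y s \<omega>))\<^sup>2) + 2 * ennreal ((norm (u s - v s))\<^sup>2)"
            using \<eta>01[of s \<omega>] by auto
        qed
        also have "\<dots> = 2 * (\<integral>\<^sup>+\<omega>. ennreal (\<eta> s \<omega> * (norm (X s \<omega> - Y s \<omega>))\<^sup>2) \<partial>M) + 2 * ennreal ((norm (u s - v s))\<^sup>2)"
          by (simp add: nn_integral_add nn_integral_cmult emeasure_space_1)
        finally show ?thesis using True by simp
      qed simp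
    qed
    finally show "R \<le> (\<integral>\<^sup>+s\<in>{0..t}. (2 * (\<integral>\<^sup>+\<omega>. ennreal (\<eta> s \<omega> * (norm (X s \<omega> - Y s \<omega>))\<^sup>2) \<partial>M) + 2 * ennreal ((norm (u s - v s))\<^sup>2)) \<partial>lborel)" .
  qed simp
  finally show ?thesis .
qed


text \<open>Each path is bounded on \<open>{0..T}\<close>, so its cut-off is eventually 1; Fatou's
  lemma removes the cut from a bound that is uniform in \<open>N\<close>.\<close>

lemma msq_le_of_stopped:
  fixes X Y :: "real \<Rightarrow> 'w \<Rightarrow> 'h"
  assumes X: "cont_adapted X" "cont_adapted Y" and t: "t \<in> {0..T}"
    and le: "\<And>N. 0 \<le> N \<Longrightarrow> (\<integral>\<^sup>+\<omega>. ennreal (below (\<lambda>s \<omega>. norm (X s \<omega>) + norm (Y s \<omega>)) N t \<omega> * (norm (X t \<omega> - Y t \<omega>))\<^sup>2) \<partial>M) \<le> C"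
  shows "msq (\<lambda>s \<omega>. X s \<omega> - Y s \<omega>) t \<le> C"
proof -
  let ?Z = "\<lambda>s \<omega>. norm (X s \<omega>) + norm (Y s \<omega>)"
  let ?f = "\<lambda>n \<omega>. ennreal (below ?Z (real n) t \<omega> * (norm (X t \<omega> - Y t \<omega>))\<^sup>2)"
  have "ennreal ((norm (X t \<omega> - Y t \<omega>))\<^sup>2) \<le> liminf (\<lambda>n. ?f n \<omega>)" for \<omega>
  proof -
    have "bounded ((\<lambda>s. ?Z s \<omega>) ` {0..T})"
      by (intro compact_imp_bounded compact_continuous_image continuous_intros cont_adaptedD(1)[OF X(1)] cont_adaptedD(1)[OF X(2)] compact_Icc)
    then obtain B where "\<forall>x\<in>(\<lambda>s. ?Z s \<omega>) ` {0..T}. norm x \<le> B" unfolding bounded_iff ..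
    then have B: "\<And>s. s \<in> {0..T} \<Longrightarrow> ?Z s \<omega> \<le> B" by simp
    obtain n0 :: nat where n0: "B \<le> real n0" using real_arch_simple by blast
    show ?thesis
    proof (rule Liminf_bounded)
      show "\<forall>\<^sub>F n in sequentially. ennreal ((norm (X t \<omega> - Y t \<omega>))\<^sup>2) \<le> ?f n \<omega>"
        using eventually_ge_at_top[of n0]
      proof eventually_elim
        case (elim n)
        have "\<forall>r\<in>{0..t}. ?Z r \<omega> \<le> real n"
        proof
          fix r assume "r \<in> {0..t}"
          then have "?Z r \<omega> \<le> B" using t by (intro B) auto
          then show "?Z r \<omega> \<le> real n" using n0 elim by linarith
        qed
        then show ?case by (simp add: below_def)
      qed
    qed
  qed
  then have "msq (\<lambda>s \<omega>. X s \<omega> - Y s \<omega>) t \<le> (\<integral>\<^sup>+\<omega>. liminf (\<lambda>n. ?f n \<omega>) \<partial>M)"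
    unfolding msq_def by (rule nn_integral_mono)
  also have "\<dots> \<le> liminf (\<lambda>n. \<integral>\<^sup>+\<omega>. ?f n \<omega> \<partial>M)"
  proof (rule nn_integral_liminf)
    fix n
    have "left_cont_adapted (below ?Z (real n))"
      by (rule below_left_cont_adapted)
        (use cont_adaptedD[OF X(1)] cont_adaptedD[OF X(2)] in \<open>auto intro!: continuous_intros borel_measurable_add borel_measurable_norm\<close>)
    then have [measurable]: "below ?Z (real n) t \<in> borel_measurable M"
      using F_M[of "below ?Z (real n) t" t borel] t unfolding left_cont_adapted_def by auto
    note [measurable] = cont_adaptedD(3)[OF X(1) t] cont_adaptedD(3)[OF X(2) t]
    show "?f n \<in> borel_measurable M" by measurable
  qed
  also have "\<dots> \<le> liminf (\<lambda>n::nat. C)" by (rule Liminf_mono) (simp add: le)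
  finally show ?thesis by (simp add: Liminf_const)
qed

text \<open>The Lipschitz bound for \<open>u - v\<close> involves the second moment without cut,
  which is not known to be bounded in time. Gronwall with the bounded inhomogeneity
  \<open>u - v\<close> first provides such a bound, uniformly in \<open>N\<close>; the second
  application inserts the Lipschitz bound and has no inhomogeneity left.\<close>

lemma prescribed_difference_zero:
  assumes u: "continuous_on {0..T} u" "continuous_on {0..T} v" and X: "prescribed_solution u X" and Y: "prescribed_solution v Y"
    and L: "0 \<le> \<Lambda>" and lip: "\<And>s. s \<in> {0..T} \<Longrightarrow> ennreal ((norm (u s - v s))\<^sup>2) \<le> ennreal \<Lambda> * msq (\<lambda>s \<omega>. X s \<omega> - Y s \<omega>) s"
    and t: "t \<in> {0..T}"
  shows "msq (\<lambda>s \<omega>. X s \<omega> - Y s \<omega>) t = 0"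
proof -
  have cX: "cont_adapted X" and cY: "cont_adapted Y" using X Y unfolding prescribed_solution_def by auto
  let ?D = "\<lambda>s \<omega>. X s \<omega> - Y s \<omega>" and ?Z = "\<lambda>s \<omega>. norm (X s \<omega>) + norm (Y s \<omega>)"
  have "bounded ((\<lambda>s. u s - v s) ` {0..T})"
    by (intro compact_imp_bounded compact_continuous_image continuous_intros u compact_Icc)
  then obtain B' where "\<forall>x\<in>(\<lambda>s. u s - v s) ` {0..T}. norm x \<le> B'" unfolding bounded_iff ..
  then have B': "\<And>s. s \<in> {0..T} \<Longrightarrow> norm (u s - v s) \<le> B'" by simp
  define B where "B = 2 * B'\<^sup>2"
  have B: "2 * ennreal ((norm (u s - v s))\<^sup>2) \<le> ennreal B" if "s \<in> {0..T}" for s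
  proof -
    have "2 * (norm (u s - v s))\<^sup>2 \<le> B" unfolding B_def using B'[OF that] by (intro mult_left_mono power_mono) auto
    then have "ennreal (2 * (norm (u s - v s))\<^sup>2) \<le> ennreal B" by (rule ennreal_leI)
    then show ?thesis by (simp add: ennreal_mult)
  qed
  have B0: "0 \<le> B" unfolding B_def by simp
  define y where "y N s = (\<integral>\<^sup>+\<omega>. ennreal (below ?Z N s \<omega> * (norm (?D s \<omega>))\<^sup>2) \<partial>M)" for N s
  define w where "w N s = 2 * y N s + 2 * ennreal ((norm (u s - v s))\<^sup>2)" for N s
  define K where "K = 2 * K_flow"
  have K: "0 < K" "ennreal K = 2 * ennreal K_flow" unfolding K_def using K_flow_pos by (auto simp: ennreal_mult)
  have step: "y N s \<le> ennreal K_flow * (\<integral>\<^sup>+r\<in>{0..s}. w N r \<partial>lborel)" if "0 \<le> N" "s \<in> {0..T}" for N s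
    unfolding y_def w_def by (rule stopped_difference[OF u X Y that])
  have yle: "y N s \<le> msq ?D s" for N s
    unfolding y_def msq_def by (rule nn_integral_mono) (auto simp: below_def)
  \<comment> \<open>Depends on \<open>N\<close>, but serves only as the finite bound that
    \<open>gronwall_nn\<close> asks for; the resulting constant \<open>C\<close> is free of
    \<open>N\<close>.\<close>
  have yb: "y N s \<le> ennreal (N\<^sup>2)" if "s \<in> {0..T}" for N s
  proof -
    have "ennreal (below ?Z N s \<omega> * (norm (?D s \<omega>))\<^sup>2) \<le> ennreal (N\<^sup>2)" for \<omega>
    proof (cases "\<forall>r\<in>{0..s}. ?Z r \<omega> \<le> N")
      case True
      then have "?Z s \<omega> \<le> N" using that by simp
      then have "norm (?D s \<omega>) \<le> N" using norm_triangle_ineq4[of "X s \<omega>" "Y s \<omega>"] by linarith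
      then have "(norm (?D s \<omega>))\<^sup>2 \<le> N\<^sup>2" by (intro power_mono) auto
      then show ?thesis using True by (simp add: below_def ennreal_leI)
    next
      case False
      then have "below ?Z N s \<omega> = 0" unfolding below_def by (rule if_not_P)
      then show ?thesis by simp
    qed
    then have "y N s \<le> (\<integral>\<^sup>+\<omega>. ennreal (N\<^sup>2) \<partial>M)" unfolding y_def by (intro nn_integral_mono)
    then show ?thesis by (simp add: emeasure_space_1)
  qed
  define C where "C = ennreal (2 * B * exp (2 * K * T))"
  have C: "msq ?D s \<le> C" if s: "s \<in> {0..T}" for s
  proof (rule msq_le_of_stopped[OF cX cY s])
    fix N :: real assume N: "0 \<le> N"
    have "w N s \<le> ennreal (2 * B * exp (2 * K * s))"
    proof (rule gronwall_nn[OF K(1) B0 _ _ _ s])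
      show "2 * ennreal (N\<^sup>2) + ennreal B < \<infinity>" by (simp add: ennreal_mult_less_top)
      show "w N r \<le> 2 * ennreal (N\<^sup>2) + ennreal B" if "r \<in> {0..T}" for r
        unfolding w_def by (intro add_mono mult_left_mono yb B that) simp
      show "w N r \<le> ennreal B + ennreal K * (\<integral>\<^sup>+s\<in>{0..r}. w N s \<partial>lborel)" if "r \<in> {0..T}" for r
      proof -
        have "w N r \<le> 2 * (ennreal K_flow * (\<integral>\<^sup>+s\<in>{0..r}. w N s \<partial>lborel)) + ennreal B"
          unfolding w_def[of N r] by (intro add_mono mult_left_mono step N B that) simp
        then show ?thesis unfolding K(2) by (simp add: mult.assoc add.commute)
      qed
    qed
    also have "\<dots> \<le> C" unfolding C_def using s K(1) B0 by (intro ennreal_leI mult_left_mono) auto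
    finally have "w N s \<le> C" .
    moreover have "y N s \<le> w N s"
    proof -
      have "1 * y N s + 0 \<le> w N s" unfolding w_def by (intro add_mono mult_right_mono) auto
      then show ?thesis by simp
    qed
    ultimately show "(\<integral>\<^sup>+\<omega>. ennreal (below ?Z N s \<omega> * (norm (?D s \<omega>))\<^sup>2) \<partial>M) \<le> C"
      unfolding y_def by (rule order.trans[rotated])
  qed
  \<comment> \<open>Collects 2 from the difference of the processes and \<open>2 * \<Lambda>\<close>
    from that of the consensus paths, so that \<open>z\<close> dominates \<open>w\<close> for every
    \<open>N\<close>.\<close>
  define c where "c = 2 + 2 * \<Lambda>"
  define z where "z s = ennreal c * msq ?D s" for s
  have c: "0 < c" unfolding c_def using L by simp
  have wz: "w N s \<le> z s" if "s \<in> {0..T}" for N s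
  proof -
    have "w N s \<le> 2 * msq ?D s + 2 * (ennreal \<Lambda> * msq ?D s)"
      unfolding w_def by (intro add_mono mult_left_mono yle lip that) simp_all
    also have "\<dots> = z s" unfolding z_def c_def using L by (simp add: ennreal_mult distrib_right mult.assoc)
    finally show ?thesis .
  qed
  have "z t \<le> ennreal (2 * 0 * exp (2 * (c * K_flow) * t))"
  proof (rule gronwall_nn[OF _ order_refl _ _ _ t])
    show "0 < c * K_flow" using c K_flow_pos by simp
    show "ennreal c * C < \<infinity>" unfolding C_def by (simp add: ennreal_mult_less_top)
    show "z s \<le> ennreal c * C" if "s \<in> {0..T}" for s unfolding z_def by (intro mult_left_mono C that) simp
    show "z s \<le> ennreal 0 + ennreal (c * K_flow) * (\<integral>\<^sup>+r\<in>{0..s}. z r \<partial>lborel)" if s: "s \<in> {0..T}" for s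
    proof -
      have "msq ?D s \<le> ennreal K_flow * (\<integral>\<^sup>+r\<in>{0..s}. z r \<partial>lborel)"
      proof (rule msq_le_of_stopped[OF cX cY s])
        fix N :: real assume N: "0 \<le> N"
        have "y N s \<le> ennreal K_flow * (\<integral>\<^sup>+r\<in>{0..s}. w N r \<partial>lborel)" by (rule step[OF N s])
        also have "\<dots> \<le> ennreal K_flow * (\<integral>\<^sup>+r\<in>{0..s}. z r \<partial>lborel)"
        proof (intro mult_left_mono nn_integral_mono)
          fix r show "w N r * indicator {0..s} r \<le> z r * indicator {0..s} r"
            using wz[of r N] s by (cases "r \<in> {0..s}") auto
        qed simp
        finally show "(\<integral>\<^sup>+\<omega>. ennreal (below ?Z N s \<omega> * (norm (?D s \<omega>))\<^sup>2) \<partial>M) \<le> ennreal K_flow * (\<integral>\<^sup>+r\<in>{0..s}. z r \<partial>lborel)"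
          unfolding y_def .
      qed
      then have "z s \<le> ennreal c * (ennreal K_flow * (\<integral>\<^sup>+r\<in>{0..s}. z r \<partial>lborel))"
        unfolding z_def[of s] by (rule mult_left_mono) simp
      then show ?thesis using c K_flow_pos by (simp add: ennreal_mult mult.assoc)
    qed
  qed
  then have "z t = 0" by simp
  then show ?thesis unfolding z_def using c by simp
qed

text \<open>A positive continuous function on a compact interval. For an arbitrary solution this
  takes the place of the a priori moment bound, which concerns processes with square integrable
  supremum.\<close>

lemma wbar_lower_bound:
  assumes X: "cont_adapted X" shows "\<exists>\<delta>>0. \<forall>t\<in>{0..T}. \<delta> \<le> wbar X t"
proof -
  have "\<exists>s\<in>{0..T}. \<forall>t\<in>{0..T}. wbar X s \<le> wbar X t"
    by (rule continuous_attains_inf[OF compact_Icc _ means_continuous(1)[OF X]]) (use T_nonneg in auto)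
  then obtain s where s: "s \<in> {0..T}" "\<forall>t\<in>{0..T}. wbar X s \<le> wbar X t" by blast
  have "0 < wbar X s" by (rule wbar_pos[where X=X and t=s, OF cont_adaptedD(3)[OF X s(1)]])
  then show ?thesis using s(2) by blast
qed

definition cpoint :: "(real \<Rightarrow> 'w \<Rightarrow> 'h) \<Rightarrow> real \<Rightarrow> 'h" where
  "cpoint X t = fbar X t /\<^sub>R wbar X t"

lemma cpoint_continuous:
  assumes X: "cont_adapted X" shows "continuous_on {0..T} (cpoint X)"
proof -
  have "wbar X t \<noteq> 0" if "t \<in> {0..T}" for t
    using wbar_pos[where X=X and t=t, OF cont_adaptedD(3)[OF X that]] by simp
  then show ?thesis
    unfolding cpoint_def using means_continuous[OF X] by (intro continuous_intros) auto
qed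

text \<open>Replacing discontinuous paths by 0 alters the process on a null set only, so the laws,
  the consensus points and the equation survive; completeness keeps the process adapted.\<close>

lemma strong_solution_prescribed:
  assumes P: "P = orthogonal_projection V" and Y: "CBO_strong_solution M F Q W T \<E> V \<alpha> lam \<sigma> \<xi> Y"
  shows "\<exists>X. prescribed_solution (cpoint X) X \<and> (AE \<omega> in M. \<forall>t\<in>{0..T}. Y t \<omega> = X t \<omega>)"
proof -
  define m where "m t = consensus_point \<alpha> \<E> (distr M borel (Y t))" for t
  note D = Y[unfolded CBO_strong_solution_def Let_def m_def[symmetric], folded P]
  have pY: "predictable M F T Y" and cY: "AE \<omega> in M. continuous_on {0..T} (\<lambda>t. Y t \<omega>)"
    using D[THEN conjunct1] D[THEN conjunct2, THEN conjunct1] .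
  obtain I where I: "has_stochastic_integral M F Q W T (\<lambda>s \<omega>. (\<sigma> * norm (Y s \<omega> - m s)) *\<^sub>R P) I"
     "AE \<omega> in M. \<forall>t\<in>{0..T}. Y t \<omega> = \<xi> \<omega> - lam *\<^sub>R (LINT s:{0..t}|lborel. Y s \<omega> - m s) + I t \<omega>"
    using D[THEN conjunct2, THEN conjunct2, THEN conjunct2, THEN conjunct2] by (elim conjE exE)
  define X where "X t \<omega> = (if continuous_on {0..T} (\<lambda>t. Y t \<omega>) then Y t \<omega> else 0)" for t \<omega>
  have eq: "AE \<omega> in M. \<forall>t\<in>{0..T}. Y t \<omega> = X t \<omega>" using cY by eventually_elim (simp add: X_def)
  have eqt: "AE \<omega> in M. Y t \<omega> = X t \<omega>" if "t \<in> {0..T}" for t using eq by eventually_elim (use that in simp)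
  have cX: "cont_adapted X"
    unfolding cont_adapted_def
  proof (intro conjI allI ballI)
    show "continuous_on {0..T} (\<lambda>t. X t \<omega>)" for \<omega>
      unfolding X_def by (cases "continuous_on {0..T} (\<lambda>t. Y t \<omega>)") simp_all
    show "X t \<in> borel_measurable (F t)" if "t \<in> {0..T}" for t
      by (rule measurable_F_AE_cong[OF predictable_adapted[OF pY that] eqt[OF that]]) (use that in simp)
  qed
  have mX: "m t = cpoint X t" if t: "t \<in> {0..T}" for t
  proof -
    have Yt: "Y t \<in> borel_measurable M" by (rule F_M[OF predictable_adapted[OF pY t]]) (use t in simp)
    note Xt = cont_adaptedD(3)[OF cX t]
    have "distr M borel (Y t) = distr M borel (X t)" by (rule distr_cong_AE[OF refl refl eqt[OF t] Yt Xt])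
    then show ?thesis unfolding m_def cpoint_def consensus_point_eq[where X=X and t=t, OF Xt, symmetric] by simp
  qed
  have zX: "cont_adapted (\<lambda>s \<omega>. X s \<omega> - cpoint X s)"
    by (rule cont_adapted_diff[OF cX det_cont_adapted[OF cpoint_continuous[OF cX]]])
  have "prescribed_solution (cpoint X) X"
    unfolding prescribed_solution_def
  proof (intro conjI cX exI[of _ I] ballI)
    fix t assume t: "t \<in> {0..T}"
    have "I t \<in> borel_measurable (F t)"
      using I(1)[unfolded has_stochastic_integral_def, THEN conjunct2, THEN conjunct2, THEN conjunct1] t by blast
    then show "I t \<in> borel_measurable M" by (rule F_M) (use t in simp)
    show "ito_at (\<lambda>s \<omega>. \<sigma> * norm (X s \<omega> - cpoint X s)) I t"
    proof (rule ito_at_AE_cong[OF left_cont_adapted_jointly_measurable[OF scaled_norm_left_cont[OF zX]] _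
          has_stochastic_integral_ito_at[OF I(1) t]])
      show "AE \<omega> in M. \<forall>s\<in>{0..T}. \<sigma> * norm (X s \<omega> - cpoint X s) = \<sigma> * norm (Y s \<omega> - m s)"
        using eq by eventually_elim (simp add: mX)
    qed
    show "AE \<omega> in M. X t \<omega> = \<xi> \<omega> - lam *\<^sub>R drift (\<lambda>s \<omega>. X s \<omega> - cpoint X s) t \<omega> + I t \<omega>"
      using eq I(2)
    proof eventually_elim
      case (elim \<omega>)
      have "(LINT s:{0..t}|lborel. Y s \<omega> - m s) = drift (\<lambda>s \<omega>. X s \<omega> - cpoint X s) t \<omega>"
        unfolding drift_def by (rule set_lebesgue_integral_cong) (use elim(1) mX t in auto)
      moreover have "X t \<omega> = Y t \<omega>" using elim(1) t by simp
      ultimately show ?case using elim(2)[rule_format, OF t] by simp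
    qed
  qed
  then show ?thesis using eq by blast
qed

lemma strong_solution_unique:
  assumes P: "P = orthogonal_projection V"
    and S: "CBO_strong_solution M F Q W T \<E> V \<alpha> lam \<sigma> \<xi> X'" "CBO_strong_solution M F Q W T \<E> V \<alpha> lam \<sigma> \<xi> Y'"
  shows "indistinguishable_on M T X' Y'"
proof -
  obtain X where X: "prescribed_solution (cpoint X) X" "AE \<omega> in M. \<forall>t\<in>{0..T}. X' t \<omega> = X t \<omega>"
    using strong_solution_prescribed[OF P S(1)] by blast
  obtain Y where Y: "prescribed_solution (cpoint Y) Y" "AE \<omega> in M. \<forall>t\<in>{0..T}. Y' t \<omega> = Y t \<omega>"
    using strong_solution_prescribed[OF P S(2)] by blast
  have cX: "cont_adapted X" and cY: "cont_adapted Y" using X(1) Y(1) unfolding prescribed_solution_def by auto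
  obtain \<delta>1 \<delta>2 where \<delta>12: "\<delta>1 > 0" "\<forall>t\<in>{0..T}. \<delta>1 \<le> wbar X t" "\<delta>2 > 0" "\<forall>t\<in>{0..T}. \<delta>2 \<le> wbar Y t"
    using wbar_lower_bound[OF cX] wbar_lower_bound[OF cY] by blast
  \<comment> \<open>With one \<open>\<delta>\<close> below both normalisations, both consensus
    points are truncated ones at the same level, and \<open>cons_lipschitz\<close> compares
    them.\<close>
  define \<delta> where "\<delta> = min \<delta>1 \<delta>2"
  have \<delta>: "\<delta> > 0" unfolding \<delta>_def using \<delta>12 by simp
  have eX: "cpoint X t = cons \<delta> X t" if "t \<in> {0..T}" for t
    using \<delta>12(2)[rule_format, OF that] unfolding cpoint_def cons_def \<delta>_def by (simp add: max_absorb1 min.coboundedI1)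
  have eY: "cpoint Y t = cons \<delta> Y t" if "t \<in> {0..T}" for t
    using \<delta>12(4)[rule_format, OF that] unfolding cpoint_def cons_def \<delta>_def by (simp add: max_absorb1 min.coboundedI2)
  let ?\<Lambda> = "2 * wB\<^sup>2 / \<delta>\<^sup>2 + 2 * wB^4 / \<delta>^4"
  have zero: "msq (\<lambda>s \<omega>. X s \<omega> - Y s \<omega>) t = 0" if t: "t \<in> {0..T}" for t
  proof (rule prescribed_difference_zero[OF cpoint_continuous[OF cX] cpoint_continuous[OF cY] X(1) Y(1) _ _ t])
    show "0 \<le> ?\<Lambda>" by simp
    show "ennreal ((norm (cpoint X s - cpoint Y s))\<^sup>2) \<le> ennreal ?\<Lambda> * msq (\<lambda>s \<omega>. X s \<omega> - Y s \<omega>) s" if s: "s \<in> {0..T}" for s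
      unfolding eX[OF s] eY[OF s]
      by (rule cons_lipschitz[where X=X and Y=Y and t=s, OF \<delta> cont_adaptedD(3)[OF cX s] cont_adaptedD(3)[OF cY s]])
  qed
  have "AE \<omega> in M. X t \<omega> = Y t \<omega>" if t: "t \<in> {0..T}" for t
  proof -
    note [measurable] = cont_adaptedD(3)[OF cX t] cont_adaptedD(3)[OF cY t]
    have "AE \<omega> in M. ennreal ((norm (X t \<omega> - Y t \<omega>))\<^sup>2) = 0"
      using zero[OF t] unfolding msq_def by (subst (asm) nn_integral_0_iff_AE) auto
    then show ?thesis by eventually_elim simp
  qed
  \<comment> \<open>Equality at fixed times gives a common null set for countably many times;
    rational times in the open interval are dense, and continuity supplies the others and both end
    points.\<close>
  then have "AE \<omega> in M. \<forall>t\<in>\<rat> \<inter> {0<..<T}. X t \<omega> = Y t \<omega>"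
    by (subst AE_ball_countable) (auto intro: countable_subset[OF _ countable_rat])
  then have "AE \<omega> in M. \<forall>t\<in>{0..T}. X t \<omega> = Y t \<omega>"
  proof eventually_elim
    case (elim \<omega>)
    show ?case
    proof
      fix t assume t: "t \<in> {0..T}"
      have cl: "closure (\<rat> \<inter> {0<..<T}) = {0..T}"
        using closure_open_Int_superset[of "{0<..<T}" \<rat>] T_pos by (simp add: Rats_closure_real Int_commute)
      have "X t \<omega> - Y t \<omega> = 0"
      proof (rule continuous_constant_on_closure[of "\<rat> \<inter> {0<..<T}" "\<lambda>t. X t \<omega> - Y t \<omega>"])
        show "continuous_on (closure (\<rat> \<inter> {0<..<T})) (\<lambda>t. X t \<omega> - Y t \<omega>)"
          unfolding cl by (intro continuous_intros cont_adaptedD(1)[OF cX] cont_adaptedD(1)[OF cY])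
      qed (use elim t cl in auto)
      then show "X t \<omega> = Y t \<omega>" by simp
    qed
  qed
  then show ?thesis unfolding indistinguishable_on_def using X(2) Y(2) by eventually_elim simp
qed

end

theorem theorem2p6:
  fixes M :: "'w measure"
    and F :: "real \<Rightarrow> 'w measure"
    and Q :: "'h::{real_inner, banach, second_countable_topology} \<Rightarrow>\<^sub>L 'h"
    and W :: "real \<Rightarrow> 'w \<Rightarrow> 'h"
    and \<E> :: "'h \<Rightarrow> real"
    and V :: "'h set"
    and \<xi> :: "'w \<Rightarrow> 'h"
    and T \<alpha> lam \<sigma> :: real
  assumes "infinite_dimensional TYPE('h)"
    and "prob_space M" and "usual_filtration M F"
    and "covariance_operator Q" and "Q_Wiener_process M F Q W"
    and "T > 0" and "\<alpha> > 0" and "lam > 0" and "\<sigma> > 0"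
    and "admissible_objective \<E>"
    and "active_subspace V Q \<E> (distr M borel \<xi>)"
    and "\<xi> \<in> borel_measurable (F 0)"
    and "integrable M (\<lambda>\<omega>. (norm (\<xi> \<omega>))\<^sup>2)"
  shows "\<exists>X. CBO_strong_solution M F Q W T \<E> V \<alpha> lam \<sigma> \<xi> X \<and> L2_continuous M T X \<and>
           (\<forall>Y. CBO_strong_solution M F Q W T \<E> V \<alpha> lam \<sigma> \<xi> Y \<longrightarrow> indistinguishable_on M T X Y)"
proof -
  obtain e :: "nat \<Rightarrow> 'h" where e: "hilbert_basis e" "inj e" "range e = (SOME B. orthonormal_basis B)"
    using trace_basis_enumeration[OF assms(1)] by blast
  interpret cbo e Q M F W T "orthogonal_projection V" \<E> \<alpha> lam \<sigma> \<xi>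
    unfolding cbo_def cbo_axioms_def ito_def ito_axioms_def wiener_def wiener_axioms_def hilbert_trace_def hilbert_trace_axioms_def
    using e assms by simp
  obtain X where "CBO_strong_solution M F Q W T \<E> V \<alpha> lam \<sigma> \<xi> X" "L2_continuous M T X"
    using cbo_solution_exists[OF refl] by blast
  then show ?thesis using strong_solution_unique[OF refl] by blast
qed

end
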